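(* Let $\mathfrak{F}$ be a solvably saturated formation containing the class $\mathfrak{U}$ of all finite supersolvable groups, let $G$ be a finite group, and let $E$ be a non-trivial normal subgroup of $G$ such that $G/E \in \mathfrak{F}$. Let $t := |\pi(E)|$, and let $p_1 < \dots < p_t$ be the distinct prime divisors of $|E|$. For each $1 \le i \le t$, let $P_i$ be a Sylow $p_i$-subgroup of $E$. Suppose that, for each $1 \le i \le t$, either $P_i$ is cyclic or there is a subgroup $D_i$ of $P_i$ with $1 < |D_i| \le |P_i|$ such that any subgroup of $P_i$ with order $|D_i|$ is an $IC\Phi$-subgroup of $G$. If $p_1 = 2$, $|D_1| = 2$ and $P_1$ is not $Q_8$-free, assume moreover that any cyclic subgroup of $P_1$ with order $4$ is an $IC\Phi$-subgroup of $G$. Then $G \in \mathfrak{F}$.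
   Context: All groups are finite. For a group $G$ and a subgroup $H \le G$, $[H,G]$ denotes the subgroup generated by all commutators $[h,g]$ with $h \in H$, $g \in G$, and $\Phi(H)$ denotes the Frattini subgroup of $H$ (the intersection of all maximal subgroups of $H$, with $\Phi(1)=1$). A subgroup $H$ of $G$ is an $IC\Phi$-subgroup of $G$ if $H \cap [H,G] \le \Phi(H)$. $\pi(E)$ is the set of prime divisors of $|E|$. $Q_8$ is the quaternion group of order $8$; a group is $Q_8$-free if none of its sections (quotients $A/B$ with $B \trianglelefteq A$ and $A$ a subgroup) is isomorphic to $Q_8$. A class of (finite) groups $\mathfrak{F}$ (closed under isomorphism) is a formation if it is closed under taking homomorphic images and subdirect products, i.e. quotients of groups in $\mathfrak{F}$ are in $\mathfrak{F}$, and if $N_1,N_2 \trianglelefteq G$ with $G/N_1, G/N_2 \in \mathfrak{F}$ then $G/(N_1\cap N_2) \in \mathfrak{F}$. A formation $\mathfrak{F}$ is solvably saturated if whenever $G$ is a group and $N$ is a solvable normal subgroup of $G$ with $G/\Phi(N) \in \mathfrak{F}$, we have $G \in \mathfrak{F}$. *)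

theory Defs
  imports "HOL-Algebra.Algebra"
begin

section \<open>Subgroups\<close>

definition commutator_subgroup :: "('a, 'b) monoid_scheme \<Rightarrow> 'a set \<Rightarrow> 'a set \<Rightarrow> 'a set" where
  "commutator_subgroup G H K =
     generate G {h \<otimes>\<^bsub>G\<^esub> k \<otimes>\<^bsub>G\<^esub> inv\<^bsub>G\<^esub> h \<otimes>\<^bsub>G\<^esub> inv\<^bsub>G\<^esub> k | h k. h \<in> H \<and> k \<in> K}"

definition maximal_subgroup :: "'a set \<Rightarrow> ('a, 'b) monoid_scheme \<Rightarrow> bool" where
  "maximal_subgroup M G \<longleftrightarrow>
     subgroup M G \<and> M \<noteq> carrier G \<and>
     (\<forall>K. subgroup K G \<longrightarrow> M \<subseteq> K \<longrightarrow> K = M \<or> K = carrier G)"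

text \<open>If there is no maximal subgroup, this is the whole group; for a finite group that happens
  only for the trivial one, which gives the convention that its Frattini subgroup is trivial.\<close>

definition frattini :: "('a, 'b) monoid_scheme \<Rightarrow> 'a set" where
  "frattini G = carrier G \<inter> \<Inter> {M. maximal_subgroup M G}"

definition IC_Phi_subgroup :: "'a set \<Rightarrow> ('a, 'b) monoid_scheme \<Rightarrow> bool" where
  "IC_Phi_subgroup H G \<longleftrightarrow>
     subgroup H G \<and>
     H \<inter> commutator_subgroup G H (carrier G) \<subseteq> frattini (G\<lparr>carrier := H\<rparr>)"

definition sylow_subgroup :: "nat \<Rightarrow> 'a set \<Rightarrow> ('a, 'b) monoid_scheme \<Rightarrow> bool" where
  "sylow_subgroup p P G \<longleftrightarrow>
     Factorial_Ring.prime p \<and> subgroup P G \<and> card P = p ^ multiplicity p (order G)"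

section \<open>The quaternion group\<close>

text \<open>The pair \<open>(a, b)\<close> stands for \<open>x\<^sup>a y\<^sup>b\<close> in the group with generators \<open>x, y\<close> and relations
  \<open>x\<^sup>4 = 1\<close>, \<open>y\<^sup>2 = x\<^sup>2\<close>, \<open>y x = x\<^sup>-\<^sup>1 y\<close>.\<close>

definition Q8 :: "(int \<times> int) monoid" where
  "Q8 = \<lparr>carrier = {0..<4} \<times> {0..<2},
         monoid.mult = (\<lambda>(a, b) (c, d).
           ((a + (if b = 0 then c else - c) + 2 * b * d) mod 4, (b + d) mod 2)),
         monoid.one = (0, 0)\<rparr>"

lemma group_Q8: "group Q8"
proof (rule groupI)
  have carr: "\<And>a b. (a, b) \<in> carrier Q8 \<longleftrightarrow> 0 \<le> a \<and> a < 4 \<and> (b = 0 \<or> b = 1)"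
    by (auto simp: Q8_def)
  have mult: "\<And>a b c d. (a, b) \<otimes>\<^bsub>Q8\<^esub> (c, d) =
      ((a + (if b = 0 then c else - c) + 2 * b * d) mod 4, (b + d) mod 2)"
    by (simp add: Q8_def)
  have one: "\<one>\<^bsub>Q8\<^esub> = (0, 0)" by (simp add: Q8_def)
  show "\<one>\<^bsub>Q8\<^esub> \<in> carrier Q8" by (simp add: one carr)
  fix x assume x: "x \<in> carrier Q8"
  obtain a b where ab: "x = (a, b)" by fastforce
  show "\<one>\<^bsub>Q8\<^esub> \<otimes>\<^bsub>Q8\<^esub> x = x" using x by (auto simp: ab one carr mult)
  have "\<exists>y. y \<in> carrier Q8 \<and> y \<otimes>\<^bsub>Q8\<^esub> x = \<one>\<^bsub>Q8\<^esub>"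
  proof (cases "b = 0")
    case True
    then show ?thesis
      by (intro exI[of _ "((- a) mod 4, 0)"]) (simp add: ab one carr mult mod_simps)
  next
    case False
    have "((a + 2) mod 4 - a + 2) mod 4 = 0" by presburger
    with False x show ?thesis
      by (intro exI[of _ "((a + 2) mod 4, 1)"]) (auto simp: ab one carr mult mod_simps)
  qed
  then show "\<exists>y\<in>carrier Q8. y \<otimes>\<^bsub>Q8\<^esub> x = \<one>\<^bsub>Q8\<^esub>" by blast
  fix y assume y: "y \<in> carrier Q8"
  obtain c d where cd: "y = (c, d)" by fastforce
  show "x \<otimes>\<^bsub>Q8\<^esub> y \<in> carrier Q8" using x y by (auto simp: ab cd carr mult)
  fix z assume z: "z \<in> carrier Q8"
  obtain e f where ef: "z = (e, f)" by fastforce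
  have bdf: "b = 0 \<or> b = 1" "d = 0 \<or> d = 1" "f = 0 \<or> f = 1"
    using x y z by (auto simp: ab cd ef carr)
  have "4 dvd (a + c) mod 4 + (- c - a)" "4 dvd (a - c) mod 4 - e - (a - (c + e) mod 4)"
    "4 dvd e + (c - e) mod 4 - c"
    by presburger+
  then show "x \<otimes>\<^bsub>Q8\<^esub> y \<otimes>\<^bsub>Q8\<^esub> z = x \<otimes>\<^bsub>Q8\<^esub> (y \<otimes>\<^bsub>Q8\<^esub> z)"
    using bdf by (elim disjE) (simp_all add: ab cd ef mult mod_simps mod_eq_dvd_iff)
qed

lemma order_Q8: "order Q8 = 8"
  by (simp add: Q8_def order_def)

definition Q8_free :: "('a, 'b) monoid_scheme \<Rightarrow> bool" where
  "Q8_free G \<longleftrightarrow>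
     \<not> (\<exists>A B. subgroup A G \<and> B \<lhd> G\<lparr>carrier := A\<rparr> \<and> (G\<lparr>carrier := A\<rparr>) Mod B \<cong> Q8)"

section \<open>Classes of finite groups\<close>

definition supersolvable :: "('a, 'b) monoid_scheme \<Rightarrow> bool" where
  "supersolvable G \<longleftrightarrow>
     (\<exists>n N. N 0 = {\<one>\<^bsub>G\<^esub>} \<and> N n = carrier G \<and>
        (\<forall>i\<le>n. N i \<lhd> G) \<and>
        (\<forall>i<n. N i \<subseteq> N (Suc i) \<and> cyclic_group ((G\<lparr>carrier := N (Suc i)\<rparr>) Mod N i)))"

text \<open>HOL has no type of all groups. Since every finite group is isomorphic to one whose elements
  are natural numbers, an isomorphism-closed class of finite groups is represented by its members
  on \<^typ>\<open>nat\<close>, and a group over any type belongs to the class if it is isomorphic to such a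
  member.\<close>

definition group_class :: "nat monoid set \<Rightarrow> bool" where
  "group_class \<FF> \<longleftrightarrow>
     (\<forall>G\<in>\<FF>. group G \<and> finite (carrier G)) \<and>
     (\<forall>G\<in>\<FF>. \<forall>H. group H \<and> G \<cong> H \<longrightarrow> H \<in> \<FF>)"

definition in_class :: "('a, 'b) monoid_scheme \<Rightarrow> nat monoid set \<Rightarrow> bool" where
  "in_class G \<FF> \<longleftrightarrow> (\<exists>H\<in>\<FF>. G \<cong> H)"

lemma in_class_nat_iff:
  fixes G :: "nat monoid"
  assumes "group_class \<FF>" and "group G"
  shows "in_class G \<FF> \<longleftrightarrow> G \<in> \<FF>"
  using assms group.iso_sym iso_refl unfolding group_class_def in_class_def by blast

lemma finite_group_nat_copy:
  fixes G :: "('a, 'b) monoid_scheme"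
  assumes "group G" and "finite (carrier G)"
  shows "\<exists>H :: nat monoid. group H \<and> G \<cong> H"
proof -
  interpret group G by fact
  obtain f :: "'a \<Rightarrow> nat" where f: "inj_on f (carrier G)"
    using assms(2) finite_imp_inj_to_nat_seg by blast
  define g where "g = inv_into (carrier G) f"
  have g: "g (f x) = x" if "x \<in> carrier G" for x
    using that f by (simp add: g_def)
  define H :: "nat monoid" where
    "H = \<lparr>carrier = f ` carrier G, monoid.mult = (\<lambda>a b. f (g a \<otimes>\<^bsub>G\<^esub> g b)), monoid.one = f \<one>\<^bsub>G\<^esub>\<rparr>"
  have "f \<in> iso G H"
    using f by (auto simp: iso_def hom_def bij_betw_def H_def g)
  moreover have "group H"
  proof (rule groupI)
    fix x assume "x \<in> carrier H"
    then obtain a where a: "a \<in> carrier G" "x = f a" by (auto simp: H_def)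
    then have "f (inv\<^bsub>G\<^esub> a) \<in> carrier H" "f (inv\<^bsub>G\<^esub> a) \<otimes>\<^bsub>H\<^esub> x = \<one>\<^bsub>H\<^esub>"
      by (auto simp: H_def g)
    then show "\<exists>y\<in>carrier H. y \<otimes>\<^bsub>H\<^esub> x = \<one>\<^bsub>H\<^esub>" by blast
  qed (auto simp: H_def g m_assoc)
  ultimately show ?thesis by (blast intro: is_isoI)
qed

definition formation :: "nat monoid set \<Rightarrow> bool" where
  "formation \<FF> \<longleftrightarrow>
     group_class \<FF> \<and>
     (\<forall>G N. G \<in> \<FF> \<and> N \<lhd> G \<longrightarrow> in_class (G Mod N) \<FF>) \<and>
     (\<forall>(G :: nat monoid) N1 N2.
        finite (carrier G) \<and> N1 \<lhd> G \<and> N2 \<lhd> G \<and>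
        in_class (G Mod N1) \<FF> \<and> in_class (G Mod N2) \<FF> \<longrightarrow>
        in_class (G Mod (N1 \<inter> N2)) \<FF>)"

definition solvably_saturated_formation :: "nat monoid set \<Rightarrow> bool" where
  "solvably_saturated_formation \<FF> \<longleftrightarrow>
     formation \<FF> \<and>
     (\<forall>(G :: nat monoid) N.
        group G \<and> finite (carrier G) \<and> N \<lhd> G \<and> solvable (G\<lparr>carrier := N\<rparr>) \<and>
        in_class (G Mod frattini (G\<lparr>carrier := N\<rparr>)) \<FF> \<longrightarrow>
        G \<in> \<FF>)"

definition supersolvable_class :: "nat monoid set" ("\<UU>") where
  "\<UU> = {G. group G \<and> finite (carrier G) \<and> supersolvable G}"

end

theory Submission
  imports Defs "HOL-Number_Theory.Number_Theory"
begin

text \<open>Let \<open>p\<close> be the smallest prime divisor of \<open>|E|\<close> and \<open>P\<close> a Sylow \<open>p\<close>-subgroup of \<open>E\<close>.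
  First, \<open>E\<close> is \<open>p\<close>-nilpotent. If \<open>P\<close> is cyclic this is Burnside's criterion. Otherwise, a
  subgroup \<open>U\<close> of \<open>P\<close> of order \<open>|D|\<close> that is a Sylow subgroup of some \<open>K \<le> E\<close> satisfies
  \<open>U \<inter> [U, K] \<le> \<Phi>(U)\<close>, so that \<open>K\<close> is \<open>p\<close>-nilpotent by Tate's theorem; in general a minimal
  counterexample is \<open>p\<close>-nilpotent by Frobenius' criterion, because an element of order prime to \<open>p\<close>
  that normalizes a \<open>p\<close>-subgroup \<open>S\<close> with \<open>|S| \<ge> |D|\<close> centralizes it: the commutators of a
  nontrivial coprime action would produce an IC\<open>\<Phi>\<close>-subgroup that violates its definition.

  Let \<open>N\<close> be the normal \<open>p\<close>-complement of \<open>E\<close>. By the Frattini argument \<open>G = N H\<close> with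
  \<open>H\<close> the normalizer of \<open>P\<close>, and \<open>P\<close> has a chain of \<open>H\<close>-invariant subgroups with indices \<open>p\<close>, which
  gives normal subgroups of \<open>G\<close> between \<open>N\<close> and \<open>E\<close>. One descends along this chain: if \<open>|L : N'| = p\<close>,
  then \<open>G / L\<close> in the class forces \<open>G / N'\<close> into it, since \<open>L / N'\<close> can be realized inside
  the Frattini subgroup of a normal cyclic subgroup of order \<open>p\<^sup>2\<close>. Hence \<open>G / N\<close> belongs to the class, and
  induction applies to \<open>N\<close>.\<close>

section \<open>Finite groups and transversals\<close>

text \<open>The condition IC\<Phi> refers to [H, G] in the whole group, whereas the subgroups H of
  order |D| need be neither Sylow subgroups nor invariant under the elements acting on them. All
  inductions that use it therefore run over subgroups of one fixed \<open>G\<close>, and such an H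
  becomes a Sylow subgroup only inside a product with a normal subgroup. The link between IC\<Phi>
  and transfer is that the Frattini subgroup of a \<open>p\<close>-group is the common kernel of its
  homomorphisms to the integers modulo \<open>p\<close>. These homomorphisms and transversals stand
  in for most factor groups. For p = 2 the commutators of a minimal coprime action are only known to
  have order dividing 4 instead of \<open>p\<close>; this is where elements of order 4 and
  quaternion sections enter. Saturation sees nothing but Frattini subgroups, so a factor of order
  \<open>p\<close> has to be moved into one. The smallest cyclic group with a Frattini subgroup of
  order \<open>p\<close> has order p^2, and the action on the factor lifts to it because a \<mapsto>
  a^p turns congruences modulo \<open>p\<close> into congruences modulo p^2.\<close>

locale finite_group = group G for G (structure) +
  assumes finite_carrier [simp]: "finite (carrier G)"
begin

lemma inv_cancel_left [simp]:
  "x \<in> carrier G \<Longrightarrow> y \<in> carrier G \<Longrightarrow> inv x \<otimes> (x \<otimes> y) = y"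
  "x \<in> carrier G \<Longrightarrow> y \<in> carrier G \<Longrightarrow> x \<otimes> (inv x \<otimes> y) = y"
  by (simp_all flip: m_assoc)

lemmas group_norm = m_assoc inv_mult_group

lemma finite_subgroup [simp]: "subgroup H G \<Longrightarrow> finite H"
  by (rule finite_subset[OF subgroup.subset finite_carrier])

lemma mem_subgroup_carrier: "subgroup H G \<Longrightarrow> x \<in> H \<Longrightarrow> x \<in> carrier G"
  by (rule subgroup.mem_carrier)

lemma card_subgroup_pos: "subgroup H G \<Longrightarrow> 0 < card H"
  using subgroup.finite_imp_card_positive finite_carrier by blast

lemma finite_subgroupI:
  assumes R: "R \<subseteq> carrier G" "R \<noteq> {}" and m: "\<And>a b. a \<in> R \<Longrightarrow> b \<in> R \<Longrightarrow> a \<otimes> b \<in> R"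
  shows "subgroup R G"
proof (rule subgroupI[OF R])
  fix a assume a: "a \<in> R"
  then have aG: "a \<in> carrier G" using R by blast
  have p: "a [^] Suc n \<in> R" for n
    using a by (induction n) (auto simp: aG m nat_pow_Suc[of a "Suc n" for n])
  have "0 < order G" by (simp add: order_gt_0_iff_finite)
  \<comment> \<open>Doubling the order makes the exponent 2 |G| - 1 positive even for the trivial
    group, so that it has the form \<open>Suc k\<close> covered by \<open>p\<close>.\<close>
  then obtain k where k: "order G + order G = Suc (Suc k)" by (metis add_gr_0 gr0_implies_Suc add_Suc_right add_Suc)
  have "a [^] Suc k \<otimes> a = a [^] (order G + order G)" using k by simp
  also have "\<dots> = \<one>" using aG pow_order_eq_1 by (simp flip: nat_pow_mult)
  finally have "inv a = a [^] Suc k" using aG by (intro inv_equality) auto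
  then show "inv a \<in> R" using p by simp
qed (rule m)

lemma subgroup_subgroup_iff:
  "subgroup H G \<Longrightarrow> subgroup M (G\<lparr>carrier := H\<rparr>) \<longleftrightarrow> subgroup M G \<and> M \<subseteq> H"
  using incl_subgroup[of H M] subgroup_incl[of M H] subgroup.subset[of M "G\<lparr>carrier := H\<rparr>"] by auto

lemma carrier_update: "carrier (G\<lparr>carrier := K\<rparr>) = K"
  by simp

lemma card_subgroup_dvd:
  assumes "subgroup P G" "subgroup K G" "P \<subseteq> K"
  shows "card P dvd card K"
proof -
  interpret K: group "G\<lparr>carrier := K\<rparr>" using assms subgroup_imp_group by blast
  have "subgroup P (G\<lparr>carrier := K\<rparr>)" using assms subgroup_incl by blast
  from K.lagrange[OF this] show ?thesis unfolding order_def by (metis dvd_triv_right carrier_update)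
qed

lemma ex_transversal:
  assumes "subgroup P G" "subgroup K G" "P \<subseteq> K"
  obtains \<sigma> where "\<And>k. k \<in> K \<Longrightarrow> \<sigma> k \<in> K" "\<And>k. k \<in> K \<Longrightarrow> inv k \<otimes> \<sigma> k \<in> P"
    "\<And>k y. k \<in> K \<Longrightarrow> y \<in> P \<Longrightarrow> \<sigma> (k \<otimes> y) = \<sigma> k"
proof -
  interpret P: subgroup P G by fact
  interpret K: subgroup K G by fact
  define \<sigma> where "\<sigma> k = (SOME x. x \<in> k <# P)" for k
  have *: "\<sigma> k \<in> k <# P" if "k \<in> K" for k
    unfolding \<sigma>_def using lcos_self[of k P] that assms(1) K.mem_carrier by (metis someI_ex)
  have a: "\<exists>y\<in>P. \<sigma> k = k \<otimes> y" if "k \<in> K" for k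
    using *[OF that] by (auto simp: l_coset_def)
  show thesis
  proof (rule that[of \<sigma>])
    fix k assume k: "k \<in> K"
    obtain y where "y \<in> P" "\<sigma> k = k \<otimes> y" using a[OF k] by blast
    then show "\<sigma> k \<in> K" "inv k \<otimes> \<sigma> k \<in> P" using k subsetD[OF assms(3)] by simp_all
  next
    fix k y assume k: "k \<in> K" "y \<in> P"
    have "(k \<otimes> y) <# P = k <# P"
    proof -
      have "k \<otimes> y \<in> k <# P" using k by (auto simp: l_coset_def)
      then show ?thesis using l_repr_independence[of "k \<otimes> y" k P] k assms by auto
    qed
    then show "\<sigma> (k \<otimes> y) = \<sigma> k" by (simp add: \<sigma>_def)
  qed
qed

end

text \<open>\<open>\<sigma>\<close> sends an element of \<open>K\<close> to the representative of
  its left coset modulo \<open>P\<close>. The transversal is the image of \<open>K\<close> under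
  \<open>\<sigma>\<close>, and the action of \<open>g\<close> on cosets becomes the map from
  \<open>t\<close> to \<open>\<sigma> (g \<otimes> t)\<close>, so that cosets need not be handled as
  sets.\<close>

locale transversal = finite_group +
  fixes P K :: "'a set" and \<sigma> :: "'a \<Rightarrow> 'a"
  assumes P: "subgroup P G" and K: "subgroup K G" and PK: "P \<subseteq> K"
    and sigma_mem: "\<And>k. k \<in> K \<Longrightarrow> \<sigma> k \<in> K"
    and sigma_coset: "\<And>k. k \<in> K \<Longrightarrow> inv k \<otimes> \<sigma> k \<in> P"
    and sigma_const: "\<And>k y. k \<in> K \<Longrightarrow> y \<in> P \<Longrightarrow> \<sigma> (k \<otimes> y) = \<sigma> k"
begin

sublocale P: subgroup P G by (rule P)
sublocale K: subgroup K G by (rule K)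

lemma P_in_K: "y \<in> P \<Longrightarrow> y \<in> K" using PK by blast

lemma sigma_mem' [simp]: "k \<in> K \<Longrightarrow> \<sigma> k \<in> K" by (rule sigma_mem)

lemma sigma_mult_sigma [simp]: "k \<in> K \<Longrightarrow> j \<in> K \<Longrightarrow> \<sigma> (j \<otimes> \<sigma> k) = \<sigma> (j \<otimes> k)"
proof -
  assume a: "k \<in> K" "j \<in> K"
  have "j \<otimes> \<sigma> k = (j \<otimes> k) \<otimes> (inv k \<otimes> \<sigma> k)" using a by (simp add: m_assoc)
  then show ?thesis using sigma_const[of "j \<otimes> k" "inv k \<otimes> \<sigma> k"] sigma_coset a by simp
qed

lemma sigma_mult_mult_sigma [simp]:
  "k \<in> K \<Longrightarrow> j \<in> K \<Longrightarrow> i \<in> K \<Longrightarrow> \<sigma> (i \<otimes> (j \<otimes> \<sigma> k)) = \<sigma> (i \<otimes> (j \<otimes> k))"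
  using sigma_mult_sigma[of k "i \<otimes> j"] by (simp add: m_assoc)

lemma sigma_idem [simp]: "k \<in> K \<Longrightarrow> \<sigma> (\<sigma> k) = \<sigma> k"
  using sigma_mult_sigma[of k \<one>] by simp

lemma sigma_fix: "t \<in> \<sigma> ` K \<Longrightarrow> \<sigma> t = t" by auto

lemma trans_mem: "t \<in> \<sigma> ` K \<Longrightarrow> t \<in> K" by auto

lemma sigma_eq_iff: "k \<in> K \<Longrightarrow> j \<in> K \<Longrightarrow> \<sigma> k = \<sigma> j \<longleftrightarrow> inv k \<otimes> j \<in> P"
proof
  assume a: "k \<in> K" "j \<in> K" "\<sigma> k = \<sigma> j"
  have "inv k \<otimes> j = (inv k \<otimes> \<sigma> k) \<otimes> inv (inv j \<otimes> \<sigma> j)"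
    using a by (simp add: group_norm)
  then show "inv k \<otimes> j \<in> P" using a(1,2) sigma_coset[OF a(1)] sigma_coset[OF a(2)] P.m_inv_closed P.m_closed by metis
next
  assume a: "k \<in> K" "j \<in> K" "inv k \<otimes> j \<in> P"
  have "\<sigma> (k \<otimes> (inv k \<otimes> j)) = \<sigma> k" using a sigma_const by blast
  then show "\<sigma> k = \<sigma> j" using a by simp
qed

lemma finite_trans [simp]: "finite (\<sigma> ` K)" using K by simp

lemma card_trans: "card (\<sigma> ` K) * card P = card K"
proof -
  have "bij_betw (\<lambda>(t, y). t \<otimes> y) (\<sigma> ` K \<times> P) K"
  proof (rule bij_betwI[where g = "\<lambda>k. (\<sigma> k, inv (\<sigma> k) \<otimes> k)"])
    show "(\<lambda>(t, y). t \<otimes> y) \<in> \<sigma> ` K \<times> P \<rightarrow> K" using P_in_K by auto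
    have "inv (\<sigma> k) \<otimes> k \<in> P" if "k \<in> K" for k
      using that sigma_eq_iff[of "\<sigma> k" k] by simp
    then show "(\<lambda>k. (\<sigma> k, inv (\<sigma> k) \<otimes> k)) \<in> K \<rightarrow> \<sigma> ` K \<times> P" by auto
  qed (auto simp: sigma_const)
  from bij_betw_same_card[OF this] show ?thesis by (simp add: card_cartesian_product)
qed

lemma bij_translate: "g \<in> K \<Longrightarrow> bij_betw (\<lambda>t. \<sigma> (g \<otimes> t)) (\<sigma> ` K) (\<sigma> ` K)"
  by (rule bij_betwI[where g = "\<lambda>t. \<sigma> (inv g \<otimes> t)"]) (auto simp flip: m_assoc)

end

section \<open>Fixed points of \<open>p\<close>-groups, counted modulo \<open>p\<close>\<close>

context finite_group
begin

lemma ex_transversal_locale: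
  assumes "subgroup P G" "subgroup K G" "P \<subseteq> K"
  obtains \<sigma> where "transversal G P K \<sigma>"
  using ex_transversal[OF assms] assms finite_group_axioms
  unfolding transversal_def transversal_axioms_def by metis

text \<open>The orbit of a point that is not fixed has length |S : T| with \<open>T\<close> its
  stabilizer, which is a power of \<open>p\<close> other than one. Removing such an orbit changes
  neither the set of fixed points nor the residue of the cardinality.\<close>

lemma card_fixed_points_cong:
  assumes S: "subgroup S G" "card S = p ^ n" "Factorial_Ring.prime p"
    and fin: "finite \<Omega>"
    and act: "\<And>s w. s \<in> S \<Longrightarrow> w \<in> \<Omega> \<Longrightarrow> act s w \<in> \<Omega>" "\<And>w. w \<in> \<Omega> \<Longrightarrow> act \<one> w = w"
      "\<And>s t w. s \<in> S \<Longrightarrow> t \<in> S \<Longrightarrow> w \<in> \<Omega> \<Longrightarrow> act (s \<otimes> t) w = act s (act t w)"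
  shows "[card {w \<in> \<Omega>. \<forall>s\<in>S. act s w = w} = card \<Omega>] (mod p)"
  using fin act
proof (induction "card \<Omega>" arbitrary: \<Omega> rule: less_induct)
  case less
  interpret S: subgroup S G by fact
  show ?case
  proof (cases "\<forall>w\<in>\<Omega>. \<forall>s\<in>S. act s w = w")
    case True
    then have "{w \<in> \<Omega>. \<forall>s\<in>S. act s w = w} = \<Omega>" by blast
    then show ?thesis by simp
  next
    case False
    then obtain w where w: "w \<in> \<Omega>" "\<not> (\<forall>s\<in>S. act s w = w)" by blast
    define Ob where "Ob = (\<lambda>s. act s w) ` S"
    define T where "T = {s \<in> S. act s w = w}"
    have inv_act: "act (inv s) (act s v) = v" if "s \<in> S" "v \<in> \<Omega>" for s v
      using less.prems(4)[of "inv s" s v] less.prems(3) that by simp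
    have T: "subgroup T G"
    proof (rule subgroupI)
      show "T \<subseteq> carrier G" by (auto simp: T_def)
      have "\<one> \<in> T" using w less.prems(3) by (simp add: T_def)
      then show "T \<noteq> {}" by blast
      show "inv a \<in> T" if "a \<in> T" for a
        using that inv_act[of a w] w by (auto simp: T_def)
      show "a \<otimes> b \<in> T" if "a \<in> T" "b \<in> T" for a b
        using that w less.prems(4) by (auto simp: T_def)
    qed
    have TS: "T \<subseteq> S" by (auto simp: T_def)
    obtain \<sigma> where "transversal G T S \<sigma>" using ex_transversal_locale[OF T S(1) TS] .
    then interpret tr: transversal G T S \<sigma> .
    \<comment> \<open>Orbit and stabilizer: two elements of \<open>S\<close> move \<open>w\<close>
      to the same point exactly if they lie in the same left coset of \<open>T\<close>.\<close>
    have "bij_betw (\<lambda>t. act t w) (\<sigma> ` S) Ob"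
    proof (rule bij_betw_imageI)
      show "inj_on (\<lambda>t. act t w) (\<sigma> ` S)"
      proof (rule inj_onI)
        fix s t assume a: "s \<in> \<sigma> ` S" "t \<in> \<sigma> ` S" "act s w = act t w"
        then have st: "s \<in> S" "t \<in> S" using tr.trans_mem by auto
        have "act (inv s \<otimes> t) w = w" using less.prems(4)[of "inv s" t w] st w inv_act[of s w] a(3) by simp
        then have "inv s \<otimes> t \<in> T" using st by (simp add: T_def)
        then have "\<sigma> s = \<sigma> t" using tr.sigma_eq_iff[of s t] st by blast
        then show "s = t" using a(1,2) tr.sigma_fix by metis
      qed
      have "act s w \<in> (\<lambda>t. act t w) ` \<sigma> ` S" if s: "s \<in> S" for s
      proof -
        have "act (\<sigma> s) w = act (s \<otimes> (inv s \<otimes> \<sigma> s)) w" using s by simp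
        also have "\<dots> = act s (act (inv s \<otimes> \<sigma> s) w)"
          using s w less.prems(4)[of s "inv s \<otimes> \<sigma> s" w] tr.sigma_coset by simp
        also have "act (inv s \<otimes> \<sigma> s) w = w" using tr.sigma_coset[OF s] by (simp add: T_def)
        finally have "act s w = act (\<sigma> s) w" by simp
        then show ?thesis using s by blast
      qed
      then show "(\<lambda>t. act t w) ` \<sigma> ` S = Ob" unfolding Ob_def using tr.trans_mem by blast
    qed
    then have cO: "card Ob * card T = p ^ n"
      using bij_betw_same_card tr.card_trans S(2) by metis
    have ObO: "Ob \<subseteq> \<Omega>" using less.prems(2) w by (auto simp: Ob_def)
    then have finOb: "finite Ob" using less.prems(1) finite_subset by blast
    have wOb: "w \<in> Ob"
      using less.prems(3)[OF w(1)] imageI[OF S.one_closed, of "\<lambda>s. act s w"] by (simp add: Ob_def)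
    have "card Ob \<noteq> 1"
    proof
      assume "card Ob = 1"
      then have "Ob = {w}" using wOb by (metis card_1_singletonE singletonD)
      then show False using w by (auto simp: Ob_def)
    qed
    moreover have "card Ob dvd p ^ n" using cO by (metis dvd_triv_left)
    ultimately have pO: "p dvd card Ob" using S(3)
      by (metis divides_primepow_nat dvd_power_same power_0 dvd_power gr0I)
    have invc: "act s v \<in> \<Omega> - Ob" if s: "s \<in> S" and v: "v \<in> \<Omega> - Ob" for s v
    proof -
      have "act s v \<notin> Ob"
      proof
        assume "act s v \<in> Ob"
        then obtain t where t: "t \<in> S" "act s v = act t w" by (auto simp: Ob_def)
        then have "v = act (inv s) (act t w)" using inv_act s v by (metis DiffD1)
        then have "v = act (inv s \<otimes> t) w" using less.prems(4) s t w by simp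
        then show False using v s t by (auto simp: Ob_def)
      qed
      then show ?thesis using less.prems(2) s v by blast
    qed
    have "card (\<Omega> - Ob) < card \<Omega>" using finOb ObO wOb less.prems(1)
      by (metis Diff_subset card_Diff1_le card_mono card_seteq Diff_iff le_neq_implies_less subsetD)
    then have "[card {v \<in> \<Omega> - Ob. \<forall>s\<in>S. act s v = v} = card (\<Omega> - Ob)] (mod p)"
      by (rule less.hyps) (use less.prems invc in auto)
    moreover have "{v \<in> \<Omega> - Ob. \<forall>s\<in>S. act s v = v} = {v \<in> \<Omega>. \<forall>s\<in>S. act s v = v}"
    proof -
      have False if v: "v \<in> Ob" "\<forall>s\<in>S. act s v = v" for v
      proof -
        obtain t where t: "t \<in> S" "v = act t w" using v by (auto simp: Ob_def)
        have "v = w" using v(2)[rule_format, of "inv t"] t inv_act w by simp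
        then show False using v w by blast
      qed
      then show ?thesis by blast
    qed
    moreover have "card \<Omega> = card (\<Omega> - Ob) + card Ob"
      using finOb ObO less.prems(1) by (metis card_Diff_subset card_mono le_add_diff_inverse2)
    ultimately show ?thesis using pO
      by (metis (no_types, lifting) cong_def mod_add_self2 dvd_def mod_mult_self2)
  qed
qed

section \<open>Sylow subgroups\<close>

text \<open>Only an inclusion is required. For a subgroup of the finite group \<open>G\<close>
  equality follows by counting, see \<open>conj_set_eq\<close>.\<close>

definition normalizes :: "'a \<Rightarrow> 'a set \<Rightarrow> bool" where
  "normalizes x H \<longleftrightarrow> (\<forall>h\<in>H. x \<otimes> h \<otimes> inv x \<in> H)"

definition conj_set :: "'a \<Rightarrow> 'a set \<Rightarrow> 'a set" where
  "conj_set x H = (\<lambda>h. x \<otimes> h \<otimes> inv x) ` H"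

definition p_subgroup :: "nat \<Rightarrow> 'a set \<Rightarrow> bool" where
  "p_subgroup p H \<longleftrightarrow> subgroup H G \<and> (\<exists>n. card H = p ^ n)"

text \<open>Phrased through the index, the quantity that counts cosets in the fixed point arguments;
  \<open>sylow_in_iff\<close> recovers the usual order.\<close>

definition sylow_in :: "nat \<Rightarrow> 'a set \<Rightarrow> 'a set \<Rightarrow> bool" where
  "sylow_in p P K \<longleftrightarrow> p_subgroup p P \<and> P \<subseteq> K \<and> \<not> p dvd card K div card P"

lemma p_subgroupD: "p_subgroup p H \<Longrightarrow> subgroup H G"
  by (simp add: p_subgroup_def)

lemma sylow_inD:
  assumes "sylow_in p P K"
  shows "p_subgroup p P" "subgroup P G" "P \<subseteq> K" "\<not> p dvd card K div card P"
  using assms by (auto simp: sylow_in_def p_subgroup_def)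

lemma normalizesD: "normalizes x H \<Longrightarrow> h \<in> H \<Longrightarrow> x \<otimes> h \<otimes> inv x \<in> H"
  by (simp add: normalizes_def)

lemma conj_set_subset_iff: "conj_set x H \<subseteq> H \<longleftrightarrow> normalizes x H"
  by (auto simp: conj_set_def normalizes_def)

lemma inj_on_conj:
  assumes "x \<in> carrier G" "H \<subseteq> carrier G"
  shows "inj_on (\<lambda>h. x \<otimes> h \<otimes> inv x) H"
proof (rule inj_onI)
  fix a b assume a: "a \<in> H" "b \<in> H" "x \<otimes> a \<otimes> inv x = x \<otimes> b \<otimes> inv x"
  then have "a \<in> carrier G" "b \<in> carrier G" using assms by auto
  then show "a = b" using a(3) assms(1) by simp
qed

lemma card_conj_set: "x \<in> carrier G \<Longrightarrow> H \<subseteq> carrier G \<Longrightarrow> card (conj_set x H) = card H"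
  unfolding conj_set_def using inj_on_conj card_image by blast

lemma subgroup_conj_set:
  assumes "x \<in> carrier G" "subgroup H G"
  shows "subgroup (conj_set x H) G"
proof -
  interpret H: subgroup H G by fact
  show ?thesis
  proof (rule subgroupI)
    show "conj_set x H \<subseteq> carrier G" using assms by (auto simp: conj_set_def)
    show "conj_set x H \<noteq> {}" using subgroup_nonempty[of G] assms(2) by (auto simp: conj_set_def)
    fix a assume "a \<in> conj_set x H"
    then obtain h where h: "h \<in> H" "a = x \<otimes> h \<otimes> inv x" by (auto simp: conj_set_def)
    then have "inv a = x \<otimes> inv h \<otimes> inv x" using assms by (simp add: group_norm)
    then show "inv a \<in> conj_set x H" using h by (auto simp: conj_set_def)
    fix b assume "b \<in> conj_set x H"
    then obtain k where k: "k \<in> H" "b = x \<otimes> k \<otimes> inv x" by (auto simp: conj_set_def)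
    have "a \<otimes> b = x \<otimes> (h \<otimes> k) \<otimes> inv x" using h k assms by (simp add: group_norm)
    then show "a \<otimes> b \<in> conj_set x H" using h k by (auto simp: conj_set_def)
  qed
qed

lemma conj_set_mult:
  assumes "x \<in> carrier G" "y \<in> carrier G" "H \<subseteq> carrier G"
  shows "conj_set (x \<otimes> y) H = conj_set x (conj_set y H)"
proof -
  have "x \<otimes> y \<otimes> h \<otimes> inv (x \<otimes> y) = x \<otimes> (y \<otimes> h \<otimes> inv y) \<otimes> inv x" if "h \<in> H" for h
    using that assms by (simp add: group_norm subsetD)
  then show ?thesis unfolding conj_set_def image_image by (rule image_cong[OF refl])
qed

lemma conj_set_one: "H \<subseteq> carrier G \<Longrightarrow> conj_set \<one> H = H"
  by (force simp: conj_set_def subsetD)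

lemma conj_set_inv_cancel:
  assumes "x \<in> carrier G" "H \<subseteq> carrier G"
  shows "conj_set (inv x) (conj_set x H) = H" "conj_set x (conj_set (inv x) H) = H"
  using conj_set_mult[of "inv x" x H] conj_set_mult[of x "inv x" H] assms conj_set_one[of H] by simp_all

lemma conj_set_eq:
  assumes "x \<in> carrier G" "subgroup H G" "normalizes x H"
  shows "conj_set x H = H"
  using card_conj_set[of x H] assms conj_set_subset_iff[of x H] card_subset_eq[of H "conj_set x H"]
    finite_subgroup subgroup.subset by metis

lemma normalizes_inv:
  assumes "x \<in> carrier G" "subgroup H G" "normalizes x H"
  shows "normalizes (inv x) H"
  using conj_set_eq[OF assms] conj_set_inv_cancel(1)[of x H] subgroup.subset[OF assms(2)] assms(1)
    conj_set_subset_iff[of "inv x" H] by simp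

lemma normalizes_mult:
  assumes "x \<in> carrier G" "y \<in> carrier G" "H \<subseteq> carrier G" "normalizes x H" "normalizes y H"
  shows "normalizes (x \<otimes> y) H"
proof -
  have "x \<otimes> y \<otimes> h \<otimes> inv (x \<otimes> y) = x \<otimes> (y \<otimes> h \<otimes> inv y) \<otimes> inv x" if "h \<in> H" for h
    using that assms by (simp add: group_norm subsetD)
  then show ?thesis using assms(4,5) by (simp add: normalizes_def)
qed

lemma normalizes_self: "subgroup H G \<Longrightarrow> x \<in> H \<Longrightarrow> normalizes x H"
  by (simp add: normalizes_def subgroup.m_closed subgroup.m_inv_closed)

lemma normalizes_Int: "normalizes x H \<Longrightarrow> normalizes x K \<Longrightarrow> normalizes x (H \<inter> K)"
  by (simp add: normalizes_def)

lemma normalizer_subgroup: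
  assumes "subgroup K G" "subgroup H G"
  shows "subgroup {k \<in> K. normalizes k H} G"
proof -
  interpret K: subgroup K G by fact
  interpret H: subgroup H G by fact
  show ?thesis
  proof (rule subgroupI)
    have "\<one> \<in> {k \<in> K. normalizes k H}" by (simp add: normalizes_def)
    then show "{k \<in> K. normalizes k H} \<noteq> {}" by blast
  qed (use assms normalizes_inv normalizes_mult H.subset in \<open>auto\<close>)
qed

lemma sylow_in_exists:
  assumes "Factorial_Ring.prime p" "subgroup K G"
  shows "\<exists>P. sylow_in p P K"
proof -
  interpret K: group "G\<lparr>carrier := K\<rparr>" using assms subgroup_imp_group by blast
  have pos: "0 < card K" using card_subgroup_pos assms(2) .
  obtain m where m: "card K = p ^ multiplicity p (card K) * m" "\<not> p dvd m"
    using multiplicity_decompose'[of "card K" p] pos assms(1) by (metis not_prime_unit not_gr_zero)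
  have "\<exists>H. subgroup H (G\<lparr>carrier := K\<rparr>) \<and> card H = p ^ multiplicity p (card K)"
    by (rule sylow_thm[OF assms(1) K.is_group, where m = m]) (use m(1) assms in \<open>simp_all add: order_def\<close>)
  then obtain H where H: "subgroup H (G\<lparr>carrier := K\<rparr>)" "card H = p ^ multiplicity p (card K)" by blast
  have "card K div card H = m"
    using m(1) H(2) assms(1) by (metis nonzero_mult_div_cancel_left power_not_zero not_prime_0)
  then show ?thesis using H m assms subgroup_subgroup_iff[of K H]
    unfolding sylow_in_def p_subgroup_def by metis
qed

text \<open>\<open>S\<close> acts on the left cosets of \<open>P\<close> in \<open>K\<close>, whose
  number is prime to \<open>p\<close>, so some coset of \<open>w\<close> is fixed and conjugation by
  \<open>inv w\<close> moves \<open>S\<close> into \<open>P\<close>. That \<open>P\<close> may be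
  any subgroup of index prime to \<open>p\<close> is what later allows a normal subgroup in its
  place.\<close>

lemma p_subgroup_conj_into:
  assumes "Factorial_Ring.prime p" "subgroup K G" "p_subgroup p S" "S \<subseteq> K"
    "subgroup P G" "P \<subseteq> K" "\<not> p dvd card K div card P"
  shows "\<exists>k\<in>K. conj_set k S \<subseteq> P"
proof -
  obtain \<sigma> where "transversal G P K \<sigma>"
    using ex_transversal_locale[of P K] assms by blast
  then interpret tr: transversal G P K \<sigma> .
  obtain n where S: "subgroup S G" "card S = p ^ n" using assms(3) by (auto simp: p_subgroup_def)
  interpret S: subgroup S G by fact
  have sK: "s \<in> K" if "s \<in> S" for s using that assms(4) by blast
  have "[card {w \<in> \<sigma> ` K. \<forall>s\<in>S. \<sigma> (s \<otimes> w) = w} = card (\<sigma> ` K)] (mod p)"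
    by (rule card_fixed_points_cong[OF S assms(1)]) (auto simp: sK m_assoc)
  moreover have "card (\<sigma> ` K) = card K div card P"
    using tr.card_trans card_subgroup_pos[OF tr.P] by (metis nonzero_mult_div_cancel_right not_gr_zero)
  ultimately have "card {w \<in> \<sigma> ` K. \<forall>s\<in>S. \<sigma> (s \<otimes> w) = w} \<noteq> 0"
    using assms(7) cong_dvd_iff by (metis dvd_0_right)
  then obtain w where w: "w \<in> \<sigma> ` K" "\<forall>s\<in>S. \<sigma> (s \<otimes> w) = w"
    by (metis (mono_tags, lifting) card_eq_0_iff empty_Collect_eq)
  have wK: "w \<in> K" using w(1) tr.trans_mem by blast
  have "inv w \<otimes> s \<otimes> inv (inv w) \<in> P" if s: "s \<in> S" for s
  proof -
    have "\<sigma> w = \<sigma> (s \<otimes> w)" using w s tr.sigma_fix by metis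
    then have "inv w \<otimes> (s \<otimes> w) \<in> P" using tr.sigma_eq_iff[of w "s \<otimes> w"] wK sK[OF s] by simp
    then show ?thesis using wK s by (simp add: m_assoc)
  qed
  then have "conj_set (inv w) S \<subseteq> P" by (auto simp: conj_set_def)
  then show ?thesis using wK tr.K.m_inv_closed by blast
qed

lemma sylow_contains:
  assumes "Factorial_Ring.prime p" "subgroup K G" "sylow_in p P K" "p_subgroup p S" "S \<subseteq> K"
  shows "\<exists>k\<in>K. conj_set k S \<subseteq> P"
  using p_subgroup_conj_into[OF assms(1,2,4,5), of P] sylow_inD[OF assms(3)] by blast

lemma card_sylow_eq:
  assumes "Factorial_Ring.prime p" "subgroup K G" "sylow_in p P K"
  shows "card P = p ^ multiplicity p (card K)"
proof -
  obtain n where n: "card P = p ^ n" using assms(3) by (auto simp: sylow_in_def p_subgroup_def)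
  have "card K = p ^ n * (card K div card P)"
    using card_subgroup_dvd[of P K] sylow_inD[OF assms(3)] assms(2) n by (metis dvd_mult_div_cancel)
  then have "multiplicity p (card K) = n"
    using multiplicity_decomposeI[of "card K" p n "card K div card P"] sylow_inD(4)[OF assms(3)] assms(1)
    by (metis not_prime_0 not_prime_unit)
  then show ?thesis using n by simp
qed

lemma sylow_in_iff:
  assumes "Factorial_Ring.prime p" "subgroup K G"
  shows "sylow_in p P K \<longleftrightarrow> subgroup P G \<and> P \<subseteq> K \<and> card P = p ^ multiplicity p (card K)"
proof
  assume "sylow_in p P K"
  then show "subgroup P G \<and> P \<subseteq> K \<and> card P = p ^ multiplicity p (card K)"
    using card_sylow_eq assms sylow_inD by blast
next
  assume a: "subgroup P G \<and> P \<subseteq> K \<and> card P = p ^ multiplicity p (card K)"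
  obtain m where m: "card K = p ^ multiplicity p (card K) * m" "\<not> p dvd m"
    using multiplicity_decompose'[of "card K" p] card_subgroup_pos[OF assms(2)] assms(1)
    by (metis not_prime_unit not_gr_zero)
  have "card K div card P = m"
    using m(1) a assms(1) by (metis nonzero_mult_div_cancel_left power_not_zero not_prime_0)
  then show "sylow_in p P K" using a m by (auto simp: sylow_in_def p_subgroup_def)
qed

lemma sylow_conj:
  assumes "Factorial_Ring.prime p" "subgroup K G" "sylow_in p P K" "sylow_in p Q K"
  shows "\<exists>k\<in>K. conj_set k P = Q"
proof -
  obtain k where k: "k \<in> K" "conj_set k P \<subseteq> Q"
    using sylow_contains[OF assms(1,2,4), of P] sylow_inD[OF assms(3)] by blast
  have "card (conj_set k P) = card P"
    using card_conj_set[of k P] k mem_subgroup_carrier[OF assms(2)] sylow_inD[OF assms(3)] subgroup.subset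
    by blast
  also have "\<dots> = card Q" using card_sylow_eq assms by metis
  finally have "conj_set k P = Q"
    using k(2) sylow_inD(2)[OF assms(4)] by (metis card_subset_eq finite_subgroup)
  then show ?thesis using k by blast
qed

lemma p_subgroup_subset:
  assumes "Factorial_Ring.prime p" "p_subgroup p P" "subgroup S G" "S \<subseteq> P"
  shows "p_subgroup p S"
  using assms card_subgroup_dvd[of S P] divides_primepow_nat[of p "card S"] unfolding p_subgroup_def by auto

text \<open>\<open>S\<close> acts on its own left cosets in \<open>P\<close>. Their number is
  divisible by \<open>p\<close>, hence so is the number of fixed cosets; as \<open>S\<close> itself
  is one, there is another, and its elements normalize \<open>S\<close>.\<close>

lemma normalizer_grows:
  assumes p: "Factorial_Ring.prime p" and P: "p_subgroup p P" and S: "subgroup S G" "S \<subset> P"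
  shows "\<exists>x\<in>P - S. normalizes x S"
proof -
  have PG: "subgroup P G" using P p_subgroupD by blast
  obtain \<sigma> where "transversal G S P \<sigma>"
    using ex_transversal_locale[of S P] S PG by blast
  then interpret tr: transversal G S P \<sigma> .
  obtain n where n: "card S = p ^ n" using p_subgroup_subset[OF p P] S by (auto simp: p_subgroup_def)
  let ?F = "{w \<in> \<sigma> ` P. \<forall>s\<in>S. \<sigma> (s \<otimes> w) = w}"
  have "[card ?F = card (\<sigma> ` P)] (mod p)"
    by (rule card_fixed_points_cong[OF S(1) n p]) (auto simp: tr.P_in_K m_assoc)
  moreover have "p dvd card (\<sigma> ` P)"
  proof -
    have "card (\<sigma> ` P) \<noteq> 1"
    proof
      assume "card (\<sigma> ` P) = 1"
      then have "card S = card P" using tr.card_trans by simp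
      then show False using S PG by (metis finite_subgroup card_subset_eq psubset_eq)
    qed
    moreover have "card (\<sigma> ` P) dvd card P" using tr.card_trans by (metis dvd_triv_left)
    ultimately show ?thesis using P p unfolding p_subgroup_def
      by (metis divides_primepow_nat dvd_power_same power_0 dvd_power gr0I)
  qed
  ultimately have F: "p dvd card ?F" using cong_dvd_iff by blast
  have "\<sigma> \<one> \<in> ?F"
  proof -
    have "\<sigma> (s \<otimes> \<sigma> \<one>) = \<sigma> \<one>" if "s \<in> S" for s
      using that tr.P_in_K[of s] tr.sigma_const[of \<one> s] by simp
    then show ?thesis by simp
  qed
  moreover have "?F \<noteq> {\<sigma> \<one>}" using F p by (metis card_1_singleton_iff not_prime_unit nat_dvd_1_iff_1 is_singletonI is_singleton_altdef One_nat_def)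
  ultimately obtain w where w: "w \<in> ?F" "w \<noteq> \<sigma> \<one>" by blast
  have wP: "w \<in> P" using w tr.trans_mem by blast
  have "w \<notin> S"
  proof
    assume "w \<in> S"
    then have "\<sigma> \<one> = \<sigma> w" using tr.sigma_const[of \<one> w] by simp
    also have "\<dots> = w" using w tr.sigma_fix by blast
    finally show False using w by simp
  qed
  moreover have "inv w \<otimes> s \<otimes> inv (inv w) \<in> S" if s: "s \<in> S" for s
  proof -
    have "\<sigma> w = \<sigma> (s \<otimes> w)" using w s tr.sigma_fix by (metis (mono_tags, lifting) mem_Collect_eq)
    then have "inv w \<otimes> (s \<otimes> w) \<in> S"
      using tr.sigma_eq_iff[of w "s \<otimes> w"] wP tr.P_in_K[OF s] by simp
    then show ?thesis using wP s by (simp add: m_assoc)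
  qed
  then have "normalizes (inv w) S" by (simp add: normalizes_def)
  then have "normalizes w S" using normalizes_inv[of "inv w" S] S(1) wP by simp
  ultimately show ?thesis using wP by blast
qed

section \<open>Characters modulo a prime\<close>

lemma ex_max_card:
  assumes "Q S" "\<And>T. Q T \<Longrightarrow> T \<subseteq> carrier G"
  obtains T where "Q T" "\<And>T'. Q T' \<Longrightarrow> card T' \<le> card T"
proof -
  have "\<forall>T. Q T \<longrightarrow> card T \<le> card (carrier G)" using assms(2) by (simp add: card_mono)
  with assms(1) have "\<exists>T. Q T \<and> (\<forall>T'. Q T' \<longrightarrow> card T' \<le> card T)"
    by (intro Lattices_Big.ex_has_greatest_nat[of Q S card "Suc (card (carrier G))"]) (simp_all add: less_Suc_eq_le)
  then show thesis using that by blast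
qed

text \<open>A homomorphism from \<open>P\<close> to the integers modulo \<open>p\<close>, carried by
  integer representatives so that the sums of transfer can be formed in \<open>int\<close>.\<close>

definition mod_char :: "nat \<Rightarrow> 'a set \<Rightarrow> ('a \<Rightarrow> int) \<Rightarrow> bool" where
  "mod_char p P l \<longleftrightarrow> (\<forall>x\<in>P. \<forall>y\<in>P. [l (x \<otimes> y) = l x + l y] (mod int p))"

lemma mod_charD: "mod_char p P l \<Longrightarrow> x \<in> P \<Longrightarrow> y \<in> P \<Longrightarrow> [l (x \<otimes> y) = l x + l y] (mod int p)"
  by (simp add: mod_char_def)

lemma mod_char_one:
  assumes "mod_char p P l" "subgroup P G"
  shows "[l \<one> = 0] (mod int p)"
proof -
  have "[l (\<one> \<otimes> \<one>) = l \<one> + l \<one>] (mod int p)"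
    using assms mod_charD subgroup.one_closed by metis
  then have "[0 + l \<one> = l \<one> + l \<one>] (mod int p)" by simp
  then show ?thesis using cong_add_rcancel cong_sym by blast
qed

lemma mod_char_inv:
  assumes "mod_char p P l" "subgroup P G" "x \<in> P"
  shows "[l (inv x) = - l x] (mod int p)"
proof -
  have x: "x \<in> carrier G" using assms mem_subgroup_carrier by blast
  have "[l (inv x \<otimes> x) = l (inv x) + l x] (mod int p)"
    using assms mod_charD subgroup.m_inv_closed by metis
  then have "[l (inv x) + l x = 0] (mod int p)"
    using mod_char_one[OF assms(1,2)] x cong_trans cong_sym by (metis l_inv)
  then have "[l (inv x) + l x + (- l x) = 0 + (- l x)] (mod int p)" by (rule cong_add) simp
  then show ?thesis by simp
qed

lemma mod_char_conj:
  assumes "mod_char p P l" "subgroup P G" "x \<in> P" "y \<in> P"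
  shows "[l (x \<otimes> y \<otimes> inv x) = l y] (mod int p)"
proof -
  interpret P: subgroup P G by fact
  have "[l (x \<otimes> y \<otimes> inv x) = l (x \<otimes> y) + l (inv x)] (mod int p)"
    using assms mod_charD by simp
  also have "[l (x \<otimes> y) + l (inv x) = (l x + l y) + (- l x)] (mod int p)"
    using assms by (intro cong_add mod_charD mod_char_inv)
  finally show ?thesis by simp
qed

lemma mod_char_inv_mult:
  assumes "mod_char p P l" "subgroup P G" "x \<in> P" "y \<in> P"
  shows "[l (inv x \<otimes> y) = l y - l x] (mod int p)"
proof -
  interpret P: subgroup P G by fact
  have "[l (inv x \<otimes> y) = l (inv x) + l y] (mod int p)"
    using assms mod_charD by simp
  also have "[l (inv x) + l y = - l x + l y] (mod int p)"
    using assms by (intro cong_add mod_char_inv) auto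
  finally show ?thesis by simp
qed

lemma mod_char_pow:
  assumes "mod_char p P l" "subgroup P G" "x \<in> P"
  shows "[l (x [^] (n::nat)) = int n * l x] (mod int p)"
proof (induction n)
  case 0
  then show ?case using mod_char_one[OF assms(1,2)] by simp
next
  case (Suc n)
  interpret P: subgroup P G by fact
  have "x [^] n \<in> P" using assms by (induction n) auto
  then have "[l (x [^] n \<otimes> x) = l (x [^] n) + l x] (mod int p)"
    using assms mod_charD by blast
  also have "[l (x [^] n) + l x = int n * l x + l x] (mod int p)" using Suc by (intro cong_add) auto
  finally show ?case by (simp add: algebra_simps)
qed

lemma nat_pow_mem: "subgroup P G \<Longrightarrow> x \<in> P \<Longrightarrow> x [^] (n::nat) \<in> P"
  by (induction n) (auto simp: subgroup.one_closed subgroup.m_closed)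

lemma mod_char_mono: "mod_char p P l \<Longrightarrow> Q \<subseteq> P \<Longrightarrow> mod_char p Q l"
  by (auto simp: mod_char_def)

lemma mod_char_kernel_subgroup:
  assumes "mod_char p P l" "subgroup P G"
  shows "subgroup {x \<in> P. int p dvd l x} G"
proof -
  interpret P: subgroup P G by fact
  show ?thesis
  proof (rule subgroupI)
    have "\<one> \<in> {x \<in> P. int p dvd l x}" using mod_char_one[OF assms] by (simp add: cong_0_iff)
    then show "{x \<in> P. int p dvd l x} \<noteq> {}" by blast
    fix a assume a: "a \<in> {x \<in> P. int p dvd l x}"
    then show "inv a \<in> {x \<in> P. int p dvd l x}"
      using mod_char_inv[OF assms, of a] cong_dvd_iff[of "l (inv a)" "- l a" "int p"] by auto
    fix b assume b: "b \<in> {x \<in> P. int p dvd l x}"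
    show "a \<otimes> b \<in> {x \<in> P. int p dvd l x}"
      using mod_charD[OF assms(1), of a b] a b cong_dvd_iff[of "l (a \<otimes> b)" "l a + l b" "int p"] by auto
  qed auto
qed

text \<open>As \<open>l y\<close> is invertible modulo \<open>p\<close>, each coset of the kernel
  contains exactly one of the powers of \<open>y\<close> with exponent below \<open>p\<close>;
  \<open>e x\<close> is the exponent that belongs to the coset of \<open>x\<close>.\<close>

lemma card_mod_char_kernel:
  assumes p: "Factorial_Ring.prime p" and l: "mod_char p P l" and P: "subgroup P G"
    and y: "y \<in> P" "\<not> int p dvd l y"
  shows "card {x \<in> P. int p dvd l x} * p = card P"
proof -
  interpret P: subgroup P G by fact
  have "coprime (l y) (int p)" using prime_imp_coprime[of "int p" "l y"] p y(2) by (simp add: coprime_commute)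
  then obtain c where c: "[l y * c = 1] (mod int p)" using cong_solve_coprime_int by blast
  define e where "e x = nat ((l x * c) mod int p)" for x
  have p0: "int p > 0" using p prime_gt_0_nat by simp
  have e: "e x < p" "[int (e x) * l y = l x] (mod int p)" for x
  proof -
    show "e x < p" using p0 by (simp add: e_def nat_less_iff)
    have "[int (e x) = l x * c] (mod int p)" using p0 by (simp add: e_def cong_def)
    then have "[int (e x) * l y = (l x * c) * l y] (mod int p)" by (rule cong_mult) simp
    also have "[l x * c * l y = l x * 1] (mod int p)" using cong_mult[OF cong_refl c, of "l x"] by (simp add: ac_simps)
    finally show "[int (e x) * l y = l x] (mod int p)" by simp
  qed
  have eu: "i = j" if "[int i * l y = int j * l y] (mod int p)" "i < p" "j < p" for i j :: nat
  proof -
    have "[int i = int j] (mod int p)" using that(1) \<open>coprime (l y) (int p)\<close> cong_mult_rcancel by blast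
    then show ?thesis using that by (simp add: cong_int_iff cong_less_modulus_unique_nat)
  qed
  let ?K = "{x \<in> P. int p dvd l x}"
  interpret K: subgroup ?K G by (rule mod_char_kernel_subgroup[OF l P])
  have pw: "y [^] (i::nat) \<in> P" for i using nat_pow_mem[OF P y(1)] .
  have "bij_betw (\<lambda>(k, i). y [^] i \<otimes> k) (?K \<times> {..<p}) P"
  proof (rule bij_betwI[where g = "\<lambda>x. (inv (y [^] e x) \<otimes> x, e x)"])
    show "(\<lambda>(k, i). y [^] i \<otimes> k) \<in> ?K \<times> {..<p} \<rightarrow> P" using pw by auto
    have "int p dvd l (inv (y [^] e x) \<otimes> x)" if "x \<in> P" for x
    proof -
      have "[l (inv (y [^] e x) \<otimes> x) = l x - l (y [^] e x)] (mod int p)"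
        by (rule mod_char_inv_mult[OF l P pw that])
      also have "[l x - l (y [^] e x) = int (e x) * l y - int (e x) * l y] (mod int p)"
        by (rule cong_diff[OF cong_sym[OF e(2)] mod_char_pow[OF l P y(1)]])
      finally show ?thesis by (simp add: cong_0_iff)
    qed
    then show "(\<lambda>x. (inv (y [^] e x) \<otimes> x, e x)) \<in> P \<rightarrow> ?K \<times> {..<p}"
      using pw e(1) by auto
    fix x assume "x \<in> P"
    then show "(case (inv (y [^] e x) \<otimes> x, e x) of (k, i) \<Rightarrow> y [^] i \<otimes> k) = x"
      using pw by (simp add: y)
  next
    fix z assume "z \<in> ?K \<times> {..<p}"
    then obtain k i where z: "z = (k, i)" "k \<in> P" "int p dvd l k" "i < p" by auto
    have "[int (e (y [^] i \<otimes> k)) * l y = l (y [^] i \<otimes> k)] (mod int p)" by (rule e(2))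
    also have "[l (y [^] i \<otimes> k) = l (y [^] i) + l k] (mod int p)" by (rule mod_charD[OF l pw z(2)])
    also have "[l (y [^] i) + l k = int i * l y + 0] (mod int p)"
      using z(3) by (intro cong_add mod_char_pow[OF l P y(1)]) (simp add: cong_0_iff)
    finally have "e (y [^] i \<otimes> k) = i" using eu[of "e (y [^] i \<otimes> k)" i] e(1) z(4) by simp
    then show "(\<lambda>x. (inv (y [^] e x) \<otimes> x, e x)) (case z of (k, i) \<Rightarrow> y [^] i \<otimes> k) = z"
      using z pw y by simp
  qed
  from bij_betw_same_card[OF this] show ?thesis by (metis card_cartesian_product card_lessThan)
qed

lemma p_power_eventually_one:
  assumes "p_subgroup p Q" "x \<in> Q"
  shows "\<exists>n. x [^] (p ^ n) = \<one>"
proof -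
  obtain n where n: "card Q = p ^ n" "subgroup Q G" using assms by (auto simp: p_subgroup_def)
  interpret Q: group "G\<lparr>carrier := Q\<rparr>" using n subgroup_imp_group by blast
  have "x [^]\<^bsub>G\<lparr>carrier := Q\<rparr>\<^esub> card Q = \<one>"
    using Q.pow_order_eq_1[of x] assms(2) by (simp add: order_def)
  then show ?thesis using n(1) by (metis nat_pow_consistent)
qed

text \<open>The commutators measure how conjugation by \<open>u\<close> moves the cosets of
  \<open>y\<close> and \<open>z\<close> modulo \<open>T\<close>. So the elements whose coset is
  fixed are closed under products.\<close>

lemma normalizes_left_coset_mult:
  assumes "subgroup T G" "u \<in> carrier G" "y \<in> carrier G" "z \<in> carrier G" "normalizes (inv z) T"
    "inv y \<otimes> (u \<otimes> y \<otimes> inv u) \<in> T" "inv z \<otimes> (u \<otimes> z \<otimes> inv u) \<in> T"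
  shows "inv (y \<otimes> z) \<otimes> (u \<otimes> (y \<otimes> z) \<otimes> inv u) \<in> T"
proof -
  have "inv (y \<otimes> z) \<otimes> (u \<otimes> (y \<otimes> z) \<otimes> inv u) =
    (inv z \<otimes> (inv y \<otimes> (u \<otimes> y \<otimes> inv u)) \<otimes> inv (inv z)) \<otimes> (inv z \<otimes> (u \<otimes> z \<otimes> inv u))"
    using assms(2-4) by (simp add: group_norm)
  then show ?thesis using assms normalizesD subgroup.m_closed by metis
qed

lemma pow_mem_iff_dvd:
  assumes p: "Factorial_Ring.prime p" and TG: "subgroup T G" and yG: "y \<in> carrier G"
    and yp: "y [^] p \<in> T" and yT: "y \<notin> T"
  shows "y [^] (i::nat) \<in> T \<longleftrightarrow> p dvd i"
proof
  assume "p dvd i"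
  then obtain k where "i = p * k" by blast
  then show "y [^] i \<in> T" using yp nat_pow_mem[OF TG yp, of k] yG by (simp add: nat_pow_pow)
next
  assume i: "y [^] i \<in> T"
  show "p dvd i"
  proof (rule ccontr)
    assume "\<not> p dvd i"
    then have "coprime i p" using p by (metis coprime_commute prime_imp_coprime)
    then obtain k where k: "[i * k = Suc 0] (mod p)" using cong_solve_coprime_nat by blast
    have "i * k \<noteq> 0"
      using k p cong_0_1_nat[of p] by (metis One_nat_def not_prime_1)
    then have "Suc 0 \<le> i * k" by simp
    then have "p dvd i * k - Suc 0" using k cong_altdef_nat by blast
    then obtain j where "i * k - Suc 0 = p * j" by blast
    then have j: "i * k = 1 + p * j" using \<open>Suc 0 \<le> i * k\<close> by linarith
    have "y [^] (i * k) \<in> T" using nat_pow_mem[OF TG i, of k] yG by (simp add: nat_pow_pow)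
    moreover have "y [^] (p * j) \<in> T" using nat_pow_mem[OF TG yp, of j] yG by (simp add: nat_pow_pow)
    moreover have "y [^] (i * k) = y \<otimes> y [^] (p * j)" using j yG by (metis nat_pow_eone nat_pow_mult)
    ultimately have "y = y [^] (i * k) \<otimes> inv (y [^] (p * j))" using yG by (simp add: m_assoc)
    then show False using yT \<open>y [^] (i * k) \<in> T\<close> \<open>y [^] (p * j) \<in> T\<close> by (metis subgroup.m_closed[OF TG] subgroup.m_inv_closed[OF TG])
  qed
qed

text \<open>By \<open>powT\<close> the element \<open>y\<close> has order \<open>p\<close> modulo
  \<open>T\<close>. Hence the exponent of \<open>y\<close> in a factorization of \<open>q\<close> is
  unique modulo \<open>p\<close>, and any choice of it serves as the value of the character at
  \<open>q\<close>.\<close>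

lemma ex_mod_char_cyclic_quotient:
  assumes TG: "subgroup T G" and Q: "subgroup Q G" and TQ: "T \<subseteq> Q"
    and nT: "\<And>q. q \<in> Q \<Longrightarrow> normalizes q T" and yQ: "y \<in> Q"
    and powT: "\<And>i::nat. y [^] i \<in> T \<longleftrightarrow> p dvd i"
    and gen: "\<And>q. q \<in> Q \<Longrightarrow> \<exists>i::nat. \<exists>a\<in>T. q = y [^] i \<otimes> a"
  obtains l where "mod_char p Q l" "\<And>i a. a \<in> T \<Longrightarrow> [l (y [^] (i::nat) \<otimes> a) = int i] (mod int p)"
    "\<And>q. (0::int) \<le> l q"
proof -
  interpret T: subgroup T G by (rule TG)
  interpret Q: subgroup Q G by (rule Q)
  have pwQ: "y [^] (i::nat) \<in> Q" for i using nat_pow_mem[OF Q yQ] .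
  have Rm: "(y [^] i \<otimes> a) \<otimes> (y [^] j \<otimes> b) \<in> {y [^] (i + j) \<otimes> c |c. c \<in> T}" if "a \<in> T" "b \<in> T" for a b and i j :: nat
  proof -
    have "(y [^] i \<otimes> a) \<otimes> (y [^] j \<otimes> b) = y [^] (i + j) \<otimes> ((inv (y [^] j) \<otimes> a \<otimes> inv (inv (y [^] j))) \<otimes> b)"
      using that pwQ[of i] pwQ[of j] yQ by (simp add: group_norm flip: nat_pow_mult)
    moreover have "(inv (y [^] j) \<otimes> a \<otimes> inv (inv (y [^] j))) \<in> T"
      using nT[of "inv (y [^] j)"] that pwQ normalizesD by blast
    ultimately show ?thesis using that by blast
  qed
  have powcong: "[int i = int j] (mod int p)" if "y [^] i \<otimes> a = y [^] j \<otimes> b" "a \<in> T" "b \<in> T" for i j :: nat and a b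
  proof -
    have main: "[int i = int j] (mod int p)" if le: "i \<le> j" and eq: "y [^] i \<otimes> a = y [^] j \<otimes> b" "a \<in> T" "b \<in> T" for i j :: nat and a b
    proof -
      have "y [^] j = y [^] i \<otimes> y [^] (j - i)" using le yQ by (simp add: nat_pow_mult)
      then have "a = y [^] (j - i) \<otimes> b" using eq pwQ[of i] pwQ[of "j-i"] by (simp add: m_assoc)
      then have "y [^] (j - i) = a \<otimes> inv b" using eq pwQ[of "j-i"] by (simp add: m_assoc)
      then have "y [^] (j - i) \<in> T" using eq by simp
      then have "p dvd j - i" using powT by blast
      then have "int p dvd int j - int i" using le by (metis int_dvd_int_iff of_nat_diff)
      then show ?thesis by (simp add: cong_iff_dvd_diff dvd_diff_commute)
    qed
    show ?thesis using main[of i j a b] main[of j i b a] that by (metis cong_sym nat_le_linear)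
  qed
  define l where "l q = int (SOME i::nat. \<exists>a\<in>T. q = y [^] i \<otimes> a)" for q
  have lR: "\<exists>a\<in>T. q = y [^] nat (l q) \<otimes> a" if "q \<in> Q" for q
  proof -
    have "\<exists>i::nat. \<exists>a\<in>T. q = y [^] i \<otimes> a" using gen[OF that] .
    from someI_ex[OF this] show ?thesis by (simp add: l_def)
  qed
  have leq: "[l q = int i] (mod int p)" if "q = y [^] i \<otimes> a" "a \<in> T" for q a and i :: nat
  proof -
    have "q \<in> Q" using that pwQ TQ by auto
    then obtain b where "b \<in> T" "q = y [^] nat (l q) \<otimes> b" using lR by blast
    then have "[int (nat (l q)) = int i] (mod int p)" using powcong that by metis
    then show ?thesis by (simp add: l_def)
  qed
  have l0: "l q \<ge> 0" for q by (simp add: l_def)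
  show thesis
  proof (rule that[of l])
    show "mod_char p Q l"
      unfolding mod_char_def
    proof (intro ballI)
      fix a b assume ab: "a \<in> Q" "b \<in> Q"
      obtain s where s: "s \<in> T" "a = y [^] nat (l a) \<otimes> s" using lR[OF ab(1)] by (elim bexE)
      obtain t where t: "t \<in> T" "b = y [^] nat (l b) \<otimes> t" using lR[OF ab(2)] by (elim bexE)
      obtain c where "c \<in> T" "a \<otimes> b = y [^] (nat (l a) + nat (l b)) \<otimes> c"
        using Rm[OF s(1) t(1), of "nat (l a)" "nat (l b)"]
        unfolding s(2)[symmetric] t(2)[symmetric] by blast
      then have "[l (a \<otimes> b) = int (nat (l a) + nat (l b))] (mod int p)" using leq by blast
      then show "[l (a \<otimes> b) = l a + l b] (mod int p)" using l0 by simp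
    qed
    show "[l (y [^] i \<otimes> a) = int i] (mod int p)" if "a \<in> T" for i a
      by (rule leq[OF refl that])
  qed (rule l0)
qed

text \<open>The chief factor of the \<open>p\<close>-group \<open>U\<close> at the top of \<open>Q\<close> is central of order \<open>p\<close>:
  \<open>U\<close> has a nontrivial fixed point on the quotient by a maximal proper invariant subgroup.\<close>

lemma ex_invariant_mod_char:
  assumes p: "Factorial_Ring.prime p" and U: "p_subgroup p U"
    and Q: "subgroup Q G" "Q \<subseteq> U" "\<And>u. u \<in> U \<Longrightarrow> normalizes u Q"
    and S: "subgroup S G" "S \<subset> Q" "\<And>u. u \<in> U \<Longrightarrow> normalizes u S"
  obtains l where "mod_char p Q l" "\<And>s. s \<in> S \<Longrightarrow> int p dvd l s"
    "\<And>u q. u \<in> U \<Longrightarrow> q \<in> Q \<Longrightarrow> [l (u \<otimes> q \<otimes> inv u) = l q] (mod int p)"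
    "\<exists>y\<in>Q. \<not> int p dvd l y"
proof -
  define inva where "inva T \<longleftrightarrow> subgroup T G \<and> S \<subseteq> T \<and> T \<subset> Q \<and> (\<forall>u\<in>U. normalizes u T)" for T
  have finQ: "finite Q" using Q by simp
  have "inva S" using S by (simp add: inva_def)
  moreover have "T \<subseteq> carrier G" if "inva T" for T using that by (auto simp: inva_def dest: subgroup.subset)
  ultimately obtain T where T: "inva T" "\<And>T'. inva T' \<Longrightarrow> card T' \<le> card T"
    using ex_max_card by metis
  have TG: "subgroup T G" and ST: "S \<subseteq> T" and TQ: "T \<subset> Q" and UT: "\<And>u. u \<in> U \<Longrightarrow> normalizes u T"
    using T(1) by (auto simp: inva_def)
  interpret T: subgroup T G by (rule TG)
  interpret Q: subgroup Q G by (rule Q)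
  have UG: "subgroup U G" using U p_subgroupD by blast
  interpret U: subgroup U G by (rule UG)
  have QP: "p_subgroup p Q" using p_subgroup_subset[OF p U Q(1,2)] .
  \<comment> \<open>The preimage in \<open>Q\<close> of the points of Q / T that \<open>U\<close>
    fixes under conjugation.\<close>
  define F where "F = {y \<in> Q. \<forall>u\<in>U. inv y \<otimes> (u \<otimes> y \<otimes> inv u) \<in> T}"
  have TF: "T \<subseteq> F"
  proof
    fix t assume t: "t \<in> T"
    then show "t \<in> F" using TQ UT normalizesD[of _ T t] by (auto simp: F_def)
  qed
  have Fm: "y \<otimes> z \<in> F" if "y \<in> F" "z \<in> F" for y z
    using that normalizes_left_coset_mult[OF TG, of _ y z] UT[of "inv z"] Q(2) by (auto simp: F_def)
  have "\<exists>y\<in>F. y \<notin> T"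
  proof -
    obtain \<sigma> where "transversal G T Q \<sigma>"
      using ex_transversal_locale[of T Q] TG TQ Q(1) by blast
    then interpret tr: transversal G T Q \<sigma> .
    let ?act = "\<lambda>u w. \<sigma> (u \<otimes> w \<otimes> inv u)"
    have uQ: "u \<otimes> w \<otimes> inv u \<in> Q" if "u \<in> U" "w \<in> Q" for u w using that Q(3) normalizesD by blast
    have us: "\<sigma> (u \<otimes> \<sigma> w \<otimes> inv u) = \<sigma> (u \<otimes> w \<otimes> inv u)" if "u \<in> U" "w \<in> Q" for u w
    proof -
      have "inv (u \<otimes> w \<otimes> inv u) \<otimes> (u \<otimes> \<sigma> w \<otimes> inv u) = u \<otimes> (inv w \<otimes> \<sigma> w) \<otimes> inv u"
        using that by (simp add: group_norm)
      also have "\<dots> \<in> T" using that UT normalizesD tr.sigma_coset by blast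
      finally show ?thesis using tr.sigma_eq_iff[of "u \<otimes> w \<otimes> inv u" "u \<otimes> \<sigma> w \<otimes> inv u"] uQ that by simp
    qed
    obtain n where n: "card U = p ^ n" using U by (auto simp: p_subgroup_def)
    let ?Fx = "{w \<in> \<sigma> ` Q. \<forall>u\<in>U. ?act u w = w}"
    have "[card ?Fx = card (\<sigma> ` Q)] (mod p)"
    proof (rule card_fixed_points_cong[OF UG n p])
      show "\<sigma> (s \<otimes> w \<otimes> inv s) \<in> \<sigma> ` Q" if "s \<in> U" "w \<in> \<sigma> ` Q" for s w
        using that uQ tr.trans_mem by blast
      show "\<sigma> (\<one> \<otimes> w \<otimes> inv \<one>) = w" if "w \<in> \<sigma> ` Q" for w
        using that by auto
      show "\<sigma> (s \<otimes> t \<otimes> w \<otimes> inv (s \<otimes> t)) = \<sigma> (s \<otimes> \<sigma> (t \<otimes> w \<otimes> inv t) \<otimes> inv s)"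
        if "s \<in> U" "t \<in> U" "w \<in> \<sigma> ` Q" for s t w
      proof -
        have "w \<in> Q" using that tr.trans_mem by blast
        then show ?thesis using that us[of s "t \<otimes> w \<otimes> inv t"] uQ by (simp add: group_norm)
      qed
    qed simp
    moreover have "p dvd card (\<sigma> ` Q)"
    proof -
      have "card (\<sigma> ` Q) \<noteq> 1"
      proof
        assume "card (\<sigma> ` Q) = 1"
        then have "card T = card Q" using tr.card_trans by simp
        then show False using TQ finQ by (metis card_subset_eq psubset_eq)
      qed
      moreover have "card (\<sigma> ` Q) dvd card Q" using tr.card_trans by (metis dvd_triv_left)
      ultimately show ?thesis using QP p unfolding p_subgroup_def
        by (metis divides_primepow_nat dvd_power_same power_0 dvd_power gr0I)
    qed
    ultimately have F: "p dvd card ?Fx" using cong_dvd_iff by blast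
    have "\<sigma> \<one> \<in> ?Fx"
    proof -
      have "\<sigma> (u \<otimes> \<sigma> \<one> \<otimes> inv u) = \<sigma> \<one>" if "u \<in> U" for u using us[OF that, of \<one>] that by simp
      then show ?thesis by simp
    qed
    moreover have "?Fx \<noteq> {\<sigma> \<one>}"
      using F p by (metis card_1_singleton_iff not_prime_unit nat_dvd_1_iff_1 One_nat_def)
    ultimately obtain w where w: "w \<in> ?Fx" "w \<noteq> \<sigma> \<one>" by blast
    have wQ: "w \<in> Q" using w tr.trans_mem by blast
    have "w \<notin> T"
    proof
      assume "w \<in> T"
      then have "\<sigma> \<one> = \<sigma> w" using tr.sigma_const[of \<one> w] by simp
      also have "\<dots> = w" using w tr.sigma_fix by blast
      finally show False using w by simp
    qed
    moreover have "inv w \<otimes> (u \<otimes> w \<otimes> inv u) \<in> T" if u: "u \<in> U" for u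
    proof -
      have "\<sigma> w = w" using w tr.sigma_fix by blast
      moreover have "\<sigma> (u \<otimes> w \<otimes> inv u) = w" using w u by blast
      ultimately have "\<sigma> w = \<sigma> (u \<otimes> w \<otimes> inv u)" by simp
      then show ?thesis using tr.sigma_eq_iff[of w "u \<otimes> w \<otimes> inv u"] wQ uQ[OF u] by simp
    qed
    ultimately show ?thesis using wQ by (auto simp: F_def)
  qed
  then obtain y0 where y0: "y0 \<in> F" "y0 \<notin> T" by blast
  have Fp: "y [^] (n::nat) \<in> F" if "y \<in> F" for y n
  proof (induction n)
    case 0
    then show ?case using TF T.one_closed by auto
  next
    case (Suc n)
    then show ?case using Fm[OF Suc that] by simp
  qed
  have y0Q: "y0 \<in> Q" using y0 by (simp add: F_def)
  have "\<exists>n. y0 [^] (p ^ n) \<in> T" using p_power_eventually_one[OF QP y0Q] T.one_closed by metis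
  \<comment> \<open>\<open>y\<close> will be the last of the iterated \<open>p\<close>-th powers of
    \<open>y0\<close> outside \<open>T\<close>, hence an element of order \<open>p\<close> modulo
    \<open>T\<close>.\<close>
  define m where "m = (LEAST n. y0 [^] (p ^ n) \<in> T)"
  have m: "y0 [^] (p ^ m) \<in> T" unfolding m_def by (rule LeastI_ex) fact
  have m0: "m \<noteq> 0" using m y0 y0Q by (metis Q.mem_carrier nat_pow_eone power_0)
  define y where "y = y0 [^] (p ^ (m - 1))"
  have yT: "y \<notin> T" unfolding y_def using not_less_Least[of "m - 1" "\<lambda>n. y0 [^] (p ^ n) \<in> T"] m0
    by (simp add: m_def)
  have "y [^] p = y0 [^] (p ^ (m - 1) * p)" unfolding y_def using y0Q by (simp add: nat_pow_pow)
  also have "p ^ (m - 1) * p = p ^ m" using m0 by (metis power_minus_mult mult.commute not_gr_zero)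
  finally have yp: "y [^] p \<in> T" using m by simp
  have yF: "y \<in> F" unfolding y_def using Fp y0 by blast
  have yQ: "y \<in> Q" using yF by (simp add: F_def)
  have yU: "y \<in> U" using yQ Q(2) by blast
  have pwQ: "y [^] (i::nat) \<in> Q" for i using nat_pow_mem[OF Q(1) yQ] .
  have nT: "normalizes q T" if "q \<in> Q" for q using that UT Q(2) by blast
  define R where "R = {q. \<exists>i::nat. \<exists>a\<in>T. q = y [^] i \<otimes> a}"
  have RQ: "R \<subseteq> Q" using pwQ TQ by (auto simp: R_def)
  have Rm: "(y [^] i \<otimes> a) \<otimes> (y [^] j \<otimes> b) \<in> {y [^] (i + j) \<otimes> c |c. c \<in> T}" if "a \<in> T" "b \<in> T" for a b and i j :: nat
  proof -
    have "(y [^] i \<otimes> a) \<otimes> (y [^] j \<otimes> b) = y [^] (i + j) \<otimes> ((inv (y [^] j) \<otimes> a \<otimes> inv (inv (y [^] j))) \<otimes> b)"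
      using that pwQ[of i] pwQ[of j] yQ by (simp add: group_norm flip: nat_pow_mult)
    moreover have "(inv (y [^] j) \<otimes> a \<otimes> inv (inv (y [^] j))) \<in> T"
      using nT[of "inv (y [^] j)"] that pwQ normalizesD by blast
    ultimately show ?thesis using that by blast
  qed
  have RG: "subgroup R G"
  proof (rule finite_subgroupI)
    show "R \<subseteq> carrier G" using RQ Q.subset by blast
    have "y [^] (0::nat) \<otimes> \<one> \<in> R" unfolding R_def using T.one_closed by blast
    then show "R \<noteq> {}" by blast
    fix x z assume "x \<in> R" "z \<in> R"
    then obtain i j a b where "x = y [^] (i::nat) \<otimes> a" "a \<in> T" "z = y [^] (j::nat) \<otimes> b" "b \<in> T"
      unfolding R_def by blast
    then show "x \<otimes> z \<in> R" using Rm[of a b i j] unfolding R_def by blast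
  qed
  have TR: "T \<subseteq> R"
  proof
    fix t assume t: "t \<in> T"
    then have "t = y [^] (0::nat) \<otimes> t" by simp
    then show "t \<in> R" using t unfolding R_def by blast
  qed
  have yR: "y \<in> R"
  proof -
    have "y = y [^] (1::nat) \<otimes> \<one>" using yQ by simp
    then show ?thesis using T.one_closed unfolding R_def by blast
  qed
  have cF: "\<exists>t\<in>T. u \<otimes> x \<otimes> inv u = x \<otimes> t" if "x \<in> F" "u \<in> U" for x u
  proof -
    have "u \<otimes> x \<otimes> inv u = x \<otimes> (inv x \<otimes> (u \<otimes> x \<otimes> inv u))" using that by (simp add: F_def)
    then show ?thesis using that unfolding F_def by blast
  qed
  have cR: "\<exists>c\<in>T. u \<otimes> (y [^] i \<otimes> a) \<otimes> inv u = y [^] i \<otimes> c" if u: "u \<in> U" and a: "a \<in> T" for u a and i :: nat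
  proof -
    obtain t where t: "t \<in> T" "u \<otimes> y [^] i \<otimes> inv u = y [^] i \<otimes> t" using cF[OF Fp[OF yF] u] by blast
    have "u \<otimes> (y [^] i \<otimes> a) \<otimes> inv u = (u \<otimes> y [^] i \<otimes> inv u) \<otimes> (u \<otimes> a \<otimes> inv u)"
      using u a pwQ[of i] by (simp add: group_norm)
    also have "\<dots> = y [^] i \<otimes> (t \<otimes> (u \<otimes> a \<otimes> inv u))"
      unfolding t(2) using u a pwQ[of i] t by (simp add: m_assoc)
    finally show ?thesis using t(1) UT[OF u] normalizesD[of u T a] a by blast
  qed
  \<comment> \<open>\<open>R\<close> is generated by \<open>y\<close> and \<open>T\<close>, and it
    is \<open>U\<close>-invariant because \<open>U\<close> fixes \<open>y\<close> modulo
    \<open>T\<close>. Since it is larger than \<open>T\<close>, maximality of \<open>T\<close>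
    leaves only \<open>Q\<close>.\<close>
  have "R = Q"
  proof (rule ccontr)
    assume "R \<noteq> Q"
    moreover have "normalizes u R" if "u \<in> U" for u
    proof -
      have "u \<otimes> r \<otimes> inv u \<in> R" if "r \<in> R" for r
      proof -
        obtain i a where "r = y [^] (i::nat) \<otimes> a" "a \<in> T" using \<open>r \<in> R\<close> unfolding R_def by blast
        then show ?thesis using cR[OF \<open>u \<in> U\<close>, of a i] unfolding R_def by blast
      qed
      then show ?thesis by (simp add: normalizes_def)
    qed
    ultimately have "inva R" using RG RQ ST TR unfolding inva_def by blast
    then have "card R \<le> card T" by (rule T(2))
    then have "T = R" using TR RG card_seteq finite_subgroup by blast
    then show False using yR yT by simp
  qed
  have powT: "y [^] i \<in> T \<longleftrightarrow> p dvd i" for i :: nat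
    using pow_mem_iff_dvd[OF p TG _ yp yT] yQ by simp
  have gen: "\<exists>i::nat. \<exists>a\<in>T. q = y [^] i \<otimes> a" if "q \<in> Q" for q
    using that \<open>R = Q\<close> R_def by blast
  obtain l where l: "mod_char p Q l" "\<And>i a. a \<in> T \<Longrightarrow> [l (y [^] (i::nat) \<otimes> a) = int i] (mod int p)"
    by (rule ex_mod_char_cyclic_quotient[OF TG Q(1) _ nT yQ powT gen]) (use TQ in blast)+
  show thesis
  proof (rule that[of l])
    show "mod_char p Q l" by (rule l(1))
    show "int p dvd l s" if "s \<in> S" for s
    proof -
      have s: "s \<in> T" using that ST by blast
      then have "[l (y [^] (0::nat) \<otimes> s) = int 0] (mod int p)" by (rule l(2))
      then show ?thesis using s by (simp add: cong_0_iff)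
    qed
    show "[l (u \<otimes> q \<otimes> inv u) = l q] (mod int p)" if uq: "u \<in> U" "q \<in> Q" for u q
    proof -
      obtain i a where a: "a \<in> T" "q = y [^] (i::nat) \<otimes> a" using gen[OF uq(2)] by blast
      obtain c where "c \<in> T" "u \<otimes> q \<otimes> inv u = y [^] i \<otimes> c" using cR[OF uq(1) a(1), of i] unfolding a(2) by blast
      then have "[l (u \<otimes> q \<otimes> inv u) = int i] (mod int p)" using l(2) by metis
      then show ?thesis using l(2)[OF a(1), of i] a(2) by (metis cong_sym cong_trans)
    qed
    have "[l (y [^] (1::nat) \<otimes> \<one>) = int 1] (mod int p)" by (rule l(2)[OF T.one_closed])
    then have "\<not> int p dvd l y" using prime_gt_1_nat[OF p] cong_dvd_iff[of "l y" "int 1" "int p"] yQ by simp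
    then show "\<exists>y\<in>Q. \<not> int p dvd l y" using yQ by blast
  qed
qed

section \<open>Frattini subgroups\<close>

lemma maximal_subgroup_iff:
  assumes "subgroup P G"
  shows "maximal_subgroup M (G\<lparr>carrier := P\<rparr>) \<longleftrightarrow>
    subgroup M G \<and> M \<subset> P \<and> (\<forall>K. subgroup K G \<longrightarrow> M \<subseteq> K \<longrightarrow> K \<subseteq> P \<longrightarrow> K = M \<or> K = P)"
  unfolding maximal_subgroup_def subgroup_subgroup_iff[OF assms] by auto

lemma ex_maximal_subgroup:
  assumes "subgroup P G" "subgroup C G" "C \<subset> P"
  shows "\<exists>M. maximal_subgroup M (G\<lparr>carrier := P\<rparr>) \<and> C \<subseteq> M"
proof -
  obtain M where M: "subgroup M G \<and> C \<subseteq> M \<and> M \<subset> P"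
    "\<And>T. subgroup T G \<and> C \<subseteq> T \<and> T \<subset> P \<Longrightarrow> card T \<le> card M"
    using ex_max_card[of "\<lambda>T. subgroup T G \<and> C \<subseteq> T \<and> T \<subset> P" C] assms subgroup.subset
    by (metis subset_refl)
  have "K = M \<or> K = P" if K: "subgroup K G" "M \<subseteq> K" "K \<subseteq> P" for K
  proof (rule ccontr)
    assume a: "\<not> (K = M \<or> K = P)"
    then have "card K \<le> card M" using K M(1) by (intro M(2)) blast
    then have "M = K" using card_seteq[OF finite_subgroup[OF K(1)] K(2)] by blast
    then show False using a by blast
  qed
  then have "maximal_subgroup M (G\<lparr>carrier := P\<rparr>)"
    unfolding maximal_subgroup_iff[OF assms(1)] using M(1) by simp
  then show ?thesis using M(1) by blast
qed

text \<open>\<open>M\<close> is properly contained in its normalizer, hence normal in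
  \<open>P\<close>. A nonzero character of \<open>P\<close> that vanishes on \<open>M\<close> has a
  proper kernel containing \<open>M\<close>, and maximality makes the two equal.\<close>

lemma maximal_subgroup_is_kernel:
  assumes p: "Factorial_Ring.prime p" and P: "p_subgroup p P"
    and M: "maximal_subgroup M (G\<lparr>carrier := P\<rparr>)"
  obtains l where "mod_char p P l" "M = {x \<in> P. int p dvd l x}" "\<exists>y\<in>P. \<not> int p dvd l y"
proof -
  have PG: "subgroup P G" using P p_subgroupD by blast
  have MG: "subgroup M G" "M \<subset> P"
    and max: "\<And>K. subgroup K G \<Longrightarrow> M \<subseteq> K \<Longrightarrow> K \<subseteq> P \<Longrightarrow> K = M \<or> K = P"
    using M maximal_subgroup_iff[OF PG] by auto
  obtain x where x: "x \<in> P - M" "normalizes x M" using normalizer_grows[OF p P MG] by blast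
  have "{k \<in> P. normalizes k M} = P"
    using max[OF normalizer_subgroup[OF PG MG(1)]] x MG normalizes_self[OF MG(1)] by blast
  then have nM: "normalizes k M" if "k \<in> P" for k using that by blast
  obtain l where l: "mod_char p P l" "\<And>s. s \<in> M \<Longrightarrow> int p dvd l s" "\<exists>y\<in>P. \<not> int p dvd l y"
    using ex_invariant_mod_char[OF p P PG subset_refl normalizes_self[OF PG] MG nM] by metis
  have "{x \<in> P. int p dvd l x} = M"
    using max[OF mod_char_kernel_subgroup[OF l(1) PG]] l(2,3) MG(2) by blast
  then show thesis using that l by blast
qed

text \<open>The index of the kernel is the prime \<open>p\<close>, so no subgroup fits strictly
  between.\<close>

lemma mod_char_kernel_maximal:
  assumes p: "Factorial_Ring.prime p" and PG: "subgroup P G"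
    and l: "mod_char p P l" "y \<in> P" "\<not> int p dvd l y"
  shows "maximal_subgroup {x \<in> P. int p dvd l x} (G\<lparr>carrier := P\<rparr>)"
proof -
  let ?M = "{x \<in> P. int p dvd l x}"
  have MG: "subgroup ?M G" by (rule mod_char_kernel_subgroup[OF l(1) PG])
  have "K = ?M \<or> K = P" if K: "subgroup K G" "?M \<subseteq> K" "K \<subseteq> P" for K
  proof -
    obtain i where i: "card K = card ?M * i" using card_subgroup_dvd[OF MG K(1,2)] by blast
    obtain j where j: "card P = card K * j" using card_subgroup_dvd[OF K(1) PG K(3)] by blast
    have "card ?M * p = card ?M * (i * j)"
      using card_mod_char_kernel[OF p l(1) PG l(2,3)] i j by (metis mult.assoc)
    then have "p = i * j" using card_subgroup_pos[OF MG] by (metis mult_cancel1 not_gr_zero)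
    then have "i = 1 \<or> j = 1" using p by (metis prime_nat_iff dvd_triv_left nat_mult_eq_1_iff mult_cancel_left1 not_prime_0 mult_eq_self_implies_10)
    then show ?thesis
    proof
      assume "i = 1"
      then have "card ?M = card K" using i by simp
      then show ?thesis using K(1,2) card_subset_eq finite_subgroup by blast
    next
      assume "j = 1"
      then have "card K = card P" using j by simp
      then show ?thesis using K(3) PG card_subset_eq finite_subgroup by blast
    qed
  qed
  then show ?thesis using maximal_subgroup_iff[OF PG] MG l(2,3) by blast
qed

text \<open>Maximal subgroups and kernels of nonzero characters are the same thing in a
  \<open>p\<close>-group. This description carries the facts about \<Phi> that depend on
  \<open>P\<close> being a \<open>p\<close>-group: conjugation, \<open>p\<close>-th powers,
  commutators, and the passage from transfer to \<Phi>.\<close>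

lemma mem_frattini_iff:
  assumes p: "Factorial_Ring.prime p" and P: "p_subgroup p P"
  shows "x \<in> frattini (G\<lparr>carrier := P\<rparr>) \<longleftrightarrow> x \<in> P \<and> (\<forall>l. mod_char p P l \<longrightarrow> int p dvd l x)"
proof -
  have PG: "subgroup P G" using P p_subgroupD by blast
  have "int p dvd l x" if x: "x \<in> P" "\<forall>M. maximal_subgroup M (G\<lparr>carrier := P\<rparr>) \<longrightarrow> x \<in> M" and l: "mod_char p P l" for l
    using mod_char_kernel_maximal[OF p PG l, of x] x by blast
  moreover have "x \<in> M" if "x \<in> P" "\<forall>l. mod_char p P l \<longrightarrow> int p dvd l x" "maximal_subgroup M (G\<lparr>carrier := P\<rparr>)" for M
    using maximal_subgroup_is_kernel[OF p P that(3)] that by blast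
  ultimately show ?thesis unfolding frattini_def by auto
qed

lemma frattini_subset: "frattini (G\<lparr>carrier := P\<rparr>) \<subseteq> P"
  by (auto simp: frattini_def)

lemma frattini_subgroup:
  assumes P: "subgroup P G"
  shows "subgroup (frattini (G\<lparr>carrier := P\<rparr>)) G"
proof -
  have "frattini (G\<lparr>carrier := P\<rparr>) = \<Inter>(insert P {M. maximal_subgroup M (G\<lparr>carrier := P\<rparr>)})"
    by (auto simp: frattini_def)
  moreover have "subgroup (\<Inter>(insert P {M. maximal_subgroup M (G\<lparr>carrier := P\<rparr>)})) G"
    by (rule subgroups_Inter) (use P maximal_subgroup_iff[OF P] in auto)
  ultimately show ?thesis by simp
qed

text \<open>A proper subgroup \<open>C\<close> lies in a maximal subgroup, which also contains
  \<Phi>(P); the two together could then not cover \<open>P\<close>.\<close>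

lemma frattini_nongenerators:
  assumes P: "subgroup P G" and C: "subgroup C G" "C \<subseteq> P"
    and gen: "\<And>x. x \<in> P \<Longrightarrow> \<exists>c\<in>C. inv c \<otimes> x \<in> frattini (G\<lparr>carrier := P\<rparr>)"
  shows "C = P"
proof (rule ccontr)
  assume "C \<noteq> P"
  then obtain M where M: "maximal_subgroup M (G\<lparr>carrier := P\<rparr>)" "C \<subseteq> M"
    using ex_maximal_subgroup[OF P C(1)] C(2) by blast
  then have MG: "subgroup M G" "M \<subset> P" using maximal_subgroup_iff[OF P] by auto
  have "P \<subseteq> M"
  proof
    fix x assume x: "x \<in> P"
    then obtain c where c: "c \<in> C" "inv c \<otimes> x \<in> frattini (G\<lparr>carrier := P\<rparr>)" using gen by blast
    then have "inv c \<otimes> x \<in> M" using M(1) by (auto simp: frattini_def)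
    then have "c \<otimes> (inv c \<otimes> x) \<in> M" using c M(2) subgroup.m_closed[OF MG(1)] by blast
    then show "x \<in> M" using c C x mem_subgroup_carrier[OF P] by auto
  qed
  then show False using MG by blast
qed

lemma frattini_proper:
  assumes P: "subgroup P G" and "P \<noteq> {\<one>}"
  shows "frattini (G\<lparr>carrier := P\<rparr>) \<noteq> P"
proof
  assume a: "frattini (G\<lparr>carrier := P\<rparr>) = P"
  have "{\<one>} = P"
  proof (rule frattini_nongenerators[OF P triv_subgroup])
    show "{\<one>} \<subseteq> P" using subgroup.one_closed[OF P] by blast
    show "\<exists>c\<in>{\<one>}. inv c \<otimes> x \<in> frattini (G\<lparr>carrier := P\<rparr>)" if "x \<in> P" for x
      using that a mem_subgroup_carrier[OF P] by simp
  qed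
  then show False using assms by simp
qed

text \<open>Composing a character of \<open>P\<close> with conjugation by \<open>x\<close> gives a
  character of \<open>P\<close> again, so the common kernel is invariant.\<close>

lemma frattini_normalizes:
  assumes p: "Factorial_Ring.prime p" and P: "p_subgroup p P" and x: "x \<in> carrier G" "normalizes x P"
  shows "normalizes x (frattini (G\<lparr>carrier := P\<rparr>))"
  unfolding normalizes_def
proof
  fix h assume h: "h \<in> frattini (G\<lparr>carrier := P\<rparr>)"
  have PG: "subgroup P G" using P p_subgroupD by blast
  have "int p dvd l (x \<otimes> h \<otimes> inv x)" if l: "mod_char p P l" for l
  proof -
    have "mod_char p P (\<lambda>y. l (x \<otimes> y \<otimes> inv x))"
      unfolding mod_char_def
    proof (intro ballI)
      fix a b assume ab: "a \<in> P" "b \<in> P"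
      then have "a \<in> carrier G" "b \<in> carrier G" using mem_subgroup_carrier[OF PG] by auto
      then have "x \<otimes> (a \<otimes> b) \<otimes> inv x = (x \<otimes> a \<otimes> inv x) \<otimes> (x \<otimes> b \<otimes> inv x)"
        using x(1) by (simp add: group_norm)
      then show "[l (x \<otimes> (a \<otimes> b) \<otimes> inv x) = l (x \<otimes> a \<otimes> inv x) + l (x \<otimes> b \<otimes> inv x)] (mod int p)"
        using mod_charD[OF l normalizesD[OF x(2) ab(1)] normalizesD[OF x(2) ab(2)]] by simp
    qed
    then show ?thesis using h mem_frattini_iff[OF p P] by blast
  qed
  then show "x \<otimes> h \<otimes> inv x \<in> frattini (G\<lparr>carrier := P\<rparr>)"
    using h x(2) mem_frattini_iff[OF p P] normalizesD by blast
qed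

lemma pow_p_in_frattini:
  assumes p: "Factorial_Ring.prime p" and P: "p_subgroup p P" and x: "x \<in> P"
  shows "x [^] p \<in> frattini (G\<lparr>carrier := P\<rparr>)"
proof -
  have PG: "subgroup P G" using P p_subgroupD by blast
  have "int p dvd l (x [^] p)" if "mod_char p P l" for l
    using mod_char_pow[OF that PG x, of p] by (simp add: cong_dvd_iff)
  then show ?thesis using mem_frattini_iff[OF p P] nat_pow_mem[OF PG x] by blast
qed

lemma conj_mult_inv_in_frattini:
  assumes p: "Factorial_Ring.prime p" and P: "p_subgroup p P" and xy: "x \<in> P" "y \<in> P"
  shows "inv y \<otimes> (x \<otimes> y \<otimes> inv x) \<in> frattini (G\<lparr>carrier := P\<rparr>)"
proof -
  have PG: "subgroup P G" using P p_subgroupD by blast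
  interpret P: subgroup P G by (rule PG)
  have "int p dvd l (inv y \<otimes> (x \<otimes> y \<otimes> inv x))" if l: "mod_char p P l" for l
  proof -
    have "[l (inv y \<otimes> (x \<otimes> y \<otimes> inv x)) = l (x \<otimes> y \<otimes> inv x) - l y] (mod int p)"
      using mod_char_inv_mult[OF l PG] xy by simp
    also have "[l (x \<otimes> y \<otimes> inv x) - l y = l y - l y] (mod int p)"
      using xy by (intro cong_diff mod_char_conj[OF l PG]) auto
    finally show ?thesis by (simp add: cong_0_iff)
  qed
  then show ?thesis using mem_frattini_iff[OF p P] xy by simp
qed

text \<open>Descend from \<open>P\<close>: as long as the order is too large, pass to a maximal
  subgroup containing \<open>S\<close>. It has index \<open>p\<close>, so no power of
  \<open>p\<close> is skipped.\<close>

lemma ex_intermediate_subgroup: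
  assumes p: "Factorial_Ring.prime p" and P: "p_subgroup p P" and S: "subgroup S G" "S \<subseteq> P"
    and m: "card S \<le> p ^ m" "p ^ m \<le> card P"
  shows "\<exists>T. subgroup T G \<and> S \<subseteq> T \<and> T \<subseteq> P \<and> card T = p ^ m"
  using P S(2) m(2)
proof (induction "card P" arbitrary: P rule: less_induct)
  case less
  have PG: "subgroup P G" using less.prems p_subgroupD by blast
  show ?case
  proof (cases "card P = p ^ m")
    case True
    then show ?thesis using less.prems PG by blast
  next
    case False
    then have lt: "p ^ m < card P" using less.prems by simp
    then have "S \<noteq> P" using m(1) by auto
    then obtain M where M: "maximal_subgroup M (G\<lparr>carrier := P\<rparr>)" "S \<subseteq> M"
      using ex_maximal_subgroup[OF PG S(1)] less.prems by blast
    obtain l where l: "mod_char p P l" "M = {x \<in> P. int p dvd l x}" "\<exists>y\<in>P. \<not> int p dvd l y"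
      using maximal_subgroup_is_kernel[OF p less.prems(1) M(1)] .
    have cM: "card M * p = card P" using card_mod_char_kernel[OF p l(1) PG] l(2,3) by blast
    obtain n where n: "card P = p ^ n" using less.prems by (auto simp: p_subgroup_def)
    have p1: "p > 1" using p prime_gt_1_nat by blast
    have "m < n" using lt n p1 by simp
    then have "p ^ m * p \<le> p ^ n" using p1 by (metis Suc_leI power_Suc2 power_increasing less_imp_le)
    then have "p ^ m \<le> card M" using cM n p1 by (metis mult_le_cancel2 less_trans zero_less_one)
    moreover have "card M < card P"
    proof -
      have "0 < card M" using cM lt p1 by (metis mult_0 not_gr_zero not_less_zero)
      then have "card M < card M * p" using p1 by simp
      then show ?thesis using cM by simp
    qed
    moreover have "p_subgroup p M"
      using p_subgroup_subset[OF p less.prems(1)] M(1) maximal_subgroup_iff[OF PG] by blast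
    ultimately obtain T where "subgroup T G \<and> S \<subseteq> T \<and> T \<subseteq> M \<and> card T = p ^ m"
      using less.hyps[of M] M(2) by blast
    moreover have "M \<subseteq> P" using M(1) maximal_subgroup_iff[OF PG] by blast
    ultimately show ?thesis by blast
  qed
qed

lemma card_generate_singleton:
  assumes q: "Factorial_Ring.prime q" and x: "x \<in> carrier G" "x [^] (q ^ n) = \<one>"
  shows "p_subgroup q (generate G {x})"
proof -
  have "ord x dvd q ^ n" using x pow_eq_id by blast
  then obtain i where "ord x = q ^ i" using divides_primepow_nat[OF q] by blast
  then show ?thesis using generate_pow_card[OF x(1)] generate_is_subgroup[of "{x}"] x(1)
    unfolding p_subgroup_def by auto
qed

lemma mem_generate_singleton:
  assumes "x \<in> carrier G"
  shows "y \<in> generate G {x} \<longleftrightarrow> (\<exists>i::nat. y = x [^] i)"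
  using generate_pow_on_finite_carrier[OF finite_carrier assms] by auto

text \<open>The last hypothesis says that conjugation by \<open>x\<close> maps the coset h Y to
  itself. The \<open>q\<close>-group generated by \<open>x\<close> acts on this set, whose
  cardinality |Y| is a power of \<open>p\<close> and so prime to \<open>q\<close>; hence it has a
  fixed point.\<close>

lemma coset_fixed_point:
  assumes q: "Factorial_Ring.prime q" and p: "Factorial_Ring.prime p" "q \<noteq> p"
    and x: "x \<in> carrier G" "x [^] (q ^ n) = \<one>"
    and Y: "p_subgroup p Y" "normalizes x Y"
    and h: "h \<in> carrier G" "inv h \<otimes> (x \<otimes> h \<otimes> inv x) \<in> Y"
  shows "\<exists>y\<in>Y. x \<otimes> (h \<otimes> y) \<otimes> inv x = h \<otimes> y"
proof -
  have YG: "subgroup Y G" using Y p_subgroupD by blast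
  interpret Y: subgroup Y G by (rule YG)
  let ?O = "(\<lambda>y. h \<otimes> y) ` Y"
  obtain m where m: "subgroup (generate G {x}) G" "card (generate G {x}) = q ^ m"
    using card_generate_singleton[OF q x] by (auto simp: p_subgroup_def)
  have OG: "w \<in> carrier G" if "w \<in> ?O" for w using that h(1) by auto
  have step: "x \<otimes> w \<otimes> inv x \<in> ?O" if w: "w \<in> ?O" for w
  proof -
    obtain y where y: "y \<in> Y" "w = h \<otimes> y" using w by blast
    have "x \<otimes> w \<otimes> inv x = h \<otimes> ((inv h \<otimes> (x \<otimes> h \<otimes> inv x)) \<otimes> (x \<otimes> y \<otimes> inv x))"
      using y h(1) x(1) by (simp add: group_norm)
    then show ?thesis using h(2) Y(2) y(1) normalizesD Y.m_closed by blast
  qed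
  have steps: "x [^] (i::nat) \<otimes> w \<otimes> inv (x [^] i) \<in> ?O" if w: "w \<in> ?O" for w i
  proof (induction i)
    case 0
    then show ?case using w OG by simp
  next
    case (Suc i)
    have "x [^] Suc i = x \<otimes> x [^] i" using nat_pow_Suc2[OF x(1)] by simp
    then have "x [^] Suc i \<otimes> w \<otimes> inv (x [^] Suc i) = x \<otimes> (x [^] i \<otimes> w \<otimes> inv (x [^] i)) \<otimes> inv x"
      using x(1) OG[OF w] by (simp add: group_norm del: nat_pow_Suc)
    then show ?case using step[OF Suc] by simp
  qed
  have gc: "s \<in> carrier G" if "s \<in> generate G {x}" for s using that m(1) mem_subgroup_carrier by blast
  have "[card {w \<in> ?O. \<forall>s\<in>generate G {x}. s \<otimes> w \<otimes> inv s = w} = card ?O] (mod q)"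
  proof (rule card_fixed_points_cong[OF m q])
    show "finite ?O" using YG by simp
    show "s \<otimes> w \<otimes> inv s \<in> ?O" if s: "s \<in> generate G {x}" and w: "w \<in> ?O" for s w
      using s steps[OF w] unfolding mem_generate_singleton[OF x(1)] by (elim exE) (simp only:)
    show "\<one> \<otimes> w \<otimes> inv \<one> = w" if "w \<in> ?O" for w using OG[OF that] by simp
    show "s \<otimes> t \<otimes> w \<otimes> inv (s \<otimes> t) = s \<otimes> (t \<otimes> w \<otimes> inv t) \<otimes> inv s"
      if "s \<in> generate G {x}" "t \<in> generate G {x}" "w \<in> ?O" for s t w
      using gc[OF that(1)] gc[OF that(2)] OG[OF that(3)] by (simp add: group_norm)
  qed
  moreover have "card ?O = card Y"
    by (intro card_image inj_onI) (use h(1) in simp)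
  moreover have "\<not> q dvd card Y"
    using Y(1) p q prime_dvd_power_nat[OF q, of p] primes_dvd_imp_eq[OF q p(1)] unfolding p_subgroup_def by auto
  ultimately have "card {w \<in> ?O. \<forall>s\<in>generate G {x}. s \<otimes> w \<otimes> inv s = w} \<noteq> 0"
    using cong_dvd_iff by (metis dvd_0_right)
  then obtain w where "w \<in> ?O" "\<forall>s\<in>generate G {x}. s \<otimes> w \<otimes> inv s = w"
    by (metis (mono_tags, lifting) card_eq_0_iff empty_Collect_eq)
  moreover have "x \<in> generate G {x}" by (rule generate.incl) simp
  ultimately show ?thesis by blast
qed

section \<open>The residual generated by the elements of order prime to \<open>p\<close>\<close>

lemma mem_set_mult: "x \<in> H <#> K \<longleftrightarrow> (\<exists>h\<in>H. \<exists>k\<in>K. x = h \<otimes> k)"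
  by (auto simp: set_mult_def)

lemma set_mult_subset_subgroup:
  "subgroup K G \<Longrightarrow> A \<subseteq> K \<Longrightarrow> B \<subseteq> K \<Longrightarrow> A <#> B \<subseteq> K"
  by (auto simp: mem_set_mult subset_iff subgroup.m_closed)

lemma subset_set_mult:
  assumes "subgroup N G" "subgroup H G"
  shows "N \<subseteq> N <#> H" "H \<subseteq> N <#> H"
proof -
  show "N \<subseteq> N <#> H"
  proof
    fix n assume n: "n \<in> N"
    then have "n = n \<otimes> \<one>" using assms mem_subgroup_carrier by simp
    then show "n \<in> N <#> H" unfolding mem_set_mult using n subgroup.one_closed[OF assms(2)] by blast
  qed
  show "H \<subseteq> N <#> H"
  proof
    fix n assume n: "n \<in> H"
    then have "n = \<one> \<otimes> n" using assms mem_subgroup_carrier by simp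
    then show "n \<in> N <#> H" unfolding mem_set_mult using n subgroup.one_closed[OF assms(1)] by blast
  qed
qed

lemma subgroup_set_mult:
  assumes N: "subgroup N G" and H: "subgroup H G" and nrm: "\<And>h. h \<in> H \<Longrightarrow> normalizes h N"
  shows "subgroup (N <#> H) G"
proof -
  interpret N: subgroup N G by fact
  interpret H: subgroup H G by fact
  show ?thesis
  proof (rule finite_subgroupI)
    show "N <#> H \<subseteq> carrier G" by (auto simp: mem_set_mult)
    show "N <#> H \<noteq> {}" using subset_set_mult(1)[OF N H] N.one_closed by blast
    fix a b assume "a \<in> N <#> H" "b \<in> N <#> H"
    then obtain n h m k where *: "n \<in> N" "h \<in> H" "a = n \<otimes> h" "m \<in> N" "k \<in> H" "b = m \<otimes> k"
      unfolding mem_set_mult by blast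
    have "a \<otimes> b = (n \<otimes> (h \<otimes> m \<otimes> inv h)) \<otimes> (h \<otimes> k)"
      using * by (simp add: group_norm)
    moreover have "n \<otimes> (h \<otimes> m \<otimes> inv h) \<in> N" using * nrm normalizesD by blast
    ultimately show "a \<otimes> b \<in> N <#> H" unfolding mem_set_mult using *(2,5) by blast
  qed
qed

lemma card_set_mult:
  assumes N: "subgroup N G" and H: "subgroup H G"
  shows "card (N <#> H) * card (N \<inter> H) = card N * card H"
proof -
  have I: "subgroup (N \<inter> H) G" using subgroups_Inter_pair[OF N H] .
  obtain \<sigma> where "transversal G (N \<inter> H) H \<sigma>" using ex_transversal_locale[OF I H] by blast
  then interpret tr: transversal G "N \<inter> H" H \<sigma> .
  interpret N: subgroup N G by fact
  define \<tau> where "\<tau> h = inv (\<sigma> (inv h))" for h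
  have tH: "\<tau> h \<in> H" if "h \<in> H" for h using that by (simp add: \<tau>_def)
  \<comment> \<open>\<open>\<sigma>\<close> represents left cosets, while the product of
    \<open>N\<close> and \<open>H\<close> splits into right cosets of \<open>N\<close>; inverses
    turn one kind into the other.\<close>
  let ?T = "(\<lambda>t. inv t) ` \<sigma> ` H"
  have "bij_betw (\<lambda>(n, t). n \<otimes> t) (N \<times> ?T) (N <#> H)"
  proof (rule bij_betw_imageI)
    show "inj_on (\<lambda>(n, t). n \<otimes> t) (N \<times> ?T)"
    proof (rule inj_onI, clarify)
      fix n m s t assume a: "n \<in> N" "m \<in> N" "s \<in> H" "t \<in> H" "n \<otimes> inv (\<sigma> s) = m \<otimes> inv (\<sigma> t)"
      have "inv (\<sigma> s) \<otimes> \<sigma> t = inv n \<otimes> (n \<otimes> inv (\<sigma> s)) \<otimes> \<sigma> t"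
        using a(1-4) by (simp add: m_assoc)
      also have "\<dots> = inv n \<otimes> m" unfolding a(5) using a(1-4) by (simp add: m_assoc)
      finally have "inv (\<sigma> s) \<otimes> \<sigma> t \<in> N" using a(1,2) by simp
      moreover have "inv (\<sigma> s) \<otimes> \<sigma> t \<in> H" using a(3,4) by simp
      ultimately have "inv (\<sigma> s) \<otimes> \<sigma> t \<in> N \<inter> H" by blast
      then have "\<sigma> (\<sigma> s) = \<sigma> (\<sigma> t)" using tr.sigma_eq_iff[of "\<sigma> s" "\<sigma> t"] a by simp
      then have "\<sigma> s = \<sigma> t" using a by simp
      then show "n = m \<and> inv (\<sigma> s) = inv (\<sigma> t)" using a by simp
    qed
    show "(\<lambda>(n, t). n \<otimes> t) ` (N \<times> ?T) = N <#> H"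
    proof
      show "(\<lambda>(n, t). n \<otimes> t) ` (N \<times> ?T) \<subseteq> N <#> H" by (force simp: mem_set_mult)
      show "N <#> H \<subseteq> (\<lambda>(n, t). n \<otimes> t) ` (N \<times> ?T)"
      proof
        fix x assume "x \<in> N <#> H"
        then obtain n h where nh: "n \<in> N" "h \<in> H" "x = n \<otimes> h" unfolding mem_set_mult by blast
        have 1: "inv (inv h) \<otimes> \<sigma> (inv h) \<in> N"
          using tr.sigma_coset[of "inv h"] tr.K.m_inv_closed[OF nh(2)] by blast
        have "x = (n \<otimes> (inv (inv h) \<otimes> \<sigma> (inv h))) \<otimes> inv (\<sigma> (inv h))"
          using nh by (simp add: m_assoc)
        moreover have "n \<otimes> (inv (inv h) \<otimes> \<sigma> (inv h)) \<in> N" by (rule N.m_closed[OF nh(1) 1])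
        moreover have "inv (\<sigma> (inv h)) \<in> ?T" using nh by simp
        ultimately show "x \<in> (\<lambda>(n, t). n \<otimes> t) ` (N \<times> ?T)" by (intro image_eqI[where x = "(n \<otimes> (inv (inv h) \<otimes> \<sigma> (inv h)), inv (\<sigma> (inv h)))"]) (simp only: prod.case, rule SigmaI)
      qed
    qed
  qed
  moreover have "card ?T = card (\<sigma> ` H)"
    by (intro card_image inj_onI) (metis inv_inv tr.K.mem_carrier tr.trans_mem)
  ultimately have "card (N <#> H) = card N * card (\<sigma> ` H)"
    by (metis bij_betw_same_card card_cartesian_product)
  then show ?thesis using tr.card_trans by simp
qed

lemma sylow_containing:
  assumes p: "Factorial_Ring.prime p" and K: "subgroup K G" and S: "p_subgroup p S" "S \<subseteq> K"
  shows "\<exists>P. sylow_in p P K \<and> S \<subseteq> P"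
proof -
  obtain P where P: "sylow_in p P K" using sylow_in_exists[OF p K] by blast
  obtain k where k: "k \<in> K" "conj_set k S \<subseteq> P" using sylow_contains[OF p K P S] by blast
  have kG: "k \<in> carrier G" using k mem_subgroup_carrier[OF K] by blast
  have SG: "S \<subseteq> carrier G" using S(1) p_subgroupD subgroup.subset by blast
  let ?P = "conj_set (inv k) P"
  have PG: "subgroup P G" "P \<subseteq> K" using sylow_inD[OF P] by auto
  have "S = conj_set (inv k) (conj_set k S)" using conj_set_inv_cancel[OF kG SG] by simp
  also have "\<dots> \<subseteq> ?P" using k(2) by (auto simp: conj_set_def)
  finally have "S \<subseteq> ?P" .
  moreover have "sylow_in p ?P K"
    unfolding sylow_in_iff[OF p K]
  proof (intro conjI)
    show "subgroup ?P G" using subgroup_conj_set PG kG by simp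
    show "?P \<subseteq> K" using k(1) PG(2) subgroup.m_closed[OF K] subgroup.m_inv_closed[OF K]
      by (auto simp: conj_set_def subset_iff)
    show "card ?P = p ^ multiplicity p (card K)"
      using card_conj_set[of "inv k" P] kG subgroup.subset[OF PG(1)] card_sylow_eq[OF p K P] by simp
  qed
  ultimately show ?thesis by blast
qed

lemma sylow_conj_set:
  assumes p: "Factorial_Ring.prime p" and K: "subgroup K G" and P: "sylow_in p P K" and k: "k \<in> K"
  shows "sylow_in p (conj_set k P) K"
  unfolding sylow_in_iff[OF p K]
proof (intro conjI)
  have kG: "k \<in> carrier G" using k mem_subgroup_carrier[OF K] by blast
  have PG: "subgroup P G" "P \<subseteq> K" using sylow_inD[OF P] by auto
  show "subgroup (conj_set k P) G" using subgroup_conj_set PG kG by simp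
  show "conj_set k P \<subseteq> K" using k PG(2) subgroup.m_closed[OF K] subgroup.m_inv_closed[OF K]
    by (auto simp: conj_set_def subset_iff)
  show "card (conj_set k P) = p ^ multiplicity p (card K)"
    using card_conj_set[OF kG] subgroup.subset[OF PG(1)] card_sylow_eq[OF p K P] by simp
qed

text \<open>A Sylow subgroup of \<open>N\<close> can be conjugated into \<open>P\<close>, and by
  normality into \<open>P \<inter> N\<close>; conversely the \<open>p\<close>-group
  \<open>P \<inter> N\<close> is no larger than a Sylow subgroup of \<open>N\<close>.\<close>

lemma sylow_Int_normal:
  assumes p: "Factorial_Ring.prime p" and K: "subgroup K G" and P: "sylow_in p P K"
    and N: "subgroup N G" "N \<subseteq> K" "\<And>k. k \<in> K \<Longrightarrow> normalizes k N"
  shows "sylow_in p (P \<inter> N) N"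
proof -
  have PG: "subgroup P G" "P \<subseteq> K" "p_subgroup p P" using sylow_inD[OF P] by auto
  obtain Q where Q: "sylow_in p Q N" using sylow_in_exists[OF p N(1)] by blast
  have QG: "subgroup Q G" "Q \<subseteq> N" "p_subgroup p Q" using sylow_inD[OF Q] by auto
  obtain k where k: "k \<in> K" "conj_set k Q \<subseteq> P" using sylow_contains[OF p K P QG(3)] QG(2) N(2) by blast
  have kG: "k \<in> carrier G" using k mem_subgroup_carrier[OF K] by blast
  have I: "subgroup (P \<inter> N) G" using subgroups_Inter_pair[OF PG(1) N(1)] .
  have "conj_set k Q \<subseteq> P \<inter> N" using k QG(2) N(3)[OF k(1)] by (auto simp: conj_set_def normalizes_def)
  then have "card Q \<le> card (P \<inter> N)"
    using card_conj_set[OF kG subgroup.subset[OF QG(1)]] card_mono[OF finite_subgroup[OF I]] by metis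
  moreover have "card (P \<inter> N) \<le> card Q"
  proof -
    have "p_subgroup p (P \<inter> N)" using p_subgroup_subset[OF p PG(3) I] by simp
    then obtain j where j: "j \<in> N" "conj_set j (P \<inter> N) \<subseteq> Q"
      using sylow_contains[OF p N(1) Q, of "P \<inter> N"] by blast
    have "j \<in> carrier G" using j mem_subgroup_carrier[OF N(1)] by blast
    then show ?thesis
      using j card_conj_set[of j "P \<inter> N"] subgroup.subset[OF I] card_mono[OF finite_subgroup[OF QG(1)]] by metis
  qed
  ultimately show ?thesis using card_sylow_eq[OF p N(1) Q] I unfolding sylow_in_iff[OF p N(1)] by simp
qed

text \<open>Not all elements of order prime to \<open>p\<close>, but only those of prime power
  order. They generate the same subgroup, and each of them generates a group of prime power order to
  which fixed point counting applies.\<close>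

definition p_regular :: "nat \<Rightarrow> 'a set \<Rightarrow> 'a set" where
  "p_regular p K = {x \<in> K. \<exists>q n. Factorial_Ring.prime q \<and> q \<noteq> p \<and> x [^] (q ^ n) = \<one>}"

text \<open>This is O^p(K), the least normal subgroup of \<open>p\<close>-power index. The group
  \<open>K\<close> is \<open>p\<close>-nilpotent exactly if \<open>p\<close> does not divide its
  order, and then it is the normal \<open>p\<close>-complement; \<open>p\<close>-nilpotency is
  stated in this form throughout.\<close>

definition p_residual :: "nat \<Rightarrow> 'a set \<Rightarrow> 'a set" where
  "p_residual p K = generate G (p_regular p K)"

lemma p_regular_mono: "K \<subseteq> L \<Longrightarrow> p_regular p K \<subseteq> p_regular p L"
  by (auto simp: p_regular_def)

lemma p_regular_subset: "p_regular p K \<subseteq> K"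
  by (auto simp: p_regular_def)

lemma p_residual_subgroup: "subgroup K G \<Longrightarrow> subgroup (p_residual p K) G"
  unfolding p_residual_def using p_regular_subset[of p K] subgroup.subset
  by (intro generate_is_subgroup) blast

lemma p_residual_subset: "subgroup K G \<Longrightarrow> p_residual p K \<subseteq> K"
  unfolding p_residual_def by (rule generate_subgroup_incl[OF p_regular_subset])

lemma p_regular_subset_residual: "p_regular p K \<subseteq> p_residual p K"
  unfolding p_residual_def by (auto intro: generate.incl)

lemma p_residual_least: "subgroup H G \<Longrightarrow> p_regular p K \<subseteq> H \<Longrightarrow> p_residual p K \<subseteq> H"
  unfolding p_residual_def by (rule generate_subgroup_incl)

lemma p_residual_mono: "K \<subseteq> L \<Longrightarrow> p_residual p K \<subseteq> p_residual p L"
  unfolding p_residual_def by (rule mono_generate[OF p_regular_mono])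

lemma generate_normalizes:
  assumes S: "S \<subseteq> carrier G" and x: "x \<in> carrier G" and c: "\<And>s. s \<in> S \<Longrightarrow> x \<otimes> s \<otimes> inv x \<in> generate G S"
  shows "normalizes x (generate G S)"
proof -
  have gG: "subgroup (generate G S) G" by (rule generate_is_subgroup[OF S])
  have "x \<otimes> h \<otimes> inv x \<in> generate G S" if "h \<in> generate G S" for h
    using that
  proof (induction rule: generate.induct)
    case one
    then show ?case using x generate.one by simp
  next
    case (incl h)
    then show ?case using c by blast
  next
    case (inv h)
    then have "h \<in> carrier G" using S by blast
    then have "x \<otimes> inv h \<otimes> inv x = inv (x \<otimes> h \<otimes> inv x)" using x by (simp add: group_norm)
    then show ?case using c[OF inv] subgroup.m_inv_closed[OF gG] by simp
  next
    case (eng a b)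
    then have "a \<in> carrier G" "b \<in> carrier G" using mem_subgroup_carrier[OF gG] by auto
    then have "x \<otimes> (a \<otimes> b) \<otimes> inv x = (x \<otimes> a \<otimes> inv x) \<otimes> (x \<otimes> b \<otimes> inv x)"
      using x by (simp add: group_norm)
    then show ?case using eng generate.eng by metis
  qed
  then show ?thesis by (simp add: normalizes_def)
qed

lemma conj_pow:
  assumes "x \<in> carrier G" "h \<in> carrier G"
  shows "(x \<otimes> h \<otimes> inv x) [^] (n::nat) = x \<otimes> h [^] n \<otimes> inv x"
  using assms by (induction n) (simp_all add: group_norm)

lemma p_regular_conj:
  assumes "x \<in> carrier G" "K \<subseteq> carrier G" "h \<in> p_regular p K" "x \<otimes> h \<otimes> inv x \<in> L"
  shows "x \<otimes> h \<otimes> inv x \<in> p_regular p L"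
proof -
  obtain q n where "Factorial_Ring.prime q" "q \<noteq> p" "h [^] (q ^ n :: nat) = \<one>" "h \<in> K"
    using assms(3) unfolding p_regular_def by blast
  moreover have "(x \<otimes> h \<otimes> inv x) [^] (q ^ n) = \<one>"
    using conj_pow[of x h "q ^ n"] assms(1,2) calculation by (simp add: subsetD)
  ultimately show ?thesis using assms(4) unfolding p_regular_def by blast
qed

lemma p_residual_normalizes:
  assumes K: "subgroup K G" and x: "x \<in> carrier G" "normalizes x K"
  shows "normalizes x (p_residual p K)"
  unfolding p_residual_def
proof (rule generate_normalizes)
  show "p_regular p K \<subseteq> carrier G" using p_regular_subset subgroup.subset[OF K] by blast
  fix s assume s: "s \<in> p_regular p K"
  then have "s \<in> K" using p_regular_subset by blast
  then show "x \<otimes> s \<otimes> inv x \<in> generate G (p_regular p K)"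
    using p_regular_conj[OF x(1) subgroup.subset[OF K] s] normalizesD[OF x(2)] generate.incl by metis
qed (rule x)

lemma p_residual_idem:
  assumes "subgroup K G"
  shows "p_regular p K \<subseteq> p_regular p (p_residual p K)"
  using p_regular_subset_residual[of p K] unfolding p_regular_def by blast

text \<open>For a prime \<open>q\<close> other than \<open>p\<close>, the index of \<open>T\<close>
  is prime to \<open>q\<close>. So a \<open>q\<close>-subgroup has a conjugate inside
  \<open>T\<close>, and lies in \<open>T\<close> itself by normality.\<close>

lemma p_regular_subset_normal:
  assumes p: "Factorial_Ring.prime p" and K: "subgroup K G" and T: "subgroup T G" "T \<subseteq> K"
    and nrm: "\<And>k. k \<in> K \<Longrightarrow> normalizes k T" and idx: "card K = card T * p ^ a"
  shows "p_regular p K \<subseteq> T"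
proof
  fix x assume x: "x \<in> p_regular p K"
  then obtain q n where q: "Factorial_Ring.prime q" "q \<noteq> p" "x [^] (q ^ n :: nat) = \<one>" and xK: "x \<in> K"
    unfolding p_regular_def by blast
  have xG: "x \<in> carrier G" using xK mem_subgroup_carrier[OF K] by blast
  have S: "p_subgroup q (generate G {x})" using card_generate_singleton[OF q(1) xG q(3)] .
  have SK: "generate G {x} \<subseteq> K" using xK by (intro generate_subgroup_incl[OF _ K]) simp
  have "card K div card T = p ^ a" using idx card_subgroup_pos[OF T(1)] by simp
  then have "\<not> q dvd card K div card T"
    using prime_dvd_power_nat[OF q(1), of p a] primes_dvd_imp_eq[OF q(1) p] q(2) by auto
  then obtain k where k: "k \<in> K" "conj_set k (generate G {x}) \<subseteq> T"
    using p_subgroup_conj_into[OF q(1) K S SK T] by blast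
  have kG: "k \<in> carrier G" using k mem_subgroup_carrier[OF K] by blast
  have "x \<in> generate G {x}" by (rule generate.incl) simp
  then have "k \<otimes> x \<otimes> inv k \<in> T" using k(2) by (auto simp: conj_set_def)
  then have "inv k \<otimes> (k \<otimes> x \<otimes> inv k) \<otimes> inv (inv k) \<in> T"
    using nrm[of "inv k"] subgroup.m_inv_closed[OF K k(1)] normalizesD by blast
  then show "x \<in> T" using kG xG by (simp add: group_norm)
qed

text \<open>The product contains a Sylow subgroup of \<open>K\<close> for every prime:
  \<open>P\<close> for \<open>p\<close>, and for any other prime a group made up of
  \<open>p_regular\<close> elements. Hence |K| divides its order.\<close>

lemma p_residual_supplement:
  assumes p: "Factorial_Ring.prime p" and K: "subgroup K G" and P: "sylow_in p P K"
  shows "p_residual p K <#> P = K"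
proof -
  let ?N = "p_residual p K"
  have N: "subgroup ?N G" "?N \<subseteq> K" using p_residual_subgroup[OF K] p_residual_subset[OF K] by auto
  have PG: "subgroup P G" "P \<subseteq> K" using sylow_inD[OF P] by auto
  have KG: "k \<in> carrier G" if "k \<in> K" for k using that mem_subgroup_carrier[OF K] by blast
  have nrm: "normalizes k ?N" if "k \<in> K" for k
    using p_residual_normalizes[OF K KG[OF that] normalizes_self[OF K that]] .
  have NP: "subgroup (?N <#> P) G" using subgroup_set_mult[OF N(1) PG(1)] nrm PG(2) by blast
  have NPK: "?N <#> P \<subseteq> K" using set_mult_subset_subgroup[OF K N(2) PG(2)] .
  have "card K dvd card (?N <#> P)"
  proof (rule multiplicity_le_imp_dvd)
    show "card K \<noteq> 0" using card_subgroup_pos[OF K] by simp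
    fix q :: nat assume q: "Factorial_Ring.prime q"
    have pos: "card (?N <#> P) \<noteq> 0" using card_subgroup_pos[OF NP] by simp
    have "\<exists>Q. subgroup Q G \<and> Q \<subseteq> ?N <#> P \<and> card Q = q ^ multiplicity q (card K)"
    proof (cases "q = p")
      case True
      then show ?thesis using PG card_sylow_eq[OF p K P] subset_set_mult(2)[OF N(1) PG(1)] by blast
    next
      case False
      obtain Q where Q: "sylow_in q Q K" using sylow_in_exists[OF q K] by blast
      have QG: "subgroup Q G" "Q \<subseteq> K" "p_subgroup q Q" using sylow_inD[OF Q] by auto
      have "Q \<subseteq> p_regular p K"
        using p_power_eventually_one[OF QG(3)] QG(2) q False unfolding p_regular_def by blast
      then have "Q \<subseteq> ?N <#> P"
        using p_regular_subset_residual[of p K] subset_set_mult(1)[OF N(1) PG(1)] by blast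
      then show ?thesis using QG card_sylow_eq[OF q K Q] by blast
    qed
    then have "q ^ multiplicity q (card K) dvd card (?N <#> P)"
      using card_subgroup_dvd[OF _ NP] by metis
    then show "multiplicity q (card K) \<le> multiplicity q (card (?N <#> P))"
      using q pos by (metis multiplicity_geI not_prime_unit)
  qed
  then have "card K \<le> card (?N <#> P)" using card_subgroup_pos[OF NP] by (rule dvd_imp_le)
  then show ?thesis using card_seteq[OF finite_subgroup[OF K] NPK] by blast
qed

end

section \<open>Transfer and Tate's theorem\<close>

context transversal
begin

lemma inv_sigma_mem: "k \<in> K \<Longrightarrow> inv (\<sigma> k) \<otimes> k \<in> P"
  using P.m_inv_closed[OF sigma_coset[of k]] by (simp add: group_norm)

lemma sum_translate:
  assumes "k \<in> K"
  shows "(\<Sum>t\<in>\<sigma> ` K. f (\<sigma> (k \<otimes> t))) = (\<Sum>t\<in>\<sigma> ` K. f t)"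
  using sum.reindex_bij_betw[OF bij_translate[OF assms]] .

text \<open>The composite of \<open>l\<close> with the transfer from \<open>K\<close> to
  \<open>P\<close>. The summand for a product splits into the summand of \<open>k\<close> at
  \<open>t\<close> and that of \<open>g\<close> at the translate of \<open>t\<close> by
  \<open>k\<close>, and translation permutes the transversal.\<close>

lemma mod_char_transfer:
  assumes l: "mod_char p P l"
  shows "mod_char p K (\<lambda>g. \<Sum>t\<in>\<sigma> ` K. l (inv (\<sigma> (g \<otimes> t)) \<otimes> (g \<otimes> t)))"
  unfolding mod_char_def
proof (intro ballI)
  fix g k assume gk: "g \<in> K" "k \<in> K"
  have "[l (inv (\<sigma> ((g \<otimes> k) \<otimes> t)) \<otimes> ((g \<otimes> k) \<otimes> t)) =
      l (inv (\<sigma> (g \<otimes> \<sigma> (k \<otimes> t))) \<otimes> (g \<otimes> \<sigma> (k \<otimes> t))) + l (inv (\<sigma> (k \<otimes> t)) \<otimes> (k \<otimes> t))] (mod int p)"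
    if "t \<in> \<sigma> ` K" for t
  proof -
    have t: "t \<in> K" using that trans_mem by blast
    have "inv (\<sigma> ((g \<otimes> k) \<otimes> t)) \<otimes> ((g \<otimes> k) \<otimes> t) =
      (inv (\<sigma> (g \<otimes> \<sigma> (k \<otimes> t))) \<otimes> (g \<otimes> \<sigma> (k \<otimes> t))) \<otimes> (inv (\<sigma> (k \<otimes> t)) \<otimes> (k \<otimes> t))"
      using gk t by (simp add: m_assoc)
    moreover have "inv (\<sigma> (g \<otimes> \<sigma> (k \<otimes> t))) \<otimes> (g \<otimes> \<sigma> (k \<otimes> t)) \<in> P"
      using inv_sigma_mem[of "g \<otimes> \<sigma> (k \<otimes> t)"] gk t by simp
    moreover have "inv (\<sigma> (k \<otimes> t)) \<otimes> (k \<otimes> t) \<in> P" using inv_sigma_mem gk t by simp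
    ultimately show ?thesis using mod_charD[OF l] by metis
  qed
  then have "[(\<Sum>t\<in>\<sigma> ` K. l (inv (\<sigma> ((g \<otimes> k) \<otimes> t)) \<otimes> ((g \<otimes> k) \<otimes> t))) =
     (\<Sum>t\<in>\<sigma> ` K. l (inv (\<sigma> (g \<otimes> \<sigma> (k \<otimes> t))) \<otimes> (g \<otimes> \<sigma> (k \<otimes> t))) + l (inv (\<sigma> (k \<otimes> t)) \<otimes> (k \<otimes> t)))] (mod int p)"
    by (rule cong_sum)
  also have "(\<Sum>t\<in>\<sigma> ` K. l (inv (\<sigma> (g \<otimes> \<sigma> (k \<otimes> t))) \<otimes> (g \<otimes> \<sigma> (k \<otimes> t))) + l (inv (\<sigma> (k \<otimes> t)) \<otimes> (k \<otimes> t))) =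
     (\<Sum>t\<in>\<sigma> ` K. l (inv (\<sigma> (g \<otimes> t)) \<otimes> (g \<otimes> t))) + (\<Sum>t\<in>\<sigma> ` K. l (inv (\<sigma> (k \<otimes> t)) \<otimes> (k \<otimes> t)))"
    unfolding sum.distrib using sum_translate[OF gk(2), of "\<lambda>t. l (inv (\<sigma> (g \<otimes> t)) \<otimes> (g \<otimes> t))"] by simp
  finally show "[(\<Sum>t\<in>\<sigma> ` K. l (inv (\<sigma> (g \<otimes> k \<otimes> t)) \<otimes> (g \<otimes> k \<otimes> t))) =
    (\<Sum>t\<in>\<sigma> ` K. l (inv (\<sigma> (g \<otimes> t)) \<otimes> (g \<otimes> t))) + (\<Sum>t\<in>\<sigma> ` K. l (inv (\<sigma> (k \<otimes> t)) \<otimes> (k \<otimes> t)))] (mod int p)" .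
qed

text \<open>Along the walk t, g t, g^2 t, ... through the cosets the local factors multiply to the
  single factor of g^n. With n the length of an orbit this evaluates the part of the transfer that
  belongs to the orbit.\<close>

lemma transfer_telescope:
  assumes l: "mod_char p P l" and g: "g \<in> K" and t: "t \<in> K"
  shows "[l (inv (\<sigma> (g [^] (n::nat) \<otimes> t)) \<otimes> (g [^] n \<otimes> \<sigma> t)) =
    (\<Sum>i<n. l (inv (\<sigma> (g \<otimes> \<sigma> (g [^] i \<otimes> t))) \<otimes> (g \<otimes> \<sigma> (g [^] i \<otimes> t))))] (mod int p)"
proof (induction n)
  case 0
  then show ?case using mod_char_one[OF l P] t g by simp
next
  case (Suc n)
  have pw: "g [^] i \<in> K" for i :: nat using nat_pow_mem[OF K g] .
  have e: "g [^] Suc n = g \<otimes> g [^] n" using nat_pow_Suc2[of g n] g by simp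
  have "inv (\<sigma> (g [^] Suc n \<otimes> t)) \<otimes> (g [^] Suc n \<otimes> \<sigma> t) =
    (inv (\<sigma> (g \<otimes> \<sigma> (g [^] n \<otimes> t))) \<otimes> (g \<otimes> \<sigma> (g [^] n \<otimes> t))) \<otimes> (inv (\<sigma> (g [^] n \<otimes> t)) \<otimes> (g [^] n \<otimes> \<sigma> t))"
    unfolding e using g t pw by (simp add: m_assoc)
  moreover have 1: "inv (\<sigma> (g \<otimes> \<sigma> (g [^] n \<otimes> t))) \<otimes> (g \<otimes> \<sigma> (g [^] n \<otimes> t)) \<in> P"
    using inv_sigma_mem[of "g \<otimes> \<sigma> (g [^] n \<otimes> t)"] g t pw by simp
  moreover have "inv (\<sigma> (g [^] n \<otimes> t)) \<otimes> (g [^] n \<otimes> \<sigma> t) \<in> P"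
    using inv_sigma_mem[of "g [^] n \<otimes> \<sigma> t"] g t pw by simp
  ultimately have "[l (inv (\<sigma> (g [^] Suc n \<otimes> t)) \<otimes> (g [^] Suc n \<otimes> \<sigma> t)) =
    l (inv (\<sigma> (g \<otimes> \<sigma> (g [^] n \<otimes> t))) \<otimes> (g \<otimes> \<sigma> (g [^] n \<otimes> t))) + l (inv (\<sigma> (g [^] n \<otimes> t)) \<otimes> (g [^] n \<otimes> \<sigma> t))] (mod int p)"
    using mod_charD[OF l] by metis
  also have "[l (inv (\<sigma> (g \<otimes> \<sigma> (g [^] n \<otimes> t))) \<otimes> (g \<otimes> \<sigma> (g [^] n \<otimes> t))) + l (inv (\<sigma> (g [^] n \<otimes> t)) \<otimes> (g [^] n \<otimes> \<sigma> t)) =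
    l (inv (\<sigma> (g \<otimes> \<sigma> (g [^] n \<otimes> t))) \<otimes> (g \<otimes> \<sigma> (g [^] n \<otimes> t))) + (\<Sum>i<n. l (inv (\<sigma> (g \<otimes> \<sigma> (g [^] i \<otimes> t))) \<otimes> (g \<otimes> \<sigma> (g [^] i \<otimes> t))))] (mod int p)"
    by (rule cong_add[OF cong_refl Suc])
  finally show ?case by (simp add: add.commute del: nat_pow_Suc)
qed

text \<open>Each orbit of \<open>g\<close> on the cosets contributes its length times \<open>l g\<close>, because
  \<open>t\<^sup>-\<^sup>1 g\<^sup>r t\<close> is conjugate to \<open>g\<^sup>r\<close> if \<open>r\<close> is the length of the orbit of \<open>t\<close>.\<close>

lemma transfer_stable:
  assumes l: "mod_char p P l"
    and stable: "\<And>x k. x \<in> P \<Longrightarrow> k \<in> K \<Longrightarrow> k \<otimes> x \<otimes> inv k \<in> P \<Longrightarrow> [l (k \<otimes> x \<otimes> inv k) = l x] (mod int p)"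
    and g: "g \<in> P"
  shows "[(\<Sum>t\<in>\<sigma> ` K. l (inv (\<sigma> (g \<otimes> t)) \<otimes> (g \<otimes> t))) = int (card (\<sigma> ` K)) * l g] (mod int p)"
proof -
  let ?f = "\<lambda>t. l (inv (\<sigma> (g \<otimes> t)) \<otimes> (g \<otimes> t))"
  have gK: "g \<in> K" using g P_in_K by blast
  have pw: "g [^] i \<in> P" for i :: nat using nat_pow_mem[OF P g] .
  have pwK: "g [^] i \<in> K" for i :: nat using pw P_in_K by blast
  have "[sum ?f A = int (card A) * l g] (mod int p)"
    if "A \<subseteq> \<sigma> ` K" "\<And>t. t \<in> A \<Longrightarrow> \<sigma> (g \<otimes> t) \<in> A" for A
    using that
  proof (induction "card A" arbitrary: A rule: less_induct)
    case less
    have finA: "finite A" using less.prems(1) finite_trans finite_subset by blast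
    show ?case
    proof (cases "A = {}")
      case False
      then obtain t where tA: "t \<in> A" by blast
      have tK: "t \<in> K" and st: "\<sigma> t = t" using tA less.prems(1) trans_mem sigma_fix by blast+
      define c where "c i = \<sigma> (g [^] (i::nat) \<otimes> t)" for i
      have cS: "\<sigma> (g \<otimes> c i) = c (Suc i)" for i
      proof -
        have "g [^] Suc i = g \<otimes> g [^] i" using nat_pow_Suc2[of g i] gK by simp
        then show ?thesis using gK tK pwK[of i] by (simp add: c_def m_assoc del: nat_pow_Suc)
      qed
      have cA: "c i \<in> A" for i
      proof (induction i)
        case 0
        then show ?case using tA st tK by (simp add: c_def)
      next
        case (Suc i)
        then show ?case using less.prems(2) cS by metis
      qed
      have per: "c (order G) = t" using pow_order_eq_1[of g] gK tK st by (simp add: c_def)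
      have o0: "0 < order G" by (simp add: order_gt_0_iff_finite)
      define r where "r = (LEAST r. 0 < r \<and> c r = t)"
      have r: "0 < r" "c r = t"
        using LeastI[of "\<lambda>r. 0 < r \<and> c r = t" "order G"] per o0 unfolding r_def by auto
      have rmin: "\<not> (0 < i \<and> c i = t)" if "i < r" for i
        using not_less_Least[of i "\<lambda>r. 0 < r \<and> c r = t"] that unfolding r_def by blast
      have shift: "c (j - i) = t" if ij: "i \<le> j" "c i = c j" for i j
      proof -
        have "inv (g [^] i \<otimes> t) \<otimes> (g [^] j \<otimes> t) \<in> P"
          using ij sigma_eq_iff[of "g [^] i \<otimes> t" "g [^] j \<otimes> t"] pwK tK by (simp add: c_def)
        moreover have "g [^] j = g [^] i \<otimes> g [^] (j - i)" using ij gK by (simp add: nat_pow_mult)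
        ultimately have "inv t \<otimes> (g [^] (j - i) \<otimes> t) \<in> P"
          using pwK[of i] pwK[of "j - i"] tK by (simp add: group_norm)
        then have "\<sigma> t = \<sigma> (g [^] (j - i) \<otimes> t)"
          using sigma_eq_iff[of t "g [^] (j - i) \<otimes> t"] tK pwK by simp
        then show ?thesis using st by (simp add: c_def)
      qed
      have inj: "inj_on c {..<r}"
      proof (rule inj_onI)
        have *: False if "i < j" "j < r" "c i = c j" for i j
        proof -
          have "j - i < r" using that by linarith
          then show False using shift[of i j] rmin[of "j - i"] that by simp
        qed
        fix i j assume "i \<in> {..<r}" "j \<in> {..<r}" "c i = c j"
        then show "i = j" using *[of i j] *[of j i] by (metis lessThan_iff linorder_neqE_nat)
      qed
      let ?O = "c ` {..<r}"
      have OA: "?O \<subseteq> A" using cA by blast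
      have cardO: "card ?O = r" using card_image[OF inj] by simp
      have "sum ?f ?O = (\<Sum>i<r. ?f (c i))" using sum.reindex[OF inj] by simp
      also have "[(\<Sum>i<r. ?f (c i)) = l (inv (\<sigma> (g [^] r \<otimes> t)) \<otimes> (g [^] r \<otimes> \<sigma> t))] (mod int p)"
        using cong_sym[OF transfer_telescope[OF l gK tK, of r]] unfolding c_def .
      also have "l (inv (\<sigma> (g [^] r \<otimes> t)) \<otimes> (g [^] r \<otimes> \<sigma> t)) = l (inv t \<otimes> g [^] r \<otimes> inv (inv t))"
        using r(2) st tK pwK by (simp add: c_def m_assoc)
      also have "[l (inv t \<otimes> g [^] r \<otimes> inv (inv t)) = l (g [^] r)] (mod int p)"
      proof (rule stable[OF pw])
        show "inv t \<in> K" using tK by simp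
        have "inv (\<sigma> (g [^] r \<otimes> t)) \<otimes> (g [^] r \<otimes> t) \<in> P" using inv_sigma_mem pwK tK by simp
        then show "inv t \<otimes> g [^] r \<otimes> inv (inv t) \<in> P"
          using r(2) tK pwK by (simp add: c_def m_assoc)
      qed
      also have "[l (g [^] r) = int r * l g] (mod int p)" by (rule mod_char_pow[OF l P g])
      finally have O: "[sum ?f ?O = int r * l g] (mod int p)" .
      have "\<sigma> (g \<otimes> s) \<in> A - ?O" if s: "s \<in> A - ?O" for s
      proof -
        have sK: "s \<in> K" "\<sigma> s = s" using s less.prems(1) trans_mem sigma_fix by blast+
        have "\<sigma> (g \<otimes> s) \<notin> ?O"
        proof
          assume "\<sigma> (g \<otimes> s) \<in> ?O"
          then obtain i where i: "i < r" "\<sigma> (g \<otimes> s) = c i" by blast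
          \<comment> \<open>The predecessor of \<open>i\<close> on the cycle of length
            \<open>r\<close>. As translation by \<open>g\<close> is injective on the transversal,
            \<open>s\<close> would have to be the orbit point \<open>c j\<close>.\<close>
          define j where "j = (if i = 0 then r - 1 else i - 1)"
          have "c 0 = t" using st tK by (simp add: c_def)
          then have j: "j < r" "c (Suc j) = c i" using i(1) r by (auto simp: j_def)
          have "\<sigma> (g \<otimes> s) = \<sigma> (g \<otimes> c j)" using j cS i by simp
          moreover have "c j \<in> \<sigma> ` K" "s \<in> \<sigma> ` K" using cA[of j] s less.prems(1) by blast+
          ultimately have "s = c j"
            using inj_onD[OF bij_betw_imp_inj_on[OF bij_translate[OF gK]]] by blast
          then show False using s j by blast
        qed
        then show ?thesis using less.prems(2) s by blast
      qed
      moreover have "card (A - ?O) < card A"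
      proof -
        have "c 0 \<in> ?O" using r(1) by blast
        then show ?thesis using OA finA by (intro psubset_card_mono) blast+
      qed
      ultimately have IH: "[sum ?f (A - ?O) = int (card (A - ?O)) * l g] (mod int p)"
        using less.hyps[of "A - ?O"] less.prems(1) by blast
      have sumA: "sum ?f A = sum ?f (A - ?O) + sum ?f ?O" using sum.subset_diff[OF OA finA] .
      have cardA: "int (card A) = int (card (A - ?O)) + int r"
        using card_Diff_subset[OF finite_subset[OF OA finA] OA] card_mono[OF finA OA] cardO by simp
      show ?thesis unfolding sumA cardA distrib_right by (rule cong_add[OF IH O])
    qed simp
  qed
  moreover have "\<sigma> (g \<otimes> t) \<in> \<sigma> ` K" if "t \<in> \<sigma> ` K" for t
    using trans_mem[OF that] gK by simp
  ultimately show ?thesis by blast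
qed

end

context finite_group
begin

text \<open>A homomorphism to the integers modulo \<open>p\<close> kills all elements of order prime
  to \<open>p\<close>, and these generate the residual.\<close>

lemma mod_char_p_residual:
  assumes p: "Factorial_Ring.prime p" and K: "subgroup K G" and V: "mod_char p (p_residual p K) V"
    and x: "x \<in> p_residual p K"
  shows "int p dvd V x"
proof -
  let ?N = "p_residual p K"
  have N: "subgroup ?N G" using p_residual_subgroup[OF K] .
  have "p_regular p K \<subseteq> {x \<in> ?N. int p dvd V x}"
  proof
    fix y assume y: "y \<in> p_regular p K"
    then have yN: "y \<in> ?N" using p_regular_subset_residual by blast
    obtain q n where q: "Factorial_Ring.prime q" "q \<noteq> p" "y [^] (q ^ n :: nat) = \<one>"
      using y unfolding p_regular_def by blast
    have "[V (y [^] (q ^ n)) = int (q ^ n) * V y] (mod int p)" by (rule mod_char_pow[OF V N yN])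
    then have "int p dvd int (q ^ n) * V y"
      using q(3) mod_char_one[OF V N] by (metis cong_0_iff cong_sym cong_trans)
    moreover have "coprime (int p) (int (q ^ n))"
      using primes_coprime[OF p q(1)] q(2) by (simp add: coprime_commute)
    ultimately have "int p dvd V y" using coprime_dvd_mult_right_iff by blast
    then show "y \<in> {x \<in> ?N. int p dvd V x}" using yN by blast
  qed
  then have "?N \<subseteq> {x \<in> ?N. int p dvd V x}"
    by (rule p_residual_least[OF mod_char_kernel_subgroup[OF V N]])
  then show ?thesis using x by blast
qed

text \<open>Tate's theorem. For a \<open>P\<close>-invariant \<open>l\<close> on \<open>Q = P \<inter> N\<close> the map
  \<open>g \<mapsto> \<Sum> l (g\<^sup>-\<^sup>1 (g t g\<^sup>-\<^sup>1)'\<^sup>-\<^sup>1 g t)\<close>, summed over a transversal of \<open>Q\<close> in \<open>N\<close> with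
  representatives written \<open>x'\<close>, is a homomorphism on all of \<open>P\<close>. On \<open>Q\<close> it is the
  transfer, which vanishes, minus \<open>|N : Q| l\<close>.\<close>

lemma p_nilpotent_if_residual_subset_frattini:
  assumes p: "Factorial_Ring.prime p" and K: "subgroup K G" and P: "sylow_in p P K"
    and Phi: "P \<inter> p_residual p K \<subseteq> frattini (G\<lparr>carrier := P\<rparr>)"
  shows "\<not> p dvd card (p_residual p K)"
proof
  let ?N = "p_residual p K"
  let ?Q = "P \<inter> ?N"
  assume pN: "p dvd card ?N"
  have PG: "subgroup P G" "P \<subseteq> K" "p_subgroup p P" using sylow_inD[OF P] by auto
  interpret P: subgroup P G by (rule PG(1))
  have N: "subgroup ?N G" "?N \<subseteq> K" using p_residual_subgroup[OF K] p_residual_subset[OF K] by auto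
  have nrm: "normalizes k ?N" if "k \<in> K" for k
    using p_residual_normalizes[OF K mem_subgroup_carrier[OF K that] normalizes_self[OF K that]] .
  have Q: "sylow_in p ?Q ?N" by (rule sylow_Int_normal[OF p K P N nrm])
  have QG: "subgroup ?Q G" "?Q \<subseteq> ?N" using sylow_inD[OF Q] by auto
  have "?Q \<noteq> {\<one>}"
  proof
    assume "?Q = {\<one>}"
    then have "card ?Q = 1" by simp
    then show False using sylow_inD(4)[OF Q] pN by simp
  qed
  then have triv: "{\<one>} \<subset> ?Q" using subgroup.one_closed[OF QG(1)] by blast
  have nPQ: "normalizes u ?Q" if "u \<in> P" for u
    using normalizes_Int[OF normalizes_self[OF PG(1) that] nrm] that PG(2) by blast
  have ntriv: "normalizes u {\<one>}" if "u \<in> P" for u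
    using that by (simp add: normalizes_def)
  \<comment> \<open>The case of the trivial subgroup for \<open>S\<close>: a nonzero character of
    \<open>Q\<close> that is invariant under the \<open>p\<close>-group \<open>P\<close>.\<close>
  have "\<exists>l. mod_char p ?Q l \<and> (\<forall>u\<in>P. \<forall>q\<in>?Q. [l (u \<otimes> q \<otimes> inv u) = l q] (mod int p)) \<and>
      (\<exists>y\<in>?Q. \<not> int p dvd l y)"
    by (rule ex_invariant_mod_char[OF p PG(3) QG(1) Int_lower1 nPQ triv_subgroup triv ntriv]) blast+
  then obtain l where l: "mod_char p ?Q l"
    "\<And>u q. u \<in> P \<Longrightarrow> q \<in> ?Q \<Longrightarrow> [l (u \<otimes> q \<otimes> inv u) = l q] (mod int p)"
    "\<exists>y\<in>?Q. \<not> int p dvd l y" by blast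
  obtain \<sigma> where "transversal G ?Q ?N \<sigma>" using ex_transversal_locale[OF QG(1) N(1) QG(2)] .
  then interpret tr: transversal G ?Q ?N \<sigma> .
  have conjN: "g \<otimes> t \<otimes> inv g \<in> ?N" if "g \<in> P" "t \<in> ?N" for g t
    using normalizesD[OF nrm[of g] that(2)] that(1) PG(2) by blast
  have conjN': "inv g \<otimes> t \<otimes> g \<in> ?N" if "g \<in> P" "t \<in> ?N" for g t
    using conjN[of "inv g" t] that by simp
  have sconj: "\<sigma> (g \<otimes> \<sigma> t \<otimes> inv g) = \<sigma> (g \<otimes> t \<otimes> inv g)" if gt: "g \<in> P" "t \<in> ?N" for g t
  proof -
    have "inv (g \<otimes> t \<otimes> inv g) \<otimes> (g \<otimes> \<sigma> t \<otimes> inv g) = g \<otimes> (inv t \<otimes> \<sigma> t) \<otimes> inv g"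
      using gt by (simp add: group_norm)
    also have "\<dots> \<in> ?Q" by (rule normalizesD[OF nPQ[OF gt(1)] tr.sigma_coset[OF gt(2)]])
    finally show ?thesis
      using tr.sigma_eq_iff[of "g \<otimes> t \<otimes> inv g" "g \<otimes> \<sigma> t \<otimes> inv g"] conjN gt by simp
  qed
  \<comment> \<open>The quotient of g t g^-1 by its representative, conjugated back by
    \<open>g\<close>. It lies in \<open>Q\<close> even though \<open>g\<close> need not lie in the
    residual.\<close>
  define h where "h g t = inv g \<otimes> inv (\<sigma> (g \<otimes> t \<otimes> inv g)) \<otimes> g \<otimes> t" for g t
  have hQ: "h g t \<in> ?Q" if gt: "g \<in> P" "t \<in> ?N" for g t
  proof -
    have s: "\<sigma> (g \<otimes> t \<otimes> inv g) \<in> carrier G" using conjN[OF gt] by simp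
    have "h g t = inv g \<otimes> (inv (\<sigma> (g \<otimes> t \<otimes> inv g)) \<otimes> (g \<otimes> t \<otimes> inv g)) \<otimes> inv (inv g)"
      using gt s by (simp add: h_def group_norm)
    also have "\<dots> \<in> ?Q"
      by (rule normalizesD[OF nPQ tr.inv_sigma_mem[OF conjN[OF gt]]]) (use gt in simp)
    finally show ?thesis .
  qed
  have bij: "bij_betw (\<lambda>t. \<sigma> (g \<otimes> t \<otimes> inv g)) (\<sigma> ` ?N) (\<sigma> ` ?N)" if g: "g \<in> P" for g
  proof (rule bij_betwI[where g = "\<lambda>t. \<sigma> (inv g \<otimes> t \<otimes> inv (inv g))"])
    have gi: "inv g \<in> P" using g by simp
    show "(\<lambda>t. \<sigma> (g \<otimes> t \<otimes> inv g)) \<in> \<sigma> ` ?N \<rightarrow> \<sigma> ` ?N"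
      by (intro funcsetI imageI conjN[OF g] tr.trans_mem)
    show "(\<lambda>t. \<sigma> (inv g \<otimes> t \<otimes> inv (inv g))) \<in> \<sigma> ` ?N \<rightarrow> \<sigma> ` ?N"
      by (intro funcsetI imageI conjN[OF gi] tr.trans_mem)
    fix t assume t: "t \<in> \<sigma> ` ?N"
    have tN: "t \<in> ?N" "\<sigma> t = t" using t tr.trans_mem tr.sigma_fix by blast+
    show "\<sigma> (inv g \<otimes> \<sigma> (g \<otimes> t \<otimes> inv g) \<otimes> inv (inv g)) = t"
      unfolding sconj[OF gi conjN[OF g tN(1)]] using g tN by (simp add: group_norm)
    show "\<sigma> (g \<otimes> \<sigma> (inv g \<otimes> t \<otimes> inv (inv g)) \<otimes> inv g) = t"
      unfolding sconj[OF g conjN[OF gi tN(1)]] using g tN by (simp add: group_norm)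
  qed
  define \<mu> where "\<mu> g = (\<Sum>t\<in>\<sigma> ` ?N. l (h g t))" for g
  have mu: "mod_char p P \<mu>"
    unfolding mod_char_def
  proof (intro ballI)
    fix g k assume gk: "g \<in> P" "k \<in> P"
    have "[l (h (g \<otimes> k) t) = l (h g (\<sigma> (k \<otimes> t \<otimes> inv k))) + l (h k t)] (mod int p)" if "t \<in> \<sigma> ` ?N" for t
    proof -
      have t: "t \<in> ?N" using that tr.trans_mem by blast
      let ?s = "\<sigma> (k \<otimes> t \<otimes> inv k)"
      have s: "?s \<in> ?N" using conjN[OF gk(2) t] by simp
      have e: "\<sigma> ((g \<otimes> k) \<otimes> t \<otimes> inv (g \<otimes> k)) = \<sigma> (g \<otimes> ?s \<otimes> inv g)"
        using sconj[OF gk(1) conjN[OF gk(2) t]] gk t by (simp add: group_norm)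
      have s2: "\<sigma> (g \<otimes> ?s \<otimes> inv g) \<in> carrier G" using conjN[OF gk(1) s] by simp
      \<comment> \<open>The factor of \<open>g\<close> appears conjugated by \<open>inv k\<close>.
        Only because \<open>l\<close> is invariant under \<open>P\<close> can this conjugation be
        dropped.\<close>
      have "h (g \<otimes> k) t = (inv k \<otimes> h g ?s \<otimes> inv (inv k)) \<otimes> h k t"
        unfolding h_def e using gk t s s2 by (simp add: group_norm)
      moreover have hs: "inv k \<otimes> h g ?s \<otimes> inv (inv k) \<in> ?Q"
        by (rule normalizesD[OF nPQ hQ[OF gk(1) s]]) (use gk in simp)
      ultimately have "[l (h (g \<otimes> k) t) = l (inv k \<otimes> h g ?s \<otimes> inv (inv k)) + l (h k t)] (mod int p)"
        using mod_charD[OF l(1) hs hQ[OF gk(2) t]] by simp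
      also have "[l (inv k \<otimes> h g ?s \<otimes> inv (inv k)) + l (h k t) = l (h g ?s) + l (h k t)] (mod int p)"
        by (rule cong_add[OF l(2)[OF _ hQ[OF gk(1) s]] cong_refl]) (use gk in simp)
      finally show ?thesis .
    qed
    then have "[\<mu> (g \<otimes> k) = (\<Sum>t\<in>\<sigma> ` ?N. l (h g (\<sigma> (k \<otimes> t \<otimes> inv k))) + l (h k t))] (mod int p)"
      unfolding \<mu>_def by (rule cong_sum)
    also have "(\<Sum>t\<in>\<sigma> ` ?N. l (h g (\<sigma> (k \<otimes> t \<otimes> inv k))) + l (h k t)) = \<mu> g + \<mu> k"
      unfolding sum.distrib \<mu>_def using sum.reindex_bij_betw[OF bij[OF gk(2)], of "\<lambda>t. l (h g t)"] by simp
    finally show "[\<mu> (g \<otimes> k) = \<mu> g + \<mu> k] (mod int p)" .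
  qed
  \<comment> \<open>At this \<open>y\<close> the character \<open>\<mu>\<close> vanishes modulo
    \<open>p\<close> since \<open>y\<close> is in \<Phi>(P), and the transfer \<open>V\<close>
    vanishes as well. What remains is |N : Q| \<open>l y\<close>, which is not divisible by
    \<open>p\<close>.\<close>
  obtain y where y: "y \<in> ?Q" "\<not> int p dvd l y" using l(3) by blast
  have yP: "y \<in> P" and yN: "y \<in> ?N" using y by auto
  define V where "V g = (\<Sum>t\<in>\<sigma> ` ?N. l (inv (\<sigma> (g \<otimes> t)) \<otimes> (g \<otimes> t)))" for g
  have V: "int p dvd V y"
    using mod_char_p_residual[OF p K tr.mod_char_transfer[OF l(1)] yN] unfolding V_def .
  have "[l (h y t) = l (inv (\<sigma> (y \<otimes> t)) \<otimes> (y \<otimes> t)) - l y] (mod int p)" if "t \<in> \<sigma> ` ?N" for t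
  proof -
    have t: "t \<in> ?N" using that tr.trans_mem by blast
    have yt: "y \<otimes> t \<in> ?N" using t y subgroup.m_closed[OF N(1)] by blast
    have yi: "inv y \<in> ?Q" using subgroup.m_inv_closed[OF QG(1) y(1)] .
    have "\<sigma> (y \<otimes> t \<otimes> inv y) = \<sigma> (y \<otimes> t)" using tr.sigma_const[OF yt yi] .
    then have "h y t = inv y \<otimes> (inv (\<sigma> (y \<otimes> t)) \<otimes> (y \<otimes> t))"
      using y t yt by (simp add: h_def m_assoc)
    then show ?thesis using mod_char_inv_mult[OF l(1) QG(1) y(1) tr.inv_sigma_mem[OF yt]] by simp
  qed
  then have "[\<mu> y = (\<Sum>t\<in>\<sigma> ` ?N. l (inv (\<sigma> (y \<otimes> t)) \<otimes> (y \<otimes> t)) - l y)] (mod int p)"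
    unfolding \<mu>_def by (rule cong_sum)
  then have "[\<mu> y = V y - int (card (\<sigma> ` ?N)) * l y] (mod int p)"
    by (simp add: V_def sum_subtractf)
  moreover have "int p dvd \<mu> y" using mem_frattini_iff[OF p PG(3), of y] Phi y(1) mu by blast
  ultimately have "int p dvd V y - int (card (\<sigma> ` ?N)) * l y" using cong_dvd_iff by blast
  then have "int p dvd int (card (\<sigma> ` ?N)) * l y" using V by (metis dvd_diff_commute dvd_diffD dvd_minus_iff diff_add_cancel dvd_add_right_iff)
  then have "int p dvd int (card (\<sigma> ` ?N))" using y(2) p by (metis prime_dvd_multD prime_nat_int_transfer)
  then have "p dvd card (\<sigma> ` ?N)" by simp
  moreover have "card (\<sigma> ` ?N) = card ?N div card ?Q"
    using tr.card_trans card_subgroup_pos[OF QG(1)] by (metis nonzero_mult_div_cancel_right not_gr_zero)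
  ultimately show False using sylow_inD(4)[OF Q] by simp
qed

text \<open>Every character \<open>l\<close> of \<open>P\<close> takes equal values on elements
  fused in \<open>K\<close>, so the transfer is |K : P| times \<open>l\<close> on \<open>P\<close>.
  Since it vanishes on the residual and |K : P| is prime to \<open>p\<close>, all characters vanish
  on the intersection of \<open>P\<close> with the residual, and Tate's theorem applies.\<close>

lemma p_nilpotent_if_fusion_frattini:
  assumes p: "Factorial_Ring.prime p" and K: "subgroup K G" and P: "sylow_in p P K"
    and fusion: "\<And>x k. x \<in> P \<Longrightarrow> k \<in> K \<Longrightarrow> k \<otimes> x \<otimes> inv k \<in> P \<Longrightarrow>
      inv x \<otimes> (k \<otimes> x \<otimes> inv k) \<in> frattini (G\<lparr>carrier := P\<rparr>)"
  shows "\<not> p dvd card (p_residual p K)"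
proof (rule p_nilpotent_if_residual_subset_frattini[OF p K P])
  have PG: "subgroup P G" "P \<subseteq> K" "p_subgroup p P" using sylow_inD[OF P] by auto
  have N: "subgroup (p_residual p K) G" "p_residual p K \<subseteq> K"
    using p_residual_subgroup[OF K] p_residual_subset[OF K] by auto
  obtain \<sigma> where "transversal G P K \<sigma>" using ex_transversal_locale[OF PG(1) K PG(2)] .
  then interpret tr: transversal G P K \<sigma> .
  have ndvd: "\<not> p dvd card (\<sigma> ` K)"
    using tr.card_trans card_subgroup_pos[OF PG(1)] sylow_inD(4)[OF P]
    by (metis nonzero_mult_div_cancel_right not_gr_zero)
  have "int p dvd l x" if x: "x \<in> P \<inter> p_residual p K" and l: "mod_char p P l" for x l
  proof -
    have stable: "[l (k \<otimes> y \<otimes> inv k) = l y] (mod int p)"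
      if "y \<in> P" "k \<in> K" "k \<otimes> y \<otimes> inv k \<in> P" for y k
    proof -
      have "int p dvd l (inv y \<otimes> (k \<otimes> y \<otimes> inv k))"
        using fusion[OF that] mem_frattini_iff[OF p PG(3)] l by blast
      then have "int p dvd l (k \<otimes> y \<otimes> inv k) - l y"
        using mod_char_inv_mult[OF l PG(1) that(1,3)] cong_dvd_iff by blast
      then show ?thesis by (simp add: cong_iff_dvd_diff)
    qed
    let ?V = "\<lambda>g. \<Sum>t\<in>\<sigma> ` K. l (inv (\<sigma> (g \<otimes> t)) \<otimes> (g \<otimes> t))"
    have "mod_char p (p_residual p K) ?V"
      by (rule mod_char_mono[OF tr.mod_char_transfer[OF l] N(2)])
    then have "int p dvd ?V x" using mod_char_p_residual[OF p K] x by blast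
    moreover have "[?V x = int (card (\<sigma> ` K)) * l x] (mod int p)"
      by (rule tr.transfer_stable[OF l stable]) (use x in auto)
    ultimately have "int p dvd int (card (\<sigma> ` K)) * l x" using cong_dvd_iff by blast
    then show ?thesis using ndvd p by (metis int_dvd_int_iff prime_dvd_multD prime_nat_int_transfer)
  qed
  then show "P \<inter> p_residual p K \<subseteq> frattini (G\<lparr>carrier := P\<rparr>)"
    using mem_frattini_iff[OF p PG(3)] by blast
qed

lemma commutator_subgroup_mem:
  "h \<in> H \<Longrightarrow> k \<in> K \<Longrightarrow> h \<otimes> k \<otimes> inv h \<otimes> inv k \<in> commutator_subgroup G H K"
  unfolding commutator_subgroup_def by (rule generate.incl) blast

text \<open>An element of \<open>P\<close> and a conjugate of it in \<open>P\<close> differ by a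
  commutator from [P, K], so fusion in \<open>P\<close> is trivial modulo \<Phi>(P). Only
  commutators with \<open>K\<close> matter, which lets the criterion be used in subgroups of
  \<open>G\<close>.\<close>

lemma p_nilpotent_if_IC_Phi_sylow:
  assumes p: "Factorial_Ring.prime p" and K: "subgroup K G" and P: "sylow_in p P K"
    and ic: "P \<inter> commutator_subgroup G P K \<subseteq> frattini (G\<lparr>carrier := P\<rparr>)"
  shows "\<not> p dvd card (p_residual p K)"
proof (rule p_nilpotent_if_fusion_frattini[OF p K P])
  have PG: "subgroup P G" using sylow_inD[OF P] by auto
  fix x k assume x: "x \<in> P" "k \<in> K" "k \<otimes> x \<otimes> inv k \<in> P"
  then have G: "x \<in> carrier G" "k \<in> carrier G" using mem_subgroup_carrier[OF PG] mem_subgroup_carrier[OF K] by auto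
  have "inv x \<otimes> k \<otimes> inv (inv x) \<otimes> inv k \<in> commutator_subgroup G P K"
    using commutator_subgroup_mem[of "inv x" P k K] x subgroup.m_inv_closed[OF PG] by blast
  then have "inv x \<otimes> (k \<otimes> x \<otimes> inv k) \<in> commutator_subgroup G P K"
    using G by (simp add: m_assoc)
  moreover have "inv x \<otimes> (k \<otimes> x \<otimes> inv k) \<in> P"
    using x subgroup.m_inv_closed[OF PG] subgroup.m_closed[OF PG] by blast
  ultimately show "inv x \<otimes> (k \<otimes> x \<otimes> inv k) \<in> frattini (G\<lparr>carrier := P\<rparr>)" using ic by blast
qed

section \<open>Centralizers and conjugation\<close>

definition centralizes :: "'a \<Rightarrow> 'a set \<Rightarrow> bool" where
  "centralizes x H \<longleftrightarrow> (\<forall>h\<in>H. x \<otimes> h = h \<otimes> x)"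

lemma centralizesD: "centralizes x H \<Longrightarrow> h \<in> H \<Longrightarrow> x \<otimes> h = h \<otimes> x"
  by (simp add: centralizes_def)

lemma centralizes_mono: "centralizes x H \<Longrightarrow> S \<subseteq> H \<Longrightarrow> centralizes x S"
  by (auto simp: centralizes_def)

lemma centralizes_iff:
  assumes "x \<in> carrier G" "H \<subseteq> carrier G"
  shows "centralizes x H \<longleftrightarrow> (\<forall>h\<in>H. x \<otimes> h \<otimes> inv x = h)"
proof -
  have "x \<otimes> h = h \<otimes> x \<longleftrightarrow> x \<otimes> h \<otimes> inv x = h" if "h \<in> carrier G" for h
    using that assms(1) inv_solve_right[of h "x \<otimes> h" x] by auto
  then show ?thesis using assms(2) unfolding centralizes_def by blast
qed

lemma centralizer_subgroup:
  assumes "subgroup K G" "H \<subseteq> carrier G"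
  shows "subgroup {k \<in> K. centralizes k H} G"
proof (rule finite_subgroupI)
  interpret K: subgroup K G by fact
  show "{k \<in> K. centralizes k H} \<subseteq> carrier G" by auto
  have "\<one> \<in> {k \<in> K. centralizes k H}" using assms(2) by (auto simp: centralizes_def)
  then show "{k \<in> K. centralizes k H} \<noteq> {}" by blast
  fix a b assume ab: "a \<in> {k \<in> K. centralizes k H}" "b \<in> {k \<in> K. centralizes k H}"
  have "a \<otimes> b \<otimes> h = h \<otimes> (a \<otimes> b)" if h: "h \<in> H" for h
  proof -
    have hG: "h \<in> carrier G" using h assms(2) by blast
    have "a \<otimes> b \<otimes> h = a \<otimes> (h \<otimes> b)" using ab h hG by (simp add: m_assoc centralizes_def)
    also have "\<dots> = (a \<otimes> h) \<otimes> b" using ab hG by (simp add: m_assoc)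
    also have "\<dots> = h \<otimes> (a \<otimes> b)" using ab h hG by (simp add: m_assoc centralizes_def)
    finally show ?thesis .
  qed
  then show "a \<otimes> b \<in> {k \<in> K. centralizes k H}" using ab by (auto simp: centralizes_def)
qed

lemma centralizes_conj:
  assumes "centralizes x S" "x \<in> carrier G" "g \<in> carrier G" "S \<subseteq> carrier G"
  shows "centralizes (g \<otimes> x \<otimes> inv g) (conj_set g S)"
  unfolding centralizes_def conj_set_def
proof (intro ballI, clarify)
  fix s assume s: "s \<in> S"
  then have sG: "s \<in> carrier G" using assms(4) by blast
  have "g \<otimes> x \<otimes> inv g \<otimes> (g \<otimes> s \<otimes> inv g) = g \<otimes> (x \<otimes> s) \<otimes> inv g"
    using assms(2,3) sG by (simp add: group_norm)
  also have "\<dots> = g \<otimes> (s \<otimes> x) \<otimes> inv g" using centralizesD[OF assms(1) s] by simp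
  also have "\<dots> = g \<otimes> s \<otimes> inv g \<otimes> (g \<otimes> x \<otimes> inv g)"
    using assms(2,3) sG by (simp add: group_norm)
  finally show "g \<otimes> x \<otimes> inv g \<otimes> (g \<otimes> s \<otimes> inv g) = g \<otimes> s \<otimes> inv g \<otimes> (g \<otimes> x \<otimes> inv g)" .
qed

lemma normalizes_conj:
  assumes "normalizes x S" "x \<in> carrier G" "g \<in> carrier G" "S \<subseteq> carrier G"
  shows "normalizes (g \<otimes> x \<otimes> inv g) (conj_set g S)"
  unfolding normalizes_def conj_set_def
proof (intro ballI, clarify)
  fix s assume s: "s \<in> S"
  then have sG: "s \<in> carrier G" using assms(4) by blast
  have "g \<otimes> x \<otimes> inv g \<otimes> (g \<otimes> s \<otimes> inv g) \<otimes> inv (g \<otimes> x \<otimes> inv g) = g \<otimes> (x \<otimes> s \<otimes> inv x) \<otimes> inv g"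
    using assms(2,3) sG by (simp add: group_norm)
  then show "g \<otimes> x \<otimes> inv g \<otimes> (g \<otimes> s \<otimes> inv g) \<otimes> inv (g \<otimes> x \<otimes> inv g) \<in> (\<lambda>h. g \<otimes> h \<otimes> inv g) ` S"
    using normalizesD[OF assms(1) s] by blast
qed

lemma conj_set_mono: "A \<subseteq> B \<Longrightarrow> conj_set x A \<subseteq> conj_set x B"
  by (auto simp: conj_set_def)

section \<open>Frobenius' criterion\<close>

lemma p_residual_centralizes:
  assumes K: "subgroup K G" and H: "H \<subseteq> carrier G"
    and c: "\<And>x. x \<in> p_regular p K \<Longrightarrow> centralizes x H"
    and x: "x \<in> p_residual p K"
  shows "centralizes x H"
proof -
  have "p_residual p K \<subseteq> {k \<in> K. centralizes k H}"
    by (rule p_residual_least[OF centralizer_subgroup[OF K H]]) (use c p_regular_subset in blast)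
  then show ?thesis using x by blast
qed

lemma normalizer_sylow_factor:
  assumes p: "Factorial_Ring.prime p" and N: "subgroup N G" and A: "sylow_in p A N" and k: "k \<in> N"
  obtains c a where "c \<in> p_residual p N" "a \<in> A" "k = c \<otimes> a"
  using p_residual_supplement[OF p N A] k unfolding mem_set_mult[symmetric] by (metis mem_set_mult)

text \<open>Extends the local hypothesis from the subgroups of one Sylow subgroup to all
  \<open>p\<close>-subgroups of \<open>K\<close>: conjugate into \<open>P\<close>, apply it there,
  and conjugate back.\<close>

lemma p_regular_transport:
  assumes p: "Factorial_Ring.prime p" and K: "subgroup K G" and P: "sylow_in p P K"
    and loc: "\<And>S x. subgroup S G \<Longrightarrow> S \<subseteq> P \<Longrightarrow> x \<in> p_regular p K \<Longrightarrow> normalizes x S \<Longrightarrow> centralizes x S"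
    and S: "p_subgroup p S" "S \<subseteq> K" and x: "x \<in> p_regular p K" "normalizes x S"
  shows "centralizes x S"
proof -
  obtain k where k: "k \<in> K" "conj_set k S \<subseteq> P" using sylow_contains[OF p K P S] by blast
  have kG: "k \<in> carrier G" using k mem_subgroup_carrier[OF K] by blast
  have SG: "subgroup S G" "S \<subseteq> carrier G" using S(1) p_subgroupD subgroup.subset by blast+
  have xK: "x \<in> K" using x p_regular_subset by blast
  then have xG: "x \<in> carrier G" using mem_subgroup_carrier[OF K] by blast
  let ?y = "k \<otimes> x \<otimes> inv k"
  have yK: "?y \<in> K" using k(1) xK K by (simp add: subgroup.m_closed subgroup.m_inv_closed)
  have "?y \<in> p_regular p K" using p_regular_conj[OF kG subgroup.subset[OF K] x(1) yK] .
  moreover have "normalizes ?y (conj_set k S)" using normalizes_conj[OF x(2) xG kG SG(2)] .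
  ultimately have "centralizes ?y (conj_set k S)"
    using loc[OF subgroup_conj_set[OF kG SG(1)] k(2)] by blast
  then have "centralizes (inv k \<otimes> ?y \<otimes> inv (inv k)) (conj_set (inv k) (conj_set k S))"
    using centralizes_conj[of ?y "conj_set k S" "inv k"] kG xG subgroup.subset[OF subgroup_conj_set[OF kG SG(1)]] by simp
  moreover have "inv k \<otimes> ?y \<otimes> inv (inv k) = x" using kG xG by (simp add: group_norm)
  ultimately show ?thesis using conj_set_inv_cancel[OF kG SG(2)] by simp
qed

text \<open>An argument in the manner of Alperin, by induction towards larger intersections D of
  \<open>S\<close> and \<open>T\<close>. The normalizer of D meets both \<open>S\<close> and
  \<open>T\<close> in more than D. Its Sylow subgroups \<open>A\<close> and \<open>B\<close> over
  these intersections lead from \<open>S\<close> to \<open>T\<close> through Sylow subgroups of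
  \<open>K\<close> above \<open>A\<close> and \<open>B\<close>: neighbours share more than D, except
  for the move from \<open>A\<close> to \<open>B\<close>, which takes place in the normalizer. Each
  move can be made by an element that centralizes D.\<close>

lemma sylow_conj_centralizing:
  assumes p: "Factorial_Ring.prime p" and K: "subgroup K G"
    and loc: "\<And>S x. p_subgroup p S \<Longrightarrow> S \<subseteq> K \<Longrightarrow> x \<in> p_regular p K \<Longrightarrow> normalizes x S \<Longrightarrow> centralizes x S"
    and ST: "sylow_in p S K" "sylow_in p T K"
  shows "\<exists>c\<in>K. centralizes c (S \<inter> T) \<and> conj_set c S = T"
  using ST
proof (induction "card K - card (S \<inter> T)" arbitrary: S T rule: less_induct)
  case less
  have SG: "subgroup S G" "S \<subseteq> K" "p_subgroup p S" "S \<subseteq> carrier G"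
    using sylow_inD[OF less.prems(1)] subgroup.subset by auto
  have TG: "subgroup T G" "T \<subseteq> K" "p_subgroup p T" "T \<subseteq> carrier G"
    using sylow_inD[OF less.prems(2)] subgroup.subset by auto
  have KG: "k \<in> carrier G" if "k \<in> K" for k using that mem_subgroup_carrier[OF K] by blast
  let ?D = "S \<inter> T"
  have DG: "subgroup ?D G" using subgroups_Inter_pair[OF SG(1) TG(1)] .
  have D: "p_subgroup p ?D" "?D \<subseteq> K" "?D \<subseteq> carrier G"
    using p_subgroup_subset[OF p SG(3) DG] SG(2) subgroup.subset[OF DG] by auto
  show ?case
  proof (cases "S = T")
    case True
    have "centralizes \<one> ?D" using D(3) by (auto simp: centralizes_def)
    then show ?thesis using True subgroup.one_closed[OF K] conj_set_one[OF SG(4)] by blast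
  next
    case False
    have cST: "card S = card T" using card_sylow_eq[OF p K] less.prems by simp
    have DS: "?D \<subset> S"
    proof -
      have "?D \<noteq> S"
      proof
        assume "?D = S"
        then have "S \<subseteq> T" by blast
        then show False using card_subset_eq[OF finite_subgroup[OF TG(1)]] cST False by blast
      qed
      then show ?thesis by blast
    qed
    have DT: "?D \<subset> T"
    proof -
      have "?D \<noteq> T"
      proof
        assume "?D = T"
        then have "T \<subseteq> S" by blast
        then show False using card_subset_eq[OF finite_subgroup[OF SG(1)], of T] cST False by simp
      qed
      then show ?thesis by blast
    qed
    \<comment> \<open>The induction hypothesis in the form used below: Sylow subgroups that share a
      set strictly above D are conjugate by an element centralizing D.\<close>
    have IH: "\<exists>c\<in>K. centralizes c ?D \<and> conj_set c S' = T'"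
      if st: "sylow_in p S' K" "sylow_in p T' K" "R \<subseteq> S'" "R \<subseteq> T'" "?D \<subset> R" for S' T' R
    proof -
      have I: "subgroup (S' \<inter> T') G"
        using subgroups_Inter_pair sylow_inD(2)[OF st(1)] sylow_inD(2)[OF st(2)] by blast
      have "card ?D < card (S' \<inter> T')"
        using st(3-5) finite_subgroup[OF I] by (intro psubset_card_mono) auto
      moreover have "card (S' \<inter> T') \<le> card K"
        using finite_subgroup[OF K] sylow_inD(3)[OF st(1)] by (intro card_mono) auto
      ultimately have "card K - card (S' \<inter> T') < card K - card ?D" by linarith
      then obtain c where c: "c \<in> K" "centralizes c (S' \<inter> T')" "conj_set c S' = T'"
        using less.hyps st(1,2) by blast
      have "centralizes c ?D" by (rule centralizes_mono[OF c(2)]) (use st(3-5) in blast)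
      then show ?thesis using c by blast
    qed
    define N where "N = {k \<in> K. normalizes k ?D}"
    have N: "subgroup N G" "N \<subseteq> K" unfolding N_def using normalizer_subgroup[OF K DG] by auto
    have cN: "centralizes x ?D" if "x \<in> p_residual p N" for x
    proof (rule p_residual_centralizes[OF N(1) D(3) _ that])
      fix y assume y: "y \<in> p_regular p N"
      then have "normalizes y ?D" using p_regular_subset[of p N] by (auto simp: N_def)
      then show "centralizes y ?D" using loc[OF D(1,2)] p_regular_mono[OF N(2)] y by blast
    qed
    have NS: "subgroup (N \<inter> S) G" "subgroup (N \<inter> T) G"
      using subgroups_Inter_pair N(1) SG(1) TG(1) by auto
    have pNS: "p_subgroup p (N \<inter> S)" "p_subgroup p (N \<inter> T)"
      using p_subgroup_subset[OF p SG(3) NS(1)] p_subgroup_subset[OF p TG(3) NS(2)] by auto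
    have DN: "?D \<subseteq> N" using D(2) normalizes_self[OF DG] by (auto simp: N_def)
    have gS: "?D \<subset> N \<inter> S"
    proof -
      obtain x where "x \<in> S - ?D" "normalizes x ?D" using normalizer_grows[OF p SG(3) DG DS] by blast
      then have "x \<in> N \<inter> S" "x \<notin> ?D" using SG(2) by (auto simp: N_def)
      then show ?thesis using DN by blast
    qed
    have gT: "?D \<subset> N \<inter> T"
    proof -
      obtain x where "x \<in> T - ?D" "normalizes x ?D" using normalizer_grows[OF p TG(3) DG DT] by blast
      then have "x \<in> N \<inter> T" "x \<notin> ?D" using TG(2) by (auto simp: N_def)
      then show ?thesis using DN by blast
    qed
    obtain A where A: "sylow_in p A N" "N \<inter> S \<subseteq> A"
      using sylow_containing[OF p N(1) pNS(1)] by blast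
    obtain B where B: "sylow_in p B N" "N \<inter> T \<subseteq> B"
      using sylow_containing[OF p N(1) pNS(2)] by blast
    have AG: "subgroup A G" "A \<subseteq> K" "p_subgroup p A" "A \<subseteq> carrier G"
      using sylow_inD[OF A(1)] N(2) subgroup.subset[of A G] by auto
    have BG: "subgroup B G" "B \<subseteq> K" "p_subgroup p B" using sylow_inD[OF B(1)] N(2) by auto
    obtain S1 where S1: "sylow_in p S1 K" "A \<subseteq> S1" using sylow_containing[OF p K AG(3,2)] by blast
    obtain T1 where T1: "sylow_in p T1 K" "B \<subseteq> T1" using sylow_containing[OF p K BG(3,2)] by blast
    obtain a where a: "a \<in> K" "centralizes a ?D" "conj_set a S = S1"
      using IH[OF less.prems(1) S1(1) _ _ gS] A(2) S1(2) by blast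
    obtain b where b: "b \<in> K" "centralizes b ?D" "conj_set b T1 = T"
      using IH[OF T1(1) less.prems(2) _ _ gT] B(2) T1(2) by blast
    obtain k where k: "k \<in> N" "conj_set k A = B" using sylow_conj[OF p N(1) A(1) B(1)] by blast
    obtain c u where cu: "c \<in> p_residual p N" "u \<in> A" "k = c \<otimes> u"
      using normalizer_sylow_factor[OF p N(1) A(1) k(1)] .
    have cK: "c \<in> K" using cu(1) p_residual_subset[OF N(1)] N(2) by blast
    have "conj_set u A = A"
      using conj_set_eq[of u A] AG cu(2) normalizes_self[OF AG(1)] by blast
    then have cA: "conj_set c A = B"
      using k(2) conj_set_mult[of c u A] cu(2,3) cK KG AG by auto
    let ?S2 = "conj_set c S1"
    have S2: "sylow_in p ?S2 K" using sylow_conj_set[OF p K S1(1) cK] .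
    have BS2: "B \<subseteq> ?S2" using cA conj_set_mono[OF S1(2)] by blast
    obtain e where e: "e \<in> K" "centralizes e ?D" "conj_set e ?S2 = T1"
      using IH[OF S2 T1(1) _ _ gT] B(2) BS2 T1(2) by blast
    have S1G: "S1 \<subseteq> carrier G" "?S2 \<subseteq> carrier G" "T1 \<subseteq> carrier G"
      using sylow_inD(2)[OF S1(1)] sylow_inD(2)[OF S2] sylow_inD(2)[OF T1(1)] by (simp_all add: subgroup.subset)
    let ?g = "b \<otimes> (e \<otimes> (c \<otimes> a))"
    have CK: "subgroup {k \<in> K. centralizes k ?D} G" using centralizer_subgroup[OF K D(3)] .
    have "?g \<in> {k \<in> K. centralizes k ?D}"
      using a b e cK cN[OF cu(1)] by (intro subgroup.m_closed[OF CK]) auto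
    moreover have "conj_set ?g S = T"
    proof -
      have "conj_set (c \<otimes> a) S = ?S2" using conj_set_mult[of c a S] a KG cK SG(4) by simp
      then have "conj_set (e \<otimes> (c \<otimes> a)) S = T1"
        using conj_set_mult[of e "c \<otimes> a" S] a e KG cK SG(4) by simp
      then show ?thesis
        using conj_set_mult[of b "e \<otimes> (c \<otimes> a)" S] a b e KG cK SG(4) by simp
    qed
    ultimately show ?thesis by blast
  qed
qed

text \<open>If a conjugate of \<open>x\<close> by \<open>k\<close> lies in \<open>P\<close>, it lies
  in two Sylow subgroups, \<open>P\<close> and its conjugate by \<open>k\<close>, and these are
  conjugate by an element that centralizes it. So fusion takes place in the normalizer of
  \<open>P\<close>, which is \<open>P\<close> times a group centralizing \<open>P\<close>. Hence it
  takes place in \<open>P\<close> and is trivial modulo \<Phi>(P).\<close>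

theorem frobenius_p_nilpotent:
  assumes p: "Factorial_Ring.prime p" and K: "subgroup K G" and P: "sylow_in p P K"
    and loc: "\<And>S x. subgroup S G \<Longrightarrow> S \<subseteq> P \<Longrightarrow> x \<in> p_regular p K \<Longrightarrow> normalizes x S \<Longrightarrow> centralizes x S"
  shows "\<not> p dvd card (p_residual p K)"
proof (rule p_nilpotent_if_fusion_frattini[OF p K P])
  have PG: "subgroup P G" "P \<subseteq> K" "p_subgroup p P" "P \<subseteq> carrier G"
    using sylow_inD[OF P] subgroup.subset by auto
  have KG: "k \<in> carrier G" if "k \<in> K" for k using that mem_subgroup_carrier[OF K] by blast
  fix x k assume x: "x \<in> P" "k \<in> K" "k \<otimes> x \<otimes> inv k \<in> P"
  let ?y = "k \<otimes> x \<otimes> inv k"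
  have yc: "?y \<in> conj_set k P" using x by (auto simp: conj_set_def)
  obtain c where c: "c \<in> K" "centralizes c (conj_set k P \<inter> P)" "conj_set c (conj_set k P) = P"
    using sylow_conj_centralizing[OF p K p_regular_transport[OF p K P loc] sylow_conj_set[OF p K P x(2)] P] by blast
  define N where "N = {k \<in> K. normalizes k P}"
  have N: "subgroup N G" "N \<subseteq> K" unfolding N_def using normalizer_subgroup[OF K PG(1)] by auto
  have ckK: "c \<otimes> k \<in> K" using c x subgroup.m_closed[OF K] by blast
  have "conj_set (c \<otimes> k) P = P" using conj_set_mult[of c k P] c x KG PG(4) by simp
  then have ck: "c \<otimes> k \<in> N" using conj_set_subset_iff[of "c \<otimes> k" P] ckK by (simp add: N_def)
  have PN: "P \<subseteq> N" using PG normalizes_self[OF PG(1)] by (auto simp: N_def)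
  have PSN: "sylow_in p P N"
    unfolding sylow_in_def
  proof (intro conjI)
    obtain i where "card N = card P * i" using card_subgroup_dvd[OF PG(1) N(1) PN] by blast
    moreover obtain j where "card K = card N * j" using card_subgroup_dvd[OF N(1) K N(2)] by blast
    ultimately have "card N div card P dvd card K div card P"
      using card_subgroup_pos[OF PG(1)] by (simp add: mult.assoc)
    then show "\<not> p dvd card N div card P" using sylow_inD(4)[OF P] dvd_trans by blast
  qed (use PG PN in auto)
  obtain o' u where ou: "o' \<in> p_residual p N" "u \<in> P" "c \<otimes> k = o' \<otimes> u"
    using normalizer_sylow_factor[OF p N(1) PSN ck] .
  have oc: "centralizes o' P"
  proof (rule p_residual_centralizes[OF N(1) PG(4) _ ou(1)])
    fix y assume y: "y \<in> p_regular p N"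
    then have "normalizes y P" using p_regular_subset[of p N] by (auto simp: N_def)
    then show "centralizes y P" using loc[OF PG(1) subset_refl] p_regular_mono[OF N(2)] y by blast
  qed
  have G: "x \<in> carrier G" "k \<in> carrier G" "c \<in> carrier G" "u \<in> carrier G" "o' \<in> carrier G"
    using x c ou KG PG(4) p_residual_subset[OF N(1), of p] N(2) by auto
  have yG: "?y \<in> carrier G" using G by simp
  have uxu: "u \<otimes> x \<otimes> inv u \<in> P" using x ou PG(1) by (simp add: subgroup.m_closed subgroup.m_inv_closed)
  have "?y = c \<otimes> ?y \<otimes> inv c"
  proof -
    have "conj_set k P \<inter> P \<subseteq> carrier G" using PG(4) by blast
    then have "\<forall>h\<in>conj_set k P \<inter> P. c \<otimes> h \<otimes> inv c = h" using centralizes_iff[OF G(3)] c(2) by blast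
    then show ?thesis using yc x(3) by (metis IntI)
  qed
  also have "\<dots> = (c \<otimes> k) \<otimes> x \<otimes> inv (c \<otimes> k)" using G by (simp add: group_norm)
  also have "\<dots> = o' \<otimes> (u \<otimes> x \<otimes> inv u) \<otimes> inv o'" unfolding ou(3) using G by (simp add: group_norm)
  also have "\<dots> = u \<otimes> x \<otimes> inv u" using centralizes_iff[OF G(5) PG(4)] oc uxu by blast
  finally show "inv x \<otimes> ?y \<in> frattini (G\<lparr>carrier := P\<rparr>)"
    using conj_mult_inv_in_frattini[OF p PG(3) ou(2) x(1)] by simp
qed

section \<open>Burnside's criterion for a cyclic Sylow subgroup\<close>

lemma nat_pow_eq_iff:
  assumes "x \<in> carrier G"
  shows "x [^] (a::nat) = x [^] (b::nat) \<longleftrightarrow> [a = b] (mod ord x)"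
proof -
  have "x [^] int a = x [^] int b \<longleftrightarrow> int (ord x) dvd int b - int a" by (rule int_pow_eq[OF assms])
  then show ?thesis
    by (simp add: int_pow_int cong_iff_dvd_diff dvd_diff_commute flip: cong_int_iff)
qed

text \<open>Powers of \<open>y\<close> of equal order have exponents with the same greatest common
  divisor with \<open>ord y\<close>, so they generate the same subgroup.\<close>

lemma cyclic_same_ord:
  assumes y: "y \<in> carrier G" and ord: "ord (y [^] (i::nat)) = ord (y [^] (j::nat))"
  shows "\<exists>a::nat. y [^] j = (y [^] i) [^] a"
proof -
  have o: "0 < ord y" using ord_ge_1[OF finite_carrier y] by simp
  have g: "ord (y [^] k) = ord y div gcd (ord y) k" for k :: nat
    using ord_pow_gen[OF y, of k] o by (cases "k = 0") simp_all
  have "gcd (ord y) i = gcd (ord y) j"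
  proof -
    have "ord y div gcd (ord y) i = ord y div gcd (ord y) j" using g ord by simp
    then have "ord y div (ord y div gcd (ord y) i) = ord y div (ord y div gcd (ord y) j)" by simp
    then show ?thesis using o by (simp add: div_div_eq_right)
  qed
  then obtain w where w: "j = gcd i (ord y) * w" by (metis dvd_def gcd.commute gcd_dvd1)
  obtain v where "[i * v = gcd i (ord y)] (mod ord y)" using cong_solve_nat by blast
  then have "[i * v * w = j] (mod ord y)" unfolding w by (rule cong_mult) simp
  then have "y [^] (i * (v * w)) = y [^] j" using nat_pow_eq_iff[OF y] by (simp add: mult.assoc)
  then show ?thesis using y by (metis nat_pow_pow)
qed

lemma cong_1_if_coprime_exponents:
  fixes a :: nat
  assumes "[a ^ m = 1] (mod n)" "[a ^ k = 1] (mod n)" "coprime m k" "m \<noteq> 0"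
  shows "[a = 1] (mod n)"
proof -
  obtain x y where xy: "m * x = k * y + 1"
    using bezout_nat[OF assms(4), of k] assms(3) by auto
  have "[a ^ (k * y) * a = 1 * a] (mod n)"
    using cong_pow[OF assms(2), of y] by (intro cong_mult) (simp_all add: power_mult)
  moreover have "[a ^ (m * x) = 1] (mod n)"
    using cong_pow[OF assms(1), of x] by (simp add: power_mult)
  ultimately show ?thesis using xy by (metis cong_sym cong_trans mult_1 power_add power_one_right)
qed

lemma ord_conj:
  assumes "x \<in> carrier G" "s \<in> carrier G"
  shows "ord (x \<otimes> s \<otimes> inv x) = ord s"
proof -
  have "x \<otimes> z \<otimes> inv x = \<one> \<longleftrightarrow> z = \<one>" if "z \<in> carrier G" for z
    using that assms(1) inj_on_conj[OF assms(1) subset_refl] by (metis inj_onD one_closed r_inv r_one)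
  then have "(x \<otimes> s \<otimes> inv x) [^] i = \<one> \<longleftrightarrow> s [^] i = \<one>" for i :: nat
    using assms by (simp add: conj_pow)
  then show ?thesis using assms by (metis dvd_antisym dvd_refl inv_closed m_closed pow_eq_id)
qed

text \<open>An element \<open>x\<close> of order a power of \<open>q\<close> acts on the cyclic
  group of \<open>s\<close> as s \<mapsto> s^a. Modulo the order p^k of \<open>s\<close>, both the
  power of \<open>a\<close> with exponent \<open>q ^ n\<close> and that with exponent
  \<open>totient (ord s)\<close> are 1. As \<open>p\<close> is the smallest prime, q > p divides
  neither p - 1 nor a power of \<open>p\<close>; so the exponents are coprime and \<open>a\<close>
  is 1.\<close>

lemma p_nilpotent_if_cyclic_sylow:
  assumes p: "Factorial_Ring.prime p" and K: "subgroup K G" and P: "sylow_in p P K"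
    and cyc: "y \<in> P" "\<And>z. z \<in> P \<Longrightarrow> \<exists>i::nat. z = y [^] i"
    and small: "\<And>q. Factorial_Ring.prime q \<Longrightarrow> q dvd card K \<Longrightarrow> p \<le> q"
  shows "\<not> p dvd card (p_residual p K)"
proof (rule frobenius_p_nilpotent[OF p K P])
  have PG: "subgroup P G" "P \<subseteq> K" "p_subgroup p P" "P \<subseteq> carrier G"
    using sylow_inD[OF P] subgroup.subset by auto
  fix S x assume S: "subgroup S G" "S \<subseteq> P" and x: "x \<in> p_regular p K" "normalizes x S"
  obtain q n where q: "Factorial_Ring.prime q" "q \<noteq> p" "x [^] (q ^ n :: nat) = \<one>" and xK: "x \<in> K"
    using x(1) unfolding p_regular_def by blast
  have xG: "x \<in> carrier G" using xK mem_subgroup_carrier[OF K] by blast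
  show "centralizes x S"
    unfolding centralizes_iff[OF xG subgroup.subset[OF S(1)]]
  proof
    fix s assume s: "s \<in> S"
    have sP: "s \<in> P" and sG: "s \<in> carrier G" using s S(2) PG(4) by auto
    have yG: "y \<in> carrier G" using cyc PG(4) by auto
    obtain m where m: "s [^] (p ^ m) = \<one>" using p_power_eventually_one[OF PG(3) sP] by blast
    have xsx: "x \<otimes> s \<otimes> inv x \<in> P" using normalizesD[OF x(2) s] S(2) by blast
    have "ord s dvd p ^ m" using m pow_eq_id[OF sG] by blast
    then obtain k where k: "ord s = p ^ k" using divides_primepow_nat[OF p] by blast
    have ordc: "ord (x \<otimes> s \<otimes> inv x) = ord s" by (rule ord_conj[OF xG sG])
    obtain i where i: "s = y [^] (i::nat)" using cyc(2)[OF sP] by blast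
    obtain j where j: "x \<otimes> s \<otimes> inv x = y [^] (j::nat)" using cyc(2)[OF xsx] by blast
    obtain a where a: "x \<otimes> s \<otimes> inv x = s [^] (a::nat)"
      using cyclic_same_ord[OF yG, of i j] ordc unfolding i[symmetric] j[symmetric] by metis
    have it: "x [^] j \<otimes> s \<otimes> inv (x [^] j) = s [^] (a ^ j)" for j :: nat
    proof (induction j)
      case 0
      then show ?case using sG by simp
    next
      case (Suc j)
      have "x [^] Suc j = x \<otimes> x [^] j" using nat_pow_Suc2[OF xG] by simp
      then have "x [^] Suc j \<otimes> s \<otimes> inv (x [^] Suc j) = x \<otimes> (x [^] j \<otimes> s \<otimes> inv (x [^] j)) \<otimes> inv x"
        using xG sG by (simp add: group_norm del: nat_pow_Suc)
      also have "\<dots> = (x \<otimes> s \<otimes> inv x) [^] (a ^ j)" unfolding Suc using conj_pow[OF xG sG] by simp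
      also have "\<dots> = s [^] (a ^ Suc j)" unfolding a using sG by (simp add: nat_pow_pow)
      finally show ?case .
    qed
    have "s [^] (a ^ (q ^ n)) = s [^] (1::nat)" using it[of "q ^ n"] q(3) sG by simp
    then have c1: "[a ^ (q ^ n) = 1] (mod ord s)" using nat_pow_eq_iff[OF sG] by blast
    have "[a = 1] (mod ord s)"
    proof (cases "k = 0 \<or> x = \<one>")
      case True
      then show ?thesis using k a nat_pow_eq_iff[OF sG, of a 1] sG by auto
    next
      case False
      have n0: "q ^ n \<noteq> 0" using prime_gt_0_nat[OF q(1)] by simp
      have "coprime (a ^ (q ^ n)) (ord s)"
        using cong_imp_coprime[OF cong_sym[OF c1]] by simp
      then have "coprime a (ord s)" using n0 by (metis coprime_power_left_iff not_gr_zero)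
      then have c2: "[a ^ totient (ord s) = 1] (mod ord s)" by (rule euler_theorem)
      have "ord x dvd q ^ n" using q(3) pow_eq_id[OF xG] by blast
      moreover have "ord x \<noteq> 1" using False ord_eq_1[OF xG] by simp
      ultimately have "q dvd ord x"
        using divides_primepow_nat[OF q(1)] by (metis dvd_power gr0I power_0)
      moreover have "ord x dvd card K"
      proof -
        have "card (generate G {x}) dvd card K"
          using card_subgroup_dvd[of "generate G {x}" K] K xK xG generate_is_subgroup[of "{x}"]
            generate_subgroup_incl[of "{x}" K] by simp
        then show ?thesis using generate_pow_card[OF xG] by simp
      qed
      ultimately have "p \<le> q" using small[OF q(1)] dvd_trans by blast
      then have "p < q" using q(2) by simp
      then have "\<not> q dvd p - 1" using prime_gt_1_nat[OF p] by (auto dest!: dvd_imp_le)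
      moreover have "\<not> q dvd p ^ (k - 1)"
        using prime_dvd_power_nat[OF q(1)] primes_dvd_imp_eq[OF q(1) p] q(2) by blast
      ultimately have "\<not> q dvd totient (ord s)"
        unfolding k using totient_prime_power[OF p, of k] False prime_dvd_mult_iff[OF q(1)] by simp
      then have "coprime (q ^ n) (totient (ord s))"
        using prime_imp_coprime[OF q(1)] by simp
      then show ?thesis using cong_1_if_coprime_exponents[OF c1 c2 _ n0] by blast
    qed
    then have "s [^] a = s [^] (1::nat)" using nat_pow_eq_iff[OF sG] by blast
    then show "x \<otimes> s \<otimes> inv x = s" using a sG by simp
  qed
qed

section \<open>Coprime action\<close>

lemma commutator_subgroup_is_subgroup:
  assumes "subgroup H G" "subgroup K G"
  shows "subgroup (commutator_subgroup G H K) G"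
  unfolding commutator_subgroup_def
proof (rule generate_is_subgroup)
  show "{h \<otimes> k \<otimes> inv h \<otimes> inv k |h k. h \<in> H \<and> k \<in> K} \<subseteq> carrier G"
    using assms[THEN mem_subgroup_carrier] by auto
qed

lemma commutator_subgroup_mono:
  "K \<subseteq> L \<Longrightarrow> commutator_subgroup G H K \<subseteq> commutator_subgroup G H L"
  unfolding commutator_subgroup_def by (rule mono_generate) blast

lemma commutator_subgroup_normalized:
  assumes H: "subgroup H G" and K: "subgroup K G" and g: "g \<in> K"
  shows "normalizes g (commutator_subgroup G H K)"
proof -
  have C: "subgroup (commutator_subgroup G H K) G" by (rule commutator_subgroup_is_subgroup[OF H K])
  have gG: "g \<in> carrier G" using g mem_subgroup_carrier[OF K] by blast
  show ?thesis
    unfolding commutator_subgroup_def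
  proof (rule generate_normalizes)
    show "{h \<otimes> k \<otimes> inv h \<otimes> inv k |h k. h \<in> H \<and> k \<in> K} \<subseteq> carrier G"
      using H K mem_subgroup_carrier by auto
    fix s assume "s \<in> {h \<otimes> k \<otimes> inv h \<otimes> inv k |h k. h \<in> H \<and> k \<in> K}"
    then obtain h k where hk: "h \<in> H" "k \<in> K" "s = h \<otimes> k \<otimes> inv h \<otimes> inv k" by blast
    have G: "h \<in> carrier G" "k \<in> carrier G" using hk mem_subgroup_carrier H K by auto
    \<comment> \<open>The identity g [h, k] g^-1 = [h, g]^-1 [h, g k] expresses the conjugate of a
      commutator by commutators with the same first entry.\<close>
    have "g \<otimes> s \<otimes> inv g = inv (h \<otimes> g \<otimes> inv h \<otimes> inv g) \<otimes> (h \<otimes> (g \<otimes> k) \<otimes> inv h \<otimes> inv (g \<otimes> k))"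
      unfolding hk(3) using G gG by (simp add: group_norm)
    also have "\<dots> \<in> commutator_subgroup G H K"
      using commutator_subgroup_mem[OF hk(1) g] commutator_subgroup_mem[OF hk(1) subgroup.m_closed[OF K g hk(2)]]
        subgroup.m_closed[OF C] subgroup.m_inv_closed[OF C] by blast
    finally show "g \<otimes> s \<otimes> inv g \<in> generate G {h \<otimes> k \<otimes> inv h \<otimes> inv k |h k. h \<in> H \<and> k \<in> K}"
      unfolding commutator_subgroup_def .
  qed (rule gG)
qed

lemma mult_eq_leftD: "a \<otimes> b = a \<Longrightarrow> a \<in> carrier G \<Longrightarrow> b \<in> carrier G \<Longrightarrow> b = \<one>"
  by simp

text \<open>Each exchange of a \<open>b\<close> with an \<open>a\<close> produces one central
  \<open>z\<close>, and collecting the powers takes n (n - 1) / 2 exchanges. The parity of this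
  number causes the difference between odd \<open>p\<close> and p = 2 below.\<close>

lemma class_two_pow:
  assumes G: "a \<in> carrier G" "b \<in> carrier G" "z \<in> carrier G"
    and z: "z \<otimes> a = a \<otimes> z" "z \<otimes> b = b \<otimes> z" and ba: "b \<otimes> a = a \<otimes> b \<otimes> z"
  shows "b [^] (n::nat) \<otimes> a = a \<otimes> b [^] n \<otimes> z [^] n"
    and "(a \<otimes> b) [^] n = a [^] n \<otimes> b [^] n \<otimes> z [^] (n * (n - 1) div 2)"
proof -
  have zb: "z [^] m \<otimes> b = b \<otimes> z [^] m" "z [^] m \<otimes> a = a \<otimes> z [^] m" for m :: nat
    using G z group_commutes_pow[of z b m] group_commutes_pow[of z a m] by auto
  have c1: "b [^] m \<otimes> a = a \<otimes> b [^] m \<otimes> z [^] m" for m :: nat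
  proof (induction m)
    case (Suc m)
    have "b [^] Suc m \<otimes> a = b [^] m \<otimes> (b \<otimes> a)" using G by (simp add: m_assoc)
    also have "\<dots> = (b [^] m \<otimes> a) \<otimes> b \<otimes> z" unfolding ba using G by (simp add: m_assoc)
    also have "\<dots> = a \<otimes> b [^] m \<otimes> (z [^] m \<otimes> b) \<otimes> z" unfolding Suc using G by (simp add: m_assoc)
    also have "\<dots> = a \<otimes> b [^] Suc m \<otimes> z [^] Suc m" unfolding zb using G by (simp add: m_assoc)
    finally show ?case .
  qed (use G in simp)
  then show "b [^] n \<otimes> a = a \<otimes> b [^] n \<otimes> z [^] n" .
  show "(a \<otimes> b) [^] n = a [^] n \<otimes> b [^] n \<otimes> z [^] (n * (n - 1) div 2)"
  proof (induction n)
    case (Suc n)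
    let ?T = "n * (n - 1) div 2"
    have T: "Suc n * (Suc n - 1) div 2 = n + ?T"
    proof -
      have "Suc n * (Suc n - 1) = 2 * n + n * (n - 1)" by (cases n) (simp_all add: algebra_simps)
      then show ?thesis by simp
    qed
    have "(a \<otimes> b) [^] Suc n = a [^] n \<otimes> b [^] n \<otimes> (z [^] ?T \<otimes> a) \<otimes> b"
      using Suc G by (simp add: m_assoc)
    also have "\<dots> = a [^] n \<otimes> (b [^] n \<otimes> a) \<otimes> (z [^] ?T \<otimes> b)" unfolding zb(2) using G by (simp add: m_assoc)
    also have "\<dots> = a [^] n \<otimes> (a \<otimes> b [^] n \<otimes> z [^] n) \<otimes> (b \<otimes> z [^] ?T)" unfolding zb c1 ..
    also have "\<dots> = a [^] n \<otimes> a \<otimes> b [^] n \<otimes> (z [^] n \<otimes> b) \<otimes> z [^] ?T" using G by (simp add: m_assoc)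
    also have "\<dots> = a [^] Suc n \<otimes> b [^] Suc n \<otimes> (z [^] n \<otimes> z [^] ?T)" unfolding zb using G by (simp add: m_assoc)
    also have "\<dots> = a [^] Suc n \<otimes> b [^] Suc n \<otimes> z [^] (n + ?T)" using G by (simp add: nat_pow_mult)
    finally show ?case unfolding T .
  qed (use G in simp)
qed

end

section \<open>Conjugation by an element whose order is a power of a prime other than
  \<open>p\<close>\<close>

locale coprime_action = finite_group +
  fixes p q n :: nat and x
  assumes p: "Factorial_Ring.prime p" and q: "Factorial_Ring.prime q" "q \<noteq> p"
    and xG: "x \<in> carrier G" and xpow: "x [^] (q ^ n) = \<one>"
begin

text \<open>The commutator of \<open>inv h\<close> with \<open>x\<close>: right multiplication by it
  turns \<open>h\<close> into its conjugate by \<open>x\<close>, and it lies in [H, G] for every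
  subgroup H containing \<open>h\<close>.\<close>

definition drift :: "'a \<Rightarrow> 'a" where
  "drift h = inv h \<otimes> (x \<otimes> h \<otimes> inv x)"

lemma mult_drift: "h \<in> carrier G \<Longrightarrow> x \<otimes> h \<otimes> inv x = h \<otimes> drift h"
  using xG by (simp add: drift_def)

lemma drift_mem: "subgroup H G \<Longrightarrow> normalizes x H \<Longrightarrow> h \<in> H \<Longrightarrow> drift h \<in> H"
  unfolding drift_def using normalizesD subgroup.m_closed subgroup.m_inv_closed by metis

lemma normalizes_if_drift_mem:
  assumes "subgroup H G" "\<And>h. h \<in> H \<Longrightarrow> drift h \<in> H"
  shows "normalizes x H"
  unfolding normalizes_def
proof
  fix h assume h: "h \<in> H"
  then have "x \<otimes> h \<otimes> inv x = h \<otimes> drift h" using mult_drift mem_subgroup_carrier[OF assms(1)] by blast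
  then show "x \<otimes> h \<otimes> inv x \<in> H" using assms h subgroup.m_closed by metis
qed

lemma drift_commutator:
  assumes "subgroup H G" "h \<in> H"
  shows "drift h \<in> commutator_subgroup G H (carrier G)"
proof -
  have hG: "h \<in> carrier G" using assms mem_subgroup_carrier by blast
  have "inv h \<otimes> x \<otimes> inv (inv h) \<otimes> inv x \<in> commutator_subgroup G H (carrier G)"
    using commutator_subgroup_mem[of "inv h" H x "carrier G"] subgroup.m_inv_closed[OF assms] xG by blast
  then show ?thesis using hG xG by (simp add: drift_def m_assoc)
qed

lemma ex_fixed_point:
  assumes "p_subgroup p Y" "normalizes x Y" "h \<in> carrier G" "drift h \<in> Y"
  shows "\<exists>y\<in>Y. x \<otimes> (h \<otimes> y) \<otimes> inv x = h \<otimes> y"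
  using coset_fixed_point[OF q(1) p q(2) xG xpow assms(1-3)] assms(4) by (simp add: drift_def)

lemma centralizes_iff_fixed: "H \<subseteq> carrier G \<Longrightarrow> centralizes x H \<longleftrightarrow> (\<forall>h\<in>H. x \<otimes> h \<otimes> inv x = h)"
  using centralizes_iff[OF xG] .

definition fixed :: "'a set \<Rightarrow> 'a set" where
  "fixed H = {h \<in> H. x \<otimes> h \<otimes> inv x = h}"

lemma fixed_subset: "fixed H \<subseteq> H"
  by (auto simp: fixed_def)

lemma fixed_subgroup:
  assumes "subgroup H G"
  shows "subgroup (fixed H) G"
proof (rule finite_subgroupI)
  interpret H: subgroup H G by fact
  show "fixed H \<subseteq> carrier G" by (auto simp: fixed_def)
  have "\<one> \<in> fixed H" using xG by (simp add: fixed_def)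
  then show "fixed H \<noteq> {}" by blast
  fix a b assume ab: "a \<in> fixed H" "b \<in> fixed H"
  have "x \<otimes> (a \<otimes> b) \<otimes> inv x = (x \<otimes> a \<otimes> inv x) \<otimes> (x \<otimes> b \<otimes> inv x)"
    using mem_subgroup_carrier[OF assms] ab fixed_subset xG by (simp add: group_norm subset_iff)
  then show "a \<otimes> b \<in> fixed H" using ab by (simp add: fixed_def)
qed

text \<open>Coprime action that is trivial modulo \<Phi>(H) is trivial: each coset of \<Phi>(H)
  contains a fixed point, so the fixed points together with \<Phi>(H) cover \<open>H\<close>, and
  nongenerators can be omitted.\<close>

lemma centralizes_if_drift_frattini:
  assumes H: "p_subgroup p H" and d: "\<And>h. h \<in> H \<Longrightarrow> drift h \<in> frattini (G\<lparr>carrier := H\<rparr>)"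
  shows "centralizes x H"
proof -
  have HG: "subgroup H G" using H p_subgroupD by blast
  interpret H: subgroup H G by (rule HG)
  let ?F = "frattini (G\<lparr>carrier := H\<rparr>)"
  have F: "subgroup ?F G" "?F \<subseteq> H" using frattini_subgroup[OF HG] frattini_subset by auto
  have xH: "normalizes x H" by (rule normalizes_if_drift_mem[OF HG]) (use d F(2) in blast)
  have "fixed H = H"
  proof (rule frattini_nongenerators[OF HG fixed_subgroup[OF HG] fixed_subset])
    fix h assume h: "h \<in> H"
    obtain y where y: "y \<in> ?F" "x \<otimes> (h \<otimes> y) \<otimes> inv x = h \<otimes> y"
      using ex_fixed_point[OF p_subgroup_subset[OF p H F] frattini_normalizes[OF p H xG xH] H.mem_carrier[OF h] d[OF h]]
      by (elim bexE)
    have yH: "y \<in> H" using F(2) y(1) by (rule subsetD)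
    have fx: "h \<otimes> y \<in> fixed H" 
      unfolding fixed_def using H.m_closed[OF h yH] y(2) by (intro CollectI conjI)
    have "inv (h \<otimes> y) \<otimes> h = inv y" using H.mem_carrier[OF h] H.mem_carrier[OF yH] by (simp add: group_norm)
    then have "inv (h \<otimes> y) \<otimes> h \<in> ?F" using subgroup.m_inv_closed[OF F(1) y(1)] by (simp only:)
    then show "\<exists>c\<in>fixed H. inv c \<otimes> h \<in> ?F" using fx by (rule bexI)
  qed
  then have "\<forall>h\<in>H. x \<otimes> h \<otimes> inv x = h" unfolding fixed_def by blast
  then show ?thesis using centralizes_iff_fixed[OF H.subset] by blast
qed

text \<open>The coset of \<open>h\<close> modulo \<open>Y\<close> contains a fixed point h y, and
  since \<open>x\<close> fixes \<open>y\<close> it also fixes \<open>h\<close>. This replaces the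
  identity [H, x, x] = [H, x] of coprime action.\<close>

lemma centralizes_if_drift_centralized:
  assumes Y: "p_subgroup p Y" "centralizes x Y" and H: "H \<subseteq> carrier G"
    and d: "\<And>h. h \<in> H \<Longrightarrow> drift h \<in> Y"
  shows "centralizes x H"
  unfolding centralizes_iff_fixed[OF H]
proof
  fix h assume h: "h \<in> H"
  have YG: "Y \<subseteq> carrier G" using Y p_subgroupD subgroup.subset by blast
  have fY: "x \<otimes> y \<otimes> inv x = y" if "y \<in> Y" for y using Y(2) that centralizes_iff_fixed[OF YG] by blast
  then have nY: "normalizes x Y" by (simp add: normalizes_def)
  obtain y where y: "y \<in> Y" "x \<otimes> (h \<otimes> y) \<otimes> inv x = h \<otimes> y"
    using ex_fixed_point[OF Y(1) nY subsetD[OF H h] d[OF h]] by (elim bexE)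
  have G: "h \<in> carrier G" "y \<in> carrier G" using h H y YG by auto
  have "x \<otimes> (h \<otimes> y) \<otimes> inv x = (x \<otimes> h \<otimes> inv x) \<otimes> (x \<otimes> y \<otimes> inv x)"
    using G xG by (simp add: group_norm)
  then have "(x \<otimes> h \<otimes> inv x) \<otimes> y = h \<otimes> y" using y fY by simp
  then show "x \<otimes> h \<otimes> inv x = h" using G xG by simp
qed

text \<open>On an invariant subgroup the commutators with \<open>x\<close> lie in H \<inter> [H, G],
  hence in \<Phi>(H).\<close>

lemma IC_Phi_centralizes:
  assumes "IC_Phi_subgroup H G" "p_subgroup p H" "normalizes x H"
  shows "centralizes x H"
proof (rule centralizes_if_drift_frattini[OF assms(2)])
  fix h assume h: "h \<in> H"
  have HG: "subgroup H G" using assms p_subgroupD by blast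
  have "drift h \<in> H \<inter> commutator_subgroup G H (carrier G)"
    using drift_mem[OF HG assms(3) h] drift_commutator[OF HG h] by blast
  then show "drift h \<in> frattini (G\<lparr>carrier := H\<rparr>)" using assms(1) unfolding IC_Phi_subgroup_def by blast
qed

lemma commutator_carrier:
  assumes "subgroup U G"
  shows "subgroup (commutator_subgroup G U (carrier G)) G"
    "\<And>g. g \<in> carrier G \<Longrightarrow> normalizes g (commutator_subgroup G U (carrier G))"
  using commutator_subgroup_is_subgroup[OF assms subgroup_self]
    commutator_subgroup_normalized[OF assms subgroup_self] by auto

end

text \<open>A smallest invariant \<open>p\<close>-group on which \<open>x\<close> acts nontrivially.
  The subgroup \<open>C\<close> of its fixed points contains every proper invariant subgroup, in
  particular \<Phi>(R), and turns out to be central; so \<open>R\<close> has class at most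
  two.\<close>

locale minimal_coprime_action = coprime_action +
  fixes R
  assumes R: "p_subgroup p R" "normalizes x R" "\<not> centralizes x R"
    and minimal: "\<And>S. subgroup S G \<Longrightarrow> S \<subset> R \<Longrightarrow> normalizes x S \<Longrightarrow> centralizes x S"
begin

lemma RG: "subgroup R G" using R(1) p_subgroupD by blast

sublocale R: subgroup R G by (rule RG)

abbreviation "C \<equiv> fixed R"

lemma C_subgroup: "subgroup C G" using fixed_subgroup[OF RG] .

lemma C_ne: "C \<noteq> R"
  using R(3) centralizes_iff_fixed[OF R.subset] by (auto simp: fixed_def)

lemma R_ne: "R \<noteq> {\<one>}"
proof
  assume "R = {\<one>}"
  then show False using R(3) xG by (simp add: centralizes_def)
qed

lemma proper_invariant_in_C:
  assumes "subgroup S G" "S \<subset> R" "normalizes x S"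
  shows "S \<subseteq> C"
proof -
  have "S \<subseteq> carrier G" using assms subgroup.subset by blast
  then show ?thesis
    using minimal[OF assms] assms(2) centralizes_iff_fixed[of S] by (auto simp: fixed_def)
qed

text \<open>A proper subgroup that contains all commutators with \<open>x\<close> would be
  invariant, hence centralized by \<open>x\<close>; by coprimality \<open>x\<close> would then
  centralize \<open>R\<close>.\<close>

lemma generated_by_drift:
  assumes "subgroup S G" "S \<subseteq> R" "\<And>r. r \<in> R \<Longrightarrow> drift r \<in> S"
  shows "S = R"
proof (rule ccontr)
  assume "S \<noteq> R"
  have "normalizes x S" by (rule normalizes_if_drift_mem[OF assms(1)]) (use assms in blast)
  then have "centralizes x S" using minimal assms \<open>S \<noteq> R\<close> by blast
  then have "centralizes x R"
    using centralizes_if_drift_centralized[OF p_subgroup_subset[OF p R(1) assms(1,2)] _ R.subset assms(3)] by blast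
  then show False using R(3) by blast
qed

lemma frattini_in_C: "frattini (G\<lparr>carrier := R\<rparr>) \<subseteq> C"
  by (rule proper_invariant_in_C[OF frattini_subgroup[OF RG] _ frattini_normalizes[OF p R(1) xG R(2)]])
    (use frattini_proper[OF RG R_ne] frattini_subset in blast)

lemma pow_p_in_C: "r \<in> R \<Longrightarrow> r [^] p \<in> C"
  using pow_p_in_frattini[OF p R(1)] frattini_in_C by blast

lemma comm_in_C:
  assumes "a \<in> R" "b \<in> R"
  shows "inv a \<otimes> (b \<otimes> a \<otimes> inv b) \<in> C"
  using conj_mult_inv_in_frattini[OF p R(1) assms(2,1)] frattini_in_C by blast

lemma C_fixed: "c \<in> C \<Longrightarrow> x \<otimes> c \<otimes> inv x = c" by (simp add: fixed_def)

lemma C_in_R: "c \<in> C \<Longrightarrow> c \<in> R" by (simp add: fixed_def)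

lemma drift_in_R: "r \<in> R \<Longrightarrow> drift r \<in> R"
  using drift_mem[OF RG R(2)] .

text \<open>The commutator of \<open>c\<close> with \<open>s\<close> lies in \<open>C\<close>.
  Conjugation by \<open>x\<close> fixes it and also \<open>c\<close>, so \<open>s\<close> and
  \<open>s \<otimes> drift s\<close> have the same commutator with \<open>c\<close>. Hence
  \<open>c\<close> commutes with every drift, and the drifts generate \<open>R\<close>.\<close>

lemma C_central:
  assumes c: "c \<in> C" and r: "r \<in> R"
  shows "c \<otimes> r = r \<otimes> c"
proof -
  have cR: "c \<in> R" and cf: "x \<otimes> c \<otimes> inv x = c" using c by (auto simp: fixed_def)
  let ?S = "{k \<in> R. centralizes k {c}}"
  have S: "subgroup ?S G" using centralizer_subgroup[OF RG, of "{c}"] cR by simp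
  have "?S = R"
  proof (rule generated_by_drift[OF S])
    fix s assume s: "s \<in> R"
    let ?k = "drift s"
    have kR: "?k \<in> R" using drift_in_R[OF s] .
    let ?w = "\<lambda>s. c \<otimes> s \<otimes> inv c \<otimes> inv s"
    have wC: "?w s \<in> C"
    proof -
      have "inv (inv s) \<otimes> (c \<otimes> inv s \<otimes> inv c) \<in> C" using comm_in_C[of "inv s" c] s cR by simp
      then have "inv (inv (inv s) \<otimes> (c \<otimes> inv s \<otimes> inv c)) \<in> C" by (rule subgroup.m_inv_closed[OF C_subgroup])
      then show ?thesis using s cR by (simp add: group_norm)
    qed
    have "?w s = x \<otimes> ?w s \<otimes> inv x" using C_fixed[OF wC] by simp
    also have "\<dots> = (x \<otimes> c \<otimes> inv x) \<otimes> (x \<otimes> s \<otimes> inv x) \<otimes> inv (x \<otimes> c \<otimes> inv x) \<otimes> inv (x \<otimes> s \<otimes> inv x)"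
      using s cR xG by (simp add: group_norm)
    also have "\<dots> = ?w (s \<otimes> ?k)" unfolding cf using mult_drift[of s] s by simp
    also have "\<dots> = ?w s \<otimes> (s \<otimes> ?w ?k \<otimes> inv s)" using s kR cR by (simp add: group_norm)
    finally have "s \<otimes> ?w ?k \<otimes> inv s = \<one>" using s kR cR by simp
    then have "inv s \<otimes> (s \<otimes> ?w ?k \<otimes> inv s) \<otimes> s = \<one>" using s by simp
    then have "?w ?k = \<one>" using s kR cR by (simp add: group_norm)
    then have "?w ?k \<otimes> (?k \<otimes> c) = ?k \<otimes> c" using kR cR by simp
    then have "c \<otimes> ?k = ?k \<otimes> c" using kR cR by (simp add: group_norm)
    then show "?k \<in> ?S" using kR by (simp add: centralizes_def)
  qed blast
  then have "r \<in> ?S" using r by blast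
  then show ?thesis by (simp add: centralizes_def)
qed

text \<open>The commutator \<open>z\<close> has order dividing \<open>p\<close> because
  \<open>b [^] p\<close> lies in \<open>C\<close> and is therefore central.\<close>

lemma class_two:
  assumes a: "a \<in> R" and b: "b \<in> R"
  obtains z where "z \<in> C" "b \<otimes> a = a \<otimes> b \<otimes> z" "z [^] p = \<one>"
    "\<And>m::nat. (a \<otimes> b) [^] m = a [^] m \<otimes> b [^] m \<otimes> z [^] (m * (m - 1) div 2)"
proof -
  let ?z = "inv a \<otimes> (b \<otimes> a \<otimes> inv b)"
  have z: "?z \<in> C" using comm_in_C[OF a b] .
  then have zR: "?z \<in> R" using C_in_R by blast
  have ba: "b \<otimes> a = a \<otimes> b \<otimes> ?z"
  proof -
    have "a \<otimes> b \<otimes> ?z = a \<otimes> (?z \<otimes> b)" using C_central[OF z b] a b zR by (simp add: m_assoc)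
    also have "\<dots> = b \<otimes> a" using a b by (simp add: m_assoc)
    finally show ?thesis by simp
  qed
  note ct = class_two_pow[OF R.mem_carrier[OF a] R.mem_carrier[OF b] R.mem_carrier[OF zR] C_central[OF z a] C_central[OF z b] ba]
  have bp: "b [^] p \<in> R" using nat_pow_mem[OF RG b] .
  have "a \<otimes> b [^] p \<otimes> ?z [^] p = a \<otimes> b [^] p"
    using ct(1)[of p] C_central[OF pow_p_in_C[OF b] a] by simp
  then have "?z [^] p = \<one>"
    by (rule mult_eq_leftD) (use a bp nat_pow_mem[OF RG zR, of p] in simp_all)
  then show thesis using that[OF z ba _ ct(2)] by blast
qed

text \<open>If r^m lies in \<open>C\<close>, then \<open>r\<close> and its conjugate
  \<open>r \<otimes> drift r\<close> have the same \<open>m\<close>-th power. Expanding in class two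
  leaves only the \<open>m\<close>-th power of the drift, provided that \<open>p\<close> divides m
  (m - 1) / 2. This holds for m = p if \<open>p\<close> is odd; for p = 2 it fails at m = 2 and
  holds at m = 4.\<close>

lemma drift_pow:
  assumes r: "r \<in> R"
  shows "p \<noteq> 2 \<Longrightarrow> drift r [^] p = \<one>" and "p = 2 \<Longrightarrow> drift r [^] (4::nat) = \<one>"
proof -
  let ?h = "drift r"
  have h: "?h \<in> R" using drift_in_R[OF r] .
  have e: "r \<otimes> ?h = x \<otimes> r \<otimes> inv x" using mult_drift[of r] r by simp
  obtain z where z: "z \<in> C" "z [^] p = \<one>"
    "\<And>m::nat. (r \<otimes> ?h) [^] m = r [^] m \<otimes> ?h [^] m \<otimes> z [^] (m * (m - 1) div 2)"
    using class_two[OF r h] by metis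
  have zR: "z \<in> R" using z C_in_R by blast
  have main: "?h [^] m = \<one>" if m: "r [^] m \<in> C" "p dvd m * (m - 1) div 2" for m :: nat
  proof -
    have "(r \<otimes> ?h) [^] m = r [^] m" unfolding e using conj_pow[OF xG, of r m] r C_fixed[OF m(1)] by simp
    moreover have "z [^] (m * (m - 1) div 2) = \<one>"
      using m(2) z(2) zR by (metis dvd_def nat_pow_one nat_pow_pow R.mem_carrier)
    ultimately have "r [^] m \<otimes> ?h [^] m = r [^] m" using z(3)[of m] r h by simp
    then show ?thesis by (rule mult_eq_leftD) (use r h in simp_all)
  qed
  show "?h [^] p = \<one>" if "p \<noteq> 2"
  proof (rule main[OF pow_p_in_C[OF r]])
    have "even (p - 1)" using p \<open>p \<noteq> 2\<close> by (metis even_diff_nat odd_one prime_ge_2_nat prime_odd_nat le_neq_implies_less even_Suc One_nat_def Suc_pred odd_pos)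
    then show "p dvd p * (p - 1) div 2" by (metis div_mult_swap dvd_triv_left)
  qed
  show "?h [^] (4::nat) = \<one>" if p2: "p = 2"
  proof (rule main)
    have "r [^] (4::nat) = (r [^] p) [^] (2::nat)" using p2 r by (simp add: nat_pow_pow)
    then show "r [^] (4::nat) \<in> C" using nat_pow_mem[OF C_subgroup pow_p_in_C[OF r]] by metis
  qed (use p2 in simp)
qed

lemma ex_drift_not_in_C: "\<exists>r\<in>R. drift r \<notin> C"
  using generated_by_drift[OF C_subgroup fixed_subset] C_ne by blast

text \<open>If the drift of \<open>u\<close> were fixed by \<open>x\<close>, then conjugating
  \<open>u\<close> by the \<open>i\<close>-th power of \<open>x\<close> would multiply it by the
  \<open>i\<close>-th power of the drift. At i = \<open>q ^ n\<close> this shows that the drift, a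
  \<open>p\<close>-element, has order dividing a power of \<open>q\<close>; so it would be trivial
  and \<open>u\<close> fixed.\<close>

lemma drift_not_in_C:
  assumes u: "u \<in> R" "u \<notin> C"
  shows "drift u \<notin> C"
proof
  assume h: "drift u \<in> C"
  let ?h = "drift u"
  have hR: "?h \<in> R" using h C_in_R by blast
  have "x [^] i \<otimes> u \<otimes> inv (x [^] i) = u \<otimes> ?h [^] i" for i :: nat
  proof (induction i)
    case (Suc i)
    have "x [^] Suc i = x \<otimes> x [^] i" using nat_pow_Suc2[OF xG] by simp
    then have "x [^] Suc i \<otimes> u \<otimes> inv (x [^] Suc i) = x \<otimes> (x [^] i \<otimes> u \<otimes> inv (x [^] i)) \<otimes> inv x"
      using xG u by (simp add: group_norm del: nat_pow_Suc)
    also have "\<dots> = (x \<otimes> u \<otimes> inv x) \<otimes> (x \<otimes> ?h [^] i \<otimes> inv x)"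
      unfolding Suc using xG u hR by (simp add: group_norm)
    also have "x \<otimes> ?h [^] i \<otimes> inv x = ?h [^] i" using C_fixed nat_pow_mem[OF C_subgroup h] by blast
    also have "x \<otimes> u \<otimes> inv x = u \<otimes> ?h" using mult_drift u by simp
    finally show ?case using nat_pow_Suc2[of ?h i] u hR by (simp add: m_assoc)
  qed (use u in simp)
  from this[of "q ^ n"] have "u \<otimes> ?h [^] (q ^ n) = u" using xpow u by simp
  then have "?h [^] (q ^ n) = \<one>" by (rule mult_eq_leftD) (use u hR in simp_all)
  then have "ord ?h dvd q ^ n" using pow_eq_id hR by simp
  moreover obtain m where "?h [^] (p ^ m) = \<one>" using p_power_eventually_one[OF R(1) hR] by blast
  then have "ord ?h dvd p ^ m" using pow_eq_id hR by simp
  moreover have "coprime (q ^ n) (p ^ m)" using primes_coprime[OF q(1) p q(2)] by simp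
  ultimately have "ord ?h = 1" by (metis coprime_common_divisor_nat is_unit_gcd dvd_1_iff_1 nat_dvd_1_iff_1 coprime_def)
  then have "?h = \<one>" using ord_eq_1 hR by simp
  then have "x \<otimes> u \<otimes> inv x = u" using mult_drift[of u] u by simp
  then show False using u by (simp add: fixed_def)
qed

text \<open>\<open>U\<close> need not be invariant, but the intersection of [U, G] with
  \<open>R\<close> is. If \<open>U\<close> contained an element outside \<open>C\<close>, this
  intersection would also do so and be all of \<open>R\<close>; then U \<le> [U, G], and IC\<Phi>
  would give U = \<Phi>(U).\<close>

lemma IC_Phi_in_C:
  assumes U: "IC_Phi_subgroup U G" "U \<subseteq> R"
  shows "U \<subseteq> C"
proof (rule ccontr)
  assume "\<not> U \<subseteq> C"
  then obtain u where u: "u \<in> U" "u \<notin> C" by blast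
  have UG: "subgroup U G" using U by (simp add: IC_Phi_subgroup_def)
  let ?W = "commutator_subgroup G U (carrier G) \<inter> R"
  have W: "subgroup ?W G" using subgroups_Inter_pair[OF commutator_carrier(1)[OF UG] RG] .
  have nW: "normalizes x ?W" using normalizes_Int[OF commutator_carrier(2)[OF UG xG] R(2)] .
  have "drift u \<in> ?W" using drift_commutator[OF UG u(1)] drift_in_R u U(2) by blast
  moreover have "drift u \<notin> C" using drift_not_in_C u U(2) by blast
  ultimately have "\<not> ?W \<subset> R" using proper_invariant_in_C[OF W _ nW] by blast
  then have "U \<subseteq> commutator_subgroup G U (carrier G)" using U(2) by blast
  then have "U \<subseteq> frattini (G\<lparr>carrier := U\<rparr>)" using U(1) by (auto simp: IC_Phi_subgroup_def)
  then have "frattini (G\<lparr>carrier := U\<rparr>) = U" using frattini_subset by blast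
  moreover have "U \<noteq> {\<one>}" using u subgroup.one_closed[OF C_subgroup] by blast
  ultimately show False using frattini_proper[OF UG] by blast
qed

end

section \<open>Quaternion sections\<close>

context finite_group
begin

lemma mult_eq_rightD: "a \<otimes> b = b \<Longrightarrow> a \<in> carrier G \<Longrightarrow> b \<in> carrier G \<Longrightarrow> a = \<one>"
  by simp

text \<open>In \<open>Q8\<close> moving past y subtracts the exponent c, while natural powers of
  \<open>u\<close> use 3 c instead; the two differ by the multiple 4 c.\<close>

lemma nat_mod_4_eq:
  fixes e :: int
  assumes "e = int k - 4 * int j"
  shows "nat (e mod 4) mod 4 = k mod 4"
proof -
  have "e = int k + (- int j) * 4" using assms by simp
  then have "e mod 4 = (int k + (- int j) * 4) mod 4" by (rule arg_cong)
  also have "\<dots> = int k mod 4" by (rule mod_mult_self1)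
  also have "\<dots> = int (k mod 4)" by (simp add: zmod_int)
  finally show ?thesis by simp
qed

text \<open>The pair (a, b) goes to u^a v^b modulo the central subgroup \<open>M\<close>. The
  hypotheses \<open>v2\<close> and \<open>vu\<close> are the relations of \<open>Q8\<close> modulo
  \<open>M\<close>, with the inverse of \<open>u\<close> written as its cube; \<open>u2\<close>
  keeps the quotient from collapsing.\<close>

lemma Q8_section_iso:
  assumes RG: "subgroup R G" and M: "subgroup M G" "M \<subseteq> R" and central: "\<And>m r. m \<in> M \<Longrightarrow> r \<in> R \<Longrightarrow> m \<otimes> r = r \<otimes> m"
    and uv: "u \<in> R" "v \<in> R" and four: "u [^] (4::nat) = \<one>"
    and u2: "u \<otimes> u \<notin> M" and v2: "\<exists>m\<in>M. v \<otimes> v = m \<otimes> (u \<otimes> u)"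
    and vu: "\<exists>m\<in>M. v \<otimes> u = m \<otimes> (u \<otimes> u \<otimes> u \<otimes> v)"
  shows "\<exists>A. subgroup A G \<and> A \<subseteq> R \<and> M \<lhd> G\<lparr>carrier := A\<rparr> \<and> (G\<lparr>carrier := A\<rparr>) Mod M \<cong> Q8"
proof -
  interpret R: subgroup R G by (rule RG)
  interpret M: subgroup M G by (rule M)
  define eq where "eq a b \<longleftrightarrow> a \<in> R \<and> b \<in> R \<and> (\<exists>m\<in>M. a = m \<otimes> b)" for a b
  have eqR: "a \<in> R" "b \<in> R" if "eq a b" for a b using that by (auto simp: eq_def)
  have eq_refl: "eq a a" if "a \<in> R" for a
    using that M.one_closed unfolding eq_def by (metis R.mem_carrier l_one)
  have eq_trans: "eq a c" if ab: "eq a b" and bc: "eq b c" for a b c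
  proof -
    obtain m k where "m \<in> M" "a = m \<otimes> b" "k \<in> M" "b = k \<otimes> c" using ab bc unfolding eq_def by blast
    then have "a = (m \<otimes> k) \<otimes> c" "m \<otimes> k \<in> M" using eqR[OF bc] by (simp_all add: m_assoc)
    then show ?thesis using eqR[OF ab] eqR[OF bc] unfolding eq_def by blast
  qed
  have eq_mult: "eq (a \<otimes> c) (b \<otimes> d)" if ab: "eq a b" and cd: "eq c d" for a b c d
  proof -
    obtain m k where mk: "m \<in> M" "a = m \<otimes> b" "k \<in> M" "c = k \<otimes> d" using ab cd unfolding eq_def by blast
    note R4 = eqR[OF ab] eqR[OF cd]
    have "a \<otimes> c = m \<otimes> ((b \<otimes> k) \<otimes> d)" unfolding mk(2,4) using mk(1,3) R4 by (simp add: m_assoc)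
    also have "b \<otimes> k = k \<otimes> b" using central[OF mk(3) R4(2)] by simp
    finally have "a \<otimes> c = (m \<otimes> k) \<otimes> (b \<otimes> d)" using mk(1,3) R4 by (simp add: m_assoc)
    then show ?thesis using R4 mk(1,3) unfolding eq_def by blast
  qed
  have pR: "u [^] (i::nat) \<in> R" "v [^] (i::nat) \<in> R" for i using nat_pow_mem[OF RG] uv by auto
  have red: "u [^] (i::nat) = u [^] (i mod 4)" for i
  proof -
    have "u [^] (4 * (i div 4) + i mod 4) = (u [^] (4::nat)) [^] (i div 4) \<otimes> u [^] (i mod 4)"
      using uv by (simp add: nat_pow_mult nat_pow_pow)
    then show ?thesis using four uv by simp
  qed
  have u_cong: "u [^] i = u [^] j" if "i mod 4 = j mod 4" for i j :: nat
    using red[of i] red[of j] that by simp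
  have vv: "eq (v \<otimes> v) (u [^] (2::nat))"
    unfolding eq_def using v2 uv pR by (simp add: numeral_2_eq_2)
  have vu': "eq (v \<otimes> u) (u [^] (3::nat) \<otimes> v)"
    unfolding eq_def using vu uv pR by (simp add: numeral_3_eq_3)
  have vpow: "eq (v \<otimes> u [^] (c::nat)) (u [^] (3 * c) \<otimes> v)" for c
  proof (induction c)
    case 0
    then show ?case using uv eq_refl by simp
  next
    case (Suc c)
    have e1: "eq ((v \<otimes> u [^] c) \<otimes> u) ((u [^] (3 * c) \<otimes> v) \<otimes> u)"
      by (rule eq_mult[OF Suc eq_refl[OF uv(1)]])
    have e2: "eq (u [^] (3 * c) \<otimes> (v \<otimes> u)) (u [^] (3 * c) \<otimes> (u [^] (3::nat) \<otimes> v))"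
      by (rule eq_mult[OF eq_refl[OF pR(1)] vu'])
    have e3: "u [^] (3 * c) \<otimes> (u [^] (3::nat) \<otimes> v) = u [^] (3 * Suc c) \<otimes> v"
      using uv pR by (simp add: nat_pow_mult add.commute flip: m_assoc)
    have e4: "(v \<otimes> u [^] c) \<otimes> u = v \<otimes> u [^] Suc c" "(u [^] (3 * c) \<otimes> v) \<otimes> u = u [^] (3 * c) \<otimes> (v \<otimes> u)"
      using uv pR by (simp_all add: m_assoc)
    show ?case using eq_trans[OF e1[unfolded e4] e2] unfolding e3 .
  qed
  define f where "f k = u [^] nat (fst k) \<otimes> v [^] nat (snd k)" for k :: "int \<times> int"
  have fR: "f k \<in> R" for k using pR by (simp add: f_def)
  have carrier: "k \<in> carrier Q8 \<longleftrightarrow> 0 \<le> fst k \<and> fst k < 4 \<and> (snd k = 0 \<or> snd k = 1)" for k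
    by (cases k) (auto simp: Q8_def)
  have fm: "eq (f k \<otimes> f l) (f (k \<otimes>\<^bsub>Q8\<^esub> l))" if kl: "k \<in> carrier Q8" "l \<in> carrier Q8" for k l
  proof -
    obtain a b c d where abcd: "k = (a, b)" "l = (c, d)" by (metis surj_pair)
    have rng: "0 \<le> a" "a < 4" "b = 0 \<or> b = 1" "0 \<le> c" "c < 4" "d = 0 \<or> d = 1"
      using kl carrier by (auto simp: abcd)
    have m: "k \<otimes>\<^bsub>Q8\<^esub> l = ((a + (if b = 0 then c else - c) + 2 * b * d) mod 4, (b + d) mod 2)"
      by (simp add: abcd Q8_def)
    have fk: "f k = u [^] nat a \<otimes> v [^] nat b" and fl: "f l = u [^] nat c \<otimes> v [^] nat d"
      by (simp_all add: f_def abcd)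
    have fkl: "f (k \<otimes>\<^bsub>Q8\<^esub> l) =
        u [^] nat ((a + (if b = 0 then c else - c) + 2 * b * d) mod 4) \<otimes> v [^] nat ((b + d) mod 2)"
      unfolding m f_def by simp
    show ?thesis
    proof (cases "b = 0")
      case True
      have "nat ((a + c) mod 4) mod 4 = (nat a + nat c) mod 4"
        using rng by (simp add: nat_mod_distrib nat_add_distrib)
      then have "u [^] nat ((a + c) mod 4) = u [^] (nat a + nat c)" by (rule u_cong)
      moreover have "(b + d) mod 2 = d" using True rng by auto
      ultimately have "f (k \<otimes>\<^bsub>Q8\<^esub> l) = u [^] (nat a + nat c) \<otimes> v [^] nat d"
        unfolding fkl using True by simp
      moreover have "f k \<otimes> f l = u [^] (nat a + nat c) \<otimes> v [^] nat d"
        unfolding fk fl using True pR uv by (simp add: nat_pow_mult flip: m_assoc)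
      ultimately have "f k \<otimes> f l = f (k \<otimes>\<^bsub>Q8\<^esub> l)" by simp
      then show ?thesis using eq_refl fR R.m_closed by metis
    next
      case False
      then have b: "b = 1" using rng by simp
      have e1: "eq (u [^] nat a \<otimes> (v \<otimes> u [^] nat c) \<otimes> v [^] nat d) (u [^] nat a \<otimes> (u [^] (3 * nat c) \<otimes> v) \<otimes> v [^] nat d)"
        by (intro eq_mult eq_refl vpow pR)
      have l: "f k \<otimes> f l = u [^] nat a \<otimes> (v \<otimes> u [^] nat c) \<otimes> v [^] nat d"
        unfolding fk fl using b pR uv by (simp add: m_assoc)
      have r: "u [^] nat a \<otimes> (u [^] (3 * nat c) \<otimes> v) \<otimes> v [^] nat d = u [^] (nat a + 3 * nat c) \<otimes> (v \<otimes> v [^] nat d)"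
        using pR uv by (simp add: m_assoc flip: nat_pow_mult)
      show ?thesis
      proof (cases "d = 0")
        case True
        have "nat ((a - c) mod 4) mod 4 = (nat a + 3 * nat c) mod 4"
          by (rule nat_mod_4_eq[where j = "nat c"]) (use rng in simp)
        then have "u [^] nat ((a - c) mod 4) = u [^] (nat a + 3 * nat c)" by (rule u_cong)
        then have "f (k \<otimes>\<^bsub>Q8\<^esub> l) = u [^] (nat a + 3 * nat c) \<otimes> (v \<otimes> v [^] nat d)"
          unfolding fkl using True b uv by simp
        then show ?thesis using e1 l r by simp
      next
        case False
        then have d: "d = 1" using rng by simp
        have "nat ((a - c + 2) mod 4) mod 4 = (nat a + 3 * nat c + 2) mod 4"
          by (rule nat_mod_4_eq[where j = "nat c"]) (use rng in simp)
        then have "u [^] nat ((a - c + 2) mod 4) = u [^] (nat a + 3 * nat c + 2)" by (rule u_cong)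
        then have "f (k \<otimes>\<^bsub>Q8\<^esub> l) = u [^] (nat a + 3 * nat c) \<otimes> u [^] (2::nat)"
          unfolding fkl using d b uv by (simp add: nat_pow_mult)
        moreover have "eq (u [^] (nat a + 3 * nat c) \<otimes> (v \<otimes> v)) (u [^] (nat a + 3 * nat c) \<otimes> u [^] (2::nat))"
          by (intro eq_mult eq_refl vv pR)
        moreover have "v [^] nat d = v" using d uv by simp
        ultimately have "eq (u [^] (nat a + 3 * nat c) \<otimes> (v \<otimes> v [^] nat d)) (f (k \<otimes>\<^bsub>Q8\<^esub> l))"
          by (simp only:)
        then show ?thesis using e1 unfolding l r by (rule eq_trans[rotated])
      qed
    qed
  qed
  define A where "A = {a. \<exists>k\<in>carrier Q8. eq a (f k)}"
  have AR: "A \<subseteq> R" using eqR by (auto simp: A_def)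
  have Q8c: "k \<otimes>\<^bsub>Q8\<^esub> l \<in> carrier Q8" if "k \<in> carrier Q8" "l \<in> carrier Q8" for k l
    using group_Q8 that by (simp add: group.is_monoid monoid.m_closed)
  have fA: "f k \<in> A" if "k \<in> carrier Q8" for k
    unfolding A_def using that eq_refl[OF fR[of k]] by blast
  have A: "subgroup A G"
  proof (rule finite_subgroupI)
    show "A \<subseteq> carrier G" using AR R.subset by blast
    show "A \<noteq> {}" using fA[of "\<one>\<^bsub>Q8\<^esub>"] group_Q8 by (auto simp: group.is_monoid monoid.one_closed)
    fix a b assume "a \<in> A" "b \<in> A"
    then obtain k l where "k \<in> carrier Q8" "eq a (f k)" "l \<in> carrier Q8" "eq b (f l)" by (auto simp: A_def)
    then show "a \<otimes> b \<in> A" using eq_trans[OF eq_mult fm] Q8c unfolding A_def by blast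
  qed
  interpret A: subgroup A G by (rule A)
  have one: "\<one>\<^bsub>Q8\<^esub> = (0, 0)" by (simp add: Q8_def)
  have MA: "M \<subseteq> A"
  proof
    fix m assume m: "m \<in> M"
    have "eq m (f \<one>\<^bsub>Q8\<^esub>)" unfolding eq_def using m M(2) uv fR by (auto simp: f_def one intro!: bexI[of _ m])
    then show "m \<in> A" using group_Q8 unfolding A_def by (auto simp: group.is_monoid monoid.one_closed)
  qed
  interpret GA: group "G\<lparr>carrier := A\<rparr>" using A subgroup_imp_group by blast
  have nrm: "M \<lhd> G\<lparr>carrier := A\<rparr>"
  proof (rule GA.normal_invI)
    show "subgroup M (G\<lparr>carrier := A\<rparr>)" using subgroup_incl[OF M(1) A MA] .
    fix a m assume am: "a \<in> carrier (G\<lparr>carrier := A\<rparr>)" "m \<in> M"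
    then have aR: "a \<in> R" using AR by auto
    have "a \<otimes> m \<otimes> inv a = m" using central[OF am(2) aR, symmetric] am(2) aR M(2) by (simp add: m_assoc)
    then show "a \<otimes>\<^bsub>G\<lparr>carrier := A\<rparr>\<^esub> m \<otimes>\<^bsub>G\<lparr>carrier := A\<rparr>\<^esub> inv\<^bsub>G\<lparr>carrier := A\<rparr>\<^esub> a \<in> M"
      using am A m_inv_consistent by simp
  qed
  interpret MA: normal M "G\<lparr>carrier := A\<rparr>" by (rule nrm)
  have coset_eq: "M #> a = M #> b" if ab: "eq a b" for a b
  proof -
    obtain m where m: "m \<in> M" "a = m \<otimes> b" using ab unfolding eq_def by blast
    have "M #> a = (M #> m) #> b" unfolding m(2) using m(1) eqR[OF ab] M.subset by (simp add: coset_mult_assoc)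
    also have "M #> m = M" using m(1) M(1) by (simp add: coset_join2)
    finally show ?thesis .
  qed
  let ?F = "(G\<lparr>carrier := A\<rparr>) Mod M"
  let ?g = "\<lambda>k. M #> f k"
  have hom: "?g \<in> hom Q8 ?F"
  proof (rule homI)
    fix k assume "k \<in> carrier Q8"
    then show "?g k \<in> carrier ?F" using fA unfolding carrier_FactGroup by simp
    fix l assume l: "l \<in> carrier Q8"
    have "?g (k \<otimes>\<^bsub>Q8\<^esub> l) = M #> (f k \<otimes> f l)" using coset_eq[OF fm] \<open>k \<in> carrier Q8\<close> l by simp
    also have "\<dots> = ?g k <#> ?g l"
      using MA.rcos_sum[of "f k" "f l"] fA \<open>k \<in> carrier Q8\<close> l by simp
    finally show "?g (k \<otimes>\<^bsub>Q8\<^esub> l) = ?g k \<otimes>\<^bsub>?F\<^esub> ?g l" by simp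
  qed
  have GF: "group ?F" by (rule MA.factorgroup_is_group)
  interpret hh: group_hom Q8 ?F ?g
    using hom GF group_Q8 by (simp add: group_hom_def group_hom_axioms_def)
  have "?g ` carrier Q8 = carrier ?F"
  proof
    show "?g ` carrier Q8 \<subseteq> carrier ?F" using hh.hom_closed by blast
    show "carrier ?F \<subseteq> ?g ` carrier Q8"
    proof
      fix Y assume "Y \<in> carrier ?F"
      then obtain a where a: "a \<in> A" "Y = M #> a" unfolding carrier_FactGroup by auto
      then obtain k where "k \<in> carrier Q8" "eq a (f k)" by (auto simp: A_def)
      then show "Y \<in> ?g ` carrier Q8" using a coset_eq by blast
    qed
  qed
  moreover have "inj_on ?g (carrier Q8)"
  proof -
    have "k = \<one>\<^bsub>Q8\<^esub>" if k: "k \<in> carrier Q8" and gk: "?g k = \<one>\<^bsub>?F\<^esub>" for k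
    proof -
      obtain a b where ab: "k = (a, b)" by fastforce
      have rng: "0 \<le> a" "a < 4" "b = 0 \<or> b = 1" using k carrier by (auto simp: ab)
      have "f k \<in> M #> f k" using rcos_self[of "f k" M] fR R.mem_carrier M(1) by blast
      then have fM: "f k \<in> M" using gk by simp
      have ua: "u [^] (2::nat) \<notin> M" using u2 uv by (simp add: numeral_2_eq_2)
      have "b = 0"
      proof (rule ccontr)
        assume "b \<noteq> 0"
        then have b: "b = 1" using rng by simp
        have fk: "f k = u [^] nat a \<otimes> v" using b uv by (simp add: f_def ab)
        \<comment> \<open>An element u^a v in \<open>M\<close> would be central, so that
          \<open>u\<close> and \<open>v\<close> commute. The relation \<open>vu\<close> would then
          put the square of \<open>u\<close> into \<open>M\<close>.\<close>
        have "u [^] nat a \<otimes> (v \<otimes> u) = u [^] nat a \<otimes> (u \<otimes> v)"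
        proof -
          have "u [^] nat a \<otimes> (v \<otimes> u) = f k \<otimes> u" unfolding fk using uv pR by (simp add: m_assoc)
          also have "\<dots> = u \<otimes> f k" by (rule central[OF fM uv(1)])
          also have "\<dots> = (u \<otimes> u [^] nat a) \<otimes> v" unfolding fk using uv pR by (simp add: m_assoc)
          also have "u \<otimes> u [^] nat a = u [^] nat a \<otimes> u" using nat_pow_Suc2[of u "nat a"] uv by simp
          finally show ?thesis using uv pR by (simp add: m_assoc)
        qed
        then have vu2: "v \<otimes> u = u \<otimes> v" using uv pR[of "nat a"] by simp
        obtain m where m: "m \<in> M" "v \<otimes> u = m \<otimes> (u \<otimes> u \<otimes> u \<otimes> v)" using vu by blast
        have mG: "m \<in> carrier G" using m(1) by simp
        have e: "(m \<otimes> (u \<otimes> u)) \<otimes> (u \<otimes> v) = u \<otimes> v" using m(2) vu2 mG uv by (simp add: m_assoc)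
        have "m \<otimes> (u \<otimes> u) = \<one>" by (rule mult_eq_rightD[OF e]) (use mG uv in simp_all)
        then have "inv (u \<otimes> u) = m" using mG uv by (intro inv_equality) simp_all
        then have "u \<otimes> u = inv m" using uv inv_inv[of "u \<otimes> u"] by simp
        then show False using u2 m(1) by simp
      qed
      moreover have "a = 0"
      proof (rule ccontr)
        assume "a \<noteq> 0"
        have uM: "u [^] nat a \<in> M" using fM \<open>b = 0\<close> uv by (simp add: f_def ab)
        have "nat a = 1 \<or> nat a = 2 \<or> nat a = 3" using rng \<open>a \<noteq> 0\<close> by linarith
        moreover have "u [^] (nat a * 2) \<in> M"
          using nat_pow_mem[OF M(1) uM, of 2] uv by (simp add: nat_pow_pow)
        moreover have "u [^] (6::nat) = u [^] (2::nat)" by (rule u_cong) simp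
        ultimately show False using ua uM by auto
      qed
      ultimately show ?thesis by (simp add: ab one)
    qed
    then show ?thesis using hh.inj_on_one_iff by blast
  qed
  ultimately have "?g \<in> iso Q8 ?F" using hom by (simp add: iso_def bij_betw_def)
  then have "?F \<cong> Q8" using group.iso_sym[OF group_Q8] is_isoI by blast
  then show ?thesis using A AR nrm by blast
qed

end

context minimal_coprime_action
begin

text \<open>All squares and commutators of \<open>R\<close> lie in the subgroup \<open>E\<close> of
  elements of \<open>C\<close> with trivial square. Modulo a subgroup \<open>M\<close> of
  \<open>E\<close> that is maximal among those without a chosen commutator \<open>z0\<close>, only
  one nontrivial value \<open>z0\<close> is left. Two elements that do not commute modulo
  \<open>M\<close> and have squares outside \<open>M\<close> then satisfy the quaternion
  relations.\<close>

lemma Q8_section: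
  assumes p2: "p = 2" and inv: "\<And>r. r \<in> R \<Longrightarrow> r [^] (2::nat) = \<one> \<Longrightarrow> r \<in> C"
  shows "\<exists>A B. subgroup A G \<and> A \<subseteq> R \<and> B \<lhd> G\<lparr>carrier := A\<rparr> \<and> (G\<lparr>carrier := A\<rparr>) Mod B \<cong> Q8"
proof -
  have sq: "r [^] (2::nat) = r \<otimes> r" if "r \<in> R" for r using that by (simp add: numeral_2_eq_2)
  have sqC: "r \<otimes> r \<in> C" if "r \<in> R" for r using pow_p_in_C[OF that] p2 sq[OF that] by simp
  have CR: "c \<in> R" if "c \<in> C" for c using C_in_R that .
  interpret C: subgroup C G by (rule C_subgroup)
  have cl: "\<exists>z\<in>C. b \<otimes> a = a \<otimes> b \<otimes> z \<and> z \<otimes> z = \<one> \<and>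
      (\<forall>m::nat. (a \<otimes> b) [^] m = a [^] m \<otimes> b [^] m \<otimes> z [^] (m * (m - 1) div 2))"
    if ab: "a \<in> R" "b \<in> R" for a b
  proof (rule class_two[OF ab])
    fix z assume z: "z \<in> C" "b \<otimes> a = a \<otimes> b \<otimes> z" "z [^] p = \<one>"
      "\<And>m::nat. (a \<otimes> b) [^] m = a [^] m \<otimes> b [^] m \<otimes> z [^] (m * (m - 1) div 2)"
    have "z \<otimes> z = \<one>" using z(3) sq[OF CR[OF z(1)]] p2 by simp
    then show ?thesis using z by (intro bexI[of _ z] conjI allI)
  qed
  \<comment> \<open>The drifts have this property and generate \<open>R\<close>. The property is
    multiplicative because the commutator enters a fourth power with exponent 6 and has order at
    most 2.\<close>
  have exp4: "r [^] (4::nat) = \<one>" if "r \<in> R" for r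
  proof -
    let ?S = "{r \<in> R. r [^] (4::nat) = \<one>}"
    have "subgroup ?S G"
    proof (rule finite_subgroupI)
      show "?S \<subseteq> carrier G" by auto
      have "\<one> \<in> ?S" by simp
      then show "?S \<noteq> {}" by blast
      fix a b assume ab: "a \<in> ?S" "b \<in> ?S"
      then obtain z where z: "z \<in> C" "z \<otimes> z = \<one>"
        "(a \<otimes> b) [^] (4::nat) = a [^] (4::nat) \<otimes> b [^] (4::nat) \<otimes> z [^] ((4::nat) * (4 - 1) div 2)"
        using cl[of a b] by blast
      have "(4::nat) * (4 - 1) div 2 = 2 * 3" by simp
      then have "z [^] ((4::nat) * (4 - 1) div 2) = (z [^] (2::nat)) [^] (3::nat)"
        using z by (simp add: nat_pow_pow)
      also have "\<dots> = \<one>" using sq[OF CR[OF z(1)]] z(2) by simp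
      finally have "(a \<otimes> b) [^] (4::nat) = \<one>" using z(3) ab by simp
      then show "a \<otimes> b \<in> ?S" using ab by simp
    qed
    then have "?S = R"
      by (rule generated_by_drift) (use drift_pow(2) p2 drift_in_R in auto)
    then show ?thesis using that by blast
  qed
  obtain a0 b0 z0 where z0: "a0 \<in> R" "b0 \<in> R" "z0 \<in> C" "b0 \<otimes> a0 = a0 \<otimes> b0 \<otimes> z0" "z0 \<otimes> z0 = \<one>" "z0 \<noteq> \<one>"
    "(a0 \<otimes> b0) [^] (2::nat) = a0 [^] (2::nat) \<otimes> b0 [^] (2::nat) \<otimes> z0"
  proof -
    obtain r where r: "r \<in> R" "drift r \<notin> C" using ex_drift_not_in_C by blast
    have h: "drift r \<in> R" using drift_in_R[OF r(1)] .
    obtain z where z: "z \<in> C" "drift r \<otimes> r = r \<otimes> drift r \<otimes> z" "z \<otimes> z = \<one>"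
      "\<forall>m::nat. (r \<otimes> drift r) [^] m = r [^] m \<otimes> drift r [^] m \<otimes> z [^] (m * (m - 1) div 2)"
      using cl[OF r(1) h] by blast
    have zz: "(r \<otimes> drift r) [^] (2::nat) = r [^] (2::nat) \<otimes> drift r [^] (2::nat) \<otimes> z"
      using z(4)[rule_format, of 2] z(1) by simp
    \<comment> \<open>If \<open>r\<close> commuted with its drift, then, as the square of
      \<open>r\<close> is fixed by \<open>x\<close>, the square of the drift would be trivial and
      \<open>inv\<close> would put the drift into \<open>C\<close>.\<close>
    have "z \<noteq> \<one>"
    proof
      assume "z = \<one>"
      then have "(r \<otimes> drift r) [^] (2::nat) = r [^] (2::nat) \<otimes> drift r [^] (2::nat)" using zz r h by simp
      moreover have "(r \<otimes> drift r) [^] (2::nat) = r [^] (2::nat)"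
        using conj_pow[OF xG, of r 2] mult_drift[of r] C_fixed[OF sqC[OF r(1)]] sq[OF r(1)] r(1) by simp
      ultimately have "r [^] (2::nat) \<otimes> drift r [^] (2::nat) = r [^] (2::nat)" by simp
      then have "drift r [^] (2::nat) = \<one>" by (rule mult_eq_leftD) (use r h in simp_all)
      then show False using inv[OF h] r(2) by blast
    qed
    then show thesis using that[of r "drift r" z] r h z zz by blast
  qed
  define E where "E = {c \<in> C. c \<otimes> c = \<one>}"
  have Ecomm: "c \<otimes> d = d \<otimes> c" if "c \<in> C" "d \<in> C" for c d using C_central[OF that(1) CR[OF that(2)]] .
  have sqE: "r \<otimes> r \<in> E" if r: "r \<in> R" for r
  proof -
    have "(r \<otimes> r) \<otimes> (r \<otimes> r) = r [^] (4::nat)" using r by (simp add: numeral_eq_Suc m_assoc)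
    then show ?thesis using exp4[OF r] sqC[OF r] by (simp add: E_def)
  qed
  have z0E: "z0 \<in> E" using z0 by (simp add: E_def)
  define ok where "ok M \<longleftrightarrow> subgroup M G \<and> M \<subseteq> E \<and> z0 \<notin> M" for M
  have "ok {\<one>}" using triv_subgroup z0(6) by (simp add: ok_def E_def)
  moreover have "M \<subseteq> carrier G" if "ok M" for M using that by (auto simp: ok_def dest: subgroup.subset)
  ultimately obtain M where okM: "ok M" and maxM: "\<And>M'. ok M' \<Longrightarrow> card M' \<le> card M"
    using ex_max_card by metis
  have M: "subgroup M G" "M \<subseteq> E" "z0 \<notin> M" using okM by (auto simp: ok_def)
  interpret M: subgroup M G by (rule M(1))
  have MC: "m \<in> C" "m \<otimes> m = \<one>" if "m \<in> M" for m using that M(2) by (auto simp: E_def)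
  have MR: "M \<subseteq> R" using MC(1) CR by blast
  have Mc: "m \<otimes> r = r \<otimes> m" if "m \<in> M" "r \<in> R" for m r using C_central MC that by blast
  \<comment> \<open>Adjoining \<open>e\<close> to \<open>M\<close> gives the group M \<union> M e
    inside \<open>E\<close>, which must contain \<open>z0\<close> by maximality. So \<open>E\<close>
    consists of \<open>M\<close> and the coset of \<open>z0\<close>.\<close>
  have key: "\<exists>m\<in>M. e = m \<otimes> z0" if e: "e \<in> E" "e \<notin> M" for e
  proof -
    have eC: "e \<in> C" "e \<otimes> e = \<one>" using e by (auto simp: E_def)
    let ?M = "M \<union> (\<lambda>m. m \<otimes> e) ` M"
    have me: "(m \<otimes> e) \<otimes> (k \<otimes> e) = m \<otimes> k" if "m \<in> M" "k \<in> M" for m k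
    proof -
      have "(m \<otimes> e) \<otimes> (k \<otimes> e) = m \<otimes> ((e \<otimes> k) \<otimes> e)" using that eC by (simp add: m_assoc)
      also have "e \<otimes> k = k \<otimes> e" using Ecomm eC MC that by blast
      also have "m \<otimes> ((k \<otimes> e) \<otimes> e) = m \<otimes> k" using that eC by (simp add: m_assoc)
      finally show ?thesis .
    qed
    have ek: "(m \<otimes> e) \<otimes> k = (m \<otimes> k) \<otimes> e" if "m \<in> M" "k \<in> M" for m k
    proof -
      have "(m \<otimes> e) \<otimes> k = m \<otimes> (e \<otimes> k)" using that eC by (simp add: m_assoc)
      also have "e \<otimes> k = k \<otimes> e" using Ecomm eC MC that by blast
      finally show ?thesis using that eC by (simp add: m_assoc)
    qed
    have "subgroup ?M G"
    proof (rule finite_subgroupI)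
      show "?M \<subseteq> carrier G" using eC by auto
      show "?M \<noteq> {}" using M.one_closed by blast
      fix a b assume "a \<in> ?M" "b \<in> ?M"
      then consider "a \<in> M" "b \<in> M" | m where "a \<in> M" "m \<in> M" "b = m \<otimes> e"
        | m where "m \<in> M" "a = m \<otimes> e" "b \<in> M" | m k where "m \<in> M" "k \<in> M" "a = m \<otimes> e" "b = k \<otimes> e" by blast
      then show "a \<otimes> b \<in> ?M"
      proof cases
        case 2
        then have "a \<otimes> b = (a \<otimes> m) \<otimes> e" using eC by (simp add: m_assoc)
        then show ?thesis using 2 M.m_closed by blast
      next
        case 3
        then show ?thesis using ek M.m_closed by blast
      next
        case 4
        then show ?thesis using me M.m_closed by simp
      qed (use M.m_closed in blast)
    qed
    moreover have "?M \<subseteq> E"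
    proof -
      have "m \<otimes> e \<in> E" if "m \<in> M" for m using that me[OF that that] MC[OF that] eC by (simp add: E_def)
      then show ?thesis using M(2) by blast
    qed
    moreover have "M \<subset> ?M"
    proof -
      have "e = \<one> \<otimes> e" using eC by simp
      then have "e \<in> ?M" using M.one_closed by blast
      then show ?thesis using e(2) by blast
    qed
    then have "card M < card ?M" by (rule psubset_card_mono[rotated]) (use M(1) in simp)
    ultimately have "z0 \<in> ?M" using maxM[of ?M] unfolding ok_def by fastforce
    then obtain m where m: "m \<in> M" "z0 = m \<otimes> e" using M(3) by blast
    have "m \<otimes> z0 = (m \<otimes> m) \<otimes> e" unfolding m(2) using m(1) eC by (simp add: m_assoc)
    then have "e = m \<otimes> z0" using MC(2)[OF m(1)] eC by simp
    then show ?thesis using m by blast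
  qed
  define T where "T = {g \<in> R. g \<otimes> g \<notin> M}"
  have TR: "T \<subseteq> R" by (auto simp: T_def)
  define w where "w v g = inv g \<otimes> (v \<otimes> g \<otimes> inv v)" for v g
  have wC: "w v g \<in> C" if "v \<in> R" "g \<in> R" for v g using comm_in_C[OF that(2,1)] by (simp add: w_def)
  have vg: "v \<otimes> g = g \<otimes> v \<otimes> w v g" if vgR: "v \<in> R" "g \<in> R" for v g
  proof -
    have "g \<otimes> v \<otimes> w v g = g \<otimes> (w v g \<otimes> v)"
      using C_central[OF wC[OF vgR] vgR(1)] vgR CR[OF wC[OF vgR]] by (simp add: m_assoc)
    also have "\<dots> = v \<otimes> g" using vgR by (simp add: w_def m_assoc)
    finally show ?thesis by simp
  qed
  have w_unique: "w v g = z" if "v \<in> R" "g \<in> R" "z \<in> C" "v \<otimes> g = g \<otimes> v \<otimes> z" for v g z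
    using vg[OF that(1,2)] that CR[OF wC[OF that(1,2)]] by simp
  have wE: "w v g \<in> E" if vgR: "v \<in> R" "g \<in> R" for v g
  proof -
    obtain z where "z \<in> C" "v \<otimes> g = g \<otimes> v \<otimes> z" "z \<otimes> z = \<one>" using cl[OF vgR(2,1)] by blast
    then show ?thesis using w_unique[OF vgR] by (simp add: E_def)
  qed
  have w_sym: "w g v \<in> M" if vgR: "v \<in> R" "g \<in> R" and wM: "w v g \<in> M" for v g
  proof -
    have "v \<otimes> g \<otimes> inv (w v g) = g \<otimes> v" unfolding vg[OF vgR] using vgR CR[OF wC[OF vgR]] by (simp add: m_assoc)
    then have "w g v = inv (w v g)" using w_unique[OF vgR(2,1)] wC[OF vgR] by simp
    then show ?thesis using wM by simp
  qed
  have Zsub: "subgroup {g \<in> R. w v g \<in> M} G" if v: "v \<in> R" for v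
  proof (rule finite_subgroupI)
    show "{g \<in> R. w v g \<in> M} \<subseteq> carrier G" by auto
    have "\<one> \<in> {g \<in> R. w v g \<in> M}" using v by (simp add: w_def)
    then show "{g \<in> R. w v g \<in> M} \<noteq> {}" by blast
    fix a b assume ab: "a \<in> {g \<in> R. w v g \<in> M}" "b \<in> {g \<in> R. w v g \<in> M}"
    then have abR: "a \<in> R" "b \<in> R" by auto
    have "w v (a \<otimes> b) = inv b \<otimes> w v a \<otimes> b \<otimes> w v b"
      using abR v by (simp add: w_def group_norm)
    also have "inv b \<otimes> w v a \<otimes> b = w v a"
      using Mc[of "w v a" b] ab abR by (simp add: m_assoc)
    finally show "a \<otimes> b \<in> {g \<in> R. w v g \<in> M}" using ab by simp
  qed
  have nonab: "w b0 a0 \<notin> M" using w_unique[OF z0(2,1,3,4)] M(3) by simp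
  \<comment> \<open>Suppose that the elements of \<open>T\<close> commute modulo \<open>M\<close>.
    If they generate \<open>R\<close>, then \<open>R\<close> is abelian modulo \<open>M\<close>,
    against \<open>nonab\<close>. Otherwise they generate a proper subgroup, which is invariant
    because \<open>x\<close> preserves squares; so \<open>T\<close> lies in
    \<open>C\<close>.\<close>
  have "\<exists>u\<in>T. \<exists>v\<in>T. w v u \<notin> M"
  proof (rule ccontr)
    assume "\<not> (\<exists>u\<in>T. \<exists>v\<in>T. w v u \<notin> M)"
    then have all: "w v u \<in> M" if "u \<in> T" "v \<in> T" for u v using that by blast
    let ?L = "generate G T"
    have TG: "T \<subseteq> carrier G" using TR R.subset by blast
    have L: "subgroup ?L G" "?L \<subseteq> R"
      using generate_is_subgroup[OF TG] generate_subgroup_incl[OF TR RG] by auto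
    show False
    proof (cases "?L = R")
      case True
      have full: "R \<subseteq> {g \<in> R. w v g \<in> M}" if "v \<in> R" "T \<subseteq> {g \<in> R. w v g \<in> M}" for v
        using generate_subgroup_incl[OF that(2) Zsub[OF that(1)]] True by blast
      have "w v g \<in> M" if "v \<in> T" "g \<in> R" for v g
      proof -
        have "T \<subseteq> {g \<in> R. w v g \<in> M}" using all that(1) TR by blast
        then show ?thesis using full[of v] that TR by blast
      qed
      then have "w g v \<in> M" if "v \<in> T" "g \<in> R" for v g using w_sym that TR by blast
      then have "T \<subseteq> {g \<in> R. w b0 g \<in> M}" using z0(2) TR by blast
      then show False using full[OF z0(2)] z0(1) nonab by blast
    next
      case False
      have "normalizes x ?L"
      proof (rule generate_normalizes[OF TG xG])
        fix s assume s: "s \<in> T"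
        have sR: "s \<in> R" using s TR by blast
        have xs: "x \<otimes> s \<otimes> inv x \<in> R" using normalizesD[OF R(2) sR] .
        have "(x \<otimes> s \<otimes> inv x) \<otimes> (x \<otimes> s \<otimes> inv x) = x \<otimes> (s \<otimes> s) \<otimes> inv x" using sR xG by (simp add: group_norm)
        also have "\<dots> = s \<otimes> s" using C_fixed[OF sqC[OF sR]] .
        finally have "x \<otimes> s \<otimes> inv x \<in> T" using s xs by (simp add: T_def)
        then show "x \<otimes> s \<otimes> inv x \<in> ?L" by (rule generate.incl)
      qed
      then have LC: "?L \<subseteq> C" using proper_invariant_in_C[OF L(1)] L(2) False by blast
      have TC: "T \<subseteq> C" using LC generate.incl[of _ T G] by blast
      \<comment> \<open>The squares of \<open>a0\<close>, \<open>b0\<close> and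
        \<open>a0 \<otimes> b0\<close> cannot all lie in \<open>M\<close>, since the last differs
        from the product of the others by \<open>z0\<close>.\<close>
      have "T \<noteq> {}"
      proof
        assume "T = {}"
        then have all: "g \<otimes> g \<in> M" if "g \<in> R" for g using that by (auto simp: T_def)
        have "(a0 \<otimes> b0) \<otimes> (a0 \<otimes> b0) = (a0 \<otimes> a0) \<otimes> (b0 \<otimes> b0) \<otimes> z0"
          using z0(7) sq[of "a0 \<otimes> b0"] sq[of a0] sq[of b0] z0(1,2) by simp
        moreover have "(a0 \<otimes> a0) \<otimes> (b0 \<otimes> b0) \<in> M" using all z0(1,2) by blast
        moreover have "(a0 \<otimes> b0) \<otimes> (a0 \<otimes> b0) \<in> M" using all[of "a0 \<otimes> b0"] z0(1,2) by blast
        ultimately have "inv ((a0 \<otimes> a0) \<otimes> (b0 \<otimes> b0)) \<otimes> ((a0 \<otimes> a0) \<otimes> (b0 \<otimes> b0) \<otimes> z0) \<in> M"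
          by (metis M.m_closed M.m_inv_closed)
        then show False using z0 M(3) by (simp add: m_assoc inv_mult_group)
      qed
      then obtain u where u: "u \<in> T" "u \<in> C" using TC by blast
      \<comment> \<open>As \<open>r\<close> is not in \<open>T\<close>, its square is in
        \<open>M\<close>. Multiplying by the central \<open>u\<close> moves the square out of
        \<open>M\<close>, so \<open>r \<otimes> u\<close> is in \<open>T\<close> and hence in
        \<open>C\<close>; but then \<open>r\<close> is in \<open>C\<close> too.\<close>
      obtain r where r: "r \<in> R" "r \<notin> C" using C_ne fixed_subset by blast
      have uR: "u \<in> R" using u TR by blast
      have rM: "r \<otimes> r \<in> M" using r TC by (auto simp: T_def)
      have "(r \<otimes> u) \<otimes> (r \<otimes> u) = r \<otimes> (u \<otimes> r) \<otimes> u" using r uR by (simp add: m_assoc)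
      also have "\<dots> = (r \<otimes> r) \<otimes> (u \<otimes> u)" unfolding C_central[OF u(2) r(1)] using r uR by (simp add: m_assoc)
      finally have e: "(r \<otimes> u) \<otimes> (r \<otimes> u) = (r \<otimes> r) \<otimes> (u \<otimes> u)" .
      have "(r \<otimes> u) \<otimes> (r \<otimes> u) \<notin> M"
      proof
        assume "(r \<otimes> u) \<otimes> (r \<otimes> u) \<in> M"
        then have "inv (r \<otimes> r) \<otimes> ((r \<otimes> r) \<otimes> (u \<otimes> u)) \<in> M" unfolding e using rM by blast
        moreover have "inv (r \<otimes> r) \<otimes> ((r \<otimes> r) \<otimes> (u \<otimes> u)) = u \<otimes> u" using r uR by simp
        ultimately show False using u by (simp add: T_def)
      qed
      then have "r \<otimes> u \<in> C" using TC r uR by (auto simp: T_def)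
      then have "(r \<otimes> u) \<otimes> inv u \<in> C" using u by blast
      then show False using r uR by (simp add: m_assoc)
    qed
  qed
  then obtain u v where uv: "u \<in> T" "v \<in> T" "w v u \<notin> M" by blast
  have uvR: "u \<in> R" "v \<in> R" using uv TR by auto
  obtain m1 where m1: "m1 \<in> M" "u \<otimes> u = m1 \<otimes> z0" using key[OF sqE[OF uvR(1)]] uv(1) by (auto simp: T_def)
  obtain m2 where m2: "m2 \<in> M" "v \<otimes> v = m2 \<otimes> z0" using key[OF sqE[OF uvR(2)]] uv(2) by (auto simp: T_def)
  obtain m3 where m3: "m3 \<in> M" "w v u = m3 \<otimes> z0" using key[OF wE[OF uvR(2,1)] uv(3)] by blast
  have z0R: "z0 \<in> R" using CR z0 by blast
  have z0u: "z0 = m1 \<otimes> (u \<otimes> u)" unfolding m1(2) using MC(2)[OF m1(1)] m1(1) z0R by (simp flip: m_assoc)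
  have "v \<otimes> v = (m2 \<otimes> m1) \<otimes> (u \<otimes> u)"
    unfolding m2(2) using m1(1) m2(1) uvR by (subst z0u) (simp add: m_assoc)
  moreover have "v \<otimes> u = (m3 \<otimes> m1) \<otimes> (u \<otimes> u \<otimes> u \<otimes> v)"
  proof -
    have "v \<otimes> u = (w v u) \<otimes> (u \<otimes> v)"
      using vg[OF uvR(2,1)] C_central[OF wC[OF uvR(2,1)], of "u \<otimes> v"] uvR by simp
    also have "w v u = (m3 \<otimes> m1) \<otimes> (u \<otimes> u)"
      unfolding m3(2) using m1(1) m3(1) uvR by (subst z0u) (simp add: m_assoc)
    finally show ?thesis using m1(1) m3(1) uvR by (simp add: m_assoc)
  qed
  ultimately obtain A where "subgroup A G" "A \<subseteq> R" "M \<lhd> G\<lparr>carrier := A\<rparr>" "(G\<lparr>carrier := A\<rparr>) Mod M \<cong> Q8"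
    using Q8_section_iso[OF RG M(1) MR Mc uvR exp4[OF uvR(1)]] uv(1) m1(1) m2(1) m3(1) M.m_closed
    unfolding T_def by blast
  then show ?thesis by blast
qed

end

section \<open>Coprime action and IC\<open>\<Phi>\<close>-subgroups\<close>

context coprime_action
begin

lemma drift_mult_mem:
  assumes H: "subgroup H G" and ab: "a \<in> carrier G" "b \<in> carrier G" and nb: "normalizes b H"
    and d: "drift a \<in> H" "drift b \<in> H"
  shows "drift (a \<otimes> b) \<in> H"
proof -
  have "drift (a \<otimes> b) = (inv b \<otimes> drift a \<otimes> inv (inv b)) \<otimes> drift b"
    using ab xG by (simp add: drift_def group_norm)
  moreover have "inv b \<otimes> drift a \<otimes> inv (inv b) \<in> H"
    by (rule normalizesD[OF normalizes_inv[OF ab(2) H nb] d(1)])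
  ultimately show ?thesis using d(2) subgroup.m_closed[OF H] by metis
qed

text \<open>Modulo \<open>H\<close>, these are the fixed points of \<open>x\<close> in
  \<open>K\<close>.\<close>

lemma drift_stable_subgroup:
  assumes K: "subgroup K G" and H: "subgroup H G" and nrm: "\<And>k. k \<in> K \<Longrightarrow> normalizes k H"
  shows "subgroup {k \<in> K. drift k \<in> H} G"
proof (rule finite_subgroupI)
  interpret K: subgroup K G by fact
  show "{k \<in> K. drift k \<in> H} \<subseteq> carrier G" by auto
  have "drift \<one> = \<one>" using xG by (simp add: drift_def)
  then have "\<one> \<in> {k \<in> K. drift k \<in> H}" using subgroup.one_closed[OF H] by simp
  then show "{k \<in> K. drift k \<in> H} \<noteq> {}" by blast
  fix a b assume "a \<in> {k \<in> K. drift k \<in> H}" "b \<in> {k \<in> K. drift k \<in> H}"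
  then show "a \<otimes> b \<in> {k \<in> K. drift k \<in> H}" using drift_mult_mem[OF H, of a b] nrm by simp
qed

text \<open>If \<open>x\<close> acts nontrivially on \<open>R\<close> with \<open>|R| \<le> d\<close>, enlarge \<open>R\<close> to a maximal \<open>x\<close>-invariant
  subgroup \<open>H\<close> of order at most \<open>d\<close>. If its order is less than \<open>d\<close>, then \<open>x\<close> acts on the next
  invariant layer \<open>K / H\<close> without fixed points, so that \<open>[U, G]\<close> covers \<open>K / H\<close> for each \<open>U\<close>
  of order \<open>d\<close> between \<open>H\<close> and \<open>K\<close>.\<close>

lemma centralizes_small_invariant:
  assumes Q: "p_subgroup p Q" "normalizes x Q" and d: "d = p ^ k" "d \<le> card Q"
    and IC: "\<And>H. subgroup H G \<Longrightarrow> H \<subseteq> Q \<Longrightarrow> card H = d \<Longrightarrow> IC_Phi_subgroup H G"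
    and R: "subgroup R G" "R \<subseteq> Q" "normalizes x R" "card R \<le> d"
  shows "centralizes x R"
proof -
  have QG: "subgroup Q G" using Q p_subgroupD by blast
  define P where "P H \<longleftrightarrow> subgroup H G \<and> R \<subseteq> H \<and> H \<subseteq> Q \<and> normalizes x H \<and> card H \<le> d" for H
  have "P R" using R by (simp add: P_def)
  moreover have "H \<subseteq> carrier G" if "P H" for H using that by (auto simp: P_def dest: subgroup.subset)
  ultimately obtain H where PH: "P H" and maxH: "\<And>H'. P H' \<Longrightarrow> card H' \<le> card H"
    using ex_max_card by metis
  have H: "subgroup H G" "R \<subseteq> H" "H \<subseteq> Q" "normalizes x H" "card H \<le> d" using PH by (auto simp: P_def)
  have pH: "p_subgroup p H" using p_subgroup_subset[OF p Q(1) H(1,3)] .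
  show ?thesis
  proof (cases "card H = d")
    case True
    then have "centralizes x H" using IC_Phi_centralizes[OF IC pH H(4)] H by blast
    then show ?thesis using H(2) centralizes_mono by blast
  next
    case False
    then have Hd: "card H < d" using H(5) by simp
    define P2 where "P2 K \<longleftrightarrow> subgroup K G \<and> H \<subset> K \<and> K \<subseteq> Q \<and> normalizes x K" for K
    have "H \<noteq> Q" using Hd d(2) by auto
    then have "P2 Q" using QG Q(2) H(3) by (auto simp: P2_def)
    then obtain K where PK: "P2 K" and minK: "\<And>K'. P2 K' \<Longrightarrow> card K \<le> card K'"
      using ex_has_least_nat[of P2 Q card] by blast
    have K: "subgroup K G" "H \<subset> K" "K \<subseteq> Q" "normalizes x K" using PK by (auto simp: P2_def)
    have pK: "p_subgroup p K" using p_subgroup_subset[OF p Q(1) K(1,3)] .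
    interpret K: subgroup K G by (rule K(1))
    interpret H: subgroup H G by (rule H(1))
    have min: "K' = K" if K': "subgroup K' G" "H \<subset> K'" "K' \<subseteq> K" "normalizes x K'" for K'
    proof -
      have "P2 K'" using K' K(3) unfolding P2_def by blast
      then have "card K \<le> card K'" by (rule minK)
      then show ?thesis using card_seteq[OF finite_subgroup[OF K(1)] K'(3)] by blast
    qed
    \<comment> \<open>The normalizer of \<open>H\<close> in \<open>K\<close> is
      \<open>x\<close>-invariant and, in the \<open>p\<close>-group \<open>K\<close>, larger than
      \<open>H\<close>. By minimality of \<open>K\<close> it is all of \<open>K\<close>.\<close>
    have "{k \<in> K. normalizes k H} = K"
    proof (rule min[OF normalizer_subgroup[OF K(1) H(1)]])
      obtain y where "y \<in> K - H" "normalizes y H" using normalizer_grows[OF p pK H(1) K(2)] by blast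
      then show "H \<subset> {k \<in> K. normalizes k H}" using K(2) normalizes_self[OF H(1)] by blast
      have "normalizes (x \<otimes> k \<otimes> inv x) H" if "k \<in> K" "normalizes k H" for k
        by (intro normalizes_mult normalizes_inv) (use that xG H in auto)
      then show "normalizes x {k \<in> K. normalizes k H}"
        using normalizesD[OF K(4)] by (auto simp: normalizes_def[of x])
    qed blast
    then have nK: "normalizes k H" if "k \<in> K" for k using that by blast
    let ?F = "{k \<in> K. drift k \<in> H}"
    have F: "subgroup ?F G" using drift_stable_subgroup[OF K(1) H(1) nK] by blast
    have HF: "H \<subseteq> ?F" using K(2) drift_mem[OF H(1,4)] by blast
    have xF: "normalizes x ?F"
      by (rule normalizes_if_drift_mem[OF F]) (use HF in blast)
    obtain j where j: "card H = p ^ j" using pH by (auto simp: p_subgroup_def)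
    have p1: "1 < p" using p prime_gt_1_nat by blast
    have jk: "j < k" using Hd j d(1) p1 by simp
    show ?thesis
    proof (cases "?F = K")
      \<comment> \<open>With trivial action on K / H, any subgroup of order p |H| between
        \<open>H\<close> and \<open>K\<close> is invariant, and its order is at most
        \<open>d\<close>. This contradicts the choice of \<open>H\<close>.\<close>
      case True
      obtain n where n: "card K = p ^ n" using pK by (auto simp: p_subgroup_def)
      have "card H < card K" using psubset_card_mono[OF finite_subgroup[OF K(1)] K(2)] .
      then have "p ^ Suc j \<le> card K" using n j p1 by (simp add: power_increasing Suc_leI del: power_Suc)
      moreover have "card H \<le> p ^ Suc j" using j p1 by simp
      ultimately obtain T where T: "subgroup T G" "H \<subseteq> T" "T \<subseteq> K" "card T = p ^ Suc j"
        using ex_intermediate_subgroup[OF p pK H(1), of "Suc j"] K(2) by blast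
      have "normalizes x T" by (rule normalizes_if_drift_mem[OF T(1)]) (use T True in blast)
      moreover have "card T \<le> d" unfolding T(4) d(1) using jk p1 by (intro power_increasing) simp_all
      ultimately have "P T" using T H(2) K(3) unfolding P_def by blast
      then have "p ^ Suc j \<le> p ^ j" using maxH[of T] T(4) j by simp
      then show ?thesis using p1 by simp
    next
      case False
      then have FH: "?F = H" using min[OF F _ _ xF] HF by blast
      have "\<not> P K" using maxH[of K] psubset_card_mono[OF finite_subgroup[OF K(1)] K(2)] by fastforce
      then have "d \<le> card K" using K H(2) unfolding P_def by auto
      then obtain U where U: "subgroup U G" "H \<subseteq> U" "U \<subseteq> K" "card U = d"
        using ex_intermediate_subgroup[OF p pK H(1), of k] K(2) Hd d(1) by auto
      have icU: "U \<inter> commutator_subgroup G U (carrier G) \<subseteq> frattini (G\<lparr>carrier := U\<rparr>)"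
        using IC[OF U(1) _ U(4)] U(3) K(3) by (auto simp: IC_Phi_subgroup_def)
      have "H \<noteq> U" using U(4) Hd by blast
      then obtain u where u: "u \<in> U" "u \<notin> H" using U(2) by blast
      let ?N = "commutator_subgroup G U (carrier G) \<inter> K"
      note cU = commutator_carrier[OF U(1)]
      have N: "subgroup ?N G" using subgroups_Inter_pair[OF cU(1) K(1)] .
      have nN: "normalizes h ?N" if "h \<in> H" for h
        using normalizes_Int[OF cU(2) normalizes_self[OF K(1)]] that K(2) by auto
      have W: "subgroup (?N <#> H) G" by (rule subgroup_set_mult[OF N H(1) nN])
      have HW: "H \<subseteq> ?N <#> H" "?N \<subseteq> ?N <#> H" using subset_set_mult[OF N H(1)] by auto
      have WK: "?N <#> H \<subseteq> K" using set_mult_subset_subgroup[OF K(1), of ?N H] K(2) by blast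
      have nx: "normalizes x ?N" using normalizes_Int[OF cU(2)[OF xG] K(4)] .
      have "normalizes x (?N <#> H)"
        unfolding normalizes_def
      proof
        fix g assume "g \<in> ?N <#> H"
        then obtain a h where ah: "a \<in> ?N" "h \<in> H" "g = a \<otimes> h" unfolding mem_set_mult by blast
        have "x \<otimes> g \<otimes> inv x = (x \<otimes> a \<otimes> inv x) \<otimes> (x \<otimes> h \<otimes> inv x)"
          using ah xG by (simp add: group_norm)
        then show "x \<otimes> g \<otimes> inv x \<in> ?N <#> H"
          unfolding mem_set_mult using normalizesD[OF nx ah(1)] normalizesD[OF H(4) ah(2)] by blast
      qed
      moreover have "H \<subset> ?N <#> H"
      proof -
        have uK: "u \<in> K" using u U(3) by blast
        have "drift u \<in> ?N" using drift_commutator[OF U(1) u(1)] drift_mem[OF K(1,4) uK] by blast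
        moreover have "drift u \<notin> H" using FH u(2) uK by blast
        ultimately show ?thesis using HW by blast
      qed
      ultimately have WeK: "?N <#> H = K" using min[OF W _ WK] by blast
      \<comment> \<open>Since \<open>K\<close> is the product of \<open>?N\<close> and
        \<open>H\<close>, each element of \<open>U\<close> agrees with one of \<open>H\<close>
        modulo U \<inter> [U, G], hence modulo \<Phi>(U).\<close>
      have "H = U"
      proof (rule frattini_nongenerators[OF U(1) H(1) U(2)])
        fix y assume y: "y \<in> U"
        have "inv y \<in> ?N <#> H" unfolding WeK using y U(3) by blast
        then obtain a h where ah: "a \<in> ?N" "h \<in> H" "inv y = a \<otimes> h" unfolding mem_set_mult by blast
        have yG: "y \<in> carrier G" using y mem_subgroup_carrier[OF U(1)] by blast
        have ai: "inv a \<in> commutator_subgroup G U (carrier G)" using ah(1) subgroup.m_inv_closed[OF cU(1)] by blast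
        have "y = inv (a \<otimes> h)" using ah(3) yG inv_inv[OF yG] by simp
        then have e: "inv (inv h) \<otimes> y = inv a" using ah(1,2) by (simp add: group_norm)
        moreover have "inv (inv h) \<otimes> y \<in> U"
          using y ah(2) U(2) subgroup.m_closed[OF U(1)] by auto
        ultimately have "inv (inv h) \<otimes> y \<in> frattini (G\<lparr>carrier := U\<rparr>)" using ai icU by auto
        then show "\<exists>c\<in>H. inv c \<otimes> y \<in> frattini (G\<lparr>carrier := U\<rparr>)" using ah(2) by blast
      qed
      then show ?thesis using \<open>H \<noteq> U\<close> by blast
    qed
  qed
qed

lemma p_subgroup_generate:
  assumes "p_subgroup p Q" "h \<in> Q"
  shows "subgroup (generate G {h}) G" "generate G {h} \<subseteq> Q" "p_subgroup p (generate G {h})"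
    "card (generate G {h}) = ord h"
proof -
  have QG: "subgroup Q G" using assms p_subgroupD by blast
  have hG: "h \<in> carrier G" using assms mem_subgroup_carrier[OF QG] by blast
  show 1: "subgroup (generate G {h}) G" using generate_is_subgroup[of "{h}"] hG by simp
  show 2: "generate G {h} \<subseteq> Q" using generate_subgroup_incl[of "{h}" Q] assms QG by simp
  show "p_subgroup p (generate G {h})" using p_subgroup_subset[OF p assms(1) 1 2] .
  show "card (generate G {h}) = ord h" using generate_pow_card[OF hG] by simp
qed

text \<open>In a minimal invariant subgroup \<open>R\<close> that is not centralized, all elements
  of order at most \<open>d\<close> are fixed by \<open>x\<close>. Some commutator with
  \<open>x\<close> is not fixed, although its order divides \<open>p\<close>, or 4 if p = 2. This
  forces p = d = 2 and a commutator of order 4. Either it generates an IC\<Phi>-subgroup and is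
  fixed after all, or, all involutions of \<open>R\<close> being fixed, \<open>R\<close> has a
  quaternion section.\<close>

theorem centralizes_if_all_IC_Phi:
  assumes Q: "p_subgroup p Q" "normalizes x Q" and d: "d = p ^ k" "1 < d" "d \<le> card Q"
    and IC: "\<And>H. subgroup H G \<Longrightarrow> H \<subseteq> Q \<Longrightarrow> card H = d \<Longrightarrow> IC_Phi_subgroup H G"
    and four: "p = 2 \<Longrightarrow> d = 2 \<Longrightarrow> Q8_free (G\<lparr>carrier := Q\<rparr>) \<or>
      (\<forall>C. subgroup C G \<longrightarrow> C \<subseteq> Q \<longrightarrow> cyclic_group (G\<lparr>carrier := C\<rparr>) \<longrightarrow> card C = 4 \<longrightarrow> IC_Phi_subgroup C G)"
  shows "centralizes x Q"
proof (rule ccontr)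
  assume nc: "\<not> centralizes x Q"
  have QG: "subgroup Q G" using Q p_subgroupD by blast
  let ?P = "\<lambda>R. subgroup R G \<and> R \<subseteq> Q \<and> normalizes x R \<and> \<not> centralizes x R"
  have "?P Q" using QG Q nc by blast
  then obtain R where R: "?P R" and minR: "\<And>R'. ?P R' \<Longrightarrow> card R \<le> card R'"
    using ex_has_least_nat[of ?P Q card] by blast
  have pR: "p_subgroup p R" using p_subgroup_subset[OF p Q(1)] R by blast
  interpret m: minimal_coprime_action G p q n x R
  proof unfold_locales
    show "p_subgroup p R" "normalizes x R" "\<not> centralizes x R" using pR R by auto
    fix S assume S: "subgroup S G" "S \<subset> R" "normalizes x S"
    show "centralizes x S"
    proof (rule ccontr)
      assume "\<not> centralizes x S"
      then have "card R \<le> card S" using S R by (intro minR) blast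
      moreover have "card S < card R" using S(2) R by (intro psubset_card_mono) simp_all
      ultimately show False by simp
    qed
  qed
  have dR: "d < card R"
    using centralizes_small_invariant[OF Q d(1,3) IC] R by (meson not_le)
  \<comment> \<open>The cyclic group of \<open>h\<close> extends inside \<open>R\<close> to a
    subgroup of order \<open>d\<close>. This subgroup has property IC\<Phi> but need not be
    invariant, which \<open>IC_Phi_in_C\<close> allows for.\<close>
  have inC: "h \<in> m.C" if h: "h \<in> R" "ord h \<le> d" for h
  proof -
    note g = p_subgroup_generate[OF pR h(1)]
    obtain U where U: "subgroup U G" "generate G {h} \<subseteq> U" "U \<subseteq> R" "card U = p ^ k"
      using ex_intermediate_subgroup[OF p pR g(1,2), of k] g(4) h(2) d(1) dR by auto
    have "IC_Phi_subgroup U G" using IC[OF U(1) _ ] U(3,4) d(1) R by blast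
    then have "U \<subseteq> m.C" using m.IC_Phi_in_C U(3) by blast
    then show ?thesis using U(2) generate.incl[of h "{h}" G] by blast
  qed
  obtain r where r: "r \<in> R" "drift r \<notin> m.C" using m.ex_drift_not_in_C by blast
  have h: "drift r \<in> R" using m.drift_in_R[OF r(1)] .
  have p1: "1 < p" using p prime_gt_1_nat by blast
  have k0: "k \<noteq> 0" using d(1,2) by (intro notI) simp
  then have pd: "p \<le> d" unfolding d(1) using p1 by (metis self_le_power less_imp_le not_gr_zero)
  have ordpos: "0 < ord a" if "a \<in> R" for a using ord_ge_1[OF finite_carrier m.R.mem_carrier[OF that]] by simp
  have ordle: "ord a \<le> i" if "a \<in> R" "a [^] i = \<one>" "0 < i" for a and i :: nat
    using that pow_eq_id[OF m.R.mem_carrier[OF that(1)]] by (auto intro: dvd_imp_le)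
  have p2: "p = 2"
  proof (rule ccontr)
    assume "p \<noteq> 2"
    then have "ord (drift r) \<le> p" using m.drift_pow(1)[OF r(1)] p1 by (intro ordle[OF h]) simp_all
    then show False using inC[OF h] pd r(2) by simp
  qed
  have o4: "ord (drift r) dvd 4" using m.drift_pow(2)[OF r(1) p2] pow_eq_id[OF m.R.mem_carrier[OF h]] by simp
  have "d = 2"
  proof (rule ccontr)
    assume "d \<noteq> 2"
    then have "k \<noteq> 1" using d(1) p2 by auto
    then have "2 \<le> k" using k0 by simp
    then have "(2::nat) ^ 2 \<le> d" unfolding d(1) p2 by (rule power_increasing) simp
    then have "ord (drift r) \<le> d" using dvd_imp_le[OF o4] by simp
    then show False using inC[OF h] r(2) by simp
  qed
  consider "Q8_free (G\<lparr>carrier := Q\<rparr>)"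
    | "\<forall>C. subgroup C G \<longrightarrow> C \<subseteq> Q \<longrightarrow> cyclic_group (G\<lparr>carrier := C\<rparr>) \<longrightarrow> card C = 4 \<longrightarrow> IC_Phi_subgroup C G"
    using four[OF p2 \<open>d = 2\<close>] by blast
  then show False
  proof cases
    case 1
    have "a \<in> m.C" if "a \<in> R" "a [^] (2::nat) = \<one>" for a
      using inC[OF that(1)] ordle[OF that] \<open>d = 2\<close> by simp
    then obtain A B where AB: "subgroup A G" "A \<subseteq> R" "B \<lhd> G\<lparr>carrier := A\<rparr>" "(G\<lparr>carrier := A\<rparr>) Mod B \<cong> Q8"
      using m.Q8_section[OF p2] by blast
    have "subgroup A (G\<lparr>carrier := Q\<rparr>)" using AB(1,2) R subgroup_subgroup_iff[OF QG] by blast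
    then show False using 1 AB(3,4) unfolding Q8_free_def by auto
  next
    case 2
    have "ord (drift r) \<noteq> 1" "ord (drift r) \<noteq> 2" using inC[OF h] r(2) \<open>d = 2\<close> by auto
    moreover have "ord (drift r) \<le> 4" using dvd_imp_le[OF o4] by simp
    moreover have "ord (drift r) \<noteq> 3" using o4 by auto
    ultimately have "ord (drift r) = 4" using ordpos[OF h] by linarith
    note g = p_subgroup_generate[OF pR h]
    have hG: "drift r \<in> carrier G" using h by simp
    have "cyclic_group (subgroup_generated G {drift r})" by (rule cyclic_group_generated)
    then have "cyclic_group (G\<lparr>carrier := generate G {drift r}\<rparr>)"
      using hG by (simp add: subgroup_generated_def)
    moreover have "card (generate G {drift r}) = 4" using g(4) \<open>ord (drift r) = 4\<close> by simp
    moreover have "generate G {drift r} \<subseteq> Q" using g(2) R by blast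
    ultimately have "IC_Phi_subgroup (generate G {drift r}) G" using 2 g(1) by blast
    then have "generate G {drift r} \<subseteq> m.C" using m.IC_Phi_in_C g(2) by blast
    then show False using r(2) generate.incl[of "drift r" "{drift r}" G] by blast
  qed
qed

end

section \<open>From IC\<Phi>-subgroups to \<open>p\<close>-nilpotency\<close>

context finite_group
begin

lemma normalizes_set_mult:
  assumes "x \<in> carrier G" "A \<subseteq> carrier G" "B \<subseteq> carrier G" "normalizes x A" "normalizes x B"
  shows "normalizes x (A <#> B)"
  unfolding normalizes_def
proof
  fix g assume "g \<in> A <#> B"
  then obtain a b where ab: "a \<in> A" "b \<in> B" "g = a \<otimes> b" unfolding mem_set_mult by blast
  then have "a \<in> carrier G" "b \<in> carrier G" using assms by auto
  then have "x \<otimes> g \<otimes> inv x = (x \<otimes> a \<otimes> inv x) \<otimes> (x \<otimes> b \<otimes> inv x)"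
    using ab(3) assms(1) by (simp add: group_norm)
  then show "x \<otimes> g \<otimes> inv x \<in> A <#> B"
    unfolding mem_set_mult using normalizesD[OF assms(4) ab(1)] normalizesD[OF assms(5) ab(2)] by blast
qed

lemma card_set_mult_p_subgroup:
  assumes p: "Factorial_Ring.prime p" and N: "subgroup N G" and P: "p_subgroup p P"
  shows "\<exists>a. card (N <#> P) = card N * p ^ a"
proof -
  have PG: "subgroup P G" using P p_subgroupD by blast
  have I: "subgroup (N \<inter> P) G" using subgroups_Inter_pair[OF N PG] .
  obtain j where j: "card P = card (N \<inter> P) * j" using card_subgroup_dvd[OF I PG] by blast
  moreover obtain n where "card P = p ^ n" using P by (auto simp: p_subgroup_def)
  ultimately have "j dvd p ^ n" by simp
  then obtain a where a: "j = p ^ a" using divides_primepow_nat[OF p] by blast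
  have "card (N <#> P) * card (N \<inter> P) = (card N * p ^ a) * card (N \<inter> P)"
    using card_set_mult[OF N PG] j a by (simp add: ac_simps)
  then have "card (N <#> P) = card N * p ^ a" using card_subgroup_pos[OF I] by simp
  then show ?thesis ..
qed

lemma frattini_argument:
  assumes p: "Factorial_Ring.prime p" and K: "subgroup K G"
    and W: "subgroup W G" "W \<subseteq> K" "\<And>k. k \<in> K \<Longrightarrow> normalizes k W"
    and Q: "sylow_in p Q W" and k: "k \<in> K"
  obtains w m where "w \<in> W" "m \<in> K" "normalizes m Q" "k = w \<otimes> m"
proof -
  have QG: "subgroup Q G" "Q \<subseteq> W" using sylow_inD[OF Q] by auto
  have kG: "k \<in> carrier G" using k mem_subgroup_carrier[OF K] by blast
  have "sylow_in p (conj_set k Q) W"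
    unfolding sylow_in_iff[OF p W(1)]
  proof (intro conjI)
    show "subgroup (conj_set k Q) G" using subgroup_conj_set[OF kG QG(1)] .
    show "conj_set k Q \<subseteq> W" using normalizesD[OF W(3)[OF k]] QG(2) by (auto simp: conj_set_def)
    show "card (conj_set k Q) = p ^ multiplicity p (card W)"
      using card_conj_set[OF kG subgroup.subset[OF QG(1)]] card_sylow_eq[OF p W(1) Q] by simp
  qed
  then obtain w where w: "w \<in> W" "conj_set w Q = conj_set k Q" using sylow_conj[OF p W(1) Q] by blast
  have wG: "w \<in> carrier G" using w mem_subgroup_carrier[OF W(1)] by blast
  let ?m = "inv w \<otimes> k"
  have "conj_set ?m Q = Q"
    using conj_set_mult[of "inv w" k Q] w(2) conj_set_inv_cancel(1)[OF wG subgroup.subset[OF QG(1)]]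
      wG kG subgroup.subset[OF QG(1)] by simp
  then have "normalizes ?m Q" using conj_set_subset_iff by blast
  moreover have "?m \<in> K" using w(1) W(2) k subgroup.m_closed[OF K] subgroup.m_inv_closed[OF K] by blast
  moreover have "k = w \<otimes> ?m" using wG kG by simp
  ultimately show thesis using that w(1) by blast
qed

lemma p_regular_coprime_action:
  assumes "Factorial_Ring.prime p" "x \<in> p_regular p K" "subgroup K G"
  shows "\<exists>q n. coprime_action G p q n x"
proof -
  obtain q n where "Factorial_Ring.prime q" "q \<noteq> p" "x [^] (q ^ n :: nat) = \<one>" "x \<in> K"
    using assms(2) unfolding p_regular_def by blast
  then have "coprime_action G p q n x"
    using assms mem_subgroup_carrier[OF assms(3)]
    by (intro coprime_action.intro finite_group_axioms coprime_action_axioms.intro) auto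
  then show ?thesis by blast
qed

lemma Q8_free_subgroup:
  assumes "subgroup P G" "subgroup S G" "S \<subseteq> P" "Q8_free (G\<lparr>carrier := P\<rparr>)"
  shows "Q8_free (G\<lparr>carrier := S\<rparr>)"
  using assms(4) subgroup_subgroup_iff[OF assms(1)] subgroup_subgroup_iff[OF assms(2)] assms(3)
  unfolding Q8_free_def by auto

text \<open>The order \<open>d\<close> is a parameter of its own, so that the condition passes from
  \<open>P\<close> to its subgroups while IC\<Phi> keeps referring to the whole of \<open>G\<close>.
  The condition on cyclic groups of order 4 is one side of a disjunction, both sides of which are
  inherited.\<close>

definition IC_Phi_at :: "nat \<Rightarrow> nat \<Rightarrow> 'a set \<Rightarrow> bool" where
  "IC_Phi_at p d P \<longleftrightarrow> (\<forall>H. subgroup H G \<longrightarrow> H \<subseteq> P \<longrightarrow> card H = d \<longrightarrow> IC_Phi_subgroup H G) \<and>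
     (p = 2 \<longrightarrow> d = 2 \<longrightarrow> Q8_free (G\<lparr>carrier := P\<rparr>) \<or>
      (\<forall>C. subgroup C G \<longrightarrow> C \<subseteq> P \<longrightarrow> cyclic_group (G\<lparr>carrier := C\<rparr>) \<longrightarrow> card C = 4 \<longrightarrow> IC_Phi_subgroup C G))"

lemma IC_Phi_at_mono:
  assumes "subgroup P G" "subgroup S G" "S \<subseteq> P" "IC_Phi_at p d P"
  shows "IC_Phi_at p d S"
  using assms(4) Q8_free_subgroup[OF assms(1-3)] assms(3) unfolding IC_Phi_at_def by blast

lemma IC_Phi_at_centralizes:
  assumes p: "Factorial_Ring.prime p" and S: "p_subgroup p S" and d: "d = p ^ k" "1 < d" "d \<le> card S"
    and IC: "IC_Phi_at p d S" and K: "subgroup K G" and x: "x \<in> p_regular p K" "normalizes x S"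
  shows "centralizes x S"
proof -
  obtain q n where "coprime_action G p q n x" using p_regular_coprime_action[OF p x(1) K] by blast
  then interpret coprime_action G p q n x .
  show ?thesis
    by (rule centralizes_if_all_IC_Phi[OF S x(2) d]) (use IC in \<open>auto simp: IC_Phi_at_def\<close>)
qed

text \<open>A proper normal subgroup \<open>L\<close> of \<open>K\<close> is
  \<open>p\<close>-nilpotent: by induction if its Sylow subgroup has order at least
  \<open>d\<close>, and otherwise by Tate's theorem in L U with \<open>U\<close> of order
  \<open>d\<close>. For Frobenius' criterion in \<open>K\<close> the subgroups of \<open>P\<close>
  of order at least \<open>d\<close> are settled by coprime action; smaller ones are enclosed in
  subgroups of order \<open>d\<close>.\<close>

theorem p_nilpotent_if_IC_Phi:
  assumes p: "Factorial_Ring.prime p" and d: "d = p ^ k" "1 < d"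
    and "subgroup K G" "sylow_in p P K" "d \<le> card P" "IC_Phi_at p d P"
  shows "\<not> p dvd card (p_residual p K)"
  using assms(4-)
proof (induction "card K" arbitrary: K P rule: less_induct)
  case less
  note K = less.prems(1) and P = less.prems(2) and dP = less.prems(3) and IC = less.prems(4)
  have PG: "subgroup P G" "P \<subseteq> K" "p_subgroup p P" "P \<subseteq> carrier G"
    using sylow_inD[OF P] subgroup.subset[of P G] by auto
  have KG: "k \<in> carrier G" if "k \<in> K" for k using that mem_subgroup_carrier[OF K] by blast
  have res_dvd: "\<not> p dvd card (p_residual p A)"
    if "p_residual p A \<subseteq> B" "subgroup A G" "subgroup B G" "\<not> p dvd card B" for A B
    using card_subgroup_dvd[OF p_residual_subgroup[OF that(2)] that(3,1)] that(4) dvd_trans by blast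
  have loc: "centralizes x S" if "subgroup S G" "S \<subseteq> P" "d \<le> card S" "x \<in> p_regular p K" "normalizes x S" for S x
    by (rule IC_Phi_at_centralizes[OF p p_subgroup_subset[OF p PG(3) that(1,2)] d that(3)
          IC_Phi_at_mono[OF PG(1) that(1,2) IC] K that(4,5)])
  have icU: "IC_Phi_subgroup U G" if "subgroup U G" "U \<subseteq> P" "card U = d" for U
    using IC that unfolding IC_Phi_at_def by blast
  have normal_nil: "\<not> p dvd card (p_residual p L)"
    if L: "subgroup L G" "L \<subset> K" "\<And>k. k \<in> K \<Longrightarrow> normalizes k L" for L
  proof -
    let ?S = "P \<inter> L"
    have LK: "L \<subseteq> K" using L(2) by blast
    have S: "sylow_in p ?S L" by (rule sylow_Int_normal[OF p K P L(1) LK L(3)])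
    have SG: "subgroup ?S G" "p_subgroup p ?S" using sylow_inD[OF S] by auto
    show ?thesis
    proof (cases "d \<le> card ?S")
      case True
      have "card L < card K" using psubset_card_mono[OF finite_subgroup[OF K] L(2)] .
      then show ?thesis
        using less.hyps[OF _ L(1) S True] IC_Phi_at_mono[OF PG(1) SG(1) _ IC] by blast
    next
      case False
      then obtain U where U: "subgroup U G" "?S \<subseteq> U" "U \<subseteq> P" "card U = d"
        using ex_intermediate_subgroup[OF p PG(3) SG(1), of k] dP d(1) by auto
      have LU: "subgroup (L <#> U) G" by (rule subgroup_set_mult[OF L(1) U(1)]) (use L(3) U(3) PG(2) in blast)
      have pU: "p_subgroup p U" using p_subgroup_subset[OF p PG(3) U(1,3)] .
      \<comment> \<open>It follows that |L U : U| = |L : P \<inter> L|, which is prime to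
        \<open>p\<close>, so \<open>U\<close> is a Sylow subgroup of L U.\<close>
      have "L \<inter> U = ?S" using U(2,3) by blast
      then have "card (L <#> U) * card ?S = card L * card U" using card_set_mult[OF L(1) U(1)] by simp
      moreover obtain i where i: "card L = card ?S * i" using card_subgroup_dvd[OF SG(1) L(1)] by blast
      ultimately have "card (L <#> U) = i * card U" using card_subgroup_pos[OF SG(1)] by simp
      then have "card (L <#> U) div card U = i" using card_subgroup_pos[OF U(1)] by simp
      moreover have "card L div card ?S = i" using i card_subgroup_pos[OF SG(1)] by simp
      ultimately have "\<not> p dvd card (L <#> U) div card U" using sylow_inD(4)[OF S] by simp
      then have sU: "sylow_in p U (L <#> U)"
        using pU subset_set_mult(2)[OF L(1) U(1)] by (simp add: sylow_in_def)
      have "commutator_subgroup G U (L <#> U) \<subseteq> commutator_subgroup G U (carrier G)"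
        by (rule commutator_subgroup_mono[OF subgroup.subset[OF LU]])
      then have "U \<inter> commutator_subgroup G U (L <#> U) \<subseteq> frattini (G\<lparr>carrier := U\<rparr>)"
        using icU[OF U(1,3,4)] unfolding IC_Phi_subgroup_def by blast
      then have "\<not> p dvd card (p_residual p (L <#> U))"
        by (rule p_nilpotent_if_IC_Phi_sylow[OF p LU sU])
      moreover have "p_residual p L \<subseteq> p_residual p (L <#> U)"
        using p_residual_mono[OF subset_set_mult(1)[OF L(1) U(1)]] .
      ultimately show ?thesis using res_dvd L(1) p_residual_subgroup[OF LU] by blast
    qed
  qed
  have nres: "normalizes k (p_residual p K)" if "k \<in> K" for k
    using p_residual_normalizes[OF K KG[OF that] normalizes_self[OF K that]] .
  show ?case
  proof (cases "p_residual p K = K")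
    case False
    have O: "subgroup (p_residual p K) G" using p_residual_subgroup[OF K] .
    have "p_residual p K \<subset> K" using False p_residual_subset[OF K] by blast
    then have "\<not> p dvd card (p_residual p (p_residual p K))" by (rule normal_nil[OF O _ nres])
    moreover have "p_residual p K \<subseteq> p_residual p (p_residual p K)"
      using p_residual_least[OF p_residual_subgroup[OF O]] p_residual_idem[OF K, of p] p_regular_subset_residual
      by blast
    ultimately show ?thesis using res_dvd K p_residual_subgroup[OF O] by blast
  next
    case resK: True
    \<comment> \<open>The group W = [U, K] U is normal in \<open>K\<close> and
      \<open>p\<close>-nilpotent. The Frattini argument for its Sylow subgroup P \<inter> W gives K
      = O^p(W) N with \<open>N\<close> the normalizer of that subgroup. If N = K, coprime action on
      P \<inter> W, which contains \<open>U\<close>, is trivial. If not, \<open>N\<close> is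
      \<open>p\<close>-nilpotent by induction and \<open>K\<close> inherits this.\<close>
    have central: "(\<forall>c\<in>U. \<forall>x\<in>p_regular p K. x \<otimes> c = c \<otimes> x) \<or> \<not> p dvd card (p_residual p K)"
      if U: "subgroup U G" "U \<subseteq> P" "card U = d" for U
    proof -
      let ?M = "commutator_subgroup G U K"
      have UK: "U \<subseteq> K" using U(2) PG(2) by blast
      have pU: "p_subgroup p U" using p_subgroup_subset[OF p PG(3) U(1,2)] .
      have M: "subgroup ?M G" using commutator_subgroup_is_subgroup[OF U(1) K] .
      have nM: "normalizes k ?M" if "k \<in> K" for k using commutator_subgroup_normalized[OF U(1) K that] .
      have MK: "?M \<subseteq> K"
        unfolding commutator_subgroup_def
      proof (rule generate_subgroup_incl[OF _ K])
        show "{h \<otimes> k \<otimes> inv h \<otimes> inv k |h k. h \<in> U \<and> k \<in> K} \<subseteq> K"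
          using UK subgroup.m_closed[OF K] subgroup.m_inv_closed[OF K] by auto
      qed
      \<comment> \<open>Otherwise IC\<Phi> would give U = \<Phi>(U), which is impossible as
        \<open>U\<close> has order d > 1. So [U, K] is a proper normal subgroup of \<open>K\<close>
        and \<open>normal_nil\<close> applies to it.\<close>
      have "\<not> U \<subseteq> ?M"
      proof
        assume "U \<subseteq> ?M"
        then have "U \<subseteq> commutator_subgroup G U (carrier G)"
          using commutator_subgroup_mono[OF subgroup.subset[OF K]] by blast
        then have "U \<subseteq> frattini (G\<lparr>carrier := U\<rparr>)" using icU[OF U] unfolding IC_Phi_subgroup_def by blast
        then have "frattini (G\<lparr>carrier := U\<rparr>) = U" using frattini_subset by blast
        moreover have "U \<noteq> {\<one>}" using U(3) d(2) by auto
        ultimately show False using frattini_proper[OF U(1)] by blast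
      qed
      then have "?M \<subset> K" using MK UK by blast
      then have nilM: "\<not> p dvd card (p_residual p ?M)" by (rule normal_nil[OF M _ nM])
      let ?W = "?M <#> U"
      have W: "subgroup ?W G" by (rule subgroup_set_mult[OF M U(1)]) (use nM UK in blast)
      have WK: "?W \<subseteq> K" using set_mult_subset_subgroup[OF K MK UK] .
      have MW: "?M \<subseteq> ?W" "U \<subseteq> ?W" using subset_set_mult[OF M U(1)] by auto
      have nW: "normalizes k ?W" if k: "k \<in> K" for k
        unfolding normalizes_def
      proof
        fix g assume "g \<in> ?W"
        then obtain m u where mu: "m \<in> ?M" "u \<in> U" "g = m \<otimes> u" unfolding mem_set_mult by blast
        have G: "m \<in> carrier G" "u \<in> carrier G" "k \<in> carrier G" using mu MK UK k KG by auto
        have "k \<otimes> g \<otimes> inv k = ((k \<otimes> m \<otimes> inv k) \<otimes> inv (u \<otimes> k \<otimes> inv u \<otimes> inv k)) \<otimes> u"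
          using G mu(3) by (simp add: group_norm)
        moreover have "(k \<otimes> m \<otimes> inv k) \<otimes> inv (u \<otimes> k \<otimes> inv u \<otimes> inv k) \<in> ?M"
          using normalizesD[OF nM[OF k] mu(1)] commutator_subgroup_mem[OF mu(2) k]
            subgroup.m_closed[OF M] subgroup.m_inv_closed[OF M] by blast
        ultimately show "k \<otimes> g \<otimes> inv k \<in> ?W" unfolding mem_set_mult using mu(2) by blast
      qed
      obtain a where a: "card ?W = card ?M * p ^ a" using card_set_mult_p_subgroup[OF p M pU] by blast
      have "p_regular p ?W \<subseteq> ?M"
        by (rule p_regular_subset_normal[OF p W M MW(1) _ a]) (use nM WK in blast)
      then have "p_regular p ?W \<subseteq> p_regular p ?M" by (auto simp: p_regular_def)
      then have "p_residual p ?W \<subseteq> p_residual p ?M"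
        using p_residual_least[OF p_residual_subgroup[OF M]] p_regular_subset_residual by blast
      then have nilW: "\<not> p dvd card (p_residual p ?W)"
        using res_dvd W p_residual_subgroup[OF M] nilM by blast
      let ?R = "p_residual p ?W"
      have R: "subgroup ?R G" "?R \<subseteq> ?W" using p_residual_subgroup[OF W] p_residual_subset[OF W] by auto
      have nR: "normalizes k ?R" if "k \<in> K" for k using p_residual_normalizes[OF W KG[OF that] nW[OF that]] .
      let ?O = "P \<inter> ?W"
      have O: "sylow_in p ?O ?W" by (rule sylow_Int_normal[OF p K P W WK nW])
      have OG: "subgroup ?O G" "?O \<subseteq> K" using sylow_inD[OF O] PG(2) by auto
      have UO: "U \<subseteq> ?O" using U(2) MW(2) by blast
      define N where "N = {k \<in> K. normalizes k ?O}"
      have N: "subgroup N G" "N \<subseteq> K" unfolding N_def using normalizer_subgroup[OF K OG(1)] by auto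
      have RN: "\<exists>r\<in>?R. \<exists>m\<in>N. g = r \<otimes> m" if g: "g \<in> K" for g
      proof -
        obtain w m where wm: "w \<in> ?W" "m \<in> K" "normalizes m ?O" "g = w \<otimes> m"
          using frattini_argument[OF p K W WK nW O g] by blast
        have "w \<in> ?R <#> ?O" using p_residual_supplement[OF p W O] wm(1) by simp
        then obtain r c where rc: "r \<in> ?R" "c \<in> ?O" "w = r \<otimes> c" unfolding mem_set_mult by blast
        have "c \<in> N" using rc(2) OG normalizes_self[OF OG(1)] by (auto simp: N_def)
        moreover have "m \<in> N" using wm by (simp add: N_def)
        ultimately have "c \<otimes> m \<in> N" using subgroup.m_closed[OF N(1)] by blast
        moreover have "r \<in> carrier G" "c \<in> carrier G" "m \<in> carrier G"
          using rc(1,2) R(2) WK OG(2) wm(2) KG by blast+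
        then have "g = r \<otimes> (c \<otimes> m)" unfolding wm(4) rc(3) by (simp add: m_assoc)
        ultimately show ?thesis using rc(1) by blast
      qed
      show ?thesis
      proof (cases "N = K")
        case True
        have "x \<otimes> c = c \<otimes> x" if c: "c \<in> U" and x: "x \<in> p_regular p K" for c x
        proof -
          have "x \<in> K" using x p_regular_subset by blast
          then have "normalizes x ?O" using True unfolding N_def by blast
          moreover have "d \<le> card ?O" using card_mono[OF finite_subgroup[OF OG(1)] UO] U(3) by simp
          ultimately have "centralizes x ?O" using loc[OF OG(1) _ _ x] by blast
          then show ?thesis using c UO centralizesD by blast
        qed
        then show ?thesis by blast
      next
        case False
        then have "card N < card K" using N by (intro psubset_card_mono finite_subgroup[OF K]) blast
        moreover have PN: "P \<subseteq> N"
        proof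
          fix g assume g: "g \<in> P"
          then have "g \<in> K" using PG(2) by blast
          then show "g \<in> N" using normalizes_Int[OF normalizes_self[OF PG(1) g] nW] by (simp add: N_def)
        qed
        moreover have PSN: "sylow_in p P N"
        proof -
          obtain i where "card N = card P * i" using card_subgroup_dvd[OF PG(1) N(1) PN] by blast
          moreover obtain j where "card K = card N * j" using card_subgroup_dvd[OF N(1) K N(2)] by blast
          ultimately have "card N div card P dvd card K div card P"
            using card_subgroup_pos[OF PG(1)] by (simp add: mult.assoc)
          then have "\<not> p dvd card N div card P" using sylow_inD(4)[OF P] dvd_trans by blast
          then show ?thesis using PG PN by (simp add: sylow_in_def)
        qed
        ultimately have nilN: "\<not> p dvd card (p_residual p N)" using less.hyps[OF _ N(1) PSN dP IC] by blast
        let ?B = "p_residual p N"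
        have B: "subgroup ?B G" "?B \<subseteq> N" using p_residual_subgroup[OF N(1)] p_residual_subset[OF N(1)] by auto
        \<comment> \<open>A product of two groups of order prime to \<open>p\<close>. It is normal
          in \<open>K\<close>, because \<open>K\<close> is the product of \<open>?R\<close> and
          \<open>N\<close>, and K = T P; so it has \<open>p\<close>-power index and contains the
          residual of \<open>K\<close>.\<close>
        let ?T = "?R <#> ?B"
        have T: "subgroup ?T G" by (rule subgroup_set_mult[OF R(1) B(1)]) (use nR B(2) N(2) in blast)
        have RK: "?R \<subseteq> K" and BK: "?B \<subseteq> K" using R(2) WK B(2) N(2) by blast+
        have TK: "?T \<subseteq> K" using set_mult_subset_subgroup[OF K RK BK] .
        have RT: "?R \<subseteq> ?T" "?B \<subseteq> ?T" using subset_set_mult[OF R(1) B(1)] by auto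
        have nT: "normalizes g ?T" if g: "g \<in> K" for g
        proof -
          obtain r m where rm: "r \<in> ?R" "m \<in> N" "g = r \<otimes> m" using RN[OF g] by blast
          have mK: "m \<in> K" "m \<in> carrier G" using rm(2) N(2) KG by auto
          have "normalizes m ?B" using p_residual_normalizes[OF N(1) mK(2) normalizes_self[OF N(1) rm(2)]] .
          then have "normalizes m ?T"
            using normalizes_set_mult[OF mK(2) subgroup.subset[OF R(1)] subgroup.subset[OF B(1)] nR[OF mK(1)]] by blast
          moreover have "normalizes r ?T" using normalizes_self[OF T] rm(1) RT by blast
          ultimately show ?thesis
            unfolding rm(3) using rm(1) RK KG mK(2) by (intro normalizes_mult subgroup.subset[OF T]) auto
        qed
        have "K \<subseteq> ?T <#> P"
        proof
          fix g assume g: "g \<in> K"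
          obtain r m where rm: "r \<in> ?R" "m \<in> N" "g = r \<otimes> m" using RN[OF g] by blast
          have "m \<in> ?B <#> P" using p_residual_supplement[OF p N(1) PSN] rm(2) by simp
          then obtain b u where bu: "b \<in> ?B" "u \<in> P" "m = b \<otimes> u" unfolding mem_set_mult by blast
          have "g = (r \<otimes> b) \<otimes> u" unfolding rm(3) bu(3) using rm(1) bu(1,2) RK BK PG(2) KG by (simp add: m_assoc subset_iff)
          moreover have "r \<otimes> b \<in> ?T" unfolding mem_set_mult using rm(1) bu(1) by blast
          ultimately show "g \<in> ?T <#> P" unfolding mem_set_mult[of g] using bu(2) by blast
        qed
        then have TP: "?T <#> P = K" using set_mult_subset_subgroup[OF K TK PG(2)] by blast
        obtain b where b: "card K = card ?T * p ^ b" using card_set_mult_p_subgroup[OF p T PG(3)] TP by auto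
        have "p_regular p K \<subseteq> ?T" by (rule p_regular_subset_normal[OF p K T TK nT b])
        then have "p_residual p K \<subseteq> ?T" by (rule p_residual_least[OF T])
        moreover have "\<not> p dvd card ?T"
        proof
          assume "p dvd card ?T"
          then have "p dvd card ?R * card ?B" using card_set_mult[OF R(1) B(1)] by (metis dvd_mult2)
          then show False using nilW nilN prime_dvd_mult_iff[OF p] by blast
        qed
        ultimately have "\<not> p dvd card (p_residual p K)" using res_dvd[OF _ K T] by blast
        then show ?thesis by blast
      qed
    qed
    show ?thesis
    proof (rule ccontr)
      assume nn: "\<not> \<not> p dvd card (p_residual p K)"
      have "\<not> p dvd card (p_residual p K)"
      proof (rule frobenius_p_nilpotent[OF p K P])
        fix S x assume S: "subgroup S G" "S \<subseteq> P" and x: "x \<in> p_regular p K" "normalizes x S"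
        show "centralizes x S"
        proof (cases "d \<le> card S")
          case True
          then show ?thesis using loc[OF S _ x] by blast
        next
          case False
          then obtain U where U: "subgroup U G" "S \<subseteq> U" "U \<subseteq> P" "card U = d"
            using ex_intermediate_subgroup[OF p PG(3) S, of k] dP d(1) by auto
          then have "\<forall>c\<in>U. \<forall>x\<in>p_regular p K. x \<otimes> c = c \<otimes> x" using central[OF U(1,3,4)] nn by blast
          then show ?thesis using U(2) x(1) unfolding centralizes_def by blast
        qed
      qed
      then show False using nn by blast
    qed
  qed
qed

end

section \<open>Formations\<close>

lemma surj_homI:
  assumes "group G" "group H" "f \<in> hom G H" "f ` carrier G = carrier H"
  shows "group_hom G H f"
  using assms by (simp add: group_hom_def group_hom_axioms_def)

lemma surj_hom_comp:
  assumes "group H" "group Z" "j \<in> hom H B" "j ` carrier H = carrier B" "g \<in> hom B Z" "g ` carrier B = carrier Z"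
  shows "group_hom H Z (g \<circ> j)" "(g \<circ> j) ` carrier H = carrier Z"
proof -
  show "(g \<circ> j) ` carrier H = carrier Z" using assms(4,6) by (metis image_comp)
  then show "group_hom H Z (g \<circ> j)" using surj_homI[OF assms(1,2) hom_compose[OF assms(3,5)]] by blast
qed

lemma in_class_iso:
  assumes "group G" "G \<cong> H" "in_class G \<FF>"
  shows "in_class H \<FF>"
  using assms group.iso_sym iso_trans unfolding in_class_def by blast

lemma in_class_surj_hom:
  fixes B :: "('a, 'b) monoid_scheme" and Y :: "('c, 'd) monoid_scheme"
  assumes F: "formation \<FF>" and B: "group B" "in_class B \<FF>" and Y: "group Y"
    and f: "f \<in> hom B Y" "f ` carrier B = carrier Y"
  shows "in_class Y \<FF>"
proof -
  obtain H where H: "H \<in> \<FF>" "B \<cong> H" using B(2) unfolding in_class_def by blast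
  have gH: "group H" using F H(1) unfolding formation_def group_class_def by blast
  obtain j where j: "j \<in> iso H B" using group.iso_sym[OF B(1) H(2)] unfolding is_iso_def by blast
  have jj: "j \<in> hom H B" "j ` carrier H = carrier B" using j by (auto simp: iso_def bij_betw_def)
  let ?g = "f \<circ> j"
  have g: "?g \<in> hom H Y" using hom_compose[OF jj(1) f(1)] .
  have gs: "?g ` carrier H = carrier Y" using jj(2) f(2) by (metis image_comp)
  interpret gh: group_hom H Y ?g using surj_homI[OF gH Y g gs] .
  have "in_class (H Mod kernel H Y ?g) \<FF>"
    using F H(1) gh.normal_kernel unfolding formation_def by blast
  moreover have "group (H Mod kernel H Y ?g)" using gh.normal_kernel normal.factorgroup_is_group by blast
  ultimately show ?thesis using in_class_iso gh.FactGroup_iso[OF gs] by blast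
qed

text \<open>Both closure properties of a formation at once, in terms of surjections:
  \<open>B\<close> modulo the intersection of the kernels of \<open>f1\<close> and \<open>f2\<close>
  is in the class, and \<open>Y\<close> is an image of that quotient. The copy \<open>H\<close> is
  taken because \<open>formation\<close> quantifies over groups on natural numbers.\<close>

lemma in_class_subdirect:
  fixes B :: "('a, 'b) monoid_scheme"
  assumes F: "formation \<FF>" and B: "group B" "finite (carrier B)"
    and Y1: "group Y1" "f1 \<in> hom B Y1" "f1 ` carrier B = carrier Y1" "in_class Y1 \<FF>"
    and Y2: "group Y2" "f2 \<in> hom B Y2" "f2 ` carrier B = carrier Y2" "in_class Y2 \<FF>"
    and Y: "group Y" "f \<in> hom B Y" "f ` carrier B = carrier Y"
    and ker: "\<And>x. x \<in> carrier B \<Longrightarrow> f1 x = \<one>\<^bsub>Y1\<^esub> \<Longrightarrow> f2 x = \<one>\<^bsub>Y2\<^esub> \<Longrightarrow> f x = \<one>\<^bsub>Y\<^esub>"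
  shows "in_class Y \<FF>"
proof -
  obtain H :: "nat monoid" where H: "group H" "B \<cong> H" using finite_group_nat_copy[OF B] by blast
  have finH: "finite (carrier H)" using iso_finite[OF H(2)] B(2) by simp
  obtain j where j: "j \<in> iso H B" using group.iso_sym[OF B(1) H(2)] unfolding is_iso_def by blast
  have jj: "j \<in> hom H B" "j ` carrier H = carrier B" using j by (auto simp: iso_def bij_betw_def)
  note c1 = surj_hom_comp[OF H(1) Y1(1) jj Y1(2,3)]
  note c2 = surj_hom_comp[OF H(1) Y2(1) jj Y2(2,3)]
  note c = surj_hom_comp[OF H(1) Y(1) jj Y(2,3)]
  interpret g1: group_hom H Y1 "f1 \<circ> j" by (rule c1(1))
  interpret g2: group_hom H Y2 "f2 \<circ> j" by (rule c2(1))
  interpret g: group_hom H Y "f \<circ> j" by (rule c(1))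
  let ?N1 = "kernel H Y1 (f1 \<circ> j)" and ?N2 = "kernel H Y2 (f2 \<circ> j)"
  have "in_class (H Mod ?N1) \<FF>"
    using in_class_iso[OF Y1(1) group.iso_sym[OF _ g1.FactGroup_iso[OF c1(2)]] Y1(4)]
      normal.factorgroup_is_group[OF g1.normal_kernel] by blast
  moreover have "in_class (H Mod ?N2) \<FF>"
    using in_class_iso[OF Y2(1) group.iso_sym[OF _ g2.FactGroup_iso[OF c2(2)]] Y2(4)]
      normal.factorgroup_is_group[OF g2.normal_kernel] by blast
  ultimately have cl: "in_class (H Mod (?N1 \<inter> ?N2)) \<FF>"
    using F finH g1.normal_kernel g2.normal_kernel unfolding formation_def by blast
  have N: "?N1 \<inter> ?N2 \<lhd> H"
    using group.normal_subgroup_intersect[OF H(1) g1.normal_kernel g2.normal_kernel] .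
  have "?N1 \<inter> ?N2 \<subseteq> kernel H Y (f \<circ> j)"
    using ker jj(2) unfolding kernel_def by auto
  then obtain h where h: "h \<in> hom (H Mod (?N1 \<inter> ?N2)) Y"
    "\<And>x. x \<in> carrier H \<Longrightarrow> h ((?N1 \<inter> ?N2) #>\<^bsub>H\<^esub> x) = (f \<circ> j) x"
    using g.FactGroup_universal_kernel[OF N] by blast
  have "h ` carrier (H Mod (?N1 \<inter> ?N2)) = (f \<circ> j) ` carrier H"
    unfolding carrier_FactGroup image_image using h(2) by (intro image_cong) simp_all
  then show ?thesis
    using in_class_surj_hom[OF F normal.factorgroup_is_group[OF N] cl Y(1) h(1)] c(2) by simp
qed

text \<open>The semidirect product of the integers modulo \<open>m\<close> with \<open>H\<close>, on
  which \<open>g\<close> acts as multiplication by \<open>\<chi> g\<close>; only the residue of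
  \<open>\<chi> g\<close> matters.\<close>

definition semidirect :: "int \<Rightarrow> ('a \<Rightarrow> int) \<Rightarrow> ('a, 'b) monoid_scheme \<Rightarrow> (int \<times> 'a) monoid" where
  "semidirect m \<chi> H = \<lparr>carrier = {0..<m} \<times> carrier H,
     monoid.mult = (\<lambda>(u, g) (v, h). ((u + \<chi> g * v) mod m, g \<otimes>\<^bsub>H\<^esub> h)),
     monoid.one = (0, \<one>\<^bsub>H\<^esub>)\<rparr>"

lemma semidirect_simps:
  "carrier (semidirect m \<chi> H) = {0..<m} \<times> carrier H"
  "(u, g) \<otimes>\<^bsub>semidirect m \<chi> H\<^esub> (v, h) = ((u + \<chi> g * v) mod m, g \<otimes>\<^bsub>H\<^esub> h)"
  "\<one>\<^bsub>semidirect m \<chi> H\<^esub> = (0, \<one>\<^bsub>H\<^esub>)"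
  by (simp_all add: semidirect_def)

lemma group_semidirect:
  assumes H: "group H" and m: "0 < m"
    and \<chi>: "\<And>g h. g \<in> carrier H \<Longrightarrow> h \<in> carrier H \<Longrightarrow> [\<chi> (g \<otimes>\<^bsub>H\<^esub> h) = \<chi> g * \<chi> h] (mod m)"
      "[\<chi> \<one>\<^bsub>H\<^esub> = 1] (mod m)"
  shows "group (semidirect m \<chi> H)"
proof (rule groupI)
  interpret H: group H by (rule H)
  show "\<one>\<^bsub>semidirect m \<chi> H\<^esub> \<in> carrier (semidirect m \<chi> H)" using m by (simp add: semidirect_simps)
  fix x assume x: "x \<in> carrier (semidirect m \<chi> H)"
  obtain u g where ug: "x = (u, g)" by fastforce
  have xu: "u \<in> {0..<m}" "g \<in> carrier H" using x by (auto simp: ug semidirect_simps)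
  have "[\<chi> \<one>\<^bsub>H\<^esub> * u = 1 * u] (mod m)" by (rule cong_mult[OF \<chi>(2) cong_refl])
  then have "(\<chi> \<one>\<^bsub>H\<^esub> * u) mod m = u" using xu by (simp add: cong_def)
  then show "\<one>\<^bsub>semidirect m \<chi> H\<^esub> \<otimes>\<^bsub>semidirect m \<chi> H\<^esub> x = x"
    using xu by (simp add: ug semidirect_simps)
  show "\<exists>y\<in>carrier (semidirect m \<chi> H). y \<otimes>\<^bsub>semidirect m \<chi> H\<^esub> x = \<one>\<^bsub>semidirect m \<chi> H\<^esub>"
  proof (intro bexI)
    let ?y = "((- (\<chi> (inv\<^bsub>H\<^esub> g) * u)) mod m, inv\<^bsub>H\<^esub> g)"
    show "?y \<in> carrier (semidirect m \<chi> H)" using xu m by (simp add: semidirect_simps)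
    show "?y \<otimes>\<^bsub>semidirect m \<chi> H\<^esub> x = \<one>\<^bsub>semidirect m \<chi> H\<^esub>"
      using xu by (simp add: ug semidirect_simps mod_simps)
  qed
  fix y assume y: "y \<in> carrier (semidirect m \<chi> H)"
  obtain v h where vh: "y = (v, h)" by fastforce
  have yv: "v \<in> {0..<m}" "h \<in> carrier H" using y by (auto simp: vh semidirect_simps)
  show "x \<otimes>\<^bsub>semidirect m \<chi> H\<^esub> y \<in> carrier (semidirect m \<chi> H)"
    using xu yv m by (simp add: ug vh semidirect_simps)
  fix z assume z: "z \<in> carrier (semidirect m \<chi> H)"
  obtain w k where wk: "z = (w, k)" by fastforce
  have zw: "w \<in> {0..<m}" "k \<in> carrier H" using z by (auto simp: wk semidirect_simps)
  have "[\<chi> (g \<otimes>\<^bsub>H\<^esub> h) * w = (\<chi> g * \<chi> h) * w] (mod m)"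
    by (rule cong_mult[OF \<chi>(1)[OF xu(2) yv(2)] cong_refl])
  then have "[(u + \<chi> g * v) + \<chi> (g \<otimes>\<^bsub>H\<^esub> h) * w = (u + \<chi> g * v) + \<chi> g * \<chi> h * w] (mod m)"
    by (rule cong_add[OF cong_refl])
  then have e: "((u + \<chi> g * v) + \<chi> (g \<otimes>\<^bsub>H\<^esub> h) * w) mod m = (u + \<chi> g * (v + \<chi> h * w)) mod m"
    by (simp add: cong_def algebra_simps)
  have "(u + \<chi> g * ((v + \<chi> h * w) mod m)) mod m = (u + \<chi> g * (v + \<chi> h * w)) mod m"
    by (metis mod_add_right_eq mod_mult_right_eq)
  moreover have "((u + \<chi> g * v) mod m + \<chi> (g \<otimes>\<^bsub>H\<^esub> h) * w) mod m = ((u + \<chi> g * v) + \<chi> (g \<otimes>\<^bsub>H\<^esub> h) * w) mod m"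
    by (simp add: mod_simps)
  ultimately show "x \<otimes>\<^bsub>semidirect m \<chi> H\<^esub> y \<otimes>\<^bsub>semidirect m \<chi> H\<^esub> z =
      x \<otimes>\<^bsub>semidirect m \<chi> H\<^esub> (y \<otimes>\<^bsub>semidirect m \<chi> H\<^esub> z)"
    using xu yv zw e by (simp add: ug vh wk semidirect_simps H.m_assoc)
qed

text \<open>In the factorization of x^p - y^p the cofactor of x - y is divisible by \<open>p\<close>
  as well, because its \<open>p\<close> summands are congruent modulo \<open>p\<close>. Thus
  \<open>p\<close>-th powers turn a character modulo \<open>p\<close> into one modulo p^2.\<close>

lemma cong_pow_prime_square:
  fixes x y :: int
  assumes "Factorial_Ring.prime (p::nat)" "[x = y] (mod int p)"
  shows "[x ^ p = y ^ p] (mod int p ^ 2)"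
proof -
  have p0: "0 < p" using assms(1) prime_gt_0_nat by blast
  have "x ^ p - y ^ p = (x - y) * (\<Sum>i<p. y ^ (p - Suc i) * x ^ i)"
    by (rule power_diff_sumr2)
  moreover have "int p dvd x - y" using assms(2) by (simp add: cong_iff_dvd_diff)
  moreover have "[(\<Sum>i<p. y ^ (p - Suc i) * x ^ i) = (\<Sum>i<p. y ^ (p - Suc i) * y ^ i)] (mod int p)"
    using assms(2) by (intro cong_sum cong_mult cong_pow) auto
  moreover have "(\<Sum>i<p. y ^ (p - Suc i) * y ^ i) = int p * y ^ (p - 1)"
  proof -
    have "y ^ (p - Suc i) * y ^ i = y ^ (p - 1)" if "i < p" for i
      using that by (simp flip: power_add)
    then show ?thesis by simp
  qed
  ultimately have "int p dvd (\<Sum>i<p. y ^ (p - Suc i) * x ^ i)" by (simp add: cong_dvd_iff)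
  then have "int p * int p dvd x ^ p - y ^ p"
    using \<open>int p dvd x - y\<close> \<open>x ^ p - y ^ p = _\<close> by (simp add: mult_dvd_mono)
  then show ?thesis by (simp add: cong_iff_dvd_diff power2_eq_square)
qed

lemma fermat_int:
  fixes x :: int
  assumes p: "Factorial_Ring.prime (p::nat)"
  shows "[x ^ p = x] (mod int p)"
proof -
  have p0: "0 < p" using p prime_gt_0_nat by blast
  define k where "k = nat (x mod int p)"
  have xk: "[x = int k] (mod int p)" using p0 by (simp add: k_def cong_def)
  have "[k ^ p = k] (mod p)"
  proof (cases "p dvd k")
    case True
    then have "p dvd k ^ p" using p0 dvd_power dvd_trans by blast
    then show ?thesis using True by (simp add: cong_def dvd_imp_mod_0)
  next
    case False
    have "[k ^ (p - 1) * k = 1 * k] (mod p)" by (rule cong_mult[OF fermat_theorem[OF p False] cong_refl])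
    then show ?thesis using p0 by (simp flip: power_Suc2)
  qed
  then have "[int k ^ p = int k] (mod int p)" by (metis cong_int_iff of_nat_power)
  then show ?thesis using xk cong_pow[OF xk, of p] cong_trans cong_sym by metis
qed

text \<open>The normal series from the trivial group through the group of \<open>c\<close> to
  \<open>G\<close> has cyclic factors, the upper one being generated by the coset of
  \<open>d\<close>.\<close>

lemma (in finite_group) supersolvable_if_metacyclic:
  assumes c: "c \<in> carrier G" "generate G {c} \<lhd> G" and d: "d \<in> carrier G"
    and gen: "\<And>y. y \<in> carrier G \<Longrightarrow> \<exists>z\<in>generate G {c}. \<exists>k::nat. y = z \<otimes> d [^] k"
    and GG: "G\<lparr>carrier := carrier G\<rparr> = G"
  shows "supersolvable G"
proof -
  let ?C = "generate G {c}"
  interpret C: normal ?C G by (rule c(2))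
  have CG: "subgroup ?C G" by (rule C.subgroup_axioms)
  define N where "N i = (if i = 0 then {\<one>} else if i = (1::nat) then ?C else carrier G)" for i
  have cyc: "cyclic_group (G\<lparr>carrier := ?C\<rparr>)"
    using cyclic_group_generated[of c] c(1) by (simp add: subgroup_generated_def)
  interpret GC: group "G\<lparr>carrier := ?C\<rparr>" using CG subgroup_imp_group by blast
  have one: "{\<one>} \<lhd> G\<lparr>carrier := ?C\<rparr>" using GC.one_is_normal by simp
  have "cyclic_group ((G\<lparr>carrier := ?C\<rparr>) Mod {\<one>})"
  proof (rule GC.cyclic_group_epimorphic_image[OF _ cyc normal.factorgroup_is_group[OF one]])
    show "(\<lambda>x. {\<one>} #>\<^bsub>G\<lparr>carrier := ?C\<rparr>\<^esub> x) \<in> epi (G\<lparr>carrier := ?C\<rparr>) ((G\<lparr>carrier := ?C\<rparr>) Mod {\<one>})"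
      using normal.r_coset_hom_Mod[OF one] unfolding epi_def carrier_FactGroup by simp
  qed
  moreover have "cyclic_group (G Mod ?C)"
  proof -
    interpret F: group "G Mod ?C" by (rule C.factorgroup_is_group)
    show ?thesis
      unfolding F.cyclic_group
    proof (intro bexI[of _ "?C #> d"] equalityI)
      show dF: "?C #> d \<in> carrier (G Mod ?C)" using d by (simp add: carrier_FactGroup)
      then show "range (\<lambda>n::int. (?C #> d) [^]\<^bsub>G Mod ?C\<^esub> n) \<subseteq> carrier (G Mod ?C)" by auto
      show "carrier (G Mod ?C) \<subseteq> range (\<lambda>n::int. (?C #> d) [^]\<^bsub>G Mod ?C\<^esub> n)"
      proof
        fix Y assume "Y \<in> carrier (G Mod ?C)"
        then obtain y where y: "y \<in> carrier G" "Y = ?C #> y" unfolding carrier_FactGroup by blast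
        obtain z k where zk: "z \<in> ?C" "y = z \<otimes> d [^] (k::nat)" using gen[OF y(1)] by blast
        have "Y = (?C #> z) #> d [^] k"
          unfolding y(2) zk(2) using zk(1) d C.subset by (simp add: coset_mult_assoc)
        also have "?C #> z = ?C" using zk(1) CG by (simp add: coset_join2)
        also have "?C #> d [^] k = (?C #> d) [^]\<^bsub>G Mod ?C\<^esub> k" using C.FactGroup_pow[OF d] by simp
        also have "\<dots> = (?C #> d) [^]\<^bsub>G Mod ?C\<^esub> (int k)" by (simp add: int_pow_int)
        finally show "Y \<in> range (\<lambda>n::int. (?C #> d) [^]\<^bsub>G Mod ?C\<^esub> n)" by blast
      qed
    qed
  qed
  moreover have "carrier G \<lhd> G" by (rule normal_self)
  moreover have "i = 0 \<or> i = 1" if "i < 2" for i :: nat using that by linarith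
  moreover have "i = 0 \<or> i = 1 \<or> i = 2" if "i \<le> 2" for i :: nat using that by linarith
  ultimately show ?thesis
    unfolding supersolvable_def
    using one_is_normal c(2) C.subset C.one_closed GG
    by (intro exI[of _ 2] exI[of _ N]) (auto simp: N_def)
qed

section \<open>Descending along a chief factor of order \<open>p\<close>\<close>

text \<open>Members of the class live on natural numbers, so a quotient of an auxiliary group is
  represented by such a copy together with the projection and its kernel.\<close>

lemma ex_nat_quotient:
  fixes B :: "('a, 'b) monoid_scheme"
  assumes B: "group B" "finite (carrier B)" and N: "N \<lhd> B"
  obtains H :: "nat monoid" and \<pi> where "finite_group H" "\<pi> \<in> hom B H" "\<pi> ` carrier B = carrier H"
    "\<forall>x\<in>carrier B. \<pi> x = \<one>\<^bsub>H\<^esub> \<longleftrightarrow> x \<in> N"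
proof -
  interpret B: group B by (rule B(1))
  interpret N: normal N B by (rule N)
  have Q: "group (B Mod N)" by (rule N.factorgroup_is_group)
  have finQ: "finite (carrier (B Mod N))" unfolding carrier_FactGroup using B(2) by simp
  obtain H :: "nat monoid" where H: "group H" "B Mod N \<cong> H" using finite_group_nat_copy[OF Q finQ] by blast
  obtain j where j: "j \<in> iso (B Mod N) H" using H(2) unfolding is_iso_def by blast
  have jj: "j \<in> hom (B Mod N) H" "j ` carrier (B Mod N) = carrier H" "inj_on j (carrier (B Mod N))"
    using j by (auto simp: iso_def bij_betw_def)
  interpret j: group_hom "B Mod N" H j using surj_homI[OF Q H(1) jj(1,2)] .
  let ?\<pi> = "j \<circ> (\<lambda>x. N #>\<^bsub>B\<^esub> x)"
  show thesis
  proof (rule that[of H ?\<pi>])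
    show "finite_group H"
      using H(1) iso_finite[OF H(2)] finQ by (simp add: finite_group_def finite_group_axioms_def)
    show "?\<pi> \<in> hom B H" by (rule hom_compose[OF N.r_coset_hom_Mod jj(1)])
    show "?\<pi> ` carrier B = carrier H" using jj(2) unfolding carrier_FactGroup by (metis image_comp)
    have "?\<pi> x = \<one>\<^bsub>H\<^esub> \<longleftrightarrow> x \<in> N" if x: "x \<in> carrier B" for x
    proof -
    have "N #>\<^bsub>B\<^esub> x \<in> carrier (B Mod N)" using x by (simp add: carrier_FactGroup)
    then have "j (N #>\<^bsub>B\<^esub> x) = \<one>\<^bsub>H\<^esub> \<longleftrightarrow> N #>\<^bsub>B\<^esub> x = \<one>\<^bsub>B Mod N\<^esub>"
      using jj(3) j.hom_one j.G.one_closed inj_onD by metis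
    also have "\<dots> \<longleftrightarrow> x \<in> N"
      using x B.coset_join1[of N x] B.coset_join2[OF x N.subgroup_axioms] N.subset N.subgroup_axioms by auto
    finally show ?thesis by simp
    qed
    then show "\<forall>x\<in>carrier B. ?\<pi> x = \<one>\<^bsub>H\<^esub> \<longleftrightarrow> x \<in> N" by blast
  qed
qed

section \<open>The extension by a cyclic group of order p^2\<close>

locale cyclic_semidirect = finite_group +
  fixes p :: nat and \<chi> :: "'a \<Rightarrow> int"
  assumes p: "Factorial_Ring.prime p"
    and chi_mult: "\<And>g h. g \<in> carrier G \<Longrightarrow> h \<in> carrier G \<Longrightarrow> [\<chi> (g \<otimes> h) = \<chi> g * \<chi> h] (mod int p ^ 2)"
    and chi_one: "[\<chi> \<one> = 1] (mod int p ^ 2)"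
begin

definition m :: int where "m = int p ^ 2"

definition B where "B = semidirect m \<chi> G"

lemma m_gt_1: "1 < m"
  using prime_gt_1_nat[OF p] by (simp add: m_def power2_eq_square less_1_mult)

lemma B_simps:
  "(u, g) \<in> carrier B \<longleftrightarrow> 0 \<le> u \<and> u < m \<and> g \<in> carrier G"
  "(u, g) \<otimes>\<^bsub>B\<^esub> (v, h) = ((u + \<chi> g * v) mod m, g \<otimes> h)"
  "\<one>\<^bsub>B\<^esub> = (0, \<one>)"
  by (auto simp: B_def semidirect_simps)

sublocale B: finite_group B
proof (intro finite_group.intro finite_group_axioms.intro)
  show "group B"
    unfolding B_def m_def
    by (rule group_semidirect[OF is_group _ chi_mult chi_one]) (use m_gt_1[unfolded m_def] in linarith)
  show "finite (carrier B)" by (simp add: B_def semidirect_simps)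
qed

lemma chi_one_mult: "[\<chi> \<one> * u = u] (mod m)"
  using cong_mult[OF chi_one cong_refl, of u] by (simp add: m_def)

lemma chi_pow: "g \<in> carrier G \<Longrightarrow> [\<chi> (g [^] (k::nat)) = \<chi> g ^ k] (mod m)"
proof (induction k)
  case 0
  then show ?case using chi_one by (simp add: m_def)
next
  case (Suc k)
  have "[\<chi> (g [^] k \<otimes> g) = \<chi> (g [^] k) * \<chi> g] (mod m)" using chi_mult Suc.prems by (simp add: m_def)
  also have "[\<chi> (g [^] k) * \<chi> g = \<chi> g ^ k * \<chi> g] (mod m)" by (rule cong_mult[OF Suc.IH[OF Suc.prems] cong_refl])
  finally show ?case by (simp add: mult.commute)
qed

lemma pow_translation: "(1, \<one>) [^]\<^bsub>B\<^esub> (k::nat) = (int k mod m, \<one>)"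
proof (induction k)
  case 0
  then show ?case by (simp add: B_simps)
next
  case (Suc k)
  have "(int k mod m + \<chi> \<one> * 1) mod m = (int k + 1) mod m"
    using chi_one_mult[of 1] by (simp add: cong_def mod_simps) (metis mod_add_left_eq mod_add_right_eq add.commute)
  then show ?case using Suc by (simp add: B_simps add.commute)
qed

lemma pow_complement: "g \<in> carrier G \<Longrightarrow> (0, g) [^]\<^bsub>B\<^esub> (k::nat) = (0, g [^] k)"
  by (induction k) (simp_all add: B_simps)

lemma B_conj:
  assumes x: "(v, h) \<in> carrier B" and y: "(u, g) \<in> carrier B"
  obtains c where "(v, h) \<otimes>\<^bsub>B\<^esub> (u, g) \<otimes>\<^bsub>B\<^esub> inv\<^bsub>B\<^esub> (v, h) = (c, h \<otimes> g \<otimes> inv h)" "0 \<le> c" "c < m"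
    "[c + \<chi> (h \<otimes> g \<otimes> inv h) * v = v + \<chi> h * u] (mod m)"
proof -
  let ?z = "(v, h) \<otimes>\<^bsub>B\<^esub> (u, g) \<otimes>\<^bsub>B\<^esub> inv\<^bsub>B\<^esub> (v, h)"
  obtain c k where z: "?z = (c, k)" by fastforce
  have "?z \<in> carrier B" using x y by simp
  then have ck: "0 \<le> c" "c < m" "k \<in> carrier G" unfolding z by (auto simp: B_simps)
  have G: "h \<in> carrier G" "g \<in> carrier G" using x y by (auto simp: B_simps)
  have "?z \<otimes>\<^bsub>B\<^esub> (v, h) = (v, h) \<otimes>\<^bsub>B\<^esub> (u, g)" using x y by (simp add: B.m_assoc)
  then have e: "(c + \<chi> k * v) mod m = (v + \<chi> h * u) mod m" "k \<otimes> h = h \<otimes> g"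
    unfolding z by (simp_all add: B_simps)
  have "k = h \<otimes> g \<otimes> inv h" using e(2) ck(3) G by (metis inv_solve_right m_closed)
  then show thesis using that[of c] z ck e(1) by (simp add: cong_def)
qed

text \<open>Conjugation by (v, g) raises the generator (1, 1) of the cyclic part to the power
  \<open>\<chi> g\<close>. Stated for images of \<open>B\<close>, since it is used both in the
  metacyclic quotient and in the quotient to which saturation is applied.\<close>

lemma translation_normal:
  assumes H: "finite_group H" and \<pi>: "\<pi> \<in> hom B H" "\<pi> ` carrier B = carrier H"
  shows "generate H {\<pi> (1, \<one>)} \<lhd> H"
proof -
  interpret H: finite_group H by (rule H)
  interpret \<pi>: group_hom B H \<pi> using surj_homI[OF B.is_group H.is_group \<pi>] .
  have c: "(1, \<one>) \<in> carrier B" using m_gt_1 by (simp add: B_simps)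
  then have cH: "\<pi> (1, \<one>) \<in> carrier H" by simp
  have pw: "\<pi> (1, \<one>) [^]\<^bsub>H\<^esub> (k::nat) = \<pi> (int k mod m, \<one>)" for k
    using \<pi>.hom_nat_pow[OF c, of k] pow_translation by simp
  have "y \<otimes>\<^bsub>H\<^esub> h \<otimes>\<^bsub>H\<^esub> inv\<^bsub>H\<^esub> y \<in> generate H {\<pi> (1, \<one>)}"
    if y: "y \<in> carrier H" and h: "h \<in> generate H {\<pi> (1, \<one>)}" for y h
  proof -
    obtain v g where vg: "(v, g) \<in> carrier B" "y = \<pi> (v, g)" using y \<pi>(2) by (metis image_iff surj_pair)
    have "y \<otimes>\<^bsub>H\<^esub> \<pi> (1, \<one>) \<otimes>\<^bsub>H\<^esub> inv\<^bsub>H\<^esub> y = \<pi> (1, \<one>) [^]\<^bsub>H\<^esub> nat (\<chi> g mod m)"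
    proof -
      have g: "g \<in> carrier G" using vg by (simp add: B_simps)
      have "(v, g) \<otimes>\<^bsub>B\<^esub> (1, \<one>) = (\<chi> g mod m, \<one>) \<otimes>\<^bsub>B\<^esub> (v, g)"
      proof -
        have "(\<chi> g mod m + \<chi> \<one> * v) mod m = (v + \<chi> g * 1) mod m"
          using chi_one_mult[of v] by (metis add.commute cong_def mod_add_left_eq mod_add_right_eq mult.right_neutral)
        then show ?thesis using g by (simp add: B_simps)
      qed
      moreover have b: "(\<chi> g mod m, \<one>) \<in> carrier B" using m_gt_1 by (simp add: B_simps)
      ultimately have "y \<otimes>\<^bsub>H\<^esub> \<pi> (1, \<one>) = \<pi> (\<chi> g mod m, \<one>) \<otimes>\<^bsub>H\<^esub> y"
        unfolding vg(2) using \<pi>.hom_mult[OF vg(1) c] \<pi>.hom_mult[OF b vg(1)] by simp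
      moreover have "\<pi> (1, \<one>) [^]\<^bsub>H\<^esub> nat (\<chi> g mod m) = \<pi> (\<chi> g mod m, \<one>)"
        unfolding pw using m_gt_1 by simp
      ultimately show ?thesis using y b by (simp add: H.m_assoc)
    qed
    then have "y \<otimes>\<^bsub>H\<^esub> \<pi> (1, \<one>) \<otimes>\<^bsub>H\<^esub> inv\<^bsub>H\<^esub> y \<in> generate H {\<pi> (1, \<one>)}"
      using H.mem_generate_singleton[OF cH] by blast
    then have "H.normalizes y (generate H {\<pi> (1, \<one>)})"
      by (intro H.generate_normalizes) (use cH y in auto)
    then show ?thesis using h by (simp add: H.normalizes_def)
  qed
  then show ?thesis
    using H.normal_invI H.generate_is_subgroup[of "{\<pi> (1, \<one>)}"] cH by simp
qed

text \<open>The elements of the complement that act trivially on the cyclic part commute with it,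
  and they are the kernel of a character of the complement.\<close>

lemma kernel_chi_normal: "{(0, g) |g. g \<in> carrier G \<and> [\<chi> g = 1] (mod m)} \<lhd> B" (is "?K \<lhd> B")
proof (rule B.normal_invI)
  show "subgroup ?K B"
  proof (rule B.finite_subgroupI)
    show "?K \<subseteq> carrier B" using m_gt_1 by (auto simp: B_simps)
    have "(0, \<one>) \<in> ?K" using chi_one by (simp add: m_def)
    then show "?K \<noteq> {}" by blast
    fix a b assume "a \<in> ?K" "b \<in> ?K"
    then obtain g h where gh: "a = (0, g)" "b = (0, h)" "g \<in> carrier G" "h \<in> carrier G"
      "[\<chi> g = 1] (mod m)" "[\<chi> h = 1] (mod m)" by blast
    have "[\<chi> (g \<otimes> h) = \<chi> g * \<chi> h] (mod m)" using chi_mult gh(3,4) by (simp add: m_def)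
    also have "[\<chi> g * \<chi> h = 1 * 1] (mod m)" by (rule cong_mult[OF gh(5,6)])
    finally show "a \<otimes>\<^bsub>B\<^esub> b \<in> ?K" using gh by (simp add: B_simps)
  qed
  fix x y assume x: "x \<in> carrier B" and y: "y \<in> ?K"
  obtain v h where vh: "x = (v, h)" by fastforce
  obtain g where g: "y = (0, g)" "g \<in> carrier G" "[\<chi> g = 1] (mod m)" using y by blast
  have h: "h \<in> carrier G" using x by (simp add: vh B_simps)
  have yB: "(0, g) \<in> carrier B" using g m_gt_1 by (simp add: B_simps)
  obtain c where c: "x \<otimes>\<^bsub>B\<^esub> y \<otimes>\<^bsub>B\<^esub> inv\<^bsub>B\<^esub> x = (c, h \<otimes> g \<otimes> inv h)" "0 \<le> c" "c < m"
    "[c + \<chi> (h \<otimes> g \<otimes> inv h) * v = v + \<chi> h * 0] (mod m)"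
    using B_conj[OF x[unfolded vh] yB] unfolding vh g(1) by metis
  have "[\<chi> (h \<otimes> g \<otimes> inv h) = \<chi> (h \<otimes> g) * \<chi> (inv h)] (mod m)" using chi_mult h g(2) by (simp add: m_def)
  also have "[\<chi> (h \<otimes> g) * \<chi> (inv h) = (\<chi> h * \<chi> g) * \<chi> (inv h)] (mod m)"
    by (rule cong_mult[OF _ cong_refl]) (use chi_mult h g(2) in \<open>simp add: m_def\<close>)
  also have "[(\<chi> h * \<chi> g) * \<chi> (inv h) = (\<chi> h * 1) * \<chi> (inv h)] (mod m)"
    by (intro cong_mult cong_refl g(3))
  also have "[(\<chi> h * 1) * \<chi> (inv h) = \<chi> (h \<otimes> inv h)] (mod m)"
    using cong_sym[OF chi_mult[of h "inv h"]] h by (simp add: m_def)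
  also have "[\<chi> (h \<otimes> inv h) = 1] (mod m)" using chi_one h by (simp add: m_def)
  finally have chi1: "[\<chi> (h \<otimes> g \<otimes> inv h) = 1] (mod m)" .
  have "[c + \<chi> (h \<otimes> g \<otimes> inv h) * v = c + 1 * v] (mod m)"
    by (intro cong_add cong_mult cong_refl chi1)
  then have "[c + v = 0 + v] (mod m)" using c(4) by (simp add: cong_def)
  then have "[c = 0] (mod m)" using cong_add_rcancel by blast
  then have "c = 0" using c(2,3) by (simp add: cong_def)
  then show "x \<otimes>\<^bsub>B\<^esub> y \<otimes>\<^bsub>B\<^esub> inv\<^bsub>B\<^esub> x \<in> ?K" using c(1) chi1 h g(2) by simp
qed

text \<open>Modulo the kernel of the action the complement is a group of units modulo p^2, generated
  by the image of \<open>\<gamma>\<close>. So the quotient of \<open>B\<close> is metacyclic, hence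
  supersolvable and in the class.\<close>

lemma metacyclic_quotient:
  assumes \<gamma>: "\<gamma> \<in> carrier G" "\<And>g. g \<in> carrier G \<Longrightarrow> \<exists>k::nat. [\<chi> g = \<chi> \<gamma> ^ k] (mod m)"
    and sup: "\<UU> \<subseteq> \<FF>"
  obtains H :: "nat monoid" and \<pi> where "finite_group H" "\<pi> \<in> hom B H" "\<pi> ` carrier B = carrier H"
    "in_class H \<FF>" "\<And>u g. (u, g) \<in> carrier B \<Longrightarrow> \<pi> (u, g) = \<one>\<^bsub>H\<^esub> \<Longrightarrow> u = 0 \<and> [\<chi> g = 1] (mod m)"
proof -
  obtain H :: "nat monoid" and \<pi> where H: "finite_group H" and \<pi>: "\<pi> \<in> hom B H" "\<pi> ` carrier B = carrier H"
    and ker: "\<forall>x\<in>carrier B. \<pi> x = \<one>\<^bsub>H\<^esub> \<longleftrightarrow> x \<in> {(0, g) |g. g \<in> carrier G \<and> [\<chi> g = 1] (mod m)}"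
    by (rule ex_nat_quotient[OF B.is_group B.finite_carrier kernel_chi_normal])
  interpret H: finite_group H by (rule H)
  interpret \<pi>: group_hom B H \<pi> using surj_homI[OF B.is_group H.is_group \<pi>] .
  have c: "(1, \<one>) \<in> carrier B" and d: "(0, \<gamma>) \<in> carrier B" using m_gt_1 \<gamma> by (simp_all add: B_simps)
  have cH: "\<pi> (1, \<one>) \<in> carrier H" and dH: "\<pi> (0, \<gamma>) \<in> carrier H" using c d by auto
  have "supersolvable H"
  proof (rule H.supersolvable_if_metacyclic[OF cH translation_normal[OF H \<pi>] dH])
    fix y assume "y \<in> carrier H"
    then obtain u g where ug: "(u, g) \<in> carrier B" "y = \<pi> (u, g)" using \<pi>(2) by (metis image_iff surj_pair)
    then have g: "g \<in> carrier G" and u: "0 \<le> u" "u < m" by (auto simp: B_simps)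
    obtain k :: nat where k: "[\<chi> g = \<chi> \<gamma> ^ k] (mod m)" using \<gamma>(2)[OF g] by blast
    let ?g = "inv (\<gamma> [^] k) \<otimes> g"
    have \<gamma>k: "\<gamma> [^] k \<in> carrier G" using \<gamma> by simp
    have "[\<chi> ?g = \<chi> (inv (\<gamma> [^] k)) * \<chi> g] (mod m)" using chi_mult \<gamma>k g by (simp add: m_def)
    also have "[\<chi> (inv (\<gamma> [^] k)) * \<chi> g = \<chi> (inv (\<gamma> [^] k)) * \<chi> (\<gamma> [^] k)] (mod m)"
      by (rule cong_mult[OF cong_refl cong_trans[OF k cong_sym[OF chi_pow[OF \<gamma>(1)]]]])
    also have "[\<chi> (inv (\<gamma> [^] k)) * \<chi> (\<gamma> [^] k) = \<chi> (inv (\<gamma> [^] k) \<otimes> \<gamma> [^] k)] (mod m)"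
      using cong_sym[OF chi_mult[of "inv (\<gamma> [^] k)" "\<gamma> [^] k"]] \<gamma>k by (simp add: m_def)
    also have "[\<chi> (inv (\<gamma> [^] k) \<otimes> \<gamma> [^] k) = 1] (mod m)" using chi_one \<gamma>k by (simp add: m_def)
    finally have g1: "[\<chi> ?g = 1] (mod m)" .
    have b: "(u, \<one>) \<in> carrier B" "(0, \<gamma> [^] k) \<in> carrier B" "(0, ?g) \<in> carrier B"
      using u \<gamma>k g m_gt_1 by (simp_all add: B_simps)
    have e: "(u, g) = (u, \<one>) \<otimes>\<^bsub>B\<^esub> (0, \<gamma> [^] k) \<otimes>\<^bsub>B\<^esub> (0, ?g)"
      using u \<gamma>k g by (simp add: B_simps)
    have "\<pi> (0, ?g) = \<one>\<^bsub>H\<^esub>" using ker b(3) g1 \<gamma>k g by blast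
    moreover have "\<pi> (0, \<gamma> [^] k) = \<pi> (0, \<gamma>) [^]\<^bsub>H\<^esub> k"
      using \<pi>.hom_nat_pow[OF d, of k] pow_complement[OF \<gamma>(1)] by simp
    moreover have "\<pi> (u, \<one>) = \<pi> (1, \<one>) [^]\<^bsub>H\<^esub> nat u"
      using \<pi>.hom_nat_pow[OF c, of "nat u"] pow_translation[of "nat u"] u by simp
    ultimately have "y = \<pi> (1, \<one>) [^]\<^bsub>H\<^esub> nat u \<otimes>\<^bsub>H\<^esub> \<pi> (0, \<gamma>) [^]\<^bsub>H\<^esub> k"
      unfolding ug(2) e using b cH dH by (simp only: \<pi>.hom_mult B.m_closed) simp
    then show "\<exists>z\<in>generate H {\<pi> (1, \<one>)}. \<exists>k::nat. y = z \<otimes>\<^bsub>H\<^esub> \<pi> (0, \<gamma>) [^]\<^bsub>H\<^esub> k"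
      using H.mem_generate_singleton[OF cH] by blast
  qed simp
  then have "H \<in> \<FF>" using sup H.is_group H.finite_carrier unfolding supersolvable_class_def by blast
  then have "in_class H \<FF>" unfolding in_class_def using iso_refl by blast
  then show thesis using that[OF H \<pi>] ker by blast
qed

end

section \<open>The action on a normal section of order \<open>p\<close>\<close>

context finite_group
begin

text \<open>The values of \<open>a\<close> form a subgroup of the cyclic group of units modulo
  \<open>p\<close>. Written as powers of a primitive root, the least positive exponent that occurs
  belongs to a generator, by division with remainder.\<close>

lemma ex_generator_mod_prime:
  assumes p: "Factorial_Ring.prime p"
    and mult: "\<And>g h. g \<in> carrier G \<Longrightarrow> h \<in> carrier G \<Longrightarrow> [a (g \<otimes> h) = a g * a h] (mod int p)"
    and one: "[a \<one> = 1] (mod int p)"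
  shows "\<exists>\<gamma>\<in>carrier G. \<forall>g\<in>carrier G. \<exists>k::nat. [a g = a \<gamma> ^ k] (mod int p)"
proof -
  have p1: "1 < p" using prime_gt_1_nat[OF p] .
  obtain r where r: "residue_primroot p r" using prime_primitive_root_exists[OF p1 p] by blast
  have gen: "bij_betw (\<lambda>i. r ^ i mod p) {..<totient p} (totatives p)"
    by (rule residue_primroot_is_generator[OF p1 r])
  have cr: "coprime (int r) (int p)"
    using r by (simp add: residue_primroot_def coprime_commute)
  have ex: "\<exists>i>0. [a g = int r ^ i] (mod int p)" if g: "g \<in> carrier G" for g
  proof -
    have "[a g * a (inv g) = 1] (mod int p)"
      using mult[of g "inv g"] one g by (metis cong_sym cong_trans inv_closed r_inv)
    then have cop: "coprime (a g) (int p)" using coprime_iff_invertible_int by blast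
    define x where "x = nat (a g mod int p)"
    have x: "[a g = int x] (mod int p)" "x < p" using p1 by (simp_all add: x_def cong_def nat_less_iff)
    have "coprime (int x) (int p)" using cop cong_imp_coprime[OF x(1)] by simp
    then have cx: "coprime x p" by simp
    then have "0 < x" using p1 by (intro Nat.gr0I) auto
    then have "x \<in> totatives p" using cx x(2) by (simp add: totatives_def)
    then obtain i where i: "x = r ^ i mod p" using gen unfolding bij_betw_def by blast
    have "[r ^ (p - 1) = 1] (mod p)"
    proof (rule fermat_theorem[OF p])
      have "coprime p r" using r by (simp add: residue_primroot_def)
      then show "\<not> p dvd r" using p1 by (metis coprime_common_divisor dvd_refl nat_dvd_1_iff_1 nat_neq_iff)
    qed
    then have "[r ^ i * r ^ (p - 1) = r ^ i * 1] (mod p)" by (rule cong_mult[OF cong_refl])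
    then have "[r ^ (i + (p - 1)) = x] (mod p)" unfolding i by (simp add: power_add cong_def)
    then have "[int r ^ (i + (p - 1)) = int x] (mod int p)" by (metis cong_int_iff of_nat_power)
    \<comment> \<open>Adding p - 1 keeps the value and makes the exponent positive, as the
      definition of \<open>E\<close> requires.\<close>
    then show ?thesis using x(1) p1 cong_trans cong_sym by (intro exI[of _ "i + (p - 1)"]) (auto intro: cong_trans cong_sym)
  qed
  define E where "E = {i. 0 < i \<and> (\<exists>g\<in>carrier G. [a g = int r ^ i] (mod int p))}"
  define e where "e = (LEAST i. i \<in> E)"
  have "\<exists>i. i \<in> E" using ex[OF one_closed] one_closed unfolding E_def by blast
  then have eE: "e \<in> E" unfolding e_def by (rule LeastI_ex)
  have least: "e \<le> i" if "i \<in> E" for i using that unfolding e_def by (rule Least_le)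
  obtain \<gamma> where \<gamma>: "\<gamma> \<in> carrier G" "[a \<gamma> = int r ^ e] (mod int p)" and e0: "0 < e"
    using eE unfolding E_def by blast
  have pw: "[a (\<gamma> [^] (k::nat)) = int r ^ (e * k)] (mod int p)" for k
  proof (induction k)
    case 0
    then show ?case using one by simp
  next
    case (Suc k)
    have "[a (\<gamma> [^] k \<otimes> \<gamma>) = a (\<gamma> [^] k) * a \<gamma>] (mod int p)" using mult \<gamma> by simp
    also have "[a (\<gamma> [^] k) * a \<gamma> = int r ^ (e * k) * int r ^ e] (mod int p)" by (rule cong_mult[OF Suc \<gamma>(2)])
    finally show ?case by (simp add: power_add mult.commute)
  qed
  have "\<exists>k::nat. [a g = a \<gamma> ^ k] (mod int p)" if g: "g \<in> carrier G" for g
  proof -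
    obtain j where j: "[a g = int r ^ j] (mod int p)" using ex[OF g] by blast
    define k where "k = j div e"
    have jk: "j = e * k + j mod e" unfolding k_def by simp
    let ?h = "inv (\<gamma> [^] k) \<otimes> g"
    have \<gamma>k: "\<gamma> [^] k \<in> carrier G" using \<gamma>(1) by simp
    have "[a (\<gamma> [^] k \<otimes> ?h) = a (\<gamma> [^] k) * a ?h] (mod int p)" by (rule mult) (use \<gamma>k g in simp_all)
    moreover have "\<gamma> [^] k \<otimes> ?h = g" using \<gamma>k g by (simp flip: m_assoc)
    moreover have "[a (\<gamma> [^] k) * a ?h = int r ^ (e * k) * a ?h] (mod int p)" by (rule cong_mult[OF pw cong_refl])
    ultimately have "[a g = int r ^ (e * k) * a ?h] (mod int p)" by (metis cong_trans)
    then have "[int r ^ (e * k) * a ?h = int r ^ (e * k) * int r ^ (j mod e)] (mod int p)"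
      using j jk by (metis cong_sym cong_trans power_add)
    moreover have "coprime (int r ^ (e * k)) (int p)" using cr by simp
    ultimately have h: "[a ?h = int r ^ (j mod e)] (mod int p)" using cong_mult_lcancel by blast
    have "\<not> 0 < j mod e"
    proof
      assume "0 < j mod e"
      moreover have "?h \<in> carrier G" using \<gamma>k g by simp
      ultimately have "j mod e \<in> E" using h unfolding E_def by blast
      then show False using least[of "j mod e"] mod_less_divisor[OF e0, of j] by linarith
    qed
    then have "j = e * k" using jk by simp
    then have "[a g = (int r ^ e) ^ k] (mod int p)" using j by (simp add: power_mult)
    then show ?thesis using cong_pow[OF \<gamma>(2), of k] cong_sym cong_trans by blast
  qed
  then show ?thesis using \<gamma>(1) by blast
qed

lemma normal_normalizes: "N \<lhd> G \<Longrightarrow> x \<in> carrier G \<Longrightarrow> normalizes x N"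
  by (simp add: normalizes_def normal.inv_op_closed2)

lemma normal_iff_normalizes: "subgroup N G \<Longrightarrow> N \<lhd> G \<longleftrightarrow> (\<forall>x\<in>carrier G. normalizes x N)"
  by (auto simp: normalizes_def normal_inv_iff)

text \<open>The section L / N has order \<open>p\<close>, so \<open>g\<close> acts on it as
  multiplication by a scalar \<open>a g\<close>, read off from the conjugate of a generator
  \<open>l\<close>.\<close>

lemma ex_conjugation_character:
  assumes p: "Factorial_Ring.prime p" and N: "N \<lhd> G" and L: "L \<lhd> G"
    and NL: "N \<subseteq> L" "card L = card N * p"
  obtains \<mu> a l where "mod_char p L \<mu>" "\<And>y. y \<in> L \<Longrightarrow> y \<in> N \<longleftrightarrow> int p dvd \<mu> y"
    "l \<in> L" "[\<mu> l = 1] (mod int p)"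
    "\<And>g y. g \<in> carrier G \<Longrightarrow> y \<in> L \<Longrightarrow> [\<mu> (g \<otimes> y \<otimes> inv g) = a g * \<mu> y] (mod int p)"
proof -
  interpret N: normal N G by (rule N)
  interpret L: normal L G by (rule L)
  have p1: "1 < p" using prime_gt_1_nat[OF p] .
  have fin: "finite L" "finite N" using L.subset N.subset finite_carrier finite_subset by blast+
  have cN: "0 < card N" using fin(2) N.one_closed card_gt_0_iff by blast
  have nN: "normalizes x N" if "x \<in> carrier G" for x using normal_normalizes[OF N that] .
  obtain l where l: "l \<in> L" "l \<notin> N"
  proof -
    have "N \<noteq> L" using NL(2) cN p1 by auto
    then show thesis using that NL(1) by blast
  qed
  have lG: "l \<in> carrier G" using l(1) L.subset by blast
  interpret GL: group "G\<lparr>carrier := L\<rparr>" by (rule L.subgroup_is_group[OF is_group])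
  have NGL: "N \<lhd> G\<lparr>carrier := L\<rparr>"
  proof (rule GL.normal_invI)
    show "subgroup N (G\<lparr>carrier := L\<rparr>)" using subgroup_subgroup_iff[OF L.subgroup_axioms] N.subgroup_axioms NL(1) by blast
    show "x \<otimes>\<^bsub>G\<lparr>carrier := L\<rparr>\<^esub> h \<otimes>\<^bsub>G\<lparr>carrier := L\<rparr>\<^esub> inv\<^bsub>G\<lparr>carrier := L\<rparr>\<^esub> x \<in> N"
      if "x \<in> carrier (G\<lparr>carrier := L\<rparr>)" "h \<in> N" for x h
    proof -
      have "x \<in> L" using that by simp
      then show ?thesis using that(2) N.inv_op_closed2[of x h] L.subset m_inv_consistent[OF L.subgroup_axioms, of x] by auto
    qed
  qed
  have lp: "l [^] p \<in> N"
  proof -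
    interpret Q: normal N "G\<lparr>carrier := L\<rparr>" by (rule NGL)
    interpret F: group "(G\<lparr>carrier := L\<rparr>) Mod N" by (rule Q.factorgroup_is_group)
    have "card (rcosets\<^bsub>G\<lparr>carrier := L\<rparr>\<^esub> N) * card N = card L"
      using GL.lagrange[OF Q.subgroup_axioms] by (simp add: order_def)
    then have "card (rcosets\<^bsub>G\<lparr>carrier := L\<rparr>\<^esub> N) = p" using NL(2) cN by (metis mult.commute mult_right_cancel not_gr0)
    then have o: "order ((G\<lparr>carrier := L\<rparr>) Mod N) = p" by (simp add: order_def FactGroup_def)
    let ?c = "N #>\<^bsub>G\<lparr>carrier := L\<rparr>\<^esub> l"
    have "?c \<in> carrier ((G\<lparr>carrier := L\<rparr>) Mod N)" using l(1) by (simp add: carrier_FactGroup)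
    then have "?c [^]\<^bsub>(G\<lparr>carrier := L\<rparr>) Mod N\<^esub> p = \<one>\<^bsub>(G\<lparr>carrier := L\<rparr>) Mod N\<^esub>"
      using F.pow_order_eq_1 o by metis
    then have "N #>\<^bsub>G\<lparr>carrier := L\<rparr>\<^esub> (l [^]\<^bsub>G\<lparr>carrier := L\<rparr>\<^esub> p) = N"
      using Q.FactGroup_pow[of l p] l(1) by simp
    moreover have "l [^]\<^bsub>G\<lparr>carrier := L\<rparr>\<^esub> p = l [^] p" by (simp add: nat_pow_consistent[symmetric])
    ultimately have "N #>\<^bsub>G\<lparr>carrier := L\<rparr>\<^esub> (l [^] p) = N" by simp
    then have "N #> (l [^] p) = N" by (simp add: r_coset_def)
    then show ?thesis using coset_join1[OF _ _ N.subgroup_axioms] lG by simp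
  qed
  have powN: "l [^] (i::nat) \<in> N \<longleftrightarrow> p dvd i" for i
    by (rule pow_mem_iff_dvd[OF p N.subgroup_axioms lG lp l(2)])
  have gs: "subgroup (generate G {l}) G" using lG by (intro generate_is_subgroup) simp
  let ?M = "N <#> generate G {l}"
  have M: "subgroup ?M G"
    using nN subgroup.mem_carrier[OF gs] by (intro subgroup_set_mult[OF N.subgroup_axioms gs]) blast
  have gL: "generate G {l} \<subseteq> L" using generate_subgroup_incl[of "{l}" L] l(1) L.subgroup_axioms by simp
  have MsL: "?M \<subseteq> L" by (rule set_mult_subset_subgroup[OF L.subgroup_axioms NL(1) gL])
  have NM: "N \<subseteq> ?M" by (rule subset_set_mult(1)[OF N.subgroup_axioms gs])
  have lM: "l \<in> ?M" using subset_set_mult(2)[OF N.subgroup_axioms gs] generate.incl[of l "{l}" G] by blast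
  have ME: "?M = L"
  proof -
    obtain i where i: "card ?M = card N * i" using card_subgroup_dvd[OF N.subgroup_axioms M NM] by blast
    obtain j where j: "card L = card ?M * j" using card_subgroup_dvd[OF M L.subgroup_axioms MsL] by blast
    have finM: "finite ?M" using MsL fin(1) finite_subset by blast
    have "card N * p = card N * (i * j)" using NL(2) i j by (metis mult.assoc)
    then have "p = i * j" using nat_mult_eq_cancel1[OF cN] by blast
    moreover have "i \<noteq> 1"
    proof
      assume "i = 1"
      then have "N = ?M" using i NM finM by (intro card_subset_eq) auto
      then show False using lM l(2) by blast
    qed
    ultimately have "j = 1" using p prime_product by metis
    then show ?thesis using j MsL fin(1) by (intro card_subset_eq) auto
  qed
  have gen: "\<exists>i::nat. \<exists>b\<in>N. q = l [^] i \<otimes> b" if "q \<in> L" for q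
  proof -
    have "q \<in> ?M" using that ME by simp
    then obtain b c where bc: "b \<in> N" "c \<in> generate G {l}" "q = b \<otimes> c" unfolding mem_set_mult by blast
    then obtain i where i: "c = l [^] (i::nat)" using mem_generate_singleton[OF lG] by blast
    have cG: "c \<in> carrier G" using i lG by simp
    have "inv c \<otimes> b \<otimes> c \<in> N" using bc(1) cG N.inv_op_closed1 by blast
    moreover have "q = c \<otimes> (inv c \<otimes> b \<otimes> c)" using bc cG N.subset by (simp add: m_assoc[symmetric] subsetD)
    ultimately show ?thesis using i by blast
  qed
  have nT: "normalizes q N" if "q \<in> L" for q using nN that L.subset by blast
  obtain \<mu> where \<mu>: "mod_char p L \<mu>" and
    \<mu>l: "\<And>i b. b \<in> N \<Longrightarrow> [\<mu> (l [^] (i::nat) \<otimes> b) = int i] (mod int p)"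
    by (rule ex_mod_char_cyclic_quotient[OF N.subgroup_axioms L.subgroup_axioms NL(1) nT l(1) powN gen]) blast+
  have ker: "y \<in> N \<longleftrightarrow> int p dvd \<mu> y" if y: "y \<in> L" for y
  proof -
    obtain i b where b: "b \<in> N" "y = l [^] (i::nat) \<otimes> b" using gen[OF y] by blast
    have "int p dvd \<mu> y \<longleftrightarrow> p dvd i" using cong_dvd_iff[OF \<mu>l[OF b(1), of i]] b(2) by simp
    also have "\<dots> \<longleftrightarrow> l [^] i \<in> N" using powN by simp
    also have "\<dots> \<longleftrightarrow> y \<in> N"
    proof
      assume "l [^] i \<in> N" then show "y \<in> N" using b by simp
    next
      assume "y \<in> N"
      then have "y \<otimes> inv b \<in> N" using b(1) by simp
      then show "l [^] i \<in> N" using b lG N.subset by (simp add: m_assoc subsetD)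
    qed
    finally show ?thesis by simp
  qed
  have l1: "[\<mu> l = 1] (mod int p)" using \<mu>l[OF N.one_closed, of 1] lG by simp
  define a where "a g = \<mu> (g \<otimes> l \<otimes> inv g)" for g
  have "[\<mu> (g \<otimes> y \<otimes> inv g) = a g * \<mu> y] (mod int p)" if g: "g \<in> carrier G" and y: "y \<in> L" for g y
  proof -
    obtain i b where b: "b \<in> N" "y = l [^] (i::nat) \<otimes> b" using gen[OF y] by blast
    have bG: "b \<in> carrier G" using b(1) N.subset by blast
    have gl: "g \<otimes> l \<otimes> inv g \<in> L" using L.inv_op_closed2 g l(1) by blast
    have gb: "g \<otimes> b \<otimes> inv g \<in> N" using N.inv_op_closed2 g b(1) by blast
    have "g \<otimes> y \<otimes> inv g = (g \<otimes> l [^] i \<otimes> inv g) \<otimes> (g \<otimes> b \<otimes> inv g)"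
      unfolding b(2) using g lG bG by (simp add: m_assoc inv_solve_left)
    also have "g \<otimes> l [^] i \<otimes> inv g = (g \<otimes> l \<otimes> inv g) [^] i" using conj_pow[of g l i] g lG by simp
    finally have "\<mu> (g \<otimes> y \<otimes> inv g) = \<mu> ((g \<otimes> l \<otimes> inv g) [^] i \<otimes> (g \<otimes> b \<otimes> inv g))" by simp
    also have "[\<dots> = \<mu> ((g \<otimes> l \<otimes> inv g) [^] i) + \<mu> (g \<otimes> b \<otimes> inv g)] (mod int p)"
      using gb NL(1) by (intro mod_charD[OF \<mu>] nat_pow_mem[OF L.subgroup_axioms gl]) blast
    also have "[\<mu> ((g \<otimes> l \<otimes> inv g) [^] i) + \<mu> (g \<otimes> b \<otimes> inv g) = int i * a g + 0] (mod int p)"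
      unfolding a_def using ker[of "g \<otimes> b \<otimes> inv g"] gb NL(1)
      by (intro cong_add mod_char_pow[OF \<mu> L.subgroup_axioms gl]) (auto simp: cong_0_iff)
    also have "[int i * a g + 0 = a g * \<mu> y] (mod int p)"
      using cong_mult[OF cong_refl[of "a g"] cong_sym[OF \<mu>l[OF b(1), of i]]] b(2) by (simp add: mult.commute)
    finally show ?thesis .
  qed
  then show thesis using that[OF \<mu> ker l(1) l1] by blast
qed

end

lemma (in finite_group) solvable_generate_singleton:
  assumes "x \<in> carrier G"
  shows "solvable (G\<lparr>carrier := generate G {x}\<rparr>)"
proof -
  have cyc: "cyclic_group (G\<lparr>carrier := generate G {x}\<rparr>)"
    using cyclic_group_generated[of x] assms by (simp add: subgroup_generated_def)
  interpret S: group "G\<lparr>carrier := generate G {x}\<rparr>"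
    using subgroup_imp_group generate_is_subgroup assms by simp
  interpret S: comm_group "G\<lparr>carrier := generate G {x}\<rparr>"
    by (rule S.cyclic_imp_abelian_group[OF cyc])
  have "derived (G\<lparr>carrier := generate G {x}\<rparr>) (carrier (G\<lparr>carrier := generate G {x}\<rparr>)) = {\<one>\<^bsub>G\<lparr>carrier := generate G {x}\<rparr>\<^esub>}"
    by (rule S.derived_eq_singleton) blast
  then show ?thesis
    unfolding S.solvable_iff_trivial_derived_seq by (intro exI[of _ 1]) simp
qed

context cyclic_semidirect
begin

lemma coset_hom:
  assumes "L \<lhd> G"
  shows "(\<lambda>(u, g). L #> g) \<in> hom B (G Mod L)" "(\<lambda>(u, g). L #> g) ` carrier B = carrier (G Mod L)"
proof -
  show "(\<lambda>(u, g). L #> g) \<in> hom B (G Mod L)"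
    using normal.r_coset_hom_Mod[OF assms] by (auto simp: hom_def Pi_iff B_simps)
  show "(\<lambda>(u, g). L #> g) ` carrier B = carrier (G Mod L)" (is "?f ` _ = _")
  proof
    show "?f ` carrier B \<subseteq> carrier (G Mod L)" by (auto simp: B_simps carrier_FactGroup)
    show "carrier (G Mod L) \<subseteq> ?f ` carrier B"
    proof
      fix Y assume "Y \<in> carrier (G Mod L)"
      then obtain g where g: "g \<in> carrier G" "Y = L #> g" unfolding carrier_FactGroup by blast
      have "(0, g) \<in> carrier B" using g(1) m_gt_1 by (simp add: B_simps)
      then show "Y \<in> ?f ` carrier B" using g(2) by force
    qed
  qed
qed

end

lemma (in finite_group) coset_eq_one_iff:
  assumes "N \<lhd> G" "g \<in> carrier G"
  shows "N #> g = \<one>\<^bsub>G Mod N\<^esub> \<longleftrightarrow> g \<in> N"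
proof -
  interpret N: normal N G by (rule assms)
  show ?thesis
    using assms(2) coset_join1[of N g] coset_join2[OF assms(2) N.subgroup_axioms] N.subset N.subgroup_axioms by auto
qed

text \<open>Let \<open>G\<close> act on \<open>L / N\<close> through \<open>a\<close>, and let \<open>B\<close> be its extension by a cyclic group \<open>C\<close> of order
  \<open>p\<^sup>2\<close> on which it acts through \<open>a\<^sup>p\<close>, which is multiplicative modulo \<open>p\<^sup>2\<close> and lifts \<open>a\<close>.
  The quotient of \<open>B\<close> by \<open>\<Delta>\<close> identifies \<open>L / N\<close> with the subgroup of order \<open>p\<close> of \<open>C\<close>, which is
  contained in \<open>\<Phi>(C)\<close>; so this quotient is in the class by saturation. The supersolvable quotient of \<open>B\<close> on
  which the complement acts faithfully separates \<open>C\<close> from the complement.\<close>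

lemma (in finite_group) in_class_prime_extension:
  assumes sat: "solvably_saturated_formation \<FF>" and sup: "\<UU> \<subseteq> \<FF>"
    and p: "Factorial_Ring.prime p" and N: "N \<lhd> G" and L: "L \<lhd> G"
    and NL: "N \<subseteq> L" "card L = card N * p" and cl: "in_class (G Mod L) \<FF>"
  shows "in_class (G Mod N) \<FF>"
proof -
  interpret L: normal L G by (rule L)
  interpret N: normal N G by (rule N)
  have form: "formation \<FF>" using sat unfolding solvably_saturated_formation_def by blast
  have p1: "1 < p" using prime_gt_1_nat[OF p] .
  obtain \<mu> a l where \<mu>: "mod_char p L \<mu>" and kmem: "\<And>y. y \<in> L \<Longrightarrow> y \<in> N \<longleftrightarrow> int p dvd \<mu> y"
    and l: "l \<in> L" "[\<mu> l = 1] (mod int p)"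
    and a: "\<And>g y. g \<in> carrier G \<Longrightarrow> y \<in> L \<Longrightarrow> [\<mu> (g \<otimes> y \<otimes> inv g) = a g * \<mu> y] (mod int p)"
    by (rule ex_conjugation_character[OF p N L NL]) blast
  have lG: "l \<in> carrier G" using l(1) L.subset by blast
  have a_val: "[\<mu> (g \<otimes> l \<otimes> inv g) = a g] (mod int p)" if "g \<in> carrier G" for g
    using cong_trans[OF a[OF that l(1)] cong_mult[OF cong_refl l(2)]] by simp
  have a_mult: "[a (g \<otimes> h) = a g * a h] (mod int p)" if gh: "g \<in> carrier G" "h \<in> carrier G" for g h
  proof -
    have hl: "h \<otimes> l \<otimes> inv h \<in> L" using L.inv_op_closed2 gh(2) l(1) by blast
    have e: "(g \<otimes> h) \<otimes> l \<otimes> inv (g \<otimes> h) = g \<otimes> (h \<otimes> l \<otimes> inv h) \<otimes> inv g"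
      using gh lG by (simp add: inv_mult_group m_assoc)
    have "[a (g \<otimes> h) = \<mu> ((g \<otimes> h) \<otimes> l \<otimes> inv (g \<otimes> h))] (mod int p)"
      using cong_sym[OF a_val[of "g \<otimes> h"]] gh by simp
    also have "[\<mu> ((g \<otimes> h) \<otimes> l \<otimes> inv (g \<otimes> h)) = a g * \<mu> (h \<otimes> l \<otimes> inv h)] (mod int p)"
      unfolding e by (rule a[OF gh(1) hl])
    also have "[a g * \<mu> (h \<otimes> l \<otimes> inv h) = a g * a h] (mod int p)"
      by (rule cong_mult[OF cong_refl a_val[OF gh(2)]])
    finally show ?thesis .
  qed
  have a_L: "[a g = 1] (mod int p)" if g: "g \<in> L" for g
    using cong_trans[OF cong_sym[OF a_val] cong_trans[OF mod_char_conj[OF \<mu> L.subgroup_axioms g l(1)] l(2)]]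
      g L.subset by blast
  have a_one: "[a \<one> = 1] (mod int p)" using a_L L.one_closed by blast
  \<comment> \<open>Multiplicative modulo p^2 because \<open>p\<close>-th powers lift congruences,
    and equal to \<open>a\<close> modulo \<open>p\<close> by Fermat. Hence \<open>G\<close> acts on
    the subgroup of order \<open>p\<close> in the cyclic group as it does on L / N.\<close>
  define \<chi> where "\<chi> g = a g ^ p" for g
  have \<chi>_mult: "[\<chi> (g \<otimes> h) = \<chi> g * \<chi> h] (mod int p ^ 2)" if "g \<in> carrier G" "h \<in> carrier G" for g h
    using cong_pow_prime_square[OF p a_mult[OF that]] by (simp add: \<chi>_def power_mult_distrib)
  have \<chi>_L: "[\<chi> g = 1] (mod int p ^ 2)" if "g \<in> L" for g
    using cong_pow_prime_square[OF p a_L[OF that]] by (simp add: \<chi>_def)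
  have \<chi>_a: "[\<chi> g = a g] (mod int p)" for g
    unfolding \<chi>_def by (rule fermat_int[OF p])
  interpret C: cyclic_semidirect G p \<chi>
    by (intro cyclic_semidirect.intro finite_group_axioms cyclic_semidirect_axioms.intro p)
      (use \<chi>_mult \<chi>_L[OF L.one_closed] in simp_all)
  have mod_m: "C.m = int p * int p" by (simp add: C.m_def power2_eq_square)
  have lift: "[int p * x = int p * y] (mod C.m)" if "[x = y] (mod int p)" for x y
    unfolding mod_m by (rule cong_cmult_leftI[OF that])
  note \<chi>_L = \<chi>_L[folded C.m_def]
  obtain \<gamma> where \<gamma>: "\<gamma> \<in> carrier G" "\<forall>g\<in>carrier G. \<exists>k::nat. [a g = a \<gamma> ^ k] (mod int p)"
    using ex_generator_mod_prime[OF p a_mult a_one] by blast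
  have gen: "\<exists>k::nat. [\<chi> g = \<chi> \<gamma> ^ k] (mod C.m)" if g: "g \<in> carrier G" for g
  proof -
    obtain k :: nat where k: "[a g = a \<gamma> ^ k] (mod int p)" using \<gamma>(2) g by blast
    have "[\<chi> g = \<chi> \<gamma> ^ k] (mod C.m)"
      using cong_pow_prime_square[OF p k] by (simp add: \<chi>_def C.m_def flip: power_mult) (simp add: mult.commute)
    then show ?thesis by blast
  qed
  obtain Y :: "nat monoid" and \<rho> where Y: "finite_group Y" "\<rho> \<in> hom C.B Y" "\<rho> ` carrier C.B = carrier Y"
    "in_class Y \<FF>" and \<rho>: "\<And>u g. (u, g) \<in> carrier C.B \<Longrightarrow> \<rho> (u, g) = \<one>\<^bsub>Y\<^esub> \<Longrightarrow> u = 0 \<and> [\<chi> g = 1] (mod C.m)"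
    by (rule C.metacyclic_quotient[OF \<gamma>(1) gen sup]) blast+
  interpret Y: finite_group Y by (rule Y(1))
  \<comment> \<open>Modulo this subgroup the element (0, g), for \<open>g\<close> in
    \<open>L\<close>, coincides with the translation by p times \<open>\<mu> g\<close>.\<close>
  let ?\<Delta> = "{(u, g). (u, g) \<in> carrier C.B \<and> g \<in> L \<and> [u + int p * \<mu> g = 0] (mod C.m)}"
  have \<Delta>: "?\<Delta> \<lhd> C.B"
  proof (rule C.B.normal_invI)
    show "subgroup ?\<Delta> C.B"
    proof (rule C.B.finite_subgroupI)
      show "?\<Delta> \<subseteq> carrier C.B" by blast
      have "[int p * \<mu> \<one> = int p * 0] (mod C.m)" by (rule lift[OF mod_char_one[OF \<mu> L.subgroup_axioms]])
      then have "(0, \<one>) \<in> ?\<Delta>" using C.m_gt_1 by (simp add: C.B_simps)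
      then show "?\<Delta> \<noteq> {}" by blast
      fix x y assume "x \<in> ?\<Delta>" "y \<in> ?\<Delta>"
      then obtain u g v h where x: "x = (u, g)" "(u, g) \<in> carrier C.B" "g \<in> L" "[u + int p * \<mu> g = 0] (mod C.m)"
        and y: "y = (v, h)" "(v, h) \<in> carrier C.B" "h \<in> L" "[v + int p * \<mu> h = 0] (mod C.m)" by blast
      have "x \<otimes>\<^bsub>C.B\<^esub> y \<in> carrier C.B" using x(1,2) y(1,2) by simp
      moreover have "[(u + \<chi> g * v) mod C.m + int p * \<mu> (g \<otimes> h) = 0] (mod C.m)"
      proof -
        have "[(u + \<chi> g * v) mod C.m + int p * \<mu> (g \<otimes> h) = (u + \<chi> g * v) + int p * \<mu> (g \<otimes> h)] (mod C.m)"
          by (intro cong_add cong_refl) simp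
        also have "[(u + \<chi> g * v) + int p * \<mu> (g \<otimes> h) = (u + 1 * v) + int p * (\<mu> g + \<mu> h)] (mod C.m)"
          by (intro cong_add cong_mult cong_refl \<chi>_L lift mod_charD[OF \<mu>] x(3) y(3))
        also have "(u + 1 * v) + int p * (\<mu> g + \<mu> h) = (u + int p * \<mu> g) + (v + int p * \<mu> h)"
          by (simp add: algebra_simps)
        also have "[(u + int p * \<mu> g) + (v + int p * \<mu> h) = 0 + 0] (mod C.m)" by (rule cong_add[OF x(4) y(4)])
        finally show ?thesis by simp
      qed
      ultimately show "x \<otimes>\<^bsub>C.B\<^esub> y \<in> ?\<Delta>" using x(1,3) y(1,3) by (simp add: C.B_simps)
    qed
    fix x y assume x: "x \<in> carrier C.B" and y: "y \<in> ?\<Delta>"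
    obtain v h where vh: "x = (v, h)" by fastforce
    obtain u g where ug: "y = (u, g)" "(u, g) \<in> carrier C.B" "g \<in> L" "[u + int p * \<mu> g = 0] (mod C.m)"
      using y by blast
    have h: "h \<in> carrier G" using x by (simp add: vh C.B_simps)
    obtain c where c: "x \<otimes>\<^bsub>C.B\<^esub> y \<otimes>\<^bsub>C.B\<^esub> inv\<^bsub>C.B\<^esub> x = (c, h \<otimes> g \<otimes> inv h)" "0 \<le> c" "c < C.m"
      "[c + \<chi> (h \<otimes> g \<otimes> inv h) * v = v + \<chi> h * u] (mod C.m)"
      using C.B_conj[OF x[unfolded vh] ug(2)] unfolding vh ug(1) by metis
    have g': "h \<otimes> g \<otimes> inv h \<in> L" using L.inv_op_closed2 h ug(3) by blast
    have "[c + 1 * v = c + \<chi> (h \<otimes> g \<otimes> inv h) * v] (mod C.m)"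
      by (intro cong_add cong_mult cong_refl cong_sym[OF \<chi>_L] g')
    then have "[c + v = \<chi> h * u + v] (mod C.m)" using cong_trans c(4) by (metis add.commute mult_1)
    then have c': "[c = \<chi> h * u] (mod C.m)" using cong_add_rcancel by blast
    have "[\<mu> (h \<otimes> g \<otimes> inv h) = \<chi> h * \<mu> g] (mod int p)"
      using cong_trans[OF a[OF h ug(3)] cong_mult[OF cong_sym[OF \<chi>_a] cong_refl]] .
    then have "[c + int p * \<mu> (h \<otimes> g \<otimes> inv h) = \<chi> h * u + int p * (\<chi> h * \<mu> g)] (mod C.m)"
      by (intro cong_add c' lift)
    also have "\<chi> h * u + int p * (\<chi> h * \<mu> g) = \<chi> h * (u + int p * \<mu> g)" by (simp add: algebra_simps)
    also have "[\<chi> h * (u + int p * \<mu> g) = \<chi> h * 0] (mod C.m)" by (rule cong_mult[OF cong_refl ug(4)])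
    finally have "[c + int p * \<mu> (h \<otimes> g \<otimes> inv h) = 0] (mod C.m)" by simp
    then show "x \<otimes>\<^bsub>C.B\<^esub> y \<otimes>\<^bsub>C.B\<^esub> inv\<^bsub>C.B\<^esub> x \<in> ?\<Delta>"
      using c(1-3) g' L.subset by (auto simp: C.B_simps)
  qed
  obtain H :: "nat monoid" and \<pi> where H: "finite_group H" "\<pi> \<in> hom C.B H" "\<pi> ` carrier C.B = carrier H"
    and ker: "\<forall>x\<in>carrier C.B. \<pi> x = \<one>\<^bsub>H\<^esub> \<longleftrightarrow> x \<in> ?\<Delta>"
    by (rule ex_nat_quotient[OF C.B.is_group C.B.finite_carrier \<Delta>])
  interpret H: finite_group H by (rule H(1))
  interpret \<pi>: group_hom C.B H \<pi> using surj_homI[OF C.B.is_group H.is_group H(2,3)] .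
  define s where "s = \<pi> (1, \<one>)"
  define S where "S = generate H {s}"
  have cB: "(1, \<one>) \<in> carrier C.B" using C.m_gt_1 by (simp add: C.B_simps)
  have sH: "s \<in> carrier H" unfolding s_def using cB by simp
  have s_pow: "s [^]\<^bsub>H\<^esub> (k::nat) = \<pi> (int k mod C.m, \<one>)" for k
    using \<pi>.hom_nat_pow[OF cB, of k] C.pow_translation unfolding s_def by simp
  have SH: "S \<lhd> H" unfolding S_def s_def by (rule C.translation_normal[OF H])
  have "s [^]\<^bsub>H\<^esub> (p ^ 2) = \<pi> \<one>\<^bsub>C.B\<^esub>" unfolding s_pow by (simp add: C.B_simps C.m_def)
  then have "s [^]\<^bsub>H\<^esub> (p ^ 2) = \<one>\<^bsub>H\<^esub>" by simp
  then have Sp: "H.p_subgroup p S" unfolding S_def by (rule H.card_generate_singleton[OF p sH])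
  have sS: "s \<in> S" unfolding S_def by (simp add: generate.incl)
  define \<Phi> where "\<Phi> = frattini (H\<lparr>carrier := S\<rparr>)"
  have \<Phi>s: "subgroup \<Phi> H" unfolding \<Phi>_def by (rule H.frattini_subgroup[OF H.p_subgroupD[OF Sp]])
  have \<Phi>: "\<Phi> \<lhd> H"
    unfolding H.normal_iff_normalizes[OF \<Phi>s]
  proof
    fix x assume x: "x \<in> carrier H"
    show "H.normalizes x \<Phi>"
      unfolding \<Phi>_def by (rule H.frattini_normalizes[OF p Sp x H.normal_normalizes[OF SH x]])
  qed
  interpret \<Phi>: normal \<Phi> H by (rule \<Phi>)
  have sp: "s [^]\<^bsub>H\<^esub> p \<in> \<Phi>" unfolding \<Phi>_def by (rule H.pow_p_in_frattini[OF p Sp sS])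
  have ker\<Phi>: "\<pi> (0, g) \<in> \<Phi>" if g: "g \<in> L" for g
  proof -
    \<comment> \<open>A natural number congruent to \<open>\<mu> g\<close>, so that
      \<open>\<pi> (0, g)\<close> is the \<open>k\<close>-th power of the \<open>p\<close>-th power
      of \<open>s\<close>, and the latter lies in \<Phi>.\<close>
    define k where "k = nat (\<mu> g mod int p)"
    have "int k = \<mu> g mod int p" using p1 by (simp add: k_def)
    then have k: "int p * \<mu> g mod C.m = int (p * k)"
      unfolding mod_m of_nat_mult by (metis mult_mod_right)
    let ?w = "(- (int p * \<mu> g)) mod C.m"
    have gG: "g \<in> carrier G" using g L.subset by blast
    have wB: "(?w, g) \<in> carrier C.B" using gG C.m_gt_1 by (simp add: C.B_simps)
    have b: "(int (p * k) mod C.m, \<one>) \<in> carrier C.B" using C.m_gt_1 by (simp add: C.B_simps)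
    have "[?w + int p * \<mu> g = - (int p * \<mu> g) + int p * \<mu> g] (mod C.m)"
      by (intro cong_add cong_refl) simp
    then have w: "[?w + int p * \<mu> g = 0] (mod C.m)" by simp
    then have "(?w, g) \<in> ?\<Delta>" using wB g by simp
    then have "\<pi> (?w, g) = \<one>\<^bsub>H\<^esub>" using ker wB by blast
    moreover have "(int (p * k) mod C.m, \<one>) \<otimes>\<^bsub>C.B\<^esub> (?w, g) = (0, g)"
    proof -
      have "[int (p * k) mod C.m + \<chi> \<one> * ?w = int p * \<mu> g + ?w] (mod C.m)"
        using C.chi_one_mult[of ?w] unfolding k[symmetric] by (intro cong_add) simp_all
      then have "[int (p * k) mod C.m + \<chi> \<one> * ?w = 0] (mod C.m)" using cong_trans w by (metis add.commute)
      then show ?thesis using gG by (simp only: C.B_simps cong_def) simp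
    qed
    ultimately have "\<pi> (0, g) = s [^]\<^bsub>H\<^esub> (p * k)"
      using \<pi>.hom_mult[OF b wB] b unfolding s_pow by simp
    then have "\<pi> (0, g) = (s [^]\<^bsub>H\<^esub> p) [^]\<^bsub>H\<^esub> k" using sH by (simp add: H.nat_pow_pow)
    then show ?thesis using H.nat_pow_mem[OF \<Phi>s sp] by simp
  qed
  \<comment> \<open>The maps from \<open>B\<close> to G / L and to \<open>Y\<close> have a common
    kernel that consists of pairs (0, g) with \<open>g\<close> in \<open>L\<close>, and
    \<open>ker\<Phi>\<close> places their images in \<Phi>.\<close>
  have "in_class (H Mod \<Phi>) \<FF>"
  proof (rule in_class_subdirect[OF form C.B.is_group C.B.finite_carrier L.factorgroup_is_group C.coset_hom[OF L] cl
        Y.is_group Y(2-4) \<Phi>.factorgroup_is_group])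
    show "(\<lambda>x. \<Phi> #>\<^bsub>H\<^esub> x) \<circ> \<pi> \<in> hom C.B (H Mod \<Phi>)"
      by (rule Group.hom_compose[OF H(2) \<Phi>.r_coset_hom_Mod])
    show "((\<lambda>x. \<Phi> #>\<^bsub>H\<^esub> x) \<circ> \<pi>) ` carrier C.B = carrier (H Mod \<Phi>)"
      unfolding carrier_FactGroup using H(3) by (metis image_comp)
    fix x assume x: "x \<in> carrier C.B" "(case x of (u, g) \<Rightarrow> L #> g) = \<one>\<^bsub>G Mod L\<^esub>" "\<rho> x = \<one>\<^bsub>Y\<^esub>"
    obtain u g where ug: "x = (u, g)" by fastforce
    have gG: "g \<in> carrier G" using x(1) by (simp add: ug C.B_simps)
    have "L #> g = \<one>\<^bsub>G Mod L\<^esub>" using x(2) by (simp add: ug)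
    then have "g \<in> L" using coset_eq_one_iff[OF L gG] by blast
    moreover have "u = 0" using \<rho> x(1,3) unfolding ug by blast
    ultimately have "\<pi> x \<in> \<Phi>" using ker\<Phi> ug by blast
    then show "((\<lambda>x. \<Phi> #>\<^bsub>H\<^esub> x) \<circ> \<pi>) x = \<one>\<^bsub>H Mod \<Phi>\<^esub>"
      using H.coset_eq_one_iff[OF \<Phi>, of "\<pi> x"] x(1) by simp
  qed
  moreover have "solvable (H\<lparr>carrier := S\<rparr>)" unfolding S_def by (rule H.solvable_generate_singleton[OF sH])
  ultimately have "H \<in> \<FF>"
    using sat SH H.is_group H.finite_carrier unfolding solvably_saturated_formation_def \<Phi>_def by blast
  then have HF: "in_class H \<FF>" unfolding in_class_def using iso_refl by blast
  \<comment> \<open>What both \<open>\<pi>\<close> and \<open>\<rho>\<close> kill has the form (0,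
    g) and lies in \<open>?\<Delta>\<close>. Then \<open>p\<close> divides \<open>\<mu> g\<close>,
    so \<open>g\<close> is in \<open>N\<close>; thus G / N is an image of a subdirect product of
    \<open>H\<close> and \<open>Y\<close>.\<close>
  show ?thesis
  proof (rule in_class_subdirect[OF form C.B.is_group C.B.finite_carrier H.is_group H(2,3) HF
        Y.is_group Y(2-4) N.factorgroup_is_group C.coset_hom[OF N]])
    fix x assume x: "x \<in> carrier C.B" "\<pi> x = \<one>\<^bsub>H\<^esub>" "\<rho> x = \<one>\<^bsub>Y\<^esub>"
    obtain u g where ug: "x = (u, g)" by fastforce
    have gG: "g \<in> carrier G" using x(1) by (simp add: ug C.B_simps)
    have u: "u = 0" using \<rho> x(1,3) unfolding ug by blast
    have "(u, g) \<in> ?\<Delta>" using ker x(1,2) ug by blast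
    then have g: "g \<in> L" "[int p * \<mu> g = 0] (mod C.m)" using u by simp_all
    then have "int p dvd \<mu> g" using p1 by (simp add: mod_m cong_0_iff)
    then have "g \<in> N" using kmem[OF g(1)] by blast
    then show "(case x of (u, g) \<Rightarrow> N #> g) = \<one>\<^bsub>G Mod N\<^esub>"
      using coset_eq_one_iff[OF N gG] ug by simp
  qed
qed

section \<open>Descending to the normal complement\<close>

context finite_group
begin

text \<open>A cyclic group has at most one subgroup of each order.\<close>

lemma normalizes_subgroup_of_cyclic:
  assumes P: "subgroup P G" and cyc: "y \<in> P" "\<And>z. z \<in> P \<Longrightarrow> \<exists>i::nat. z = y [^] i"
    and T: "subgroup T G" "T \<subseteq> P" and h: "h \<in> carrier G" "normalizes h P"
  shows "normalizes h T"
  unfolding normalizes_def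
proof
  fix t assume t: "t \<in> T"
  have yG: "y \<in> carrier G" and tG: "t \<in> carrier G" using cyc(1) t P T(1) subgroup.mem_carrier by fast+
  obtain i where i: "t = y [^] (i::nat)" using cyc(2) t T(2) by blast
  have "h \<otimes> t \<otimes> inv h \<in> P" using h(2) t T(2) by (auto simp: normalizes_def)
  then obtain j where j: "h \<otimes> t \<otimes> inv h = y [^] (j::nat)" using cyc(2) by blast
  have "ord (y [^] i) = ord (y [^] j)" using ord_conj[OF h(1) tG] unfolding i[symmetric] j[symmetric] by simp
  then obtain k :: nat where "y [^] j = (y [^] i) [^] k" using cyclic_same_ord[OF yG] by blast
  then have "h \<otimes> t \<otimes> inv h = t [^] k" using i j by simp
  then show "h \<otimes> t \<otimes> inv h \<in> T" using nat_pow_mem[OF T(1) t] by simp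
qed

text \<open>A Sylow subgroup \<open>S\<close> of \<open>H\<close> leaves some nonzero character of
  \<open>T\<close> invariant and so normalizes its kernel. The residual of \<open>H\<close> is
  generated by elements centralizing \<open>T\<close> and normalizes the kernel too; together the
  two make up \<open>H\<close>.\<close>

lemma ex_invariant_index_p:
  assumes p: "Factorial_Ring.prime p" and H: "subgroup H G" and T: "p_subgroup p T" "T \<noteq> {\<one>}" "T \<subseteq> H"
    and HT: "\<And>h. h \<in> H \<Longrightarrow> normalizes h T" and c: "\<And>x. x \<in> p_regular p H \<Longrightarrow> centralizes x T"
  shows "\<exists>T'. subgroup T' G \<and> T' \<subseteq> T \<and> card T = card T' * p \<and> (\<forall>h\<in>H. normalizes h T')"
proof -
  have TG: "subgroup T G" using T(1) p_subgroupD by blast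
  obtain S where S: "sylow_in p S H" "T \<subseteq> S" using sylow_containing[OF p H T(1,3)] by blast
  have SG: "p_subgroup p S" "subgroup S G" "S \<subseteq> H" using sylow_inD[OF S(1)] by auto
  have one: "subgroup {\<one>} G" by (rule triv_subgroup)
  have "{\<one>} \<subset> T" using T(2) subgroup.one_closed[OF TG] by blast
  moreover have "normalizes u {\<one>}" if "u \<in> S" for u
    using that SG(2) subgroup.mem_carrier by (fastforce simp: normalizes_def)
  moreover have "normalizes u T" if "u \<in> S" for u using HT that SG(3) by blast
  ultimately have "\<exists>l. mod_char p T l \<and> (\<forall>u\<in>S. \<forall>q\<in>T. [l (u \<otimes> q \<otimes> inv u) = l q] (mod int p)) \<and> (\<exists>y\<in>T. \<not> int p dvd l y)"
    by (elim ex_invariant_mod_char[OF p SG(1) TG S(2) _ one]) blast+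
  then obtain l y where l: "mod_char p T l" "\<forall>u\<in>S. \<forall>q\<in>T. [l (u \<otimes> q \<otimes> inv u) = l q] (mod int p)"
    and y: "y \<in> T" "\<not> int p dvd l y" by blast
  let ?T = "{x \<in> T. int p dvd l x}"
  have T': "subgroup ?T G" by (rule mod_char_kernel_subgroup[OF l(1) TG])
  have sub: "subgroup {h \<in> H. normalizes h ?T} G" by (rule normalizer_subgroup[OF H T'])
  have "p_regular p H \<subseteq> {h \<in> H. normalizes h ?T}"
  proof
    fix x assume x: "x \<in> p_regular p H"
    have xH: "x \<in> H" using x p_regular_subset by blast
    have xG: "x \<in> carrier G" using xH subgroup.mem_carrier[OF H] by blast
    have "x \<otimes> t \<otimes> inv x = t" if "t \<in> T" for t
    proof -
      have tG: "t \<in> carrier G" using that subgroup.mem_carrier[OF TG] by blast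
      have "x \<otimes> t = t \<otimes> x" using c[OF x] that by (simp add: centralizes_def)
      then show ?thesis using xG tG by (simp add: m_assoc)
    qed
    then have "normalizes x ?T" by (simp add: normalizes_def)
    then show "x \<in> {h \<in> H. normalizes h ?T}" using xH by blast
  qed
  then have r: "p_residual p H \<subseteq> {h \<in> H. normalizes h ?T}" by (rule p_residual_least[OF sub])
  have s: "S \<subseteq> {h \<in> H. normalizes h ?T}"
  proof
    fix u assume u: "u \<in> S"
    have "u \<otimes> t \<otimes> inv u \<in> ?T" if t: "t \<in> ?T" for t
    proof -
      have "u \<otimes> t \<otimes> inv u \<in> T" using HT[of u] u SG(3) t by (auto simp: normalizes_def)
      moreover have "int p dvd l (u \<otimes> t \<otimes> inv u)" using l(2) u t cong_dvd_iff by blast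
      ultimately show ?thesis by blast
    qed
    then show "u \<in> {h \<in> H. normalizes h ?T}" using u SG(3) by (auto simp: normalizes_def)
  qed
  have "p_residual p H <#> S \<subseteq> {h \<in> H. normalizes h ?T}" by (rule set_mult_subset_subgroup[OF sub r s])
  then have "H \<subseteq> {h \<in> H. normalizes h ?T}" using p_residual_supplement[OF p H S(1)] by simp
  then have "normalizes h ?T" if "h \<in> H" for h using that by blast
  moreover have "card T = card ?T * p" using card_mod_char_kernel[OF p l(1) TG y] by simp
  ultimately show ?thesis using T' by (intro exI[of _ ?T]) blast
qed

text \<open>Since G = N H, an \<open>H\<close>-invariant \<open>p\<close>-subgroup A yields a normal
  subgroup N A of \<open>G\<close>, and its order is |N| |A| because \<open>p\<close> does not
  divide |N|. So each passage from \<open>T\<close> to \<open>T'\<close> is an extension of order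
  \<open>p\<close>. How \<open>T'\<close> arises is left to \<open>step\<close>, as it differs for
  cyclic and IC\<Phi> Sylow subgroups.\<close>

lemma in_class_complement:
  assumes sat: "solvably_saturated_formation \<FF>" and sup: "\<UU> \<subseteq> \<FF>"
    and p: "Factorial_Ring.prime p" and N: "N \<lhd> G" "\<not> p dvd card N" and H: "subgroup H G"
    and fac: "\<And>g. g \<in> carrier G \<Longrightarrow> \<exists>n\<in>N. \<exists>h\<in>H. g = n \<otimes> h"
    and step: "\<And>T. p_subgroup p T \<Longrightarrow> T \<subseteq> P \<Longrightarrow> T \<noteq> {\<one>} \<Longrightarrow> (\<And>h. h \<in> H \<Longrightarrow> normalizes h T) \<Longrightarrow>
      \<exists>T'. subgroup T' G \<and> T' \<subseteq> T \<and> card T = card T' * p \<and> (\<forall>h\<in>H. normalizes h T')"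
    and T: "p_subgroup p T" "T \<subseteq> P" "\<And>h. h \<in> H \<Longrightarrow> normalizes h T" "in_class (G Mod (N <#> T)) \<FF>"
  shows "in_class (G Mod N) \<FF>"
  using T
proof (induction "card T" arbitrary: T rule: less_induct)
  case less
  note T = less.prems
  interpret N: normal N G by (rule N(1))
  have p1: "1 < p" using prime_gt_1_nat[OF p] .
  have HG: "h \<in> carrier G" if "h \<in> H" for h using that subgroup.mem_carrier[OF H] by blast
  have norm: "N <#> A \<lhd> G" if A: "subgroup A G" "\<And>h. h \<in> H \<Longrightarrow> normalizes h A" for A
  proof -
    have s: "subgroup (N <#> A) G"
      using normal_normalizes[OF N(1)] subgroup.mem_carrier[OF A(1)]
      by (intro subgroup_set_mult[OF N.subgroup_axioms A(1)]) blast
    have "normalizes g (N <#> A)" if g: "g \<in> carrier G" for g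
    proof -
      obtain n h where nh: "n \<in> N" "h \<in> H" "g = n \<otimes> h" using fac[OF g] by blast
      have "normalizes n (N <#> A)"
        using normalizes_self[OF s] subset_set_mult(1)[OF N.subgroup_axioms A(1)] nh(1) by blast
      moreover have "normalizes h (N <#> A)"
        by (rule normalizes_set_mult[OF HG[OF nh(2)] N.subset subgroup.subset[OF A(1)]
              normal_normalizes[OF N(1) HG[OF nh(2)]] A(2)[OF nh(2)]])
      ultimately show ?thesis
        unfolding nh(3) using nh(1,2) HG N.subset subgroup.subset[OF s] by (intro normalizes_mult) auto
    qed
    then show ?thesis using normal_iff_normalizes[OF s] by blast
  qed
  have card: "card (N <#> A) = card N * card A" if A: "p_subgroup p A" for A
  proof -
    have AG: "subgroup A G" using A p_subgroupD by blast
    obtain k where k: "card A = p ^ k" using A unfolding p_subgroup_def by blast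
    have I: "subgroup (N \<inter> A) G" by (rule subgroups_Inter_pair[OF N.subgroup_axioms AG])
    have "card (N \<inter> A) dvd card N" "card (N \<inter> A) dvd p ^ k"
      using card_subgroup_dvd[OF I N.subgroup_axioms] card_subgroup_dvd[OF I AG] k by simp_all
    moreover have "coprime (card N) (p ^ k)" using N(2) p prime_imp_coprime coprime_commute coprime_power_right_iff by metis
    ultimately have "card (N \<inter> A) = 1" by (metis coprime_common_divisor nat_dvd_1_iff_1)
    then show ?thesis using card_set_mult[OF N.subgroup_axioms AG] by simp
  qed
  show ?case
  proof (cases "T = {\<one>}")
    case True
    have "N <#> {\<one>} = N" using N.subset by (force simp: set_mult_def)
    then show ?thesis using T(4) True by simp
  next
    case False
    then obtain T' where T': "subgroup T' G" "T' \<subseteq> T" "card T = card T' * p" "\<forall>h\<in>H. normalizes h T'"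
      using step[OF T(1,2) False T(3)] by blast
    have pT': "p_subgroup p T'" by (rule p_subgroup_subset[OF p T(1) T'(1,2)])
    have TG: "subgroup T G" using T(1) p_subgroupD by blast
    have n: "normalizes h T'" if "h \<in> H" for h using T'(4) that by blast
    have "in_class (G Mod (N <#> T')) \<FF>"
    proof (rule in_class_prime_extension[OF sat sup p norm[OF T'(1) n] norm[OF TG T(3)] _ _ T(4)])
      show "N <#> T' \<subseteq> N <#> T" using T'(2) by (auto simp: set_mult_def)
      show "card (N <#> T) = card (N <#> T') * p" using card[OF T(1)] card[OF pT'] T'(3) by simp
    qed
    moreover have "card T' < card T" using T'(3) p1 card_subgroup_pos[OF T'(1)] by simp
    ultimately show ?thesis using less.hyps[of T'] pT' T'(2) T(2) n by blast
  qed
qed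

theorem in_class_if_cyclic_or_IC_Phi:
  assumes sat: "solvably_saturated_formation \<FF>" and sup: "\<UU> \<subseteq> \<FF>"
    and "K \<lhd> G" "in_class (G Mod K) \<FF>"
    and "\<And>p. Factorial_Ring.prime p \<Longrightarrow> p dvd card K \<Longrightarrow> \<exists>P. sylow_in p P K \<and>
      ((\<exists>y\<in>P. \<forall>z\<in>P. \<exists>i::nat. z = y [^] i) \<or> (\<exists>k. 1 < p ^ k \<and> p ^ k \<le> card P \<and> IC_Phi_at p (p ^ k) P))"
  shows "in_class G \<FF>"
  using assms(3-)
proof (induction "card K" arbitrary: K rule: less_induct)
  case less
  note cl = less.prems(2) and loc = less.prems(3)
  interpret K: normal K G by (rule less.prems(1))
  have K: "subgroup K G" by (rule K.subgroup_axioms)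
  show ?case
  proof (cases "card K = 1")
    case True
    then have "K = {\<one>}" using K.one_closed by (metis card_1_singletonE singletonD)
    moreover have "G Mod {\<one>} \<cong> G" using trivial_factor_iso is_isoI by blast
    ultimately show ?thesis using cl in_class_iso[OF K.factorgroup_is_group] by simp
  next
    case False
    define p where "p = (LEAST q. Factorial_Ring.prime q \<and> q dvd card K)"
    have "\<exists>q. Factorial_Ring.prime q \<and> q dvd card K" using prime_factor_nat[OF False] by blast
    then have p: "Factorial_Ring.prime p" "p dvd card K"
      unfolding p_def using LeastI_ex[of "\<lambda>q. Factorial_Ring.prime q \<and> q dvd card K"] by blast+
    have least: "p \<le> q" if "Factorial_Ring.prime q" "q dvd card K" for q
      unfolding p_def using that by (intro Least_le) blast
    obtain P where P: "sylow_in p P K" and alt: "(\<exists>y\<in>P. \<forall>z\<in>P. \<exists>i::nat. z = y [^] i) \<or>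
        (\<exists>k. 1 < p ^ k \<and> p ^ k \<le> card P \<and> IC_Phi_at p (p ^ k) P)"
      using loc[OF p] by blast
    have PG: "p_subgroup p P" "subgroup P G" "P \<subseteq> K" using sylow_inD[OF P] by auto
    have PC: "P \<subseteq> carrier G" using PG(2) subgroup.subset by blast
    let ?N = "p_residual p K"
    have nil: "\<not> p dvd card ?N"
      using alt
    proof
      assume "\<exists>y\<in>P. \<forall>z\<in>P. \<exists>i::nat. z = y [^] i"
      then obtain y where y: "y \<in> P" "\<And>z. z \<in> P \<Longrightarrow> \<exists>i::nat. z = y [^] i" by blast
      then show ?thesis by (rule p_nilpotent_if_cyclic_sylow[OF p(1) K P _ _ least])
    next
      assume "\<exists>k. 1 < p ^ k \<and> p ^ k \<le> card P \<and> IC_Phi_at p (p ^ k) P"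
      then obtain k where "1 < p ^ k" "p ^ k \<le> card P" "IC_Phi_at p (p ^ k) P" by blast
      then show ?thesis using p_nilpotent_if_IC_Phi[OF p(1) refl _ K P] by blast
    qed
    have NG: "subgroup ?N G" by (rule p_residual_subgroup[OF K])
    have N: "?N \<lhd> G"
      unfolding normal_iff_normalizes[OF NG]
      using p_residual_normalizes[OF K _ normal_normalizes[OF less.prems(1)]] by blast
    have NK: "?N \<subseteq> K" by (rule p_residual_subset[OF K])
    have supp: "?N <#> P = K" by (rule p_residual_supplement[OF p(1) K P])
    define H where "H = {h \<in> carrier G. normalizes h P}"
    have H: "subgroup H G" unfolding H_def by (rule normalizer_subgroup[OF subgroup_self PG(2)])
    have PH: "P \<subseteq> H" unfolding H_def using PC normalizes_self[OF PG(2)] by blast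
    have fac: "\<exists>n\<in>?N. \<exists>h\<in>H. g = n \<otimes> h" if g: "g \<in> carrier G" for g
    proof -
      obtain w m where w: "w \<in> K" and m: "m \<in> carrier G" "normalizes m P" and gwm: "g = w \<otimes> m"
        by (rule frattini_argument[OF p(1) subgroup_self K K.subset normal_normalizes[OF less.prems(1)] P g])
      have "w \<in> ?N <#> P" using w supp by simp
      then obtain n x where nx: "n \<in> ?N" "x \<in> P" "w = n \<otimes> x" unfolding mem_set_mult by blast
      have "x \<otimes> m \<in> H" using subgroup.m_closed[OF H] PH nx(2) m unfolding H_def by blast
      moreover have "g = n \<otimes> (x \<otimes> m)"
        unfolding gwm nx(3) using m(1) nx(1,2) PC subgroup.subset[OF NG] by (simp add: m_assoc subsetD)
      ultimately show ?thesis using nx(1) by blast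
    qed
    have step: "\<exists>T'. subgroup T' G \<and> T' \<subseteq> T \<and> card T = card T' * p \<and> (\<forall>h\<in>H. normalizes h T')"
      if T: "p_subgroup p T" "T \<subseteq> P" "T \<noteq> {\<one>}" "\<And>h. h \<in> H \<Longrightarrow> normalizes h T" for T
      using alt
    proof
      assume "\<exists>y\<in>P. \<forall>z\<in>P. \<exists>i::nat. z = y [^] i"
      then obtain y where y: "y \<in> P" "\<And>z. z \<in> P \<Longrightarrow> \<exists>i::nat. z = y [^] i" by blast
      have TG: "subgroup T G" using T(1) p_subgroupD by blast
      \<comment> \<open>A \<open>p\<close>-group has no nontrivial elements of order prime to
        \<open>p\<close>. Letting \<open>T\<close> act on itself thus yields a subgroup of index
        \<open>p\<close>, and inside the cyclic group \<open>P\<close> it is invariant under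
        \<open>H\<close>.\<close>
      have "centralizes x T" if "x \<in> p_regular p T" for x
      proof -
        have "p_residual p T \<subseteq> {\<one>}"
        proof (rule p_residual_least[OF triv_subgroup])
          obtain k where "card T = p ^ k" using T(1) unfolding p_subgroup_def by blast
          then show "p_regular p T \<subseteq> {\<one>}"
            using subgroup.one_closed[OF TG] normal_normalizes[OF one_is_normal] subgroup.mem_carrier[OF TG]
            by (intro p_regular_subset_normal[OF p(1) TG triv_subgroup]) auto
        qed
        then have "x = \<one>" using that p_regular_subset_residual by blast
        then show ?thesis using subgroup.mem_carrier[OF TG] by (simp add: centralizes_def)
      qed
      then obtain T' where "subgroup T' G" "T' \<subseteq> T" "card T = card T' * p"
        using ex_invariant_index_p[OF p(1) TG T(1,3) subset_refl normalizes_self[OF TG]] by blast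
      moreover have "normalizes h T'" if "h \<in> H" "subgroup T' G" "T' \<subseteq> T" for h T'
        using normalizes_subgroup_of_cyclic[OF PG(2) y that(2) subset_trans[OF that(3) T(2)]] that(1)
        unfolding H_def by blast
      ultimately show ?thesis by blast
    next
      assume "\<exists>k. 1 < p ^ k \<and> p ^ k \<le> card P \<and> IC_Phi_at p (p ^ k) P"
      then obtain k where k: "1 < p ^ k" "p ^ k \<le> card P" "IC_Phi_at p (p ^ k) P" by blast
      have c: "centralizes x T" if x: "x \<in> p_regular p H" for x
      proof -
        have "normalizes x P" using x p_regular_subset unfolding H_def by blast
        then have "centralizes x P" by (rule IC_Phi_at_centralizes[OF p(1) PG(1) refl k H x])
        then show ?thesis using T(2) by (auto simp: centralizes_def)
      qed
      show ?thesis by (rule ex_invariant_index_p[OF p(1) H T(1,3) subset_trans[OF T(2) PH] T(4) c])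
    qed
    have "in_class (G Mod ?N) \<FF>"
      by (rule in_class_complement[OF sat sup p(1) N nil H fac step PG(1) subset_refl])
        (use cl supp in \<open>auto simp: H_def\<close>)
    moreover have "card ?N < card K"
    proof (rule psubset_card_mono)
      show "finite K" using K.subset finite_carrier finite_subset by blast
      show "?N \<subset> K" using NK nil p(2) by auto
    qed
    moreover have "\<exists>P. sylow_in q P ?N \<and>
        ((\<exists>y\<in>P. \<forall>z\<in>P. \<exists>i::nat. z = y [^] i) \<or> (\<exists>k. 1 < q ^ k \<and> q ^ k \<le> card P \<and> IC_Phi_at q (q ^ k) P))"
      if q: "Factorial_Ring.prime q" "q dvd card ?N" for q
    proof -
      have qK: "q dvd card K" using q(2) card_subgroup_dvd[OF NG K NK] dvd_trans by blast
      have qp: "q \<noteq> p" using q(2) nil by blast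
      obtain Q where Q: "sylow_in q Q K" and Qa: "(\<exists>y\<in>Q. \<forall>z\<in>Q. \<exists>i::nat. z = y [^] i) \<or>
          (\<exists>k. 1 < q ^ k \<and> q ^ k \<le> card Q \<and> IC_Phi_at q (q ^ k) Q)"
        using loc[OF q(1) qK] by blast
      \<comment> \<open>The residual contains all elements of \<open>q\<close>-power order, so Sylow
        subgroups for the other primes carry over to the next step together with their
        hypotheses.\<close>
      have "Q \<subseteq> ?N"
      proof
        fix x assume x: "x \<in> Q"
        obtain n where "x [^] (q ^ n) = \<one>" using p_power_eventually_one[OF sylow_inD(1)[OF Q] x] by blast
        then have "x \<in> p_regular p K" unfolding p_regular_def using q(1) qp x sylow_inD(3)[OF Q] by blast
        then show "x \<in> ?N" using p_regular_subset_residual by blast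
      qed
      then have "Q \<inter> ?N = Q" by blast
      moreover have "sylow_in q (Q \<inter> ?N) ?N"
        using N K.subset by (intro sylow_Int_normal[OF q(1) K Q NG NK] normal_normalizes) auto
      ultimately show ?thesis using Qa by metis
    qed
    ultimately show ?thesis using less.hyps[of ?N] N by blast
  qed
qed

end

theorem theorem1p4:
  fixes \<FF> :: "nat monoid set"
    and G :: "'a monoid"
    and E :: "'a set"
    and t :: nat
    and p :: "nat \<Rightarrow> nat"
    and P D :: "nat \<Rightarrow> 'a set"
  assumes "solvably_saturated_formation \<FF>"
    and "\<UU> \<subseteq> \<FF>"
    and "group G" and "finite (carrier G)"
    and "E \<lhd> G" and "E \<noteq> {\<one>\<^bsub>G\<^esub>}"
    and "in_class (G Mod E) \<FF>"
    and "t = card (prime_factors (card E))"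
    and "strict_mono_on {1..t} p"
    and "p ` {1..t} = prime_factors (card E)"
    and "\<And>i. i \<in> {1..t} \<Longrightarrow> sylow_subgroup (p i) (P i) (G\<lparr>carrier := E\<rparr>)"
    and "\<And>i. i \<in> {1..t} \<Longrightarrow>
           cyclic_group (G\<lparr>carrier := P i\<rparr>) \<or>
           (subgroup (D i) (G\<lparr>carrier := P i\<rparr>) \<and> 1 < card (D i) \<and> card (D i) \<le> card (P i) \<and>
            (\<forall>H. subgroup H (G\<lparr>carrier := P i\<rparr>) \<and> card H = card (D i) \<longrightarrow>
                 IC_Phi_subgroup H G))"
    and "p 1 = 2 \<and> card (D 1) = 2 \<and> \<not> Q8_free (G\<lparr>carrier := P 1\<rparr>) \<Longrightarrow>
           \<forall>C. subgroup C (G\<lparr>carrier := P 1\<rparr>) \<and> cyclic_group (G\<lparr>carrier := C\<rparr>) \<and> card C = 4 \<longrightarrow>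
               IC_Phi_subgroup C G"
  shows "in_class G \<FF>"
proof -
  interpret group G by fact
  interpret finite_group G using assms(3,4) by (intro finite_group.intro finite_group_axioms.intro)
  interpret E: normal E G by fact
  have E: "subgroup E G" by (rule E.subgroup_axioms)
  have cE: "0 < card E" by (rule card_subgroup_pos[OF E])
  show ?thesis
  proof (rule in_class_if_cyclic_or_IC_Phi[OF assms(1,2,5,7)])
    fix q assume q: "Factorial_Ring.prime q" "q dvd card E"
    then have "q \<in> p ` {1..t}" using cE assms(10) by (simp add: prime_factors_dvd)
    then obtain i where i: "i \<in> {1..t}" "p i = q" by blast
    have "subgroup (P i) (G\<lparr>carrier := E\<rparr>)" "card (P i) = q ^ multiplicity q (card E)"
      using assms(11)[OF i(1)] i(2) by (simp_all add: sylow_subgroup_def order_def)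
    then have Pi: "sylow_in q (P i) E" "card (P i) = q ^ multiplicity q (card E)"
      using sylow_in_iff[OF q(1) E] subgroup_subgroup_iff[OF E] by blast+
    have PG: "subgroup (P i) G" by (rule sylow_inD(2)[OF Pi(1)])
    have "(\<exists>y\<in>P i. \<forall>z\<in>P i. \<exists>n::nat. z = y [^]\<^bsub>G\<^esub> n) \<or>
        (\<exists>k. 1 < q ^ k \<and> q ^ k \<le> card (P i) \<and> IC_Phi_at q (q ^ k) (P i))"
      using assms(12)[OF i(1)]
    proof
      assume "cyclic_group (G\<lparr>carrier := P i\<rparr>)"
      then obtain y where y: "y \<in> P i" "P i = range (\<lambda>n::int. y [^]\<^bsub>G\<lparr>carrier := P i\<rparr>\<^esub> n)"
        using group.cyclic_group[OF subgroup_imp_group[OF PG]] by auto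
      have yG: "y \<in> carrier G" using y(1) subgroup.mem_carrier[OF PG] by blast
      have "\<exists>n::nat. z = y [^]\<^bsub>G\<^esub> n" if "z \<in> P i" for z
      proof -
        obtain n :: int where "z = y [^]\<^bsub>G\<lparr>carrier := P i\<rparr>\<^esub> n" using y(2) \<open>z \<in> P i\<close> by blast
        then have "z = y [^]\<^bsub>G\<^esub> n" using int_pow_consistent[OF PG y(1)] by simp
        then have "z \<in> generate G {y}" using generate_pow[OF yG] by blast
        then show ?thesis using mem_generate_singleton[OF yG] by blast
      qed
      then show ?thesis using y(1) by blast
    next
      assume D: "subgroup (D i) (G\<lparr>carrier := P i\<rparr>) \<and> 1 < card (D i) \<and> card (D i) \<le> card (P i) \<and>
            (\<forall>H. subgroup H (G\<lparr>carrier := P i\<rparr>) \<and> card H = card (D i) \<longrightarrow> IC_Phi_subgroup H G)"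
      then have "card (D i) dvd card (P i)"
        using card_subgroup_dvd[OF _ PG] subgroup_subgroup_iff[OF PG] by blast
      then obtain k where k: "card (D i) = q ^ k" using divides_primepow_nat[OF q(1)] Pi(2) by auto
      have "Q8_free (G\<lparr>carrier := P i\<rparr>) \<or>
          (\<forall>C. subgroup C G \<longrightarrow> C \<subseteq> P i \<longrightarrow> cyclic_group (G\<lparr>carrier := C\<rparr>) \<longrightarrow> card C = 4 \<longrightarrow> IC_Phi_subgroup C G)"
        if "q = 2" "card (D i) = 2"
      proof -
        \<comment> \<open>The extra assumption on groups of order 4 is available for the first index
          only. As \<open>p\<close> is increasing and no prime is below 2, the prime 2 can occur
          only there.\<close>
        have "1 \<in> {1..t}" using i(1) by simp
        then have "p 1 \<in> prime_factors (card E)" using assms(10) by blast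
        then have "2 \<le> p 1" using prime_ge_2_nat by blast
        moreover have "p 1 < p i" if "1 < i"
          using assms(9) i(1) \<open>1 \<in> {1..t}\<close> that unfolding strict_mono_on_def by blast
        ultimately have "i = 1" using i \<open>q = 2\<close> by (cases "i = 1") auto
        then show ?thesis using assms(13) that i(2) subgroup_subgroup_iff[OF PG] by blast
      qed
      then have "IC_Phi_at q (q ^ k) (P i)"
        using D k subgroup_subgroup_iff[OF PG] unfolding IC_Phi_at_def by auto
      then show ?thesis using D k by metis
    qed
    then show "\<exists>P. sylow_in q P E \<and> ((\<exists>y\<in>P. \<forall>z\<in>P. \<exists>n::nat. z = y [^]\<^bsub>G\<^esub> n) \<or>
        (\<exists>k. 1 < q ^ k \<and> q ^ k \<le> card P \<and> IC_Phi_at q (q ^ k) P))"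
      using Pi(1) by blast
  qed
qed

end
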